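(* Let $n\ge2$, $G=\mathrm{SL}_n(\mathbb C)$, let $T,B,U$ be the subgroups of diagonal, upper triangular, and unipotent upper triangular matrices, let $\mathfrak h$ be the space of traceless diagonal $n\times n$ matrices and $W=S_n$. Write $x_1,\dots,x_n,y_1,\dots,y_n$ for the coordinates on $\mathfrak h\times\mathfrak h$ and for $S,S'\subseteq[n]=\{1,\dots,n\}$ set $f_{S,S'}=\prod_{s\in S,\,t\in S'}(x_s-y_t)$. Then the closed subscheme $\overline{T^*(G/U)}^{\,T\times B/U}$ of $\mathfrak h\times_{\mathfrak h/W}\mathfrak h$ has coordinate ring $$\mathbb C\left[\overline{T^*(G/U)}^{\,T\times B/U}\right]=\frac{\mathbb C[\mathfrak h\times_{\mathfrak h/W}\mathfrak h]}{\left\langle f_{S,S'}: \emptyset\ne S,S'\subseteq[n],\ |S|+|S'|=n\right\rangle}.$$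
   Context: $\overline{T^*(G/U)}=\operatorname{Spec}\mathbb C[T^*(G/U)]$ is the affine closure of the cotangent bundle of $G/U$. Via the Killing form $T^*(G/U)\cong G\times_U\mathfrak b=(G\times\mathfrak b)/U$, with $u\cdot(g,b)=(gu,u^{-1}bu)$ and $\mathfrak b=\mathrm{Lie}(B)$. $T$ acts by $t\cdot[g,b]=[tg,b]$, and $B/U$ (identified with the diagonal torus) acts by $[g,b]\mapsto[gt,t^{-1}bt]$. For an algebraic group $H$ acting on an affine scheme $X$, the scheme-theoretic fixed points are $X^H=\operatorname{Spec}\left(\mathbb C[X]/\langle f-h(f): f\in\mathbb C[X],h\in H\rangle\right)$. The map $[g,b]\mapsto (gbg^{-1},\,b\bmod[\mathfrak b,\mathfrak b])$ identifies $\overline{T^*(G/U)}/\!\!/(B/U)$ with $\mathfrak g\times_{\mathfrak h/W}\mathfrak h$. Consequently $\overline{T^*(G/U)}^{B/U}$ is a closed subscheme of $\mathfrak g\times_{\mathfrak h/W}\mathfrak h$, and $\overline{T^*(G/U)}^{T\times B/U}$ is a closed subscheme of $(\mathfrak g\times_{\mathfrak h/W}\mathfrak h)^T=\mathfrak h\times_{\mathfrak h/W}\mathfrak h$; the $x_i$ are the coordinates on the first factor (contained in $\mathfrak g$) and the $y_i$ those on the second factor. *)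

theory Defs
  imports
    "Jordan_Normal_Form.Determinant"
    "HOL-Combinatorics.Permutations"
    "HOL-Algebra.Generated_Rings"
    "HOL-Algebra.QuotRing"
begin

text \<open>
  Matrix indices and the index set \<open>[n]\<close> are \<open>{..<n}\<close>, following the matrix library.
\<close>

section \<open>Coordinate rings\<close>

definition fun_ring :: "'a set \<Rightarrow> ('a \<Rightarrow> complex) ring" where
  "fun_ring V =
    \<lparr>carrier = V \<rightarrow>\<^sub>E UNIV,
     mult = (\<lambda>f g. \<lambda>z\<in>V. f z * g z), one = (\<lambda>z\<in>V. 1),
     zero = (\<lambda>z\<in>V. 0), add = (\<lambda>f g. \<lambda>z\<in>V. f z + g z)\<rparr>"

text \<open>
  For a Zariski closed subset \<open>V\<close> of an affine space with coordinate functions \<open>E\<close>, this is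
  \<open>\<complex>[V]\<close> for the reduced structure on \<open>V\<close>: the restrictions to \<open>V\<close> of the polynomials in
  the coordinates. It is only applied to smooth varieties (\<open>G \<times> \<bb>\<close> and vector spaces).
\<close>

definition coord_ring :: "'a set \<Rightarrow> ('a \<Rightarrow> complex) set \<Rightarrow> ('a \<Rightarrow> complex) ring" where
  "coord_ring V E =
    (fun_ring V)\<lparr>carrier := generate_ring (fun_ring V)
      ({\<lambda>z\<in>V. c | c. True} \<union> {\<lambda>z\<in>V. e z | e. e \<in> E})\<rparr>"

definition entries :: "nat \<Rightarrow> (complex mat \<Rightarrow> complex) set" where
  "entries n = {\<lambda>x. x $$ (i, j) | i j. i < n \<and> j < n}"

definition pair_entries :: "nat \<Rightarrow> (complex mat \<times> complex mat \<Rightarrow> complex) set" where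
  "pair_entries n = {\<lambda>(x, y). e x | e. e \<in> entries n} \<union> {\<lambda>(x, y). e y | e. e \<in> entries n}"

section \<open>The group and its Lie algebra\<close>

definition SL :: "nat \<Rightarrow> complex mat monoid" where
  "SL n = \<lparr>carrier = {g \<in> carrier_mat n n. det g = 1}, mult = (*), one = 1\<^sub>m n\<rparr>"

definition torus :: "nat \<Rightarrow> complex mat set" where
  "torus n = {t \<in> carrier (SL n). diagonal_mat t}"

definition unipotent :: "nat \<Rightarrow> complex mat set" where
  "unipotent n = {u \<in> carrier (SL n). upper_triangular u \<and> (\<forall>i<n. u $$ (i, i) = 1)}"

definition sl_lie :: "nat \<Rightarrow> complex mat set" where
  "sl_lie n = {x \<in> carrier_mat n n. (\<Sum>i<n. x $$ (i, i)) = 0}"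

definition borel_lie :: "nat \<Rightarrow> complex mat set" where
  "borel_lie n = {b \<in> sl_lie n. upper_triangular b}"

definition cartan_lie :: "nat \<Rightarrow> complex mat set" where
  "cartan_lie n = {x \<in> sl_lie n. diagonal_mat x}"

section \<open>The affine closure of the cotangent bundle and its fixed points\<close>

abbreviation GB :: "nat \<Rightarrow> (complex mat \<times> complex mat) set" where
  "GB n \<equiv> carrier (SL n) \<times> borel_lie n"

text \<open>
  Since \<open>T\<^sup>*(G/U) = (G \<times> \<bb>)/U\<close>, its regular functions are the regular functions on
  \<open>G \<times> \<bb>\<close> that are invariant under \<open>u \<cdot> (g, b) = (g u, u\<inverse> b u)\<close>.
\<close>

definition cotangent_ring :: "nat \<Rightarrow> (complex mat \<times> complex mat \<Rightarrow> complex) ring" where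
  "cotangent_ring n = (coord_ring (GB n) (pair_entries n))
    \<lparr>carrier := {f \<in> carrier (coord_ring (GB n) (pair_entries n)).
       \<forall>u\<in>unipotent n. \<forall>(g, b)\<in>GB n. f (g * u, inv\<^bsub>SL n\<^esub> u * b * u) = f (g, b)}\<rparr>"

text \<open>
  The element \<open>(t, s)\<close> of \<open>T \<times> B/U\<close>, with \<open>B/U\<close> identified with the diagonal torus, sends
  \<open>[g, b]\<close> to \<open>[t g s, s\<inverse> b s]\<close>; on functions it acts by \<open>h(f)(z) = f(h\<inverse> z)\<close>.
\<close>

definition torus_point ::
  "nat \<Rightarrow> complex mat \<times> complex mat \<Rightarrow> complex mat \<times> complex mat \<Rightarrow> complex mat \<times> complex mat" where
  "torus_point n = (\<lambda>(t, s) (g, b). (t * g * s, inv\<^bsub>SL n\<^esub> s * b * s))"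

definition torus_act ::
  "nat \<Rightarrow> complex mat \<times> complex mat \<Rightarrow> (complex mat \<times> complex mat \<Rightarrow> complex)
    \<Rightarrow> (complex mat \<times> complex mat \<Rightarrow> complex)" where
  "torus_act n = (\<lambda>(t, s) f. \<lambda>z\<in>GB n. f (torus_point n (inv\<^bsub>SL n\<^esub> t, inv\<^bsub>SL n\<^esub> s) z))"

definition fixed_ideal :: "nat \<Rightarrow> (complex mat \<times> complex mat \<Rightarrow> complex) set" where
  "fixed_ideal n = Idl\<^bsub>cotangent_ring n\<^esub>
    {f \<ominus>\<^bsub>cotangent_ring n\<^esub> torus_act n h f | f h.
       f \<in> carrier (cotangent_ring n) \<and> h \<in> torus n \<times> torus n}"

definition fixed_ring :: "nat \<Rightarrow> (complex mat \<times> complex mat \<Rightarrow> complex) set ring" where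
  "fixed_ring n = cotangent_ring n Quot fixed_ideal n"

section \<open>The fibre product \<open>\<hh> \<times>\<^bsub>\<hh>/W\<^esub> \<hh>\<close>\<close>

abbreviation HH :: "nat \<Rightarrow> (complex mat \<times> complex mat) set" where
  "HH n \<equiv> cartan_lie n \<times> cartan_lie n"

definition weyl_invariants :: "nat \<Rightarrow> (complex mat \<Rightarrow> complex) set" where
  "weyl_invariants n = {p \<in> carrier (coord_ring (cartan_lie n) (entries n)).
     \<forall>\<sigma>. \<sigma> permutes {..<n} \<longrightarrow>
       (\<forall>x\<in>cartan_lie n. p (mat_diag n (\<lambda>i. x $$ (\<sigma> i, \<sigma> i))) = p x)}"

text \<open>
  \<open>\<complex>[\<hh>] \<otimes>\<^bsub>\<complex>[\<hh>]\<^sup>W\<^esub> \<complex>[\<hh>]\<close>, as the quotient of \<open>\<complex>[\<hh> \<times> \<hh>]\<close> by the ideal generated by all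
  \<open>p \<otimes> 1 - 1 \<otimes> p\<close> with \<open>p\<close> in \<open>\<complex>[\<hh>]\<^sup>W\<close>.
\<close>

definition fibre_ideal :: "nat \<Rightarrow> (complex mat \<times> complex mat \<Rightarrow> complex) set" where
  "fibre_ideal n = Idl\<^bsub>coord_ring (HH n) (pair_entries n)\<^esub>
    {\<lambda>(x, y)\<in>HH n. p x - p y | p. p \<in> weyl_invariants n}"

definition fibre_ring :: "nat \<Rightarrow> (complex mat \<times> complex mat \<Rightarrow> complex) set ring" where
  "fibre_ring n = coord_ring (HH n) (pair_entries n) Quot fibre_ideal n"

text \<open>The class in \<open>fibre_ring n\<close> of the restriction of a function to \<open>\<hh> \<times> \<hh>\<close>.\<close>

definition fibre_class ::
  "nat \<Rightarrow> (complex mat \<times> complex mat \<Rightarrow> complex) \<Rightarrow> (complex mat \<times> complex mat \<Rightarrow> complex) set" where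
  "fibre_class n F = fibre_ideal n +>\<^bsub>coord_ring (HH n) (pair_entries n)\<^esub> restrict F (HH n)"

definition f_SS ::
  "nat set \<Rightarrow> nat set \<Rightarrow> complex mat \<times> complex mat \<Rightarrow> complex" where
  "f_SS S S' = (\<lambda>(x, y). \<Prod>s\<in>S. \<Prod>t\<in>S'. x $$ (s, s) - y $$ (t, t))"

definition f_ideal :: "nat \<Rightarrow> (complex mat \<times> complex mat \<Rightarrow> complex) set set" where
  "f_ideal n = Idl\<^bsub>fibre_ring n\<^esub>
    {fibre_class n (f_SS S S') | S S'.
       S \<subseteq> {..<n} \<and> S' \<subseteq> {..<n} \<and> S \<noteq> {} \<and> S' \<noteq> {} \<and> card S + card S' = n}"

section \<open>The embedding of the fixed points in \<open>\<hh> \<times>\<^bsub>\<hh>/W\<^esub> \<hh>\<close>\<close>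

text \<open>
  Pullback of functions along \<open>[g, b] \<mapsto> (g b g\<inverse>, b mod [\<bb>, \<bb>])\<close>, where \<open>\<bb>/[\<bb>, \<bb>]\<close> is
  identified with \<open>\<hh>\<close> by taking diagonal parts.
\<close>

definition moment_pullback ::
  "nat \<Rightarrow> (complex mat \<times> complex mat \<Rightarrow> complex) \<Rightarrow> (complex mat \<times> complex mat \<Rightarrow> complex)" where
  "moment_pullback n F =
    (\<lambda>(g, b)\<in>GB n. F (g * b * inv\<^bsub>SL n\<^esub> g, mat_diag n (\<lambda>i. b $$ (i, i))))"

text \<open>
  The map \<open>\<pi>\<close> is the comorphism of the closed embedding of the fixed point scheme into
  \<open>\<hh> \<times>\<^bsub>\<hh>/W\<^esub> \<hh>\<close> induced by \<open>[g, b] \<mapsto> (g b g\<inverse>, b mod [\<bb>, \<bb>])\<close>: it is a surjection, and it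
  makes commute the square formed with the restriction \<open>\<complex>[\<gg> \<times> \<hh>] \<rightarrow> \<complex>[\<hh> \<times>\<^bsub>\<hh>/W\<^esub> \<hh>]\<close>
  and the pullback \<open>\<complex>[\<gg> \<times> \<hh>] \<rightarrow> \<complex>[T\<^sup>*(G/U)]\<close>. Both of these factor through
  \<open>\<complex>[\<gg> \<times>\<^bsub>\<hh>/W\<^esub> \<hh>]\<close>. As the restriction is onto, at most one \<open>\<pi>\<close> on the carrier
  satisfies this.
\<close>

definition is_closed_embedding ::
  "nat \<Rightarrow> ((complex mat \<times> complex mat \<Rightarrow> complex) set
      \<Rightarrow> (complex mat \<times> complex mat \<Rightarrow> complex) set) \<Rightarrow> bool" where
  "is_closed_embedding n \<pi> \<longleftrightarrow>
    \<pi> \<in> ring_hom (fibre_ring n) (fixed_ring n) \<and>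
    \<pi> ` carrier (fibre_ring n) = carrier (fixed_ring n) \<and>
    (\<forall>F \<in> carrier (coord_ring (sl_lie n \<times> cartan_lie n) (pair_entries n)).
       \<pi> (fibre_class n F) =
         fixed_ideal n +>\<^bsub>cotangent_ring n\<^esub> moment_pullback n F)"

end

theory Submission
  imports Defs "Jordan_Normal_Form.Schur_Decomposition"
begin

text \<open>
  A regular function on \<open>G \<times> \<bb>\<close> that is invariant under \<open>U\<close> and of weight zero for \<open>B/U\<close> is a polynomial in
  \<open>x = g b g\<inverse>\<close> and the diagonal of \<open>b\<close>: where a vector \<open>v\<close> is cyclic for \<open>x\<close>, an invariant flag is
  reconstructed polynomially from \<open>x\<close> and its ordered eigenvalues up to powers of the Krylov determinant of \<open>v\<close>,
  and the denominators of two such charts cancel. Modulo the ideal of the fixed points every function of nonzero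
  weight vanishes, in particular the off-diagonal entries of \<open>x\<close>, so that the coordinate ring of the fixed
  points is a quotient of \<open>\<complex>[\<hh> \<times> \<hh>]\<close>.

  The functions of weight zero in this ideal are sums of products of two functions of opposite nonzero weights.
  Modulo \<open>p(x) - p(y)\<close> with \<open>p\<close> symmetric, a polynomial on \<open>\<hh> \<times> \<hh>\<close> is determined by its restrictions
  to the graphs of the permutations, which are the values of the function at the points \<open>[w, y]\<close>. The
  stabilizer of \<open>[w, y]\<close> in \<open>T \<times> B/U\<close> forces such a product to vanish there unless \<open>w\<close> maps \<open>I\<close> into \<open>S\<close>, where
  \<open>I\<close> and \<open>S\<close> are level sets of the two components of the weight, and interpolation on the permutation graphs shows
  that a polynomial vanishing on all other graphs is a multiple of \<open>f\<close> for \<open>I\<close> and the complement of \<open>S\<close>. Conversely these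
  \<open>f\<close> arise from the products of the minors of eigenvectors of \<open>b\<close> for complementary sets of indices.
\<close>

text \<open>A function of x and an ordering of its eigenvalues lives on a fibre product over
  \<hh>/W, where density arguments and the removal of denominators are awkward. The kernel
  \<open>kern\<close> brings them back to affine space: expanding it into products m_j(x) s_j(z)
  makes every polynomial in the eigenvalues a combination of the m_j with symmetric coefficients,
  and symmetric functions of the eigenvalues are polynomials in the traces of powers of x. The same
  kernel yields the interpolation formula; ordering the indices with I first makes the factor f for
  I and the complement of S split off from it. Denominators cancel by an elementary argument: on the
  lines x + t \<open>upshift\<close> the Krylov determinant of the last unit vector is monic in t,
  that of the first unit vector is a nonzero constant on one such line, and a resultant then shows
  that the two are generically coprime. Density rests on \<open>line_connected\<close>: points are
  joined by polynomial curves, and a product of polynomials in one parameter vanishes only if a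
  factor does. Only linear spaces are treated this way; G enters with g held fixed while b
  varies.\<close>

section \<open>Polynomial functions on a set\<close>

text \<open>Elements are total functions that agree on \<open>V\<close> with a polynomial in
  \<open>E\<close>. The rule \<open>cong\<close> leaves the values off \<open>V\<close> arbitrary,
  so that functions such as the entries of a matrix inverse, whose formula is valid only on
  \<open>V\<close>, count as polynomial.\<close>

inductive_set pfun :: "'a set \<Rightarrow> ('a \<Rightarrow> complex) set \<Rightarrow> ('a \<Rightarrow> complex) set"
  for V E where
  const: "(\<lambda>_. c) \<in> pfun V E"
| coord: "e \<in> E \<Longrightarrow> e \<in> pfun V E"
| add: "f \<in> pfun V E \<Longrightarrow> g \<in> pfun V E \<Longrightarrow> (\<lambda>z. f z + g z) \<in> pfun V E"
| mult: "f \<in> pfun V E \<Longrightarrow> g \<in> pfun V E \<Longrightarrow> (\<lambda>z. f z * g z) \<in> pfun V E"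
| cong: "f \<in> pfun V E \<Longrightarrow> (\<And>z. z \<in> V \<Longrightarrow> g z = f z) \<Longrightarrow> g \<in> pfun V E"

lemmas pfun_const = pfun.const
lemmas pfun_coord = pfun.coord
lemmas pfun_add = pfun.add
lemmas pfun_mult = pfun.mult

lemma pfun_cmult: "f \<in> pfun V E \<Longrightarrow> (\<lambda>z. c * f z) \<in> pfun V E"
  by (rule pfun_mult[OF pfun_const])

lemma pfun_uminus: "f \<in> pfun V E \<Longrightarrow> (\<lambda>z. - f z) \<in> pfun V E"
  using pfun_cmult[of f V E "-1"] by simp

lemma pfun_diff: "f \<in> pfun V E \<Longrightarrow> g \<in> pfun V E \<Longrightarrow> (\<lambda>z. f z - g z) \<in> pfun V E"
  using pfun_add[OF _ pfun_uminus, of f V E g] by simp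

lemma pfun_sum: "(\<And>i. i \<in> I \<Longrightarrow> f i \<in> pfun V E) \<Longrightarrow> (\<lambda>z. \<Sum>i\<in>I. f i z) \<in> pfun V E"
  by (induction I rule: infinite_finite_induct) (auto intro: pfun_const pfun_add)

lemma pfun_prod: "(\<And>i. i \<in> I \<Longrightarrow> f i \<in> pfun V E) \<Longrightarrow> (\<lambda>z. \<Prod>i\<in>I. f i z) \<in> pfun V E"
  by (induction I rule: infinite_finite_induct) (auto intro: pfun_const pfun_mult)

lemma pfun_power: "f \<in> pfun V E \<Longrightarrow> (\<lambda>z. f z ^ k) \<in> pfun V E"
  by (induction k) (auto intro: pfun_const pfun_mult)

lemma pfun_comp:
  assumes "f \<in> pfun V E" and "\<And>e. e \<in> E \<Longrightarrow> (\<lambda>z. e (\<phi> z)) \<in> pfun V' E'"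
    and "\<And>z. z \<in> V' \<Longrightarrow> \<phi> z \<in> V"
  shows "(\<lambda>z. f (\<phi> z)) \<in> pfun V' E'"
  using assms(1)
proof induction
  case (cong f g)
  show ?case by (rule pfun.cong[OF cong.IH]) (use cong assms(3) in auto)
qed (auto intro: assms pfun_const pfun_add pfun_mult)

lemma pfun_mono: "f \<in> pfun V E \<Longrightarrow> V' \<subseteq> V \<Longrightarrow> E \<subseteq> E' \<Longrightarrow> f \<in> pfun V' E'"
  using pfun_comp[of f V E "\<lambda>z. z" V' E'] by (auto intro: pfun_coord)

text \<open>Restores a genuine polynomial from a function with arbitrary values off
  \<open>V\<close>, so that it can be composed with maps that leave \<open>V\<close>.\<close>

lemma pfun_extend: "f \<in> pfun V E \<Longrightarrow> \<exists>p\<in>pfun UNIV E. \<forall>z\<in>V. f z = p z"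
proof (induction rule: pfun.induct)
  case (const c) then show ?case by (intro bexI[OF _ pfun_const]) auto
next
  case (coord e) then show ?case by (intro bexI[OF _ pfun_coord]) auto
next
  case (add f g)
  then obtain p q where "p \<in> pfun UNIV E" "q \<in> pfun UNIV E" "\<forall>z\<in>V. f z = p z" "\<forall>z\<in>V. g z = q z" by auto
  then show ?case by (intro bexI[OF _ pfun_add[of p _ _ q]]) auto
next
  case (mult f g)
  then obtain p q where "p \<in> pfun UNIV E" "q \<in> pfun UNIV E" "\<forall>z\<in>V. f z = p z" "\<forall>z\<in>V. g z = q z" by auto
  then show ?case by (intro bexI[OF _ pfun_mult[of p _ _ q]]) auto
next
  case (cong f g) then show ?case by auto
qed

lemma permutes_nat_less: "p permutes {0..<n} \<Longrightarrow> i < n \<Longrightarrow> p i < (n::nat)"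
  using permutes_in_image[of p "{0..<n}" i] by simp

lemma pfun_det:
  assumes "\<And>i j. i < n \<Longrightarrow> j < n \<Longrightarrow> (\<lambda>z. f z (i, j)) \<in> pfun V E"
  shows "(\<lambda>z. det (mat n n (f z))) \<in> pfun V E"
proof -
  have *: "det (mat n n (f z)) =
      (\<Sum>p\<in>{p. p permutes {0..<n}}. signof p * (\<Prod>i\<in>{0..<n}. f z (i, p i)))" for z
    by (subst det_def'[of _ n]) (auto intro!: sum.cong prod.cong simp: permutes_nat_less)
  show ?thesis unfolding *
    by (intro pfun_sum pfun_mult pfun_const pfun_prod assms) (auto simp: permutes_nat_less)
qed

section \<open>Products of sets and separation of variables\<close>

definition prod_coords :: "('a \<Rightarrow> complex) set \<Rightarrow> ('b \<Rightarrow> complex) set \<Rightarrow> ('a \<times> 'b \<Rightarrow> complex) set" where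
  "prod_coords E F = {\<lambda>z. e (fst z) | e. e \<in> E} \<union> {\<lambda>z. e (snd z) | e. e \<in> F}"

lemma pair_entries_eq: "pair_entries n = prod_coords (entries n) (entries n)"
  by (auto simp: pair_entries_def prod_coords_def case_prod_beta')

lemma pfun_fst: "f \<in> pfun V E \<Longrightarrow> (\<lambda>z. f (fst z)) \<in> pfun (V \<times> V') (prod_coords E F)"
  by (rule pfun_comp) (auto intro!: pfun_coord simp: prod_coords_def)

lemma pfun_snd: "f \<in> pfun V F \<Longrightarrow> (\<lambda>z. f (snd z)) \<in> pfun (V' \<times> V) (prod_coords E F)"
  by (rule pfun_comp) (auto intro!: pfun_coord simp: prod_coords_def)

lemma pfun_comp_pair:
  assumes "f \<in> pfun (V \<times> V') (prod_coords E F)"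
    and "\<And>e. e \<in> E \<Longrightarrow> (\<lambda>z. e (\<phi> z)) \<in> pfun W G" and "\<And>e. e \<in> F \<Longrightarrow> (\<lambda>z. e (\<psi> z)) \<in> pfun W G"
    and "\<And>z. z \<in> W \<Longrightarrow> \<phi> z \<in> V" and "\<And>z. z \<in> W \<Longrightarrow> \<psi> z \<in> V'"
  shows "(\<lambda>z. f (\<phi> z, \<psi> z)) \<in> pfun W G"
  by (rule pfun_comp[OF assms(1)]) (use assms in \<open>auto simp: prod_coords_def\<close>)

inductive_set tensors :: "('a \<Rightarrow> complex) set \<Rightarrow> ('b \<Rightarrow> complex) set \<Rightarrow> ('a \<times> 'b \<Rightarrow> complex) set"
  for M R where
  pure: "m \<in> M \<Longrightarrow> r \<in> R \<Longrightarrow> (\<lambda>z. m (fst z) * r (snd z)) \<in> tensors M R"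
| plus: "f \<in> tensors M R \<Longrightarrow> g \<in> tensors M R \<Longrightarrow> (\<lambda>z. f z + g z) \<in> tensors M R"

lemma tensors_mult:
  assumes "f \<in> tensors M R" "g \<in> tensors M R"
    and M: "\<And>m m'. m \<in> M \<Longrightarrow> m' \<in> M \<Longrightarrow> (\<lambda>z. m z * m' z) \<in> M"
    and R: "\<And>m m'. m \<in> R \<Longrightarrow> m' \<in> R \<Longrightarrow> (\<lambda>z. m z * m' z) \<in> R"
  shows "(\<lambda>z. f z * g z) \<in> tensors M R"
  using assms(1)
proof induction
  case (pure m r)
  show ?case using assms(2)
  proof induction
    case (pure m' r')
    show ?case using tensors.pure[OF M[OF \<open>m \<in> M\<close> pure(1)] R[OF \<open>r \<in> R\<close> pure(2)]]
      by (simp add: mult_ac)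
  next
    case (plus f g) then show ?case using tensors.plus by (force simp: distrib_left)
  qed
next
  case (plus f f') then show ?case using tensors.plus by (force simp: distrib_right)
qed

text \<open>Used to separate the two variables of \<open>kern\<close>, and to symmetrize a
  polynomial in its first variable alone.\<close>

lemma pfun_imp_tensors:
  assumes "f \<in> pfun (V \<times> V') (prod_coords E F)"
  shows "\<exists>t\<in>tensors (pfun V E) (pfun V' F). \<forall>z\<in>V \<times> V'. f z = t z"
  using assms
proof induction
  case (const c)
  show ?case by (intro bexI[OF _ tensors.pure[OF pfun_const[of c] pfun_const[of 1]]]) auto
next
  case (coord e)
  then consider e' where "e' \<in> E" "e = (\<lambda>z. e' (fst z))" | e' where "e' \<in> F" "e = (\<lambda>z. e' (snd z))"
    by (auto simp: prod_coords_def)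
  then show ?case
  proof cases
    case 1 then show ?thesis
      by (intro bexI[OF _ tensors.pure[OF pfun_coord[of e'] pfun_const[of 1]]]) auto
  next
    case 2 then show ?thesis
      by (intro bexI[OF _ tensors.pure[OF pfun_const[of 1] pfun_coord[of e']]]) auto
  qed
next
  case (add f g)
  then obtain s t where "s \<in> tensors (pfun V E) (pfun V' F)" "t \<in> tensors (pfun V E) (pfun V' F)"
    "\<forall>z\<in>V \<times> V'. f z = s z" "\<forall>z\<in>V \<times> V'. g z = t z" by auto
  then show ?case by (intro bexI[OF _ tensors.plus[of s _ _ t]]) auto
next
  case (mult f g)
  then obtain s t where "s \<in> tensors (pfun V E) (pfun V' F)" "t \<in> tensors (pfun V E) (pfun V' F)"
    "\<forall>z\<in>V \<times> V'. f z = s z" "\<forall>z\<in>V \<times> V'. g z = t z" by auto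
  then show ?case by (intro bexI[OF _ tensors_mult[of s _ _ t]]) (auto intro: pfun_mult)
next
  case (cong f g) then show ?case by auto
qed

lemma tensors_finite_sum:
  fixes f :: "'a \<times> 'b \<Rightarrow> complex"
  assumes "f \<in> tensors M R"
  shows "\<exists>(K::nat) m r. (\<forall>j<K. m j \<in> M \<and> r j \<in> R) \<and> (\<forall>x y. f (x, y) = (\<Sum>j<K. m j x * r j y))"
  using assms
proof induction
  case (pure m r)
  then show ?case by (intro exI[of _ 1] exI[of _ "\<lambda>_. m"] exI[of _ "\<lambda>_. r"]) auto
next
  case (plus f g)
  obtain K :: nat and m :: "nat \<Rightarrow> 'a \<Rightarrow> complex" and r :: "nat \<Rightarrow> 'b \<Rightarrow> complex" where
    1: "\<forall>j<K. m j \<in> M \<and> r j \<in> R" and 2: "\<forall>x y. f (x, y) = (\<Sum>j<K. m j x * r j y)"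
    using plus.IH(1) by auto
  obtain K' :: nat and m' :: "nat \<Rightarrow> 'a \<Rightarrow> complex" and r' :: "nat \<Rightarrow> 'b \<Rightarrow> complex" where
    3: "\<forall>j<K'. m' j \<in> M \<and> r' j \<in> R" and 4: "\<forall>x y. g (x, y) = (\<Sum>j<K'. m' j x * r' j y)"
    using plus.IH(2) by auto
  define m2 where "m2 j = (if j < K then m j else m' (j-K))" for j
  define r2 where "r2 j = (if j < K then r j else r' (j-K))" for j
  have "(\<Sum>j<K+K'. m2 j x * r2 j y) = (\<Sum>j<K. m j x * r j y) + (\<Sum>j<K'. m' j x * r' j y)" for x y
  proof -
    have "(\<Sum>j<K+K'. m2 j x * r2 j y) = (\<Sum>j<K. m2 j x * r2 j y) + (\<Sum>j\<in>{K..<K+K'}. m2 j x * r2 j y)"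
      by (subst sum.union_disjoint[symmetric]) (auto simp: ivl_disj_un)
    moreover have "(\<Sum>j\<in>{K..<K+K'}. m2 j x * r2 j y) = (\<Sum>j<K'. m' j x * r' j y)"
      by (rule sum.reindex_bij_witness[of _ "\<lambda>j. j + K" "\<lambda>j. j - K"]) (auto simp: m2_def r2_def)
    ultimately show ?thesis by (simp add: m2_def r2_def)
  qed
  moreover have "\<forall>j<K+K'. m2 j \<in> M \<and> r2 j \<in> R" using 1 3 by (auto simp: m2_def r2_def)
  ultimately have "(\<forall>j<K+K'. m2 j \<in> M \<and> r2 j \<in> R) \<and>
      (\<forall>x y. f (x, y) + g (x, y) = (\<Sum>j<K+K'. m2 j x * r2 j y))"
    using 2 4 by simp
  then show ?case by blast
qed

text \<open>The quotient \<open>q\<close> exists because \<open>f \<mapsto> f - f \<circ> \<phi>\<close> is a twisted derivation.\<close>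

lemma pfun_diff_factor:
  assumes "f \<in> pfun V E" and \<phi>: "\<And>z. z \<in> V \<Longrightarrow> \<phi> z \<in> V"
    and E: "\<And>e. e \<in> E \<Longrightarrow> (\<lambda>z. e (\<phi> z)) \<in> pfun V E"
      "\<And>e. e \<in> E \<Longrightarrow> \<exists>q\<in>pfun V E. \<forall>z\<in>V. e z - e (\<phi> z) = d z * q z"
  shows "\<exists>q\<in>pfun V E. \<forall>z\<in>V. f z - f (\<phi> z) = d z * q z"
  using assms(1)
proof induction
  case (const c) then show ?case by (intro bexI[OF _ pfun_const[of 0]]) auto
next
  case (coord e) then show ?case by (rule E)
next
  case (add f g)
  then obtain s t where "s \<in> pfun V E" "t \<in> pfun V E"
    "\<forall>z\<in>V. f z - f (\<phi> z) = d z * s z" "\<forall>z\<in>V. g z - g (\<phi> z) = d z * t z" by auto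
  then show ?case by (intro bexI[OF _ pfun_add[of s _ _ t]]) (auto simp: algebra_simps)
next
  case (mult f g)
  then obtain s t where st: "s \<in> pfun V E" "t \<in> pfun V E"
    "\<forall>z\<in>V. f z - f (\<phi> z) = d z * s z" "\<forall>z\<in>V. g z - g (\<phi> z) = d z * t z" by auto
  have "(\<lambda>z. g (\<phi> z)) \<in> pfun V E" by (rule pfun_comp[OF mult(2)]) (auto intro: E \<phi>)
  then have "(\<lambda>z. f z * t z + s z * g (\<phi> z)) \<in> pfun V E" using st mult by (intro pfun_add pfun_mult) auto
  moreover have "f z * g z - f (\<phi> z) * g (\<phi> z) = d z * (f z * t z + s z * g (\<phi> z))" if "z \<in> V" for z
  proof -
    have "f z * g z - f (\<phi> z) * g (\<phi> z) = f z * (g z - g (\<phi> z)) + (f z - f (\<phi> z)) * g (\<phi> z)"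
      by (simp add: algebra_simps)
    then show ?thesis using st that by (simp add: algebra_simps)
  qed
  ultimately show ?case by (intro bexI[of _ "\<lambda>z. f z * t z + s z * g (\<phi> z)"]) auto
next
  case (cong f g) then show ?case using \<phi> by auto
qed

section \<open>Density along polynomial curves\<close>

text \<open>A substitute for irreducibility: restricted to such a curve, the functions become
  polynomials in one parameter, among which there are no zero divisors.\<close>

definition line_connected :: "'a set \<Rightarrow> ('a \<Rightarrow> complex) set \<Rightarrow> bool" where
  "line_connected V E \<longleftrightarrow> (\<forall>z\<in>V. \<forall>z'\<in>V. \<exists>\<gamma>. (\<forall>t. \<gamma> t \<in> V) \<and> \<gamma> 0 = z \<and> \<gamma> 1 = z' \<and>
     (\<forall>e\<in>E. \<exists>p. \<forall>t::complex. e (\<gamma> t) = poly p t))"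

lemma pfun_on_curve:
  assumes "f \<in> pfun V E" "\<And>t. \<gamma> t \<in> V" "\<forall>e\<in>E. \<exists>p. \<forall>t::complex. e (\<gamma> t) = poly p t"
  shows "\<exists>p. \<forall>t. f (\<gamma> t) = poly p t"
  using assms(1)
proof induction
  case (const c) then show ?case by (intro exI[of _ "[:c:]"]) auto
next
  case (coord e) then show ?case using assms by auto
next
  case (add f g)
  then obtain p q where "\<forall>t. f (\<gamma> t) = poly p t" "\<forall>t. g (\<gamma> t) = poly q t" by auto
  then show ?case by (intro exI[of _ "p + q"]) auto
next
  case (mult f g)
  then obtain p q where "\<forall>t. f (\<gamma> t) = poly p t" "\<forall>t. g (\<gamma> t) = poly q t" by auto
  then show ?case by (intro exI[of _ "p * q"]) auto
next
  case (cong f g) then show ?case using assms by auto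
qed

text \<open>On a curve from \<open>z0\<close> to \<open>z\<close> the product \<open>d * f\<close>
  is the zero polynomial, while \<open>d\<close> is not, because it is nonzero at the start. Hence
  \<open>f\<close> vanishes along the whole curve, also at its end \<open>z\<close>.\<close>

lemma pfun_density:
  assumes V: "line_connected V E" and f: "f \<in> pfun V E" and d: "d \<in> pfun V E"
    and z0: "z0 \<in> V" "d z0 \<noteq> 0" and eq: "\<And>z. z \<in> V \<Longrightarrow> d z \<noteq> 0 \<Longrightarrow> f z = 0" and z: "z \<in> V"
  shows "f z = 0"
proof -
  obtain \<gamma> where \<gamma>: "\<And>t. \<gamma> t \<in> V" "\<gamma> 0 = z0" "\<gamma> 1 = z" "\<forall>e\<in>E. \<exists>p. \<forall>t::complex. e (\<gamma> t) = poly p t"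
    using V z0 z unfolding line_connected_def by metis
  obtain p q where pq: "\<And>t. f (\<gamma> t) = poly p t" "\<And>t. d (\<gamma> t) = poly q t"
    using pfun_on_curve[OF f \<gamma>(1,4)] pfun_on_curve[OF d \<gamma>(1,4)] by auto
  have "poly (q * p) t = 0" for t using eq[OF \<gamma>(1)[of t]] pq by auto
  then have "q * p = 0" using poly_all_0_iff_0[of "q * p"] by blast
  moreover have "q \<noteq> 0" using z0 pq(2)[of 0] \<gamma> by auto
  ultimately show ?thesis using pq(1)[of 1] \<gamma> by auto
qed

lemma pfun_nonzero_mult:
  assumes V: "line_connected V E" and f: "f \<in> pfun V E" and d: "d \<in> pfun V E"
    and "z0 \<in> V" "d z0 \<noteq> 0" "z1 \<in> V" "f z1 \<noteq> 0"
  shows "\<exists>z\<in>V. d z \<noteq> 0 \<and> f z \<noteq> 0"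
  using pfun_density[OF V f d assms(4,5) _ assms(6)] assms(7) by blast

lemma line_connectedI_affine:
  assumes "\<And>z z' t. z \<in> V \<Longrightarrow> z' \<in> V \<Longrightarrow> L z z' t \<in> V" "\<And>z z'. z \<in> V \<Longrightarrow> z' \<in> V \<Longrightarrow> L z z' 0 = z"
    "\<And>z z'. z \<in> V \<Longrightarrow> z' \<in> V \<Longrightarrow> L z z' 1 = z'"
    "\<And>e z z' t. e \<in> E \<Longrightarrow> z \<in> V \<Longrightarrow> z' \<in> V \<Longrightarrow> e (L z z' t) = e z + t * (e z' - e z)"
  shows "line_connected V E"
  unfolding line_connected_def
proof (intro ballI)
  fix z z' assume z: "z \<in> V" "z' \<in> V"
  have "\<exists>p. \<forall>t. e (L z z' t) = poly p t" if "e \<in> E" for e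
    using that by (intro exI[of _ "[:e z, e z' - e z:]"]) (auto simp: assms(4)[OF that z])
  then show "\<exists>\<gamma>. (\<forall>t. \<gamma> t \<in> V) \<and> \<gamma> 0 = z \<and> \<gamma> 1 = z' \<and> (\<forall>e\<in>E. \<exists>p. \<forall>t. e (\<gamma> t) = poly p t)"
    using z assms(1-3) by (intro exI[of _ "L z z'"]) auto
qed

lemma line_connected_Times:
  assumes "line_connected V E" "line_connected V' F"
  shows "line_connected (V \<times> V') (prod_coords E F)"
  unfolding line_connected_def
proof (intro ballI)
  fix z z' assume z: "z \<in> V \<times> V'" "z' \<in> V \<times> V'"
  obtain \<gamma> where \<gamma>: "\<And>t. \<gamma> t \<in> V" "\<gamma> 0 = fst z" "\<gamma> 1 = fst z'" "\<forall>e\<in>E. \<exists>p. \<forall>t::complex. e (\<gamma> t) = poly p t"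
    using assms(1) z unfolding line_connected_def by (metis mem_Times_iff)
  obtain \<delta> where \<delta>: "\<And>t. \<delta> t \<in> V'" "\<delta> 0 = snd z" "\<delta> 1 = snd z'" "\<forall>e\<in>F. \<exists>p. \<forall>t::complex. e (\<delta> t) = poly p t"
    using assms(2) z unfolding line_connected_def by (metis mem_Times_iff)
  show "\<exists>\<gamma>. (\<forall>t. \<gamma> t \<in> V \<times> V') \<and> \<gamma> 0 = z \<and> \<gamma> 1 = z' \<and> (\<forall>e\<in>prod_coords E F. \<exists>p. \<forall>t. e (\<gamma> t) = poly p t)"
    by (intro exI[of _ "\<lambda>t. (\<gamma> t, \<delta> t)"]) (use \<gamma> \<delta> in \<open>auto simp: prod_coords_def\<close>)
qed

section \<open>Vectors\<close>

definition vcoords :: "nat \<Rightarrow> ((nat \<Rightarrow> complex) \<Rightarrow> complex) set" where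
  "vcoords n = {\<lambda>y. y i | i. i < n}"

lemma pfun_vcoord: "i < n \<Longrightarrow> (\<lambda>y. y i) \<in> pfun V (vcoords n)"
  by (rule pfun_coord) (auto simp: vcoords_def)

lemma line_connected_vec: "line_connected UNIV (vcoords n)"
  by (rule line_connectedI_affine[of _ "\<lambda>z z' t i. z i + t * (z' i - z i)"]) (auto simp: vcoords_def)

lemma pfun_vec_cong:
  assumes "f \<in> pfun UNIV (vcoords n)" "\<And>i. i < n \<Longrightarrow> y i = y' i"
  shows "f y = f y'"
  using assms(1) by induction (use assms(2) in \<open>auto simp: vcoords_def\<close>)

lemma pfun_entry: "i < n \<Longrightarrow> j < n \<Longrightarrow> (\<lambda>x. x $$ (i, j)) \<in> pfun V (entries n)"
  by (rule pfun_coord) (auto simp: entries_def)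

lemma pfun_density_pair:
  assumes "line_connected V E" "line_connected V' F" "f \<in> pfun (V \<times> V') (prod_coords E F)"
    "d \<in> pfun (V \<times> V') (prod_coords E F)" "x0 \<in> V" "y0 \<in> V'" "d (x0, y0) \<noteq> 0"
    "\<And>x y. x \<in> V \<Longrightarrow> y \<in> V' \<Longrightarrow> d (x, y) \<noteq> 0 \<Longrightarrow> f (x, y) = 0" "x \<in> V" "y \<in> V'"
  shows "f (x, y) = 0"
  by (rule pfun_density[OF line_connected_Times[OF assms(1,2)] assms(3,4), of "(x0, y0)" "(x, y)"])
    (use assms in auto)

section \<open>Symmetric functions and interpolation on permutation graphs\<close>

text \<open>A ranking \<open>\<rho>\<close> that is injective on \<open>{..<n}\<close> encodes a linear order of the indices.\<close>

definition ranked :: "(nat \<Rightarrow> nat) \<Rightarrow> nat \<Rightarrow> (nat \<times> nat) set" where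
  "ranked \<rho> n = {(i, j). i < n \<and> j < n \<and> \<rho> i < \<rho> j}"

definition vdm :: "(nat \<Rightarrow> nat) \<Rightarrow> nat \<Rightarrow> (nat \<Rightarrow> complex) \<Rightarrow> complex" where
  "vdm \<rho> n z = (\<Prod>(i, j)\<in>ranked \<rho> n. z i - z j)"

text \<open>After reversal of the second set of variables this is, for the order given by
  \<open>\<rho>\<close>, the double Schubert polynomial of the longest permutation: it is the
  Vandermonde product on the diagonal and vanishes on the graph of every other permutation.\<close>

definition kern :: "(nat \<Rightarrow> nat) \<Rightarrow> nat \<Rightarrow> (nat \<Rightarrow> complex) \<Rightarrow> (nat \<Rightarrow> complex) \<Rightarrow> complex" where
  "kern \<rho> n x z = (\<Prod>(i, j)\<in>ranked \<rho> n. x i - z j)"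

lemma finite_ranked [simp]: "finite (ranked \<rho> n)"
  by (rule finite_subset[of _ "{..<n} \<times> {..<n}"]) (auto simp: ranked_def)

lemma kern_diag: "kern \<rho> n z z = vdm \<rho> n z"
  by (simp add: kern_def vdm_def)

lemma pfun_vdm: "vdm \<rho> n \<in> pfun V (vcoords n)"
proof -
  have "(\<lambda>z. \<Prod>p\<in>ranked \<rho> n. z (fst p) - z (snd p)) \<in> pfun V (vcoords n)"
    by (intro pfun_prod pfun_diff pfun_vcoord) (auto simp: ranked_def)
  then show ?thesis by (simp add: vdm_def[abs_def] case_prod_beta')
qed

lemma pfun_kern: "(\<lambda>p. kern \<rho> n (fst p) (snd p)) \<in> pfun (UNIV \<times> UNIV) (prod_coords (vcoords n) (vcoords n))"
proof -
  have "(\<lambda>z. \<Prod>p\<in>ranked \<rho> n. fst z (fst p) - snd z (snd p)) \<in> pfun (UNIV \<times> UNIV) (prod_coords (vcoords n) (vcoords n))"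
    by (intro pfun_prod pfun_diff pfun_fst[of "\<lambda>y. y _"] pfun_snd[of "\<lambda>y. y _"] pfun_vcoord) (auto simp: ranked_def)
  then show ?thesis by (simp add: kern_def[abs_def] case_prod_beta')
qed

lemma vdm_nonzero:
  assumes "\<And>i j. i < n \<Longrightarrow> j < n \<Longrightarrow> i \<noteq> j \<Longrightarrow> z i \<noteq> z j"
  shows "vdm \<rho> n z \<noteq> 0"
proof -
  have "z i - z j \<noteq> 0" if "(i, j) \<in> ranked \<rho> n" for i j
    using assms[of i j] that by (auto simp: ranked_def)
  then show ?thesis by (auto simp: vdm_def)
qed

lemma vdm_compose:
  assumes \<rho>: "inj_on \<rho> {..<n}" and v: "v permutes {..<n}"
  shows "vdm \<rho> n (z \<circ> v) =
    (\<Prod>(i, j)\<in>ranked \<rho> n. if (v i, v j) \<in> ranked \<rho> n then 1 else - 1) * vdm \<rho> n z"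
proof -
  let ?R = "ranked \<rho> n"
  \<comment> \<open>A permutation sends a ranked pair to one that is ranked up to swapping its
    members; \<open>srt\<close> undoes the swap, and each swap costs a factor -1.\<close>
  define srt where "srt p = (if p \<in> ?R then p else (snd p, fst p))" for p
  have tot: "(i, j) \<in> ?R \<or> (j, i) \<in> ?R" if "i < n" "j < n" "i \<noteq> j" for i j
    using \<rho> that by (auto simp: ranked_def) (metis inj_onD lessThan_iff linorder_neqE_nat)
  have asym: "(j, i) \<notin> ?R" if "(i, j) \<in> ?R" for i j using that by (auto simp: ranked_def)
  have lt: "u i < n" if "i < n" "u permutes {..<n}" for u i
    using permutes_in_image[OF that(2), of i] that(1) by simp
  have inj: "u i \<noteq> u j" if "(i, j) \<in> ?R" "u permutes {..<n}" for u i j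
    using that permutes_inj[OF that(2)] by (auto simp: ranked_def inj_def)
  have mem: "srt (u i, u j) \<in> ?R" if "(i, j) \<in> ?R" "u permutes {..<n}" for u i j
    using tot[OF lt[OF _ that(2)] lt[OF _ that(2)] inj[OF that]] that(1) by (auto simp: srt_def ranked_def)
  have inv: "srt (u' (fst (srt (u i, u j))), u' (snd (srt (u i, u j)))) = (i, j)"
    if "(i, j) \<in> ?R" "\<And>k. u' (u k) = k" for u u' i j
    using that asym by (auto simp: srt_def)
  have "vdm \<rho> n (z \<circ> v) = (\<Prod>p\<in>?R. (if (v (fst p), v (snd p)) \<in> ?R then 1 else - 1) *
      (z (fst (srt (v (fst p), v (snd p)))) - z (snd (srt (v (fst p), v (snd p))))))"
    unfolding vdm_def by (intro prod.cong) (auto simp: srt_def)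
  also have "\<dots> = (\<Prod>p\<in>?R. if (v (fst p), v (snd p)) \<in> ?R then 1 else - 1) *
      (\<Prod>p\<in>?R. z (fst (srt (v (fst p), v (snd p)))) - z (snd (srt (v (fst p), v (snd p)))))"
    by (rule prod.distrib)
  also have "(\<Prod>p\<in>?R. z (fst (srt (v (fst p), v (snd p)))) - z (snd (srt (v (fst p), v (snd p)))))
      = (\<Prod>p\<in>?R. z (fst p) - z (snd p))"
  proof (rule prod.reindex_bij_witness[of _ "\<lambda>p. srt (inv_into UNIV v (fst p), inv_into UNIV v (snd p))" "\<lambda>p. srt (v (fst p), v (snd p))"])
    fix p assume p: "p \<in> ?R"
    then obtain i j where ij: "p = (i, j)" by (cases p)
    have 1: "inv_into UNIV v (v k) = k" "v (inv_into UNIV v k) = k" for k using permutes_inverses[OF v] by auto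
    show "srt (inv_into UNIV v (fst (srt (v (fst p), v (snd p)))), inv_into UNIV v (snd (srt (v (fst p), v (snd p))))) = p"
      using inv[of i j "inv_into UNIV v" v] p ij 1 by simp
    show "srt (v (fst (srt (inv_into UNIV v (fst p), inv_into UNIV v (snd p)))), v (snd (srt (inv_into UNIV v (fst p), inv_into UNIV v (snd p))))) = p"
      using inv[of i j v "inv_into UNIV v"] p ij 1 by simp
    show "srt (v (fst p), v (snd p)) \<in> ?R" using mem[of i j v] p ij v by simp
    show "srt (inv_into UNIV v (fst p), inv_into UNIV v (snd p)) \<in> ?R" using mem[of i j "inv_into UNIV v"] p ij permutes_inv[OF v] by simp
  qed auto
  finally show ?thesis by (simp add: vdm_def case_prod_beta')
qed

text \<open>By \<open>vdm_compose\<close> the transposition acts by a scalar c. Splitting off the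
  factor z_a' - z_b', which changes its sign, leaves a cofactor that is multiplied by -c, and a
  fixed point of the transposition at which the cofactor is nonzero gives -c = 1. No inversions are
  counted.\<close>

lemma vdm_transpose:
  assumes \<rho>: "inj_on \<rho> {..<n}" and ab: "a < n" "b < n" "a \<noteq> b"
  shows "vdm \<rho> n (z \<circ> Transposition.transpose a b) = - vdm \<rho> n z"
proof -
  let ?t = "Transposition.transpose a b" and ?R = "ranked \<rho> n"
  define c :: complex where "c = (\<Prod>(i, j)\<in>?R. if (?t i, ?t j) \<in> ?R then 1 else - 1)"
  have t: "?t permutes {..<n}" using ab by (intro permutes_swap_id) auto
  have c: "vdm \<rho> n (z \<circ> ?t) = c * vdm \<rho> n z" for z
    unfolding c_def using vdm_compose[OF \<rho> t] .
  have "(a, b) \<in> ?R \<or> (b, a) \<in> ?R"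
    using \<rho> ab by (auto simp: ranked_def) (metis inj_onD lessThan_iff linorder_neqE_nat)
  then obtain a' b' where ab': "(a', b') \<in> ?R" "{a', b'} = {a, b}" by auto
  define V' where "V' z = (\<Prod>p\<in>?R - {(a', b')}. z (fst p) - z (snd p))" for z :: "nat \<Rightarrow> complex"
  have split: "vdm \<rho> n z = (z a' - z b') * V' z" for z
    unfolding vdm_def V'_def using ab'(1) by (simp add: prod.remove case_prod_beta')
  have V'p: "V' \<in> pfun UNIV (vcoords n)"
    unfolding V'_def[abs_def] by (intro pfun_prod pfun_diff pfun_vcoord) (auto simp: ranked_def)
  have V't: "(\<lambda>z. V' (z \<circ> ?t)) \<in> pfun UNIV (vcoords n)"
  proof (rule pfun_comp[OF V'p])
    fix e assume "e \<in> vcoords n"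
    then obtain i where i: "i < n" "e = (\<lambda>y. y i)" by (auto simp: vcoords_def)
    have "?t i < n" using permutes_in_image[OF t, of i] i by simp
    then show "(\<lambda>z. e (z \<circ> ?t)) \<in> pfun UNIV (vcoords n)" using pfun_vcoord i by simp
  qed auto
  have tab: "?t a' = b'" "?t b' = a'" using ab'(2) by (auto simp: doubleton_eq_iff)
  have d: "(\<lambda>z. z a' - z b') \<in> pfun UNIV (vcoords n)"
    using ab'(1) by (intro pfun_diff pfun_vcoord) (auto simp: ranked_def)
  define z1 :: "nat \<Rightarrow> complex" where "z1 i = of_nat i" for i
  have z1: "z1 a' - z1 b' \<noteq> 0" using ab' by (auto simp: z1_def ranked_def)
  have eq: "V' (z \<circ> ?t) + c * V' z = 0" for z
  proof (rule pfun_density[OF line_connected_vec _ d, of "\<lambda>z. V' (z \<circ> ?t) + c * V' z" z1 z])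
    show "(\<lambda>z. V' (z \<circ> ?t) + c * V' z) \<in> pfun UNIV (vcoords n)"
      by (intro pfun_add V't pfun_cmult V'p)
    fix z :: "nat \<Rightarrow> complex" assume z: "z a' - z b' \<noteq> 0"
    have "(z b' - z a') * V' (z \<circ> ?t) = c * ((z a' - z b') * V' z)"
      using c[of z] unfolding split by (simp add: tab)
    then have "(z a' - z b') * (V' (z \<circ> ?t) + c * V' z) = 0" by (simp add: algebra_simps)
    then show "V' (z \<circ> ?t) + c * V' z = 0" using z by simp
  qed (use z1 in auto)
  \<comment> \<open>This point is fixed by the transposition, and of all the factors only the one
    split off vanishes there.\<close>
  define z0 :: "nat \<Rightarrow> complex" where "z0 i = of_nat (if i = b' then a' else i)" for i
  have z0t: "z0 \<circ> ?t = z0"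
    using ab'(2) by (auto simp: z0_def fun_eq_iff Transposition.transpose_def doubleton_eq_iff)
  have "z0 (fst p) - z0 (snd p) \<noteq> 0" if "p \<in> ?R - {(a', b')}" for p
    using ab'(1) that by (cases p) (auto simp: z0_def ranked_def)
  then have "V' z0 \<noteq> 0" by (auto simp: V'_def)
  with eq[of z0] have "c = - 1" unfolding z0t
    by (metis add.commute add_cancel_left_right add_eq_0_iff mult_cancel_right1 mult_minus_left)
  then show ?thesis using c by simp
qed

lemma vdm_permute:
  assumes \<rho>: "inj_on \<rho> {..<n}" and v: "v permutes {..<n}"
  shows "vdm \<rho> n (z \<circ> v) = of_int (sign v) * vdm \<rho> n z"
  using finite_lessThan v
proof (induction rule: permutes_rev_induct)
  case id then show ?case by simp
next
  case (swap a b p)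
  let ?t = "Transposition.transpose a b"
  have "sign (p \<circ> ?t) = sign p * sign ?t"
    by (rule sign_compose[OF permutation_permutes[THEN iffD2] permutation_swap_id]) (use swap in auto)
  then have "sign (p \<circ> ?t) = - sign p" using swap by (simp add: sign_swap_id)
  moreover have "vdm \<rho> n ((z \<circ> p) \<circ> ?t) = - vdm \<rho> n (z \<circ> p)"
    by (rule vdm_transpose[OF \<rho>]) (use swap in auto)
  ultimately show ?case using swap by (simp only: o_assoc) simp
qed

text \<open>A permutation preserves the sum of the ranks, so unless it is the identity it lowers the
  rank of some t. Then (w t, t) is a ranked pair, and its factor x_(w t) - x_(w t) is zero.\<close>

lemma kern_permute_zero:
  assumes \<rho>: "inj_on \<rho> {..<n}" and w: "w permutes {..<n}" "w \<noteq> id"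
  shows "kern \<rho> n x (x \<circ> w) = 0"
proof -
  have lt: "w i < n" if "i < n" for i using permutes_in_image[OF w(1), of i] that by simp
  have "\<exists>t<n. \<rho> (w t) < \<rho> t"
  proof (rule ccontr)
    assume "\<not> ?thesis"
    then have ge: "\<rho> t \<le> \<rho> (w t)" if "t < n" for t using that by auto
    have "(\<Sum>t<n. \<rho> (w t)) = (\<Sum>t<n. \<rho> t)"
      by (rule sum.reindex_bij_betw[OF permutes_imp_bij[OF w(1)]])
    then have eq: "\<rho> (w t) = \<rho> t" if "t < n" for t
      using sum_mono_inv[of \<rho> "{..<n}" "\<lambda>t. \<rho> (w t)" t] ge that by auto
    have "w t = t" for t
      using eq[of t] \<rho> lt[of t] permutes_not_in[OF w(1), of t] by (cases "t < n") (auto dest: inj_onD)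
    then show False using w(2) by auto
  qed
  then obtain t where t: "t < n" "\<rho> (w t) < \<rho> t" by auto
  then have "(w t, t) \<in> ranked \<rho> n" using lt by (auto simp: ranked_def)
  then have "\<exists>p\<in>ranked \<rho> n. (case p of (i, j) \<Rightarrow> x i - (x \<circ> w) j) = 0" by (intro bexI[of _ "(w t, t)"]) auto
  then show ?thesis unfolding kern_def by (intro prod_zero) auto
qed

lemma vdm_cancel:
  assumes "f \<in> pfun (UNIV \<times> Vp) (prod_coords (vcoords n) Ep)" "line_connected Vp Ep"
    "\<And>z p. p \<in> Vp \<Longrightarrow> vdm \<rho> n z \<noteq> 0 \<Longrightarrow> f (z, p) = 0" "p \<in> Vp"
  shows "f (z, p) = 0"
  by (rule pfun_density_pair[OF line_connected_vec assms(2,1) pfun_fst[OF pfun_vdm[of \<rho>]], of of_nat p])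
    (use assms vdm_nonzero[of n of_nat \<rho>] in auto)

lemma pfun_permute_fst:
  assumes "f \<in> pfun (UNIV \<times> Vp) (prod_coords (vcoords n) Ep)" "v permutes {..<n}"
  shows "(\<lambda>p. f (fst p \<circ> v, snd p)) \<in> pfun (UNIV \<times> Vp) (prod_coords (vcoords n) Ep)"
proof (rule pfun_comp_pair[OF assms(1)])
  fix e assume "e \<in> vcoords n"
  then obtain i where i: "i < n" "e = (\<lambda>y. y i)" by (auto simp: vcoords_def)
  have "v i < n" using permutes_in_image[OF assms(2), of i] i by simp
  then show "(\<lambda>z. e (fst z \<circ> v)) \<in> pfun (UNIV \<times> Vp) (prod_coords (vcoords n) Ep)"
    using pfun_fst[OF pfun_vcoord, of "v i" n] i by simp
next
  fix e assume "e \<in> Ep"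
  then show "(\<lambda>z. e (snd z)) \<in> pfun (UNIV \<times> Vp) (prod_coords (vcoords n) Ep)"
    by (rule pfun_snd[OF pfun_coord])
qed auto

lemma pfun_permute:
  assumes "f \<in> pfun UNIV (vcoords n)" "v permutes {..<n}"
  shows "(\<lambda>z. f (z \<circ> v)) \<in> pfun UNIV (vcoords n)"
proof (rule pfun_comp[OF assms(1)])
  fix e assume "e \<in> vcoords n"
  then obtain i where i: "i < n" "e = (\<lambda>y. y i)" by (auto simp: vcoords_def)
  have "v i < n" using permutes_in_image[OF assms(2), of i] i by simp
  then show "(\<lambda>z. e (z \<circ> v)) \<in> pfun UNIV (vcoords n)" using pfun_vcoord i by simp
qed auto

text \<open>Linear factors are split off one at a time. On the next hyperplane the product of the
  earlier factors is generically nonzero, as a ranked set of pairs lists each hyperplane only once;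
  so the current quotient vanishes there too and is divisible by the next factor.\<close>

lemma hyperplanes_divide:
  assumes N: "N \<in> pfun (UNIV \<times> Vp) (prod_coords (vcoords n) Ep)" and Vp: "line_connected Vp Ep"
    and R: "R \<subseteq> ranked \<rho> n"
    and van: "\<And>z p i j. p \<in> Vp \<Longrightarrow> (i, j) \<in> R \<Longrightarrow> z i = z j \<Longrightarrow> N (z, p) = 0"
  shows "\<exists>\<Phi>\<in>pfun (UNIV \<times> Vp) (prod_coords (vcoords n) Ep).
    \<forall>z. \<forall>p\<in>Vp. N (z, p) = (\<Prod>(i, j)\<in>R. z i - z j) * \<Phi> (z, p)"
proof -
  let ?E = "prod_coords (vcoords n) Ep"
  have "finite R" using R finite_ranked by (rule finite_subset)
  then show ?thesis using R van
  proof (induction R rule: finite_induct)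
    case empty then show ?case using N by (intro bexI[of _ N]) auto
  next
    case (insert ab F)
    obtain a b where ab: "ab = (a, b)" by (cases ab)
    with insert.prems have abn: "a < n" "b < n" "a \<noteq> b" by (auto simp: ranked_def)
    have "F \<subseteq> ranked \<rho> n" using insert.prems by simp
    moreover have "N (z, p) = 0" if "p \<in> Vp" "(i, j) \<in> F" "z i = z j" for z p i j
      using insert.prems(2)[OF that(1) _ that(3)] that(2) by simp
    ultimately have "\<exists>\<Phi>\<in>pfun (UNIV \<times> Vp) ?E. \<forall>z. \<forall>p\<in>Vp. N (z, p) = (\<Prod>(i, j)\<in>F. z i - z j) * \<Phi> (z, p)"
      by (rule insert.IH)
    then obtain M where M: "M \<in> pfun (UNIV \<times> Vp) ?E"
      and NM: "\<And>z p. p \<in> Vp \<Longrightarrow> N (z, p) = (\<Prod>(i, j)\<in>F. z i - z j) * M (z, p)"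
      by blast
    define H where "H = {z :: nat \<Rightarrow> complex. z a = z b}"
    have H: "line_connected H (vcoords n)"
      by (rule line_connectedI_affine[of _ "\<lambda>z z' t i. z i + t * (z' i - z i)"]) (auto simp: vcoords_def H_def)
    have M0: "M (z, p) = 0" if zp: "z \<in> H" "p \<in> Vp" for z p
    proof -
      \<comment> \<open>On the hyperplane z_a = z_b this point has no further coincidences, so none
        of the factors already split off vanishes there.\<close>
      define z0 :: "nat \<Rightarrow> complex" where "z0 i = of_nat (if i = b then a else i)" for i
      have F: "F \<subseteq> ranked \<rho> n" "(a, b) \<notin> F" using insert ab by auto
      have "(b, a) \<notin> ranked \<rho> n" using insert.prems ab by (auto simp: ranked_def)
      moreover have "(b, b) \<notin> ranked \<rho> n" "(a, a) \<notin> ranked \<rho> n" "(i, i) \<notin> ranked \<rho> n" for i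
        by (auto simp: ranked_def)
      ultimately have "z0 (fst p) - z0 (snd p) \<noteq> 0" if "p \<in> F" for p
        using F that by (cases p) (auto simp: z0_def)
      then have nz: "(\<Prod>(i, j)\<in>F. z0 i - z0 j) \<noteq> 0"
        using \<open>finite F\<close> by (auto simp: case_prod_beta')
      have d: "(\<lambda>zp. \<Prod>q\<in>F. fst zp (fst q) - fst zp (snd q)) \<in> pfun (H \<times> Vp) ?E"
        using F by (intro pfun_prod pfun_diff pfun_fst[of "\<lambda>y. y _"] pfun_vcoord) (auto simp: ranked_def)
      show ?thesis
      proof (rule pfun_density_pair[OF H Vp _ d, of M z0 p])
        show "M \<in> pfun (H \<times> Vp) ?E" by (rule pfun_mono[OF M]) auto
        show "z0 \<in> H" "p \<in> Vp" "z \<in> H" "p \<in> Vp" using zp by (auto simp: H_def z0_def)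
        show "(\<Prod>q\<in>F. fst (z0, p) (fst q) - fst (z0, p) (snd q)) \<noteq> 0" using nz by (simp add: case_prod_beta')
        fix y p assume y: "y \<in> H" "p \<in> Vp" "(\<Prod>q\<in>F. fst (y, p) (fst q) - fst (y, p) (snd q)) \<noteq> 0"
        then have "N (y, p) = 0" using insert.prems(2)[of p a b y] ab by (auto simp: H_def)
        then show "M (y, p) = 0" using NM[of p y] y by (auto simp: case_prod_beta')
      qed
    qed
    \<comment> \<open>Retraction onto the hyperplane: \<open>M (\<phi> zp) = 0\<close> by
      \<open>M0\<close>, so the difference below is \<open>M\<close> itself.\<close>
    define \<phi> where "\<phi> zp = ((fst zp)(b := fst zp a), snd zp)" for zp :: "(nat \<Rightarrow> complex) \<times> 'a"
    have "\<exists>q\<in>pfun (UNIV \<times> Vp) ?E. \<forall>zp\<in>UNIV \<times> Vp. M zp - M (\<phi> zp) = (fst zp a - fst zp b) * q zp"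
    proof (rule pfun_diff_factor[OF M])
      fix e assume e: "e \<in> ?E"
      then consider i where "i < n" "e = (\<lambda>z. fst z i)" | e' where "e' \<in> Ep" "e = (\<lambda>z. e' (snd z))"
        by (auto simp: prod_coords_def vcoords_def)
      then have "(\<lambda>z. e (\<phi> z)) \<in> pfun (UNIV \<times> Vp) ?E \<and>
        (\<exists>q\<in>pfun (UNIV \<times> Vp) ?E. \<forall>z\<in>UNIV \<times> Vp. e z - e (\<phi> z) = (fst z a - fst z b) * q z)"
      proof cases
        case 1
        show ?thesis
        proof (cases "i = b")
          case True
          then show ?thesis using 1 abn pfun_fst[OF pfun_vcoord[of a n]]
            by (auto simp: \<phi>_def intro!: bexI[OF _ pfun_const[of "-1"]])
        next
          case False
          then show ?thesis using 1 abn pfun_fst[OF pfun_vcoord[of i n]]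
            by (auto simp: \<phi>_def intro!: bexI[OF _ pfun_const[of 0]])
        qed
      next
        case 2
        then show ?thesis using pfun_coord[OF e]
            by (auto simp: \<phi>_def intro!: bexI[OF _ pfun_const[of 0]])
      qed
      then show "(\<lambda>z. e (\<phi> z)) \<in> pfun (UNIV \<times> Vp) ?E"
        "\<exists>q\<in>pfun (UNIV \<times> Vp) ?E. \<forall>z\<in>UNIV \<times> Vp. e z - e (\<phi> z) = (fst z a - fst z b) * q z" by auto
    qed (auto simp: \<phi>_def)
    then obtain q where q: "q \<in> pfun (UNIV \<times> Vp) ?E"
      "\<And>zp. zp \<in> UNIV \<times> Vp \<Longrightarrow> M zp - M (\<phi> zp) = (fst zp a - fst zp b) * q zp" by auto
    have "M (z, p) = (z a - z b) * q (z, p)" if "p \<in> Vp" for z p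
      using q(2)[of "(z, p)"] M0[of "z(b := z a)" p] that abn by (auto simp: \<phi>_def H_def)
    then show ?case using NM q(1) insert.hyps ab by (intro bexI[of _ q]) (auto simp: mult_ac)
  qed
qed

section \<open>Symmetric coefficients and interpolation\<close>

definition symf :: "nat \<Rightarrow> ((nat \<Rightarrow> complex) \<Rightarrow> complex) set" where
  "symf n = {q \<in> pfun UNIV (vcoords n). \<forall>v y. v permutes {..<n} \<longrightarrow> q (y \<circ> v) = q y}"

lemma sum_permutes_compose_left:
  assumes "v permutes S"
  shows "(\<Sum>w\<in>{w. w permutes S}. f (v \<circ> w)) = (\<Sum>w\<in>{w. w permutes S}. f w)"
proof (rule sum.reindex_bij_witness[of _ "\<lambda>w. inv_into UNIV v \<circ> w" "\<lambda>w. v \<circ> w"])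
qed (use assms in \<open>auto simp: o_assoc permutes_inv_o intro: permutes_compose permutes_inv\<close>)

text \<open>A point with \<open>z i = z j\<close> is fixed by the transposition of i and j, which
  changes the sign of N; so N vanishes on every hyperplane. Both N and the Vandermonde product
  change by the sign of a permutation, hence their quotient is symmetric.\<close>

lemma antisymmetric_divide:
  assumes N: "N \<in> pfun (UNIV \<times> Vp) (prod_coords (vcoords n) Ep)" and Vp: "line_connected Vp Ep"
    and \<rho>: "inj_on \<rho> {..<n}"
    and anti: "\<And>v z p. v permutes {..<n} \<Longrightarrow> p \<in> Vp \<Longrightarrow> N (z \<circ> v, p) = of_int (sign v) * N (z, p)"
  shows "\<exists>\<Phi>\<in>pfun (UNIV \<times> Vp) (prod_coords (vcoords n) Ep).
    (\<forall>z. \<forall>p\<in>Vp. N (z, p) = vdm \<rho> n z * \<Phi> (z, p)) \<and>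
    (\<forall>v z. \<forall>p\<in>Vp. v permutes {..<n} \<longrightarrow> \<Phi> (z \<circ> v, p) = \<Phi> (z, p))"
proof -
  have van: "N (z, p) = 0" if p: "p \<in> Vp" and ij: "(i, j) \<in> ranked \<rho> n" "z i = z j" for z p i j
  proof -
    let ?t = "Transposition.transpose i j"
    have "?t permutes {..<n}" using ij by (intro permutes_swap_id) (auto simp: ranked_def)
    moreover have "z \<circ> ?t = z" using ij(2) by (auto simp: fun_eq_iff Transposition.transpose_def)
    moreover have "sign ?t = - 1" using ij(1) by (auto simp: sign_swap_id ranked_def)
    ultimately have "N (z, p) = - N (z, p)" using anti[of ?t p z] p by simp
    then show ?thesis by simp
  qed
  have "\<exists>\<Phi>\<in>pfun (UNIV \<times> Vp) (prod_coords (vcoords n) Ep).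
    \<forall>z. \<forall>p\<in>Vp. N (z, p) = vdm \<rho> n z * \<Phi> (z, p)"
    unfolding vdm_def by (rule hyperplanes_divide[OF N Vp order_refl]) (rule van)
  then obtain \<Phi> where \<Phi>: "\<Phi> \<in> pfun (UNIV \<times> Vp) (prod_coords (vcoords n) Ep)"
    "\<And>z p. p \<in> Vp \<Longrightarrow> N (z, p) = vdm \<rho> n z * \<Phi> (z, p)"
    by blast
  have "\<Phi> (z \<circ> v, p) = \<Phi> (z, p)" if p: "p \<in> Vp" and v: "v permutes {..<n}" for v z p
  proof -
    have f: "(\<lambda>zp. \<Phi> (fst zp \<circ> v, snd zp) - \<Phi> zp) \<in> pfun (UNIV \<times> Vp) (prod_coords (vcoords n) Ep)"
      by (intro pfun_diff \<Phi> pfun_permute_fst v)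
    have "\<Phi> (z \<circ> v, p) = \<Phi> (z, p)" if p: "p \<in> Vp" and z: "vdm \<rho> n z \<noteq> 0" for z p
    proof -
      have "vdm \<rho> n (z \<circ> v) * \<Phi> (z \<circ> v, p) = of_int (sign v) * (vdm \<rho> n z * \<Phi> (z, p))"
        using anti[OF v p, of z] \<Phi>(2)[OF p] by auto
      then show ?thesis using z by (simp add: vdm_permute[OF \<rho> v])
    qed
    then show ?thesis using vdm_cancel[OF f Vp, of \<rho> p z] p by auto
  qed
  then show ?thesis using \<Phi> by (intro bexI[of _ \<Phi>]) auto
qed

text \<open>This makes the m_j generators of the polynomials in z over the symmetric ones. The
  coefficient of m_j is the antisymmetrization of s_j P divided by the Vandermonde product; summing
  over j rebuilds \<open>kern\<close> at (z, z w), and only the term of the identity survives. The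
  parameter in \<open>Vp\<close> is carried along because later P also depends on a matrix.\<close>

lemma symmetric_expansion:
  assumes \<rho>: "inj_on \<rho> {..<n}"
    and ms: "\<And>j. j < (K::nat) \<Longrightarrow> m j \<in> pfun UNIV (vcoords n)" "\<And>j. j < K \<Longrightarrow> s j \<in> pfun UNIV (vcoords n)"
    and kern: "\<And>x z. kern \<rho> n x z = (\<Sum>j<K. m j x * s j z)"
    and P: "P \<in> pfun (UNIV \<times> Vp) (prod_coords (vcoords n) Ep)" and Vp: "line_connected Vp Ep"
  shows "\<exists>\<Phi>. (\<forall>j<K. \<Phi> j \<in> pfun (UNIV \<times> Vp) (prod_coords (vcoords n) Ep) \<and>
      (\<forall>v z. \<forall>p\<in>Vp. v permutes {..<n} \<longrightarrow> \<Phi> j (z \<circ> v, p) = \<Phi> j (z, p)) \<and>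
      (\<forall>z. \<forall>p\<in>Vp. vdm \<rho> n z * \<Phi> j (z, p) =
        (\<Sum>w\<in>{w. w permutes {..<n}}. of_int (sign w) * s j (z \<circ> w) * P (z \<circ> w, p)))) \<and>
    (\<forall>z. \<forall>p\<in>Vp. P (z, p) = (\<Sum>j<K. m j z * \<Phi> j (z, p)))"
proof -
  let ?E = "prod_coords (vcoords n) Ep" and ?W = "{w. w permutes {..<n}}"
  define N where "N j zp = (\<Sum>w\<in>?W. of_int (sign w) * s j (fst zp \<circ> w) * P (fst zp \<circ> w, snd zp))" for j zp
  define Q where "Q j \<Phi> \<longleftrightarrow> \<Phi> \<in> pfun (UNIV \<times> Vp) ?E \<and> (\<forall>z. \<forall>p\<in>Vp. N j (z, p) = vdm \<rho> n z * \<Phi> (z, p)) \<and>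
    (\<forall>v z. \<forall>p\<in>Vp. v permutes {..<n} \<longrightarrow> \<Phi> (z \<circ> v, p) = \<Phi> (z, p))" for j \<Phi>
  have "\<exists>\<Phi>. Q j \<Phi>" if j: "j < K" for j
    unfolding Q_def
  proof (rule antisymmetric_divide[OF _ Vp \<rho>, unfolded Bex_def])
    show "N j \<in> pfun (UNIV \<times> Vp) ?E" unfolding N_def[abs_def]
      by (intro pfun_sum pfun_mult pfun_const pfun_permute_fst[OF P] pfun_fst[of "\<lambda>z. s j (z \<circ> _)"]
          pfun_permute ms(2)[OF j]) auto
    fix v z p assume v: "v permutes {..<n}"
    have perm: "permutation w" if "w permutes {..<n}" for w :: "nat \<Rightarrow> nat"
      using that by (auto simp: permutation_permutes)
    have "N j (z \<circ> v, p) = (\<Sum>w\<in>?W. of_int (sign v) * (of_int (sign (v \<circ> w)) * s j (z \<circ> (v \<circ> w)) * P (z \<circ> (v \<circ> w), p)))"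
      unfolding N_def
    proof (intro sum.cong refl)
      fix w assume "w \<in> ?W"
      then have "sign (v \<circ> w) = sign v * sign w" using v perm by (simp add: sign_compose)
      then have "(of_int (sign v) :: complex) * of_int (sign (v \<circ> w)) = of_int (sign w)"
        by (simp flip: of_int_mult)
      then show "of_int (sign w) * s j (fst (z \<circ> v, p) \<circ> w) * P (fst (z \<circ> v, p) \<circ> w, snd (z \<circ> v, p)) =
        of_int (sign v) * (of_int (sign (v \<circ> w)) * s j (z \<circ> (v \<circ> w)) * P (z \<circ> (v \<circ> w), p))"
        by (simp add: o_assoc mult.assoc[symmetric])
    qed
    also have "\<dots> = of_int (sign v) * N j (z, p)"
      unfolding N_def sum_distrib_left[symmetric]
      using sum_permutes_compose_left[OF v, of "\<lambda>w. of_int (sign w) * s j (z \<circ> w) * P (z \<circ> w, p)"] by simp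
    finally show "N j (z \<circ> v, p) = of_int (sign v) * N j (z, p)" .
  qed
  then obtain \<Phi> where "\<And>j. j < K \<Longrightarrow> Q j (\<Phi> j)" by metis
  then have \<Phi>: "\<And>j. j < K \<Longrightarrow> \<Phi> j \<in> pfun (UNIV \<times> Vp) ?E"
    "\<And>j z p. j < K \<Longrightarrow> p \<in> Vp \<Longrightarrow> N j (z, p) = vdm \<rho> n z * \<Phi> j (z, p)"
    "\<And>j v z p. j < K \<Longrightarrow> p \<in> Vp \<Longrightarrow> v permutes {..<n} \<Longrightarrow> \<Phi> j (z \<circ> v, p) = \<Phi> j (z, p)"
    unfolding Q_def by blast+
  have "P (z, p) = (\<Sum>j<K. m j z * \<Phi> j (z, p))" if p: "p \<in> Vp" for z p
  proof -
    have f: "(\<lambda>zp. P zp - (\<Sum>j<K. m j (fst zp) * \<Phi> j zp)) \<in> pfun (UNIV \<times> Vp) ?E"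
      by (intro pfun_diff pfun_sum pfun_mult pfun_fst P ms \<Phi>) auto
    have "P (z, p) = (\<Sum>j<K. m j z * \<Phi> j (z, p))" if zp': "p \<in> Vp" "vdm \<rho> n z \<noteq> 0" for z p
    proof -
      have "vdm \<rho> n z * (\<Sum>j<K. m j z * \<Phi> j (z, p)) = (\<Sum>j<K. m j z * N j (z, p))"
        using \<Phi>(2)[of _ p z] zp' by (simp add: sum_distrib_left mult_ac)
      also have "\<dots> = (\<Sum>j<K. \<Sum>w\<in>?W. m j z * (of_int (sign w) * s j (z \<circ> w) * P (z \<circ> w, p)))"
        unfolding N_def by (simp add: sum_distrib_left)
      also have "\<dots> = (\<Sum>w\<in>?W. of_int (sign w) * kern \<rho> n z (z \<circ> w) * P (z \<circ> w, p))"
        by (subst sum.swap) (simp add: kern sum_distrib_left sum_distrib_right mult_ac)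
      also have "\<dots> = (\<Sum>w\<in>{id}. of_int (sign w) * kern \<rho> n z (z \<circ> w) * P (z \<circ> w, p))"
        by (rule sum.mono_neutral_right)
          (auto simp: finite_permutations permutes_id intro: kern_permute_zero[OF \<rho>])
      also have "\<dots> = vdm \<rho> n z * P (z, p)" by (simp add: kern_diag)
      finally show ?thesis using zp' by simp
    qed
    then show ?thesis using vdm_cancel[OF f Vp, of \<rho> p z] p by auto
  qed
  then show ?thesis using \<Phi> by (intro exI[of _ \<Phi>]) (auto simp: N_def)
qed

lemma kern_expansion:
  "\<exists>(K::nat) m s. (\<forall>j<K. m j \<in> pfun UNIV (vcoords n) \<and> s j \<in> pfun UNIV (vcoords n)) \<and>
    (\<forall>x z. kern \<rho> n x z = (\<Sum>j<K. m j x * s j z))"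
proof -
  obtain t where t: "t \<in> tensors (pfun UNIV (vcoords n)) (pfun UNIV (vcoords n))"
    "\<And>x z. kern \<rho> n x z = t (x, z)"
    using pfun_imp_tensors[OF pfun_kern] by fastforce
  show ?thesis unfolding t(2) by (rule tensors_finite_sum[OF t(1)])
qed

text \<open>Averaging over the permutations of the first variable fixes f and turns each factor in
  that variable into a symmetric polynomial.\<close>

lemma symmetric_tensors:
  assumes f: "f \<in> pfun (UNIV \<times> Vp) (prod_coords (vcoords n) Ep)"
    and sym: "\<And>v z p. v permutes {..<n} \<Longrightarrow> p \<in> Vp \<Longrightarrow> f (z \<circ> v, p) = f (z, p)"
  shows "\<exists>t\<in>tensors (symf n) (pfun Vp Ep). \<forall>z. \<forall>p\<in>Vp. f (z, p) = t (z, p)"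
proof -
  let ?W = "{w. w permutes {..<n}}"
  define avg where "avg g zp = (1 / of_nat (card ?W)) * (\<Sum>w\<in>?W. g (fst zp \<circ> w, snd zp))"
    for g :: "(nat \<Rightarrow> complex) \<times> 'a \<Rightarrow> complex" and zp
  have W: "card ?W \<noteq> 0"
    by (simp add: card_permutations[OF refl finite_lessThan])
  obtain t where t: "t \<in> tensors (pfun UNIV (vcoords n)) (pfun Vp Ep)" "\<And>z p. p \<in> Vp \<Longrightarrow> f (z, p) = t (z, p)"
    using pfun_imp_tensors[OF f] by fastforce
  have "avg t \<in> tensors (symf n) (pfun Vp Ep)"
    using t(1)
  proof induction
    case (pure m r)
    have "(\<lambda>z. (1 / of_nat (card ?W)) * (\<Sum>w\<in>?W. m (z \<circ> w))) \<in> symf n"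
      unfolding symf_def
    proof (intro CollectI conjI allI impI)
      show "(\<lambda>z. (1 / of_nat (card ?W)) * (\<Sum>w\<in>?W. m (z \<circ> w))) \<in> pfun UNIV (vcoords n)"
        by (intro pfun_cmult pfun_sum pfun_permute pure) auto
      fix v and y :: "nat \<Rightarrow> complex" assume "v permutes {..<n}"
      from sum_permutes_compose_left[OF this, of "\<lambda>w. m (y \<circ> w)"]
      show "1 / of_nat (card ?W) * (\<Sum>w\<in>?W. m (y \<circ> v \<circ> w)) = 1 / of_nat (card ?W) * (\<Sum>w\<in>?W. m (y \<circ> w))"
        by (simp add: o_assoc)
    qed
    from tensors.pure[OF this pure(2)] show ?case
      by (simp add: avg_def[abs_def] sum_distrib_left mult_ac)
  next
    case (plus f g)
    have "avg (\<lambda>z. f z + g z) = (\<lambda>z. avg f z + avg g z)"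
      by (simp add: avg_def[abs_def] sum.distrib add_divide_distrib)
    then show ?case using tensors.plus plus by simp
  qed
  moreover have "f (z, p) = avg t (z, p)" if "p \<in> Vp" for z p
  proof -
    have "avg t (z, p) = (1 / of_nat (card ?W)) * (\<Sum>w\<in>?W. f (z, p))"
      unfolding avg_def using t(2)[OF that] sym[OF _ that] by (auto intro!: sum.cong)
    then show ?thesis using W by simp
  qed
  ultimately show ?thesis by blast
qed

text \<open>This is the ideal of the fibre product of two affine n-spaces over their quotient by W;
  the restriction to traceless vectors is made later through \<open>trless\<close>.\<close>

inductive_set sym_differences :: "nat \<Rightarrow> ((nat \<Rightarrow> complex) \<times> (nat \<Rightarrow> complex) \<Rightarrow> complex) set" for n where
  diff: "q \<in> symf n \<Longrightarrow> r \<in> pfun (UNIV \<times> UNIV) (prod_coords (vcoords n) (vcoords n)) \<Longrightarrow>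
    (\<lambda>z. (q (fst z) - q (snd z)) * r z) \<in> sym_differences n"
| plus: "f \<in> sym_differences n \<Longrightarrow> g \<in> sym_differences n \<Longrightarrow> (\<lambda>z. f z + g z) \<in> sym_differences n"

lemma sym_differences_zero: "(\<lambda>z. 0) \<in> sym_differences n"
  using sym_differences.diff[of "\<lambda>_. 0" n "\<lambda>_. 0"] by (simp add: symf_def pfun_const)

lemma sym_differences_sum:
  "(\<And>i. i \<in> I \<Longrightarrow> f i \<in> sym_differences n) \<Longrightarrow> (\<lambda>z. \<Sum>i\<in>I. f i z) \<in> sym_differences n"
  by (induction I rule: infinite_finite_induct) (auto intro: sym_differences_zero sym_differences.plus)

lemma sym_differences_mult:
  assumes "f \<in> sym_differences n" "g \<in> pfun (UNIV \<times> UNIV) (prod_coords (vcoords n) (vcoords n))"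
  shows "(\<lambda>z. g z * f z) \<in> sym_differences n"
  using assms(1)
proof induction
  case (diff q r)
  from sym_differences.diff[OF diff(1) pfun_mult[OF diff(2) assms(2)]] show ?case by (simp add: mult_ac)
next
  case (plus f h)
  then show ?case using sym_differences.plus by (force simp: distrib_left)
qed

text \<open>By \<open>symmetric_tensors\<close> f is a sum of terms q(x) r(y) with q symmetric, and
  modulo the ideal q(x) may be exchanged for q(y).\<close>

lemma symmetric_in_fst_difference:
  assumes f: "f \<in> pfun (UNIV \<times> UNIV) (prod_coords (vcoords n) (vcoords n))"
    and sym: "\<And>v z p. v permutes {..<n} \<Longrightarrow> f (z \<circ> v, p) = f (z, p)"
  shows "(\<lambda>z. f z - f (snd z, snd z)) \<in> sym_differences n"
proof -
  obtain t where t: "t \<in> tensors (symf n) (pfun UNIV (vcoords n))" and ft: "f = t"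
    using symmetric_tensors[OF f sym] by fastforce
  show ?thesis unfolding ft using t
  proof induction
    case (pure m r)
    from sym_differences.diff[OF pure(1) pfun_snd[OF pure(2)]] show ?case by (simp add: algebra_simps)
  next
    case (plus f g)
    have "(\<lambda>z. f z + g z - (f (snd z, snd z) + g (snd z, snd z))) =
      (\<lambda>z. (f z - f (snd z, snd z)) + (g z - g (snd z, snd z)))" by auto
    then show ?case using sym_differences.plus[OF plus.IH] by simp
  qed
qed

text \<open>
  The interpolation formula \<open>P(x,y) \<equiv> \<Sum>\<^sub>w sgn(w) S(x,yw) P(yw,y) / \<Delta>(y)\<close> modulo the differences of
  symmetric functions, where \<open>S\<close> is \<open>kern\<close> and \<open>\<Delta>\<close> is \<open>vdm\<close>.
\<close>

lemma interpolation:
  assumes \<rho>: "inj_on \<rho> {..<n}"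
    and P: "P \<in> pfun (UNIV \<times> UNIV) (prod_coords (vcoords n) (vcoords n))"
  shows "\<exists>\<Psi>\<in>pfun (UNIV \<times> UNIV) (prod_coords (vcoords n) (vcoords n)).
    (\<lambda>z. P z - \<Psi> z) \<in> sym_differences n \<and>
    (\<forall>x y. vdm \<rho> n y * \<Psi> (x, y) =
      (\<Sum>w\<in>{w. w permutes {..<n}}. of_int (sign w) * kern \<rho> n x (y \<circ> w) * P (y \<circ> w, y)))"
proof -
  let ?E = "prod_coords (vcoords n) (vcoords n)" and ?W = "{w. w permutes {..<n}}"
  obtain K :: nat and m s where ms: "\<forall>j<K. m j \<in> pfun UNIV (vcoords n) \<and> s j \<in> pfun UNIV (vcoords n)"
    "\<And>x z. kern \<rho> n x z = (\<Sum>j<K. m j x * s j z)"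
    using kern_expansion[of n \<rho>] by metis
  have mj: "m j \<in> pfun UNIV (vcoords n)" "s j \<in> pfun UNIV (vcoords n)" if "j < K" for j using ms(1) that by auto
  obtain \<Phi> where \<Phi>0: "(\<forall>j<K. \<Phi> j \<in> pfun (UNIV \<times> UNIV) ?E \<and>
      (\<forall>v z. \<forall>p\<in>UNIV. v permutes {..<n} \<longrightarrow> \<Phi> j (z \<circ> v, p) = \<Phi> j (z, p)) \<and>
      (\<forall>z. \<forall>p\<in>UNIV. vdm \<rho> n z * \<Phi> j (z, p) =
        (\<Sum>w\<in>?W. of_int (sign w) * s j (z \<circ> w) * P (z \<circ> w, p)))) \<and>
    (\<forall>z. \<forall>p\<in>UNIV. P (z, p) = (\<Sum>j<K. m j z * \<Phi> j (z, p)))"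
    by (rule exE[OF symmetric_expansion[OF \<rho> mj ms(2) P line_connected_vec]], assumption, assumption, rule that)
  note \<Phi>j = \<Phi>0[THEN conjunct1, THEN spec, THEN mp]
  have \<Phi>: "\<And>j. j < K \<Longrightarrow> \<Phi> j \<in> pfun (UNIV \<times> UNIV) ?E"
    by (rule \<Phi>j[THEN conjunct1])
  have \<Phi>_sym: "\<And>j v z p. j < K \<Longrightarrow> v permutes {..<n} \<Longrightarrow> \<Phi> j (z \<circ> v, p) = \<Phi> j (z, p)"
    by (rule \<Phi>j[THEN conjunct2, THEN conjunct1, rule_format, OF _ UNIV_I])
  have \<Phi>_vdm: "\<And>j z p. j < K \<Longrightarrow> vdm \<rho> n z * \<Phi> j (z, p) =
        (\<Sum>w\<in>?W. of_int (sign w) * s j (z \<circ> w) * P (z \<circ> w, p))"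
    by (rule \<Phi>j[THEN conjunct2, THEN conjunct2, rule_format, OF _ UNIV_I])
  have \<Phi>_P: "\<And>z p. P (z, p) = (\<Sum>j<K. m j z * \<Phi> j (z, p))"
    by (rule \<Phi>0[THEN conjunct2, rule_format, OF UNIV_I])
  \<comment> \<open>The coefficients are symmetric in the first argument, so modulo the ideal this
    argument may be set to y; x then enters only through the m_j.\<close>
  define \<Psi> where "\<Psi> z = (\<Sum>j<K. m j (fst z) * \<Phi> j (snd z, snd z))" for z
  have dg: "(\<lambda>z. \<Phi> j (snd z, snd z)) \<in> pfun (UNIV \<times> UNIV) ?E" if "j < K" for j
    by (rule pfun_comp_pair[OF \<Phi>[OF that]]) (erule pfun_snd[OF pfun_coord] | rule UNIV_I)+
  have "\<Psi> \<in> pfun (UNIV \<times> UNIV) ?E"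
    unfolding \<Psi>_def[abs_def] by (intro pfun_sum pfun_mult pfun_fst dg) (use mj in auto)
  moreover have "(\<lambda>z. P z - \<Psi> z) \<in> sym_differences n"
  proof -
    have "(\<lambda>z. \<Sum>j<K. m j (fst z) * (\<Phi> j z - \<Phi> j (snd z, snd z))) \<in> sym_differences n"
      by (intro sym_differences_sum sym_differences_mult symmetric_in_fst_difference pfun_fst \<Phi> \<Phi>_sym) (use mj in auto)
    moreover have "P z - \<Psi> z = (\<Sum>j<K. m j (fst z) * (\<Phi> j z - \<Phi> j (snd z, snd z)))" for z
      using \<Phi>_P[of "fst z" "snd z"] by (simp add: \<Psi>_def right_diff_distrib sum_subtractf)
    ultimately show ?thesis by simp
  qed
  moreover have "vdm \<rho> n y * \<Psi> (x, y) =
      (\<Sum>w\<in>?W. of_int (sign w) * kern \<rho> n x (y \<circ> w) * P (y \<circ> w, y))" for x y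
  proof -
    have "vdm \<rho> n y * \<Psi> (x, y) = (\<Sum>j<K. m j x * (vdm \<rho> n y * \<Phi> j (y, y)))"
      unfolding \<Psi>_def by (simp add: sum_distrib_left mult_ac)
    also have "\<dots> = (\<Sum>j<K. \<Sum>w\<in>?W. m j x * (of_int (sign w) * s j (y \<circ> w) * P (y \<circ> w, y)))"
      by (simp add: \<Phi>_vdm sum_distrib_left)
    also have "\<dots> = (\<Sum>w\<in>?W. of_int (sign w) * kern \<rho> n x (y \<circ> w) * P (y \<circ> w, y))"
      by (subst sum.swap) (simp add: ms(2) sum_distrib_left sum_distrib_right mult_ac)
    finally show ?thesis .
  qed
  ultimately show ?thesis by blast
qed

text \<open>By the interpolation formula P is, modulo the ideal, a polynomial whose product with the
  Vandermonde product is zero. Geometrically, the fibre product is reduced.\<close>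

lemma vanish_on_graphs:
  assumes P: "P \<in> pfun (UNIV \<times> UNIV) (prod_coords (vcoords n) (vcoords n))"
    and van: "\<And>w y. w permutes {..<n} \<Longrightarrow> P (y \<circ> w, y) = 0"
  shows "P \<in> sym_differences n"
proof -
  obtain \<Psi> where \<Psi>: "\<Psi> \<in> pfun (UNIV \<times> UNIV) (prod_coords (vcoords n) (vcoords n))"
    "(\<lambda>z. P z - \<Psi> z) \<in> sym_differences n"
    "\<And>x y. vdm id n y * \<Psi> (x, y) = 0"
    using interpolation[OF inj_on_id P] van by auto
  have "\<Psi> (x, y) = 0" for x y
    by (rule pfun_density_pair[OF line_connected_vec line_connected_vec \<Psi>(1) pfun_snd[OF pfun_vdm[of id n]], of x of_nat])
      (use \<Psi>(3) vdm_nonzero[of n of_nat id] in auto)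
  then have "(\<lambda>z. P z - \<Psi> z) = P" by auto
  then show ?thesis using \<Psi>(2) by simp
qed

text \<open>Only those w contribute to the interpolation formula that carry the complement of I onto
  S'. For them the factors of \<open>kern\<close> with i in I and j outside I multiply to the block
  product, independently of w. It remains to divide the other factor by the Vandermonde product in
  y.\<close>

lemma supported_on_graphs:
  assumes P: "P \<in> pfun (UNIV \<times> UNIV) (prod_coords (vcoords n) (vcoords n))"
    and I: "I \<subseteq> {..<n}" "S' \<subseteq> {..<n}" "card I + card S' = n"
    and van: "\<And>w y. w permutes {..<n} \<Longrightarrow> w ` I \<inter> S' \<noteq> {} \<Longrightarrow> P (y \<circ> w, y) = 0"
  shows "\<exists>H\<in>pfun (UNIV \<times> UNIV) (prod_coords (vcoords n) (vcoords n)).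
    (\<lambda>(x, y). P (x, y) - (\<Prod>i\<in>I. \<Prod>t\<in>S'. x i - y t) * H (x, y)) \<in> sym_differences n"
proof -
  let ?E = "prod_coords (vcoords n) (vcoords n)" and ?W = "{w. w permutes {..<n}}"
  \<comment> \<open>This order puts I before its complement, so that all pairs in I times its
    complement are ranked; adding n keeps the two blocks apart.\<close>
  define \<rho> where "\<rho> i = (if i \<in> I then i else n + i)" for i
  have \<rho>: "inj_on \<rho> {..<n}" by (auto simp: inj_on_def \<rho>_def split: if_splits)
  obtain \<Psi> where \<Psi>: "\<Psi> \<in> pfun (UNIV \<times> UNIV) ?E" "(\<lambda>z. P z - \<Psi> z) \<in> sym_differences n"
    "\<And>x y. vdm \<rho> n y * \<Psi> (x, y) = (\<Sum>w\<in>?W. of_int (sign w) * kern \<rho> n x (y \<circ> w) * P (y \<circ> w, y))"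
    using interpolation[OF \<rho> P] by blast
  define W' where "W' = {w \<in> ?W. w ` I \<inter> S' = {}}"
  define R0 where "R0 = ranked \<rho> n - I \<times> ({..<n} - I)"
  define k0 where "k0 x z = (\<Prod>p\<in>R0. x (fst p) - z (snd p))" for x z :: "nat \<Rightarrow> complex"
  define f where "f x y = (\<Prod>i\<in>I. \<Prod>t\<in>S'. x i - y t)" for x y :: "nat \<Rightarrow> complex"
  have fin: "finite I" "finite S'" using I finite_subset by auto
  have R: "ranked \<rho> n = R0 \<union> I \<times> ({..<n} - I)" "R0 \<inter> I \<times> ({..<n} - I) = {}"
    using I by (auto simp: R0_def ranked_def \<rho>_def)
  have kern: "kern \<rho> n x (y \<circ> w) = f x y * k0 x (y \<circ> w)" if w: "w \<in> W'" for x y w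
  proof -
    have wp: "w permutes {..<n}" "w ` I \<inter> S' = {}" using w by (auto simp: W'_def)
    have inj: "inj_on w A" for A using permutes_inj[OF wp(1)] by (simp add: inj_on_def)
    have "w ` ({..<n} - I) = {..<n} - w ` I"
      using permutes_image[OF wp(1)] inj by (metis I(1) inj_on_image_set_diff Diff_subset subset_refl)
    moreover have "{..<n} - w ` I = S'"
    proof (rule card_subset_eq[symmetric])
      have "w ` I \<subseteq> {..<n}" using I(1) permutes_image[OF wp(1)] by blast
      then show "card S' = card ({..<n} - w ` I)"
        using I(3) card_image[OF inj, of I] fin by (simp add: card_Diff_subset)
    qed (use I wp in auto)
    ultimately have img: "w ` ({..<n} - I) = S'" by simp
    have "kern \<rho> n x (y \<circ> w) = k0 x (y \<circ> w) * (\<Prod>p\<in>I \<times> ({..<n} - I). x (fst p) - y (w (snd p)))"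
      unfolding kern_def R(1) k0_def using R(2) fin
      by (subst prod.union_disjoint) (auto simp: R0_def case_prod_beta')
    also have "(\<Prod>p\<in>I \<times> ({..<n} - I). x (fst p) - y (w (snd p))) = (\<Prod>i\<in>I. \<Prod>t\<in>{..<n} - I. x i - y (w t))"
      by (subst prod.cartesian_product) (simp add: case_prod_beta')
    also have "\<dots> = f x y"
      unfolding f_def img[symmetric] prod.reindex[OF inj] o_def ..
    finally show ?thesis by (simp add: o_def mult.commute)
  qed
  \<comment> \<open>The variables are exchanged, y first, because \<open>hyperplanes_divide\<close>
    divides by hyperplanes in the first argument.\<close>
  define N0 where "N0 z = (\<Sum>w\<in>W'. of_int (sign w) * k0 (snd z) (fst z \<circ> w) * P (fst z \<circ> w, fst z))" for z
  have N0: "vdm \<rho> n y * \<Psi> (x, y) = f x y * N0 (y, x)" for x y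
  proof -
    have "vdm \<rho> n y * \<Psi> (x, y) = (\<Sum>w\<in>W'. of_int (sign w) * kern \<rho> n x (y \<circ> w) * P (y \<circ> w, y))"
      unfolding \<Psi>(3) by (rule sum.mono_neutral_right) (auto simp: W'_def van finite_permutations)
    also have "\<dots> = f x y * N0 (y, x)" unfolding N0_def by (simp add: sum_distrib_left kern mult_ac)
    finally show ?thesis .
  qed
  have lt: "w i < n" if "w permutes {..<n}" "i < n" for w i
    using permutes_in_image[OF that(1), of i] that by simp
  have N0p: "N0 \<in> pfun (UNIV \<times> UNIV) ?E"
  proof -
    have 1: "(\<lambda>z. k0 (snd z) (fst z \<circ> w)) \<in> pfun (UNIV \<times> UNIV) ?E" if "w \<in> W'" for w
      unfolding k0_def o_def
      by (intro pfun_prod pfun_diff pfun_fst[of "\<lambda>y. y _"] pfun_snd[of "\<lambda>y. y _"] pfun_vcoord)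
        (use that in \<open>auto simp: R0_def ranked_def W'_def lt\<close>)
    have 2: "(\<lambda>z. P (fst z \<circ> w, fst z)) \<in> pfun (UNIV \<times> UNIV) ?E" if "w \<in> W'" for w
    proof -
      have "w permutes {..<n}" using that by (auto simp: W'_def)
      note 3 = pfun_fst[OF pfun_permute[OF pfun_coord this]]
      show ?thesis by (rule pfun_comp_pair[OF P]) (erule 3 pfun_fst[OF pfun_coord] | rule UNIV_I)+
    qed
    show ?thesis unfolding N0_def[abs_def] by (intro pfun_sum pfun_mult pfun_const 1 2)
  qed
  have fp: "(\<lambda>z. f (snd z) (fst z)) \<in> pfun (V \<times> UNIV) ?E" for V
    unfolding f_def using I
    by (intro pfun_prod pfun_diff pfun_fst[of "\<lambda>y. y _"] pfun_snd[of "\<lambda>y. y _"] pfun_vcoord) auto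
  \<comment> \<open>A constant vector whose entry exceeds every |z_i|, so that no factor x_i - z_t
    vanishes at x = \<open>far z\<close>. It shows that the block product is generically nonzero
    even when y is confined to a hyperplane, and can be cancelled there.\<close>
  define far :: "(nat \<Rightarrow> complex) \<Rightarrow> nat \<Rightarrow> complex" where "far z = (\<lambda>_. 1 + (\<Sum>i<n. of_real (norm (z i))))" for z
  have far: "f (far z) z \<noteq> 0" for z
  proof -
    have "far z i \<noteq> z t" if "t < n" for i t
    proof
      assume "far z i = z t"
      then have "norm (z t) = norm (1 + (\<Sum>i<n. of_real (norm (z i))) :: complex)" by (simp add: far_def)
      also have "1 + (\<Sum>i<n. of_real (norm (z i))) = (of_real (1 + (\<Sum>i<n. norm (z i))) :: complex)" by simp
      also have "norm \<dots> = 1 + (\<Sum>i<n. norm (z i))"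
        unfolding norm_of_real by (simp add: sum_nonneg add_nonneg_nonneg)
      also have "\<dots> > norm (z t)"
        using member_le_sum[of t "{..<n}" "\<lambda>i. norm (z i)"] that by auto
      finally show False by simp
    qed
    then show ?thesis unfolding f_def using I(2) fin by auto
  qed
  have "\<exists>H\<in>pfun (UNIV \<times> UNIV) ?E. \<forall>z. \<forall>p\<in>UNIV. N0 (z, p) = (\<Prod>(i, j)\<in>ranked \<rho> n. z i - z j) * H (z, p)"
  proof (rule hyperplanes_divide[OF N0p line_connected_vec order_refl])
    fix z p :: "nat \<Rightarrow> complex" and i j assume ij: "(i, j) \<in> ranked \<rho> n" "z i = z j"
    define H where "H = {z :: nat \<Rightarrow> complex. z i = z j}"
    have H: "line_connected H (vcoords n)"
      by (rule line_connectedI_affine[of _ "\<lambda>z z' t i. z i + t * (z' i - z i)"]) (auto simp: vcoords_def H_def)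
    show "N0 (z, p) = 0"
    proof (rule pfun_density_pair[OF H line_connected_vec pfun_mono[OF N0p] fp, of z "far z"])
      fix y x :: "nat \<Rightarrow> complex" assume y: "y \<in> H" "f (snd (y, x)) (fst (y, x)) \<noteq> 0"
      have "(case (i, j) of (i, j) \<Rightarrow> y i - y j) = 0" using y(1) by (simp add: H_def)
      then have "vdm \<rho> n y = 0" unfolding vdm_def using ij(1) by (intro prod_zero finite_ranked) blast
      then show "N0 (y, x) = 0" using N0[of y x] y(2) by simp
    qed (use ij far in \<open>auto simp: H_def\<close>)
  qed
  then obtain H where H: "H \<in> pfun (UNIV \<times> UNIV) ?E" "\<And>z p. N0 (z, p) = vdm \<rho> n z * H (z, p)"
    unfolding vdm_def by auto
  have sw: "(\<lambda>z. H (snd z, fst z)) \<in> pfun (UNIV \<times> UNIV) ?E"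
    by (rule pfun_comp_pair[OF H(1)]) (erule pfun_fst[OF pfun_coord] pfun_snd[OF pfun_coord] | rule UNIV_I)+
  have fp': "(\<lambda>z. f (fst z) (snd z)) \<in> pfun (UNIV \<times> UNIV) ?E"
    unfolding f_def using I
    by (intro pfun_prod pfun_diff pfun_fst[of "\<lambda>y. y _"] pfun_snd[of "\<lambda>y. y _"] pfun_vcoord) auto
  have "\<Psi> (x, y) = f x y * H (y, x)" for x y
  proof -
    have g: "(\<lambda>z. \<Psi> z - f (fst z) (snd z) * H (snd z, fst z)) \<in> pfun (UNIV \<times> UNIV) ?E"
      by (rule pfun_diff[OF \<Psi>(1) pfun_mult[OF fp' sw]])
    have "\<Psi> (x, y) = f x y * H (y, x)" if "vdm \<rho> n y \<noteq> 0" for x y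
      using N0[of y x] H(2)[of y x] that by (auto simp: mult_ac)
    then show ?thesis
      using pfun_density_pair[OF line_connected_vec line_connected_vec g pfun_snd[OF pfun_vdm[of \<rho> n]], of x of_nat x y]
        vdm_nonzero[of n of_nat \<rho>] by auto
  qed
  then have "(\<lambda>(x, y). P (x, y) - (\<Prod>i\<in>I. \<Prod>t\<in>S'. x i - y t) * H (y, x)) = (\<lambda>z. P z - \<Psi> z)"
    by (auto simp: f_def)
  then show ?thesis using \<Psi>(2) sw by (intro bexI[OF _ sw]) simp
qed

section \<open>Symmetric functions of the eigenvalues\<close>

definition psum :: "nat \<Rightarrow> nat \<Rightarrow> (nat \<Rightarrow> complex) \<Rightarrow> complex" where
  "psum n k y = (\<Sum>i<n. y i ^ k)"

text \<open>Power sums of the eigenvalues are traces of powers of the matrix, hence polynomial in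
  its entries. It therefore suffices to show that this algebra contains all symmetric
  polynomials.\<close>

inductive_set psum_alg :: "nat \<Rightarrow> ((nat \<Rightarrow> complex) \<Rightarrow> complex) set" for n where
  const: "(\<lambda>_. c) \<in> psum_alg n"
| psum: "psum n k \<in> psum_alg n"
| add: "f \<in> psum_alg n \<Longrightarrow> g \<in> psum_alg n \<Longrightarrow> (\<lambda>z. f z + g z) \<in> psum_alg n"
| mult: "f \<in> psum_alg n \<Longrightarrow> g \<in> psum_alg n \<Longrightarrow> (\<lambda>z. f z * g z) \<in> psum_alg n"

lemma psum_alg_cmult: "f \<in> psum_alg n \<Longrightarrow> (\<lambda>z. c * f z) \<in> psum_alg n"
  by (rule psum_alg.mult[OF psum_alg.const])

lemma psum_alg_diff: "f \<in> psum_alg n \<Longrightarrow> g \<in> psum_alg n \<Longrightarrow> (\<lambda>z. f z - g z) \<in> psum_alg n"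
  using psum_alg.add[OF _ psum_alg_cmult[of g n "-1"], of f] by simp

lemma psum_alg_sum: "(\<And>i. i \<in> I \<Longrightarrow> f i \<in> psum_alg n) \<Longrightarrow> (\<lambda>z. \<Sum>i\<in>I. f i z) \<in> psum_alg n"
  by (induction I rule: infinite_finite_induct) (auto intro: psum_alg.const psum_alg.add)

definition arrangements :: "nat \<Rightarrow> nat \<Rightarrow> nat list set" where
  "arrangements n k = {xs. distinct xs \<and> length xs = k \<and> set xs \<subseteq> {..<n}}"

text \<open>An augmented monomial symmetric function: the exponents are attached to pairwise
  distinct variables in all possible ways.\<close>

definition arr_sum :: "nat \<Rightarrow> nat list \<Rightarrow> (nat \<Rightarrow> complex) \<Rightarrow> complex" where
  "arr_sum n as y = (\<Sum>xs\<in>arrangements n (length as). \<Prod>i<length as. y (xs ! i) ^ (as ! i))"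

lemma finite_arrangements: "finite (arrangements n k)"
  by (rule finite_subset[OF _ finite_lists_length_eq[of "{..<n}" k]]) (auto simp: arrangements_def)

text \<open>Letting the first index run freely gives the product with a power sum; the excess comes
  from its coincidence with the j-th remaining index, which merges the two exponents. The lists on
  the right are shorter, so the recursion ends in power sums.\<close>

lemma arr_sum_Cons:
  "arr_sum n (a # as) y = psum n a y * arr_sum n as y - (\<Sum>j<length as. arr_sum n (as[j := as ! j + a]) y)"
proof -
  let ?k = "length as" and ?D = "arrangements n (length as)"
  define Q where "Q xs = (\<Prod>i<?k. y (xs ! i) ^ (as ! i))" for xs
  have "arr_sum n (a # as) y = (\<Sum>xs\<in>arrangements n (Suc ?k). y (hd xs) ^ a * Q (tl xs))"
    unfolding arr_sum_def Q_def
  proof (intro sum.cong)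
    fix xs assume "xs \<in> arrangements n (Suc ?k)"
    then obtain v vs where "xs = v # vs" by (cases xs) (auto simp: arrangements_def)
    then show "(\<Prod>i<length (a # as). y (xs ! i) ^ ((a # as) ! i)) = y (hd xs) ^ a * (\<Prod>i<?k. y (tl xs ! i) ^ (as ! i))"
      by (simp add: prod.lessThan_Suc_shift del: prod.lessThan_Suc)
  qed simp
  also have "\<dots> = (\<Sum>(xs, v)\<in>Sigma ?D (\<lambda>xs. {..<n} - set xs). y v ^ a * Q xs)"
  proof (rule sum.reindex_bij_witness[of _ "\<lambda>(xs, v). v # xs" "\<lambda>l. (tl l, hd l)"])
    fix l assume l: "l \<in> arrangements n (Suc ?k)"
    then obtain v vs where "l = v # vs" by (cases l) (auto simp: arrangements_def)
    then show "(case (tl l, hd l) of (xs, v) \<Rightarrow> v # xs) = l"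
      "(tl l, hd l) \<in> Sigma ?D (\<lambda>xs. {..<n} - set xs)"
      "(case (tl l, hd l) of (xs, v) \<Rightarrow> y v ^ a * Q xs) = y (hd l) ^ a * Q (tl l)"
      using l by (auto simp: arrangements_def)
  qed (auto simp: arrangements_def)
  also have "\<dots> = (\<Sum>xs\<in>?D. \<Sum>v\<in>{..<n} - set xs. y v ^ a * Q xs)"
    by (rule sum.Sigma[symmetric]) (auto simp: finite_arrangements)
  also have "\<dots> = (\<Sum>xs\<in>?D. psum n a y * Q xs - (\<Sum>j<?k. y (xs ! j) ^ a * Q xs))"
  proof (intro sum.cong refl)
    fix xs assume xs: "xs \<in> ?D"
    have "(\<Sum>j<?k. y (xs ! j) ^ a) = (\<Sum>v\<in>set xs. y v ^ a)"
      using xs by (intro sum.reindex_bij_betw bij_betw_nth) (auto simp: arrangements_def)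
    moreover have "(\<Sum>v\<in>{..<n} - set xs. y v ^ a) = psum n a y - (\<Sum>v\<in>set xs. y v ^ a)"
      unfolding psum_def using xs by (intro sum_diff) (auto simp: arrangements_def)
    ultimately show "(\<Sum>v\<in>{..<n} - set xs. y v ^ a * Q xs) = psum n a y * Q xs - (\<Sum>j<?k. y (xs ! j) ^ a * Q xs)"
      by (simp add: sum_distrib_right[symmetric] left_diff_distrib)
  qed
  also have "\<dots> = psum n a y * arr_sum n as y - (\<Sum>xs\<in>?D. \<Sum>j<?k. y (xs ! j) ^ a * Q xs)"
    unfolding arr_sum_def Q_def by (simp add: sum_subtractf sum_distrib_left)
  also have "(\<Sum>xs\<in>?D. \<Sum>j<?k. y (xs ! j) ^ a * Q xs) = (\<Sum>j<?k. \<Sum>xs\<in>?D. y (xs ! j) ^ a * Q xs)"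
    by (rule sum.swap)
  also have "\<dots> = (\<Sum>j<?k. arr_sum n (as[j := as ! j + a]) y)"
  proof (intro sum.cong refl)
    fix j assume j: "j \<in> {..<?k}"
    have "y (xs ! j) ^ a * Q xs = (\<Prod>i<?k. y (xs ! i) ^ (as[j := as ! j + a] ! i))" for xs
    proof -
      have "(\<Prod>i<?k. y (xs ! i) ^ (as[j := as ! j + a] ! i)) =
          y (xs ! j) ^ (as ! j + a) * (\<Prod>i\<in>{..<?k} - {j}. y (xs ! i) ^ (as ! i))"
        using j by (subst prod.remove[of _ j]) (auto intro!: prod.cong)
      also have "\<dots> = y (xs ! j) ^ a * (y (xs ! j) ^ (as ! j) * (\<Prod>i\<in>{..<?k} - {j}. y (xs ! i) ^ (as ! i)))"
        by (simp add: power_add mult_ac)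
      also have "y (xs ! j) ^ (as ! j) * (\<Prod>i\<in>{..<?k} - {j}. y (xs ! i) ^ (as ! i)) = Q xs"
        unfolding Q_def by (rule prod.remove[symmetric]) (use j in auto)
      finally show ?thesis by simp
    qed
    then show "(\<Sum>xs\<in>?D. y (xs ! j) ^ a * Q xs) = arr_sum n (as[j := as ! j + a]) y"
      unfolding arr_sum_def by simp
  qed
  finally show ?thesis .
qed

lemma arr_sum_alg: "arr_sum n as \<in> psum_alg n"
proof (induction "length as" arbitrary: as)
  case 0
  have "arrangements n 0 = {[]}" by (auto simp: arrangements_def)
  then have "arr_sum n as = (\<lambda>_. 1)" using 0 by (auto simp: arr_sum_def fun_eq_iff)
  then show ?case by (simp add: psum_alg.const)
next
  case (Suc k)
  then obtain a bs where as: "as = a # bs" "length bs = k" by (cases as) auto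
  have "(\<lambda>y. psum n a y * arr_sum n bs y - (\<Sum>j<length bs. arr_sum n (bs[j := bs ! j + a]) y)) \<in> psum_alg n"
    by (intro psum_alg_diff psum_alg.mult psum_alg.psum psum_alg_sum Suc(1)) (use as in auto)
  then show ?case unfolding as(1) by (simp add: arr_sum_Cons[symmetric] fun_eq_iff[symmetric] cong: if_cong)
qed

inductive_set monomial_sums :: "nat \<Rightarrow> ((nat \<Rightarrow> complex) \<Rightarrow> complex) set" for n where
  mono: "(\<lambda>y. c * (\<Prod>i<n. y i ^ e i)) \<in> monomial_sums n"
| plus: "f \<in> monomial_sums n \<Longrightarrow> g \<in> monomial_sums n \<Longrightarrow> (\<lambda>z. f z + g z) \<in> monomial_sums n"

lemma monomial_sums_mult:
  assumes "f \<in> monomial_sums n" "g \<in> monomial_sums n"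
  shows "(\<lambda>z. f z * g z) \<in> monomial_sums n"
  using assms(1)
proof induction
  case (mono c e)
  show ?case using assms(2)
  proof induction
    case (mono c' e')
    have "(\<lambda>y. c * (\<Prod>i<n. y i ^ e i) * (c' * (\<Prod>i<n. y i ^ e' i))) = (\<lambda>y. (c * c') * (\<Prod>i<n. y i ^ (e i + e' i)))"
      by (simp add: fun_eq_iff power_add prod.distrib mult_ac)
    then show ?case using monomial_sums.mono[of "c * c'" "\<lambda>i. e i + e' i" n] by simp
  next
    case (plus f g) then show ?case using monomial_sums.plus by (force simp: distrib_left)
  qed
next
  case (plus f f') then show ?case using monomial_sums.plus by (force simp: distrib_right)
qed

lemma pfun_monomial_sums: "f \<in> pfun UNIV (vcoords n) \<Longrightarrow> f \<in> monomial_sums n"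
proof (induction rule: pfun.induct)
  case (const c) then show ?case using monomial_sums.mono[of c "\<lambda>_. 0" n] by simp
next
  case (coord e)
  then obtain i where i: "i < n" "e = (\<lambda>y. y i)" by (auto simp: vcoords_def)
  have "(\<Prod>k<n. y k ^ (if k = i then 1 else 0)) = y i" for y :: "nat \<Rightarrow> complex"
    using i(1) by (subst prod.remove[of _ i]) auto
  then show ?case using monomial_sums.mono[of 1 "\<lambda>k. if k = i then 1 else 0" n] i(2) by simp
next
  case (cong f g)
  then have "g = f" by auto
  then show ?case using cong by simp
qed (auto intro: monomial_sums.plus monomial_sums_mult)

text \<open>Permutations are the arrangements of full length n, so symmetrizing a monomial gives an
  \<open>arr_sum\<close>.\<close>

lemma permutation_sum_alg:
  assumes "f \<in> pfun UNIV (vcoords n)"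
  shows "(\<lambda>y. \<Sum>w\<in>{w. w permutes {..<n}}. f (y \<circ> w)) \<in> psum_alg n"
  using pfun_monomial_sums[OF assms]
proof induction
  case (mono c e)
  have "(\<Sum>w\<in>{w. w permutes {..<n}}. c * (\<Prod>i<n. (y \<circ> w) i ^ e i)) = c * arr_sum n (map e [0..<n]) y" for y
  proof -
    have "(\<Sum>w\<in>{w. w permutes {..<n}}. \<Prod>i<n. (y \<circ> w) i ^ e i) = arr_sum n (map e [0..<n]) y"
      unfolding arr_sum_def
    proof (rule sum.reindex_bij_witness[of _ "\<lambda>xs i. if i < n then xs ! i else i" "\<lambda>w. map w [0..<n]"])
      fix w assume w: "w \<in> {w. w permutes {..<n}}"
      show "(\<lambda>i. if i < n then map w [0..<n] ! i else i) = w"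
        using w permutes_not_in[of w "{..<n}"] by (auto simp: fun_eq_iff)
      have "w i < n" if "i < n" for i using w permutes_in_image[of w "{..<n}" i] that by auto
      moreover have "inj_on w A" for A using w permutes_inj[of w] by (auto simp: inj_on_def inj_def)
      ultimately show "map w [0..<n] \<in> arrangements n (length (map e [0..<n]))"
        by (auto simp: arrangements_def distinct_map)
      show "(\<Prod>i<length (map e [0..<n]). y (map w [0..<n] ! i) ^ (map e [0..<n] ! i)) = (\<Prod>i<n. (y \<circ> w) i ^ e i)"
        by (auto intro!: prod.cong)
    next
      fix xs assume xs: "xs \<in> arrangements n (length (map e [0..<n]))"
      then show "map (\<lambda>i. if i < n then xs ! i else i) [0..<n] = xs"
        by (auto simp: arrangements_def intro!: nth_equalityI)
      have "inj_on (\<lambda>i. if i < n then xs ! i else i) {..<n}"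
        using xs by (auto simp: inj_on_def arrangements_def nth_eq_iff_index_eq)
      moreover have "(\<lambda>i. if i < n then xs ! i else i) ` {..<n} \<subseteq> {..<n}"
      proof (rule image_subsetI)
        fix i assume i: "i \<in> {..<n}"
        then have "xs ! i \<in> set xs" using xs by (auto simp: arrangements_def)
        moreover have "set xs \<subseteq> {..<n}" using xs by (simp add: arrangements_def)
        ultimately have "xs ! i \<in> {..<n}" by blast
        then show "(if i < n then xs ! i else i) \<in> {..<n}" using i by simp
      qed
      ultimately have "bij_betw (\<lambda>i. if i < n then xs ! i else i) {..<n} {..<n}"
        unfolding bij_betw_def using endo_inj_surj[OF finite_lessThan] by blast
      then show "(\<lambda>i. if i < n then xs ! i else i) \<in> {w. w permutes {..<n}}"
        by (intro CollectI bij_imp_permutes) auto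
    qed
    then show ?thesis by (simp add: sum_distrib_left[symmetric])
  qed
  then show ?case using psum_alg_cmult[OF arr_sum_alg] by presburger
next
  case (plus f g)
  then show ?case using psum_alg.add[OF plus.IH] by (simp add: sum.distrib)
qed

lemma symf_psum_alg:
  assumes "q \<in> symf n"
  shows "q \<in> psum_alg n"
proof -
  let ?c = "of_nat (card {w. w permutes {..<n}}) :: complex"
  have "(\<Sum>w\<in>{w. w permutes {..<n}}. q (y \<circ> w)) = ?c * q y" for y
    using assms by (simp add: symf_def)
  moreover have "?c \<noteq> 0" by (simp add: card_permutations[OF refl finite_lessThan])
  ultimately have "q = (\<lambda>y. (1 / ?c) * (\<Sum>w\<in>{w. w permutes {..<n}}. q (y \<circ> w)))" by simp
  then show ?thesis
    using psum_alg_cmult[OF permutation_sum_alg, of q n "1 / ?c"] assms by (simp add: symf_def)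
qed

section \<open>Traces, conjugation and triangular matrices\<close>

lemma index_mult_mat_sum:
  "A \<in> carrier_mat m n \<Longrightarrow> B \<in> carrier_mat n k \<Longrightarrow> i < m \<Longrightarrow> j < k \<Longrightarrow>
    (A * B) $$ (i, j) = (\<Sum>l<n. A $$ (i, l) * B $$ (l, j))"
  by (auto simp: scalar_prod_def atLeast0LessThan intro!: sum.cong)

lemma pfun_mat_mult:
  assumes "\<And>z. z \<in> V \<Longrightarrow> A z \<in> carrier_mat m n" "\<And>z. z \<in> V \<Longrightarrow> B z \<in> carrier_mat n k"
    "\<And>i l. i < m \<Longrightarrow> l < n \<Longrightarrow> (\<lambda>z. A z $$ (i, l)) \<in> pfun V E"
    "\<And>l j. l < n \<Longrightarrow> j < k \<Longrightarrow> (\<lambda>z. B z $$ (l, j)) \<in> pfun V E" "i < m" "j < k"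
  shows "(\<lambda>z. (A z * B z) $$ (i, j)) \<in> pfun V E"
proof (rule pfun.cong)
  show "(\<lambda>z. \<Sum>l<n. A z $$ (i, l) * B z $$ (l, j)) \<in> pfun V E"
    by (intro pfun_sum pfun_mult assms) (use assms in auto)
qed (simp only: index_mult_mat_sum[OF assms(1,2,5,6)])

lemma trace_mult_commute:
  fixes A B :: "complex mat"
  assumes "A \<in> carrier_mat n n" "B \<in> carrier_mat n n"
  shows "(\<Sum>i<n. (A * B) $$ (i, i)) = (\<Sum>i<n. (B * A) $$ (i, i))"
proof -
  have "(\<Sum>i<n. (A * B) $$ (i, i)) = (\<Sum>i<n. \<Sum>l<n. A $$ (i, l) * B $$ (l, i))"
    by (intro sum.cong refl index_mult_mat_sum[OF assms]) auto
  also have "\<dots> = (\<Sum>l<n. \<Sum>i<n. B $$ (l, i) * A $$ (i, l))"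
    by (subst sum.swap) (simp add: mult.commute)
  also have "\<dots> = (\<Sum>i<n. (B * A) $$ (i, i))"
    by (intro sum.cong refl index_mult_mat_sum[OF assms(2,1), symmetric]) auto
  finally show ?thesis .
qed

lemma pow_mat_conjugate:
  fixes g b g' :: "complex mat"
  assumes "g \<in> carrier_mat n n" "b \<in> carrier_mat n n" "g' \<in> carrier_mat n n" "g' * g = 1\<^sub>m n" "g * g' = 1\<^sub>m n"
  shows "(g * b * g') ^\<^sub>m k = g * b ^\<^sub>m k * g'"
proof (induction k)
  case 0 then show ?case using assms by simp
next
  case (Suc k)
  have bk: "b ^\<^sub>m k \<in> carrier_mat n n" using assms by simp
  have "(g * b * g') ^\<^sub>m Suc k = (g * b ^\<^sub>m k * g') * (g * b * g')" using Suc by simp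
  also have "\<dots> = g * b ^\<^sub>m k * (g' * (g * (b * g')))"
    using assms bk by (simp add: assoc_mult_mat[of _ n n _ n _ n] mult_carrier_mat[of _ n n])
  also have "g' * (g * (b * g')) = b * g'"
    using assms by (subst assoc_mult_mat[of _ n n _ n _ n, symmetric]) auto
  also have "g * b ^\<^sub>m k * (b * g') = g * (b ^\<^sub>m k * b) * g'"
    using assms bk by (simp add: assoc_mult_mat[of _ n n _ n _ n] mult_carrier_mat[of _ n n])
  finally show ?case by simp
qed

lemma upper_triangular_mult:
  fixes A B :: "complex mat"
  assumes "A \<in> carrier_mat n n" "B \<in> carrier_mat n n" "upper_triangular A" "upper_triangular B"
  shows "upper_triangular (A * B)" "\<And>i. i < n \<Longrightarrow> (A * B) $$ (i, i) = A $$ (i, i) * B $$ (i, i)"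
proof -
  have A0: "A $$ (i, l) = 0" if "l < i" "i < n" for i l using assms that by auto
  have B0: "B $$ (i, l) = 0" if "l < i" "i < n" for i l using assms that by auto
  show "upper_triangular (A * B)"
  proof
    fix i j assume ij: "j < i" "i < dim_row (A * B)"
    then have "(A * B) $$ (i, j) = (\<Sum>l<n. A $$ (i, l) * B $$ (l, j))"
      using assms by (intro index_mult_mat_sum[of A n n B n]) auto
    also have "\<dots> = 0"
    proof (rule sum.neutral, rule ballI)
      fix l assume "l \<in> {..<n}"
      then show "A $$ (i, l) * B $$ (l, j) = 0"
        using A0[of l i] B0[of j l] ij assms by (cases "l < i") auto
    qed
    finally show "(A * B) $$ (i, j) = 0" .
  qed
  fix i assume i: "i < n"
  have "(A * B) $$ (i, i) = (\<Sum>l<n. A $$ (i, l) * B $$ (l, i))"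
    using assms i by (intro index_mult_mat_sum[of A n n B n]) auto
  also have "\<dots> = (\<Sum>l\<in>{i}. A $$ (i, l) * B $$ (l, i))"
  proof (rule sum.mono_neutral_right)
    show "\<forall>l\<in>{..<n} - {i}. A $$ (i, l) * B $$ (l, i) = 0"
    proof
      fix l assume "l \<in> {..<n} - {i}"
      then show "A $$ (i, l) * B $$ (l, i) = 0"
        using A0[of l i] B0[of i l] i by (cases "l < i") auto
    qed
  qed (use i in auto)
  finally show "(A * B) $$ (i, i) = A $$ (i, i) * B $$ (i, i)" by simp
qed

lemma upper_triangular_pow:
  fixes b :: "complex mat"
  assumes "b \<in> carrier_mat n n" "upper_triangular b"
  shows "upper_triangular (b ^\<^sub>m k) \<and> (\<forall>i<n. (b ^\<^sub>m k) $$ (i, i) = b $$ (i, i) ^ k)"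
proof (induction k)
  case 0 then show ?case using assms by auto
next
  case (Suc k)
  then show ?case using upper_triangular_mult[of "b ^\<^sub>m k" n b] assms by auto
qed

lemma pfun_pow_mat:
  "i < n \<Longrightarrow> j < n \<Longrightarrow> (\<lambda>x. (x ^\<^sub>m k) $$ (i, j)) \<in> pfun (carrier_mat n n) (entries n)"
proof (induction k arbitrary: i j)
  case 0
  then show ?case by (intro pfun.cong[OF pfun_const[of "if i = j then 1 else 0"]]) auto
next
  case (Suc k)
  have "(\<lambda>x. (x ^\<^sub>m k * x) $$ (i, j)) \<in> pfun (carrier_mat n n) (entries n)"
    by (rule pfun_mat_mult[of _ _ n n _ n]) (use Suc in \<open>auto intro: pfun_entry\<close>)
  then show ?case by simp
qed

text \<open>Traces of powers are invariant under conjugation, and for triangular b they are the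
  power sums of its diagonal.\<close>

lemma psum_alg_spectral:
  assumes "q \<in> psum_alg n"
  shows "\<exists>Q\<in>pfun (carrier_mat n n) (entries n). \<forall>g b g'. g \<in> carrier_mat n n \<longrightarrow> b \<in> carrier_mat n n \<longrightarrow>
    g' \<in> carrier_mat n n \<longrightarrow> g' * g = 1\<^sub>m n \<longrightarrow> g * g' = 1\<^sub>m n \<longrightarrow> upper_triangular b \<longrightarrow>
    Q (g * b * g') = q (\<lambda>i. b $$ (i, i))"
  using assms
proof induction
  case (const c) show ?case by (intro bexI[OF _ pfun_const[of c]]) auto
next
  case (psum k)
  show ?case
  proof (intro bexI[of _ "\<lambda>x. \<Sum>i<n. (x ^\<^sub>m k) $$ (i, i)"] allI impI)
    show "(\<lambda>x. \<Sum>i<n. (x ^\<^sub>m k) $$ (i, i)) \<in> pfun (carrier_mat n n) (entries n)"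
      by (intro pfun_sum pfun_pow_mat) auto
    fix g b g' :: "complex mat"
    assume *: "g \<in> carrier_mat n n" "b \<in> carrier_mat n n" "g' \<in> carrier_mat n n" "g' * g = 1\<^sub>m n"
      "g * g' = 1\<^sub>m n" "upper_triangular b"
    have bk: "b ^\<^sub>m k \<in> carrier_mat n n" using * by simp
    have "(\<Sum>i<n. ((g * b * g') ^\<^sub>m k) $$ (i, i)) = (\<Sum>i<n. (g * b ^\<^sub>m k * g') $$ (i, i))"
      using pow_mat_conjugate[OF *(1-5)] by simp
    also have "\<dots> = (\<Sum>i<n. (g' * (g * b ^\<^sub>m k)) $$ (i, i))"
      by (rule trace_mult_commute) (use * bk in auto)
    also have "g' * (g * b ^\<^sub>m k) = b ^\<^sub>m k"
      using * bk by (subst assoc_mult_mat[of _ n n _ n _ n, symmetric]) auto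
    finally show "(\<Sum>i<n. ((g * b * g') ^\<^sub>m k) $$ (i, i)) = psum n k (\<lambda>i. b $$ (i, i))"
      using upper_triangular_pow[OF *(2,6), of k] by (simp add: psum_def)
  qed
next
  case (add f h)
  then obtain Q R where "Q \<in> pfun (carrier_mat n n) (entries n)" "R \<in> pfun (carrier_mat n n) (entries n)"
    "\<forall>g b g'. g \<in> carrier_mat n n \<longrightarrow> b \<in> carrier_mat n n \<longrightarrow>
    g' \<in> carrier_mat n n \<longrightarrow> g' * g = 1\<^sub>m n \<longrightarrow> g * g' = 1\<^sub>m n \<longrightarrow> upper_triangular b \<longrightarrow>
    Q (g * b * g') = f (\<lambda>i. b $$ (i, i))"
    "\<forall>g b g'. g \<in> carrier_mat n n \<longrightarrow> b \<in> carrier_mat n n \<longrightarrow>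
    g' \<in> carrier_mat n n \<longrightarrow> g' * g = 1\<^sub>m n \<longrightarrow> g * g' = 1\<^sub>m n \<longrightarrow> upper_triangular b \<longrightarrow>
    R (g * b * g') = h (\<lambda>i. b $$ (i, i))" by blast
  then show ?case by (intro bexI[OF _ pfun_add[of Q _ _ R]]) simp_all
next
  case (mult f h)
  then obtain Q R where "Q \<in> pfun (carrier_mat n n) (entries n)" "R \<in> pfun (carrier_mat n n) (entries n)"
    "\<forall>g b g'. g \<in> carrier_mat n n \<longrightarrow> b \<in> carrier_mat n n \<longrightarrow>
    g' \<in> carrier_mat n n \<longrightarrow> g' * g = 1\<^sub>m n \<longrightarrow> g * g' = 1\<^sub>m n \<longrightarrow> upper_triangular b \<longrightarrow>
    Q (g * b * g') = f (\<lambda>i. b $$ (i, i))"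
    "\<forall>g b g'. g \<in> carrier_mat n n \<longrightarrow> b \<in> carrier_mat n n \<longrightarrow>
    g' \<in> carrier_mat n n \<longrightarrow> g' * g = 1\<^sub>m n \<longrightarrow> g * g' = 1\<^sub>m n \<longrightarrow> upper_triangular b \<longrightarrow>
    R (g * b * g') = h (\<lambda>i. b $$ (i, i))" by blast
  then show ?case by (intro bexI[OF _ pfun_mult[of Q _ _ R]]) simp_all
qed

text \<open>The parameters are separated off by \<open>symmetric_tensors\<close>, and
  \<open>psum_alg_spectral\<close> is applied to each symmetric factor. The choice of an order of
  the eigenvalues disappears here.\<close>

lemma symmetric_spectral:
  assumes f: "f \<in> pfun (UNIV \<times> Vp) (prod_coords (vcoords n) Ep)"
    and sym: "\<And>v z p. v permutes {..<n} \<Longrightarrow> p \<in> Vp \<Longrightarrow> f (z \<circ> v, p) = f (z, p)"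
  shows "\<exists>Q\<in>pfun (carrier_mat n n \<times> Vp) (prod_coords (entries n) Ep). \<forall>g b g' p.
    g \<in> carrier_mat n n \<longrightarrow> b \<in> carrier_mat n n \<longrightarrow> g' \<in> carrier_mat n n \<longrightarrow> g' * g = 1\<^sub>m n \<longrightarrow>
    g * g' = 1\<^sub>m n \<longrightarrow> upper_triangular b \<longrightarrow> p \<in> Vp \<longrightarrow> Q (g * b * g', p) = f (\<lambda>i. b $$ (i, i), p)"
proof -
  obtain t where t: "t \<in> tensors (symf n) (pfun Vp Ep)" "\<And>z p. p \<in> Vp \<Longrightarrow> f (z, p) = t (z, p)"
    using symmetric_tensors[OF f sym] by blast
  define good where "good Q t \<longleftrightarrow> (\<forall>g b g' p.
    g \<in> carrier_mat n n \<longrightarrow> b \<in> carrier_mat n n \<longrightarrow> g' \<in> carrier_mat n n \<longrightarrow> g' * g = 1\<^sub>m n \<longrightarrow>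
    g * g' = 1\<^sub>m n \<longrightarrow> upper_triangular b \<longrightarrow> p \<in> Vp \<longrightarrow> Q (g * b * g', p) = t (\<lambda>i. b $$ (i, i), p))"
    for Q and t :: "(nat \<Rightarrow> complex) \<times> 'a \<Rightarrow> complex"
  have "\<exists>Q\<in>pfun (carrier_mat n n \<times> Vp) (prod_coords (entries n) Ep). good Q t"
    using t(1)
  proof induction
    case (pure m r)
    obtain Q where Q: "Q \<in> pfun (carrier_mat n n) (entries n)" "\<forall>g b g'. g \<in> carrier_mat n n \<longrightarrow> b \<in> carrier_mat n n \<longrightarrow>
      g' \<in> carrier_mat n n \<longrightarrow> g' * g = 1\<^sub>m n \<longrightarrow> g * g' = 1\<^sub>m n \<longrightarrow> upper_triangular b \<longrightarrow>
      Q (g * b * g') = m (\<lambda>i. b $$ (i, i))"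
      using psum_alg_spectral[OF symf_psum_alg[OF pure(1)]] by blast
    show ?case
      by (intro bexI[OF _ pfun_mult[OF pfun_fst[OF Q(1)] pfun_snd[OF pure(2)]]]) (use Q(2) in \<open>auto simp: good_def\<close>)
  next
    case (plus f h)
    then obtain Q R where "Q \<in> pfun (carrier_mat n n \<times> Vp) (prod_coords (entries n) Ep)" "good Q f"
      "R \<in> pfun (carrier_mat n n \<times> Vp) (prod_coords (entries n) Ep)" "good R h" by blast
    then show ?case by (intro bexI[OF _ pfun_add[of Q _ _ R]]) (auto simp: good_def)
  qed
  then show ?thesis unfolding good_def using t(2) by auto
qed

section \<open>The special linear group\<close>

lemma SL_carrier: "g \<in> carrier (SL n) \<longleftrightarrow> g \<in> carrier_mat n n \<and> det g = 1"
  by (auto simp: SL_def)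

lemma SL_simps: "mult (SL n) = (*)" "one (SL n) = 1\<^sub>m n"
  by (auto simp: SL_def)

lemma adj_mat_SL:
  assumes "g \<in> carrier (SL n)"
  shows "adj_mat g \<in> carrier (SL n)" "adj_mat g * g = 1\<^sub>m n" "g * adj_mat g = 1\<^sub>m n"
proof -
  have g: "g \<in> carrier_mat n n" "det g = 1" using assms by (auto simp: SL_carrier)
  show 1: "adj_mat g * g = 1\<^sub>m n" "g * adj_mat g = 1\<^sub>m n" using adj_mat[OF g(1)] g(2) by auto
  have "det (adj_mat g) * det g = det (adj_mat g * g)"
    by (rule det_mult[symmetric]) (use adj_mat[OF g(1)] g in auto)
  then show "adj_mat g \<in> carrier (SL n)" using 1 g adj_mat[OF g(1)] by (auto simp: SL_carrier)
qed

lemma group_SL: "group (SL n)"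
proof (rule groupI)
  fix x y z assume "x \<in> carrier (SL n)" "y \<in> carrier (SL n)" "z \<in> carrier (SL n)"
  then show "x \<otimes>\<^bsub>SL n\<^esub> y \<in> carrier (SL n)" "x \<otimes>\<^bsub>SL n\<^esub> y \<otimes>\<^bsub>SL n\<^esub> z = x \<otimes>\<^bsub>SL n\<^esub> (y \<otimes>\<^bsub>SL n\<^esub> z)"
    by (auto simp: SL_carrier SL_simps det_mult)
next
  fix x assume "x \<in> carrier (SL n)"
  then show "\<exists>y\<in>carrier (SL n). y \<otimes>\<^bsub>SL n\<^esub> x = \<one>\<^bsub>SL n\<^esub>"
    using adj_mat_SL[of x n] by (auto simp: SL_simps)
qed (auto simp: SL_carrier SL_simps)

lemma inv_SL_eq: "g \<in> carrier (SL n) \<Longrightarrow> h \<in> carrier (SL n) \<Longrightarrow> h * g = 1\<^sub>m n \<Longrightarrow> inv\<^bsub>SL n\<^esub> g = h"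
  by (rule group.inv_equality[OF group_SL]) (auto simp: SL_simps)

lemma inv_SL_adj: "g \<in> carrier (SL n) \<Longrightarrow> inv\<^bsub>SL n\<^esub> g = adj_mat g"
  by (rule inv_SL_eq) (auto simp: adj_mat_SL)

lemma inv_SL:
  assumes "g \<in> carrier (SL n)"
  shows "inv\<^bsub>SL n\<^esub> g \<in> carrier (SL n)" "inv\<^bsub>SL n\<^esub> g \<in> carrier_mat n n"
    "inv\<^bsub>SL n\<^esub> g * g = 1\<^sub>m n" "g * inv\<^bsub>SL n\<^esub> g = 1\<^sub>m n"
  using adj_mat_SL[OF assms] inv_SL_adj[OF assms] by (auto simp: SL_carrier)

lemma SL_mult: "g \<in> carrier (SL n) \<Longrightarrow> h \<in> carrier (SL n) \<Longrightarrow> g * h \<in> carrier (SL n)"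
  by (auto simp: SL_carrier det_mult)

lemma inv_SL_mult:
  "g \<in> carrier (SL n) \<Longrightarrow> h \<in> carrier (SL n) \<Longrightarrow> inv\<^bsub>SL n\<^esub> (g * h) = inv\<^bsub>SL n\<^esub> h * inv\<^bsub>SL n\<^esub> g"
  using group.inv_mult_group[OF group_SL, of g n h] by (simp add: SL_simps)

lemma inv_SL_inv: "g \<in> carrier (SL n) \<Longrightarrow> inv\<^bsub>SL n\<^esub> (inv\<^bsub>SL n\<^esub> g) = g"
  using group.inv_inv[OF group_SL] .

lemma pfun_adj_mat:
  assumes "\<And>z. z \<in> V \<Longrightarrow> A z \<in> carrier_mat n n" "i < n" "j < n"
    "\<And>i l. i < n \<Longrightarrow> l < n \<Longrightarrow> (\<lambda>z. A z $$ (i, l)) \<in> pfun V E"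
  shows "(\<lambda>z. adj_mat (A z) $$ (i, j)) \<in> pfun V E"
proof (rule pfun.cong)
  show "(\<lambda>z. (- 1) ^ (j + i) * det (mat (n - 1) (n - 1) ((\<lambda>z (i', j').
      A z $$ (if i' < j then i' else Suc i', if j' < i then j' else Suc j')) z))) \<in> pfun V E"
    by (intro pfun_mult pfun_const pfun_det) (auto intro!: assms(4))
  fix z assume "z \<in> V"
  then have "A z \<in> carrier_mat n n" by (rule assms)
  then show "adj_mat (A z) $$ (i, j) = (- 1) ^ (j + i) * det (mat (n - 1) (n - 1) ((\<lambda>z (i', j').
      A z $$ (if i' < j then i' else Suc i', if j' < i then j' else Suc j')) z))"
    using assms(2,3) by (simp add: adj_mat_def cofactor_def mat_delete_def)
qed

lemma pfun_inv_SL: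
  assumes "\<And>z. z \<in> V \<Longrightarrow> A z \<in> carrier (SL n)" "i < n" "j < n"
    "\<And>i l. i < n \<Longrightarrow> l < n \<Longrightarrow> (\<lambda>z. A z $$ (i, l)) \<in> pfun V E"
  shows "(\<lambda>z. (inv\<^bsub>SL n\<^esub> (A z)) $$ (i, j)) \<in> pfun V E"
  by (rule pfun.cong[OF pfun_adj_mat[of V A n i j E]]) (use assms in \<open>auto simp: inv_SL_adj SL_carrier\<close>)

lemma det_diag_nonzero: "det (mat_diag n f) = (\<Prod>i<n. f i)" for f :: "nat \<Rightarrow> complex"
proof -
  have "det (mat_diag n f) = prod_list (diag_mat (mat_diag n f))"
    by (rule det_upper_triangular) (auto simp: mat_diag_def)
  also have "diag_mat (mat_diag n f) = map f [0..<n]"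
    by (auto simp: diag_mat_def mat_diag_def)
  finally show ?thesis
    using prod.distinct_set_conv_list[of "[0..<n]" f] by (simp add: atLeast0LessThan)
qed

lemma triangularize:
  fixes x :: "complex mat"
  assumes x: "x \<in> sl_lie n" and n: "0 < n"
  shows "\<exists>g b. g \<in> carrier (SL n) \<and> b \<in> borel_lie n \<and> x = g * b * inv\<^bsub>SL n\<^esub> g"
proof -
  have xc: "x \<in> carrier_mat n n" using x by (auto simp: sl_lie_def)
  obtain as where "char_poly x = (\<Prod>a\<leftarrow>as. [:- a, 1:])" using char_poly_factorized[OF xc] by blast
  from schur_upper_triangular[OF xc this]
  obtain B where B: "B \<in> carrier_mat n n" "upper_triangular B" "similar_mat x B" by blast
  then obtain P Q where "similar_mat_wit x B P Q" by (auto simp: similar_mat_def)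
  then have PQ: "P \<in> carrier_mat n n" "Q \<in> carrier_mat n n" "P * Q = 1\<^sub>m n" "Q * P = 1\<^sub>m n" "x = P * B * Q"
    using xc by (auto simp: similar_mat_wit_def Let_def)
  have d: "det P * det Q = 1" using det_mult[OF PQ(1,2)] PQ(3) by simp
  \<comment> \<open>The matrix P of the Schur decomposition has arbitrary determinant; scaling its
    first column by det Q = 1 / det P moves it into SL_n, and conjugation by a diagonal matrix keeps
    B triangular.\<close>
  define s where "s = mat_diag n (\<lambda>i. if i = 0 then det Q else 1)"
  define s' where "s' = mat_diag n (\<lambda>i. if i = 0 then det P else 1)"
  have s: "s \<in> carrier_mat n n" "s' \<in> carrier_mat n n" by (auto simp: s_def s'_def)
  have ss: "s * s' = 1\<^sub>m n" "s' * s = 1\<^sub>m n"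
    using d by (auto simp: s_def s'_def mult.commute if_distrib if_distribR cong: if_cong simp flip: mat_diag_one intro!: arg_cong[of _ _ "mat_diag n"])
  have "det s = det Q" unfolding s_def det_diag_nonzero using n by (simp add: prod.remove[of _ 0])
  then have gS: "P * s \<in> carrier (SL n)" using PQ s d by (auto simp: SL_carrier det_mult)
  have "s' * Q * (P * s) = s' * (Q * P) * s" using PQ(1,2) s by (simp add: assoc_mult_mat[of _ n n _ n _ n] mult_carrier_mat[of _ n n])
  also have "\<dots> = 1\<^sub>m n" using PQ s ss by simp
  finally have inv1: "s' * Q * (P * s) = 1\<^sub>m n" .
  have "det (s' * Q) * det (P * s) = 1" using inv1 PQ s by (metis det_mult det_one mult_carrier_mat)
  then have "s' * Q \<in> carrier (SL n)" using gS PQ s by (auto simp: SL_carrier)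
  then have invg: "inv\<^bsub>SL n\<^esub> (P * s) = s' * Q" using gS inv1 by (intro inv_SL_eq) auto
  have dt: "upper_triangular s" "upper_triangular s'" by (auto simp: s_def s'_def mat_diag_def)
  have ut: "upper_triangular (s' * B * s)"
    using B s dt by (intro upper_triangular_mult[of _ n]) auto
  have "P * s * (s' * B * s) * (s' * Q) = P * (s * s') * B * (s * s') * Q"
    using PQ s B by (simp add: assoc_mult_mat[of _ n n _ n _ n] mult_carrier_mat[of _ n n])
  also have "\<dots> = x" using PQ s ss B by simp
  finally have xeq: "x = P * s * (s' * B * s) * inv\<^bsub>SL n\<^esub> (P * s)" unfolding invg by simp
  have bc: "s' * B * s \<in> carrier_mat n n" using s B by simp
  have "(\<Sum>i<n. (P * s * (s' * B * s) * inv\<^bsub>SL n\<^esub> (P * s)) $$ (i, i))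
      = (\<Sum>i<n. (inv\<^bsub>SL n\<^esub> (P * s) * (P * s * (s' * B * s))) $$ (i, i))"
    by (rule trace_mult_commute) (use bc inv_SL[OF gS] gS in \<open>auto simp: SL_carrier\<close>)
  also have "inv\<^bsub>SL n\<^esub> (P * s) * (P * s * (s' * B * s)) = s' * B * s"
    using bc inv_SL[OF gS] gS by (subst assoc_mult_mat[of _ n n _ n _ n, symmetric]) (auto simp: SL_carrier)
  finally have "(\<Sum>i<n. (s' * B * s) $$ (i, i)) = 0" using x xeq by (simp add: sl_lie_def)
  then have "s' * B * s \<in> borel_lie n" using bc ut by (auto simp: borel_lie_def sl_lie_def)
  then show ?thesis using gS xeq by blast
qed

section \<open>Cyclic vectors\<close>

text \<open>Column vectors are functions of which only the first \<open>n\<close> values matter.\<close>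

definition mv :: "nat \<Rightarrow> complex mat \<Rightarrow> (nat \<Rightarrow> complex) \<Rightarrow> nat \<Rightarrow> complex" where
  "mv n x u = (\<lambda>i. \<Sum>k<n. x $$ (i, k) * u k)"

lemma mv_cong: "(\<And>k. k < n \<Longrightarrow> u k = u' k) \<Longrightarrow> mv n x u = mv n x u'"
  by (simp add: mv_def)

lemma mv_mult:
  assumes "A \<in> carrier_mat n n" "B \<in> carrier_mat n n" "i < n"
  shows "mv n (A * B) u i = mv n A (mv n B u) i"
proof -
  have "mv n (A * B) u i = (\<Sum>k<n. \<Sum>l<n. A $$ (i, l) * B $$ (l, k) * u k)"
    unfolding mv_def using assms by (intro sum.cong refl) (simp add: index_mult_mat_sum[of A n n B n] sum_distrib_right del: index_mult_mat(1))
  also have "\<dots> = (\<Sum>l<n. \<Sum>k<n. A $$ (i, l) * B $$ (l, k) * u k)" by (rule sum.swap)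
  also have "\<dots> = mv n A (mv n B u) i" by (simp add: mv_def sum_distrib_left mult.assoc)
  finally show ?thesis .
qed

lemma mv_one: "i < n \<Longrightarrow> mv n (1\<^sub>m n) u i = u i"
proof -
  assume i: "i < n"
  have "mv n (1\<^sub>m n) u i = (\<Sum>k<n. if k = i then u k else 0)"
    unfolding mv_def using i by (intro sum.cong) auto
  then show ?thesis using i by (simp add: sum.delta)
qed

lemma mv_add: "mv n x (\<lambda>i. u i + u' i) = (\<lambda>i. mv n x u i + mv n x u' i)"
  by (simp add: mv_def algebra_simps sum.distrib)

lemma mv_diff: "mv n x (\<lambda>i. u i - u' i) = (\<lambda>i. mv n x u i - mv n x u' i)"
  by (simp add: mv_def algebra_simps sum_subtractf)

lemma mv_cmult: "mv n x (\<lambda>i. c * u i) = (\<lambda>i. c * mv n x u i)"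
  by (simp add: mv_def algebra_simps sum_distrib_left)

lemma mv_sum: "mv n x (\<lambda>i. \<Sum>l\<in>L. u l i) = (\<lambda>i. \<Sum>l\<in>L. mv n x (u l) i)"
  by (simp add: mv_def sum_distrib_left sum.swap[of _ L])

lemma mat_mult_mv:
  assumes "A \<in> carrier_mat n n"
  shows "A * mat n n (\<lambda>(i, j). c j i) = mat n n (\<lambda>(i, j). mv n A (c j) i)"
  by (rule eq_matI) (use assms in \<open>auto simp: index_mult_mat_sum[of A n n _ n] mv_def simp del: index_mult_mat(1)\<close>)

primrec krylov :: "nat \<Rightarrow> complex mat \<Rightarrow> (nat \<Rightarrow> complex) \<Rightarrow> nat \<Rightarrow> nat \<Rightarrow> complex" where
  "krylov n x v 0 = v"
| "krylov n x v (Suc k) = mv n x (krylov n x v k)"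

text \<open>The columns run from the highest power of x down to v. In this order the leading columns
  of the related \<open>flag_mat\<close> span the invariant subspaces, as the equation x g = g b
  with upper triangular b demands.\<close>

definition krylov_mat :: "nat \<Rightarrow> (nat \<Rightarrow> complex) \<Rightarrow> complex mat \<Rightarrow> complex mat" where
  "krylov_mat n v x = mat n n (\<lambda>(i, j). krylov n x v (n - 1 - j) i)"

abbreviation krylov_det :: "nat \<Rightarrow> (nat \<Rightarrow> complex) \<Rightarrow> complex mat \<Rightarrow> complex" where
  "krylov_det n v x \<equiv> det (krylov_mat n v x)"

text \<open>For a cyclic vector \<open>v\<close>, the columns of \<open>flag_mat n x y v\<close> are adapted to the flag of
  \<open>x\<close>-invariant subspaces on whose successive quotients \<open>x\<close> acts by \<open>y 0, y 1, \<dots>\<close>.\<close>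

primrec flag_vec :: "nat \<Rightarrow> complex mat \<Rightarrow> (nat \<Rightarrow> complex) \<Rightarrow> (nat \<Rightarrow> complex) \<Rightarrow> nat \<Rightarrow> nat \<Rightarrow> complex" where
  "flag_vec n x y v 0 = v"
| "flag_vec n x y v (Suc k) = (\<lambda>i. mv n x (flag_vec n x y v k) i - y (n - 1 - k) * flag_vec n x y v k i)"

definition flag_mat :: "nat \<Rightarrow> complex mat \<Rightarrow> (nat \<Rightarrow> complex) \<Rightarrow> (nat \<Rightarrow> complex) \<Rightarrow> complex mat" where
  "flag_mat n x y v = mat n n (\<lambda>(i, j). flag_vec n x y v (n - 1 - j) i)"

text \<open>\<open>flag_vec n x y v k\<close> is this polynomial evaluated at x and applied to v;
  the eigenvalues are consumed from the last one down.\<close>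

definition flag_poly :: "nat \<Rightarrow> (nat \<Rightarrow> complex) \<Rightarrow> nat \<Rightarrow> complex poly" where
  "flag_poly n y k = (\<Prod>t<k. [:- y (n - 1 - t), 1:])"

lemma flag_poly_Suc_coeff:
  "Polynomial.coeff (flag_poly n y (Suc k)) l =
    (if l = 0 then 0 else Polynomial.coeff (flag_poly n y k) (l - 1)) - y (n - 1 - k) * Polynomial.coeff (flag_poly n y k) l"
proof -
  have "flag_poly n y (Suc k) = flag_poly n y k * [:- y (n - 1 - k), 1:]" by (simp add: flag_poly_def)
  also have "\<dots> = pCons 0 (flag_poly n y k) - Polynomial.smult (y (n - 1 - k)) (flag_poly n y k)" by simp
  finally show ?thesis by (cases l) auto
qed

lemma flag_poly_high: "Polynomial.coeff (flag_poly n y k) k = 1 \<and> (\<forall>l>k. Polynomial.coeff (flag_poly n y k) l = 0)"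
proof (induction k)
  case 0 then show ?case by (auto simp: flag_poly_def)
next
  case (Suc k) then show ?case by (auto simp: flag_poly_Suc_coeff)
qed

lemma flag_vec_krylov:
  "flag_vec n x y v k i = (\<Sum>l\<le>k. Polynomial.coeff (flag_poly n y k) l * krylov n x v l i)"
proof (induction k arbitrary: i)
  case 0 then show ?case by (simp add: flag_poly_def)
next
  case (Suc k)
  let ?c = "Polynomial.coeff (flag_poly n y k)"
  have "flag_vec n x y v k = (\<lambda>i. \<Sum>l\<le>k. ?c l * krylov n x v l i)" using Suc by auto
  then have "flag_vec n x y v (Suc k) i = (\<Sum>l\<le>k. ?c l * krylov n x v (Suc l) i)
      - y (n - 1 - k) * (\<Sum>l\<le>k. ?c l * krylov n x v l i)"
    by (simp add: mv_sum mv_cmult)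
  also have "(\<Sum>l\<le>k. ?c l * krylov n x v (Suc l) i) =
      (\<Sum>l\<le>Suc k. (if l = 0 then 0 else ?c (l - 1)) * krylov n x v l i)"
    by (subst sum.atMost_Suc_shift) simp
  also have "(\<Sum>l\<le>k. ?c l * krylov n x v l i) = (\<Sum>l\<le>Suc k. ?c l * krylov n x v l i)"
    using flag_poly_high[of n y k] by simp
  finally show ?case
    unfolding flag_poly_Suc_coeff left_diff_distrib sum_subtractf sum_distrib_left mult.assoc .
qed

text \<open>At level n all eigenvalues have been consumed, and the product of the linear factors
  does not depend on their order.\<close>

lemma flag_vec_permute:
  assumes "w permutes {..<n}"
  shows "flag_vec n x (y \<circ> w) v n = flag_vec n x y v n"
proof -
  have rev: "flag_poly n y n = (\<Prod>t<n. [:- y t, 1:])" for y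
    unfolding flag_poly_def
    by (rule prod.reindex_bij_witness[of _ "\<lambda>t. n - 1 - t" "\<lambda>t. n - 1 - t"]) auto
  have "flag_poly n (y \<circ> w) n = flag_poly n y n"
    unfolding rev using prod.reindex_bij_betw[OF permutes_imp_bij[OF assms], of "\<lambda>t. [:- y t, 1:]"] by simp
  then show ?thesis by (auto simp: flag_vec_krylov)
qed

text \<open>\<open>flag_poly\<close> is monic of degree k, so in the descending numbering the
  passage from Krylov vectors to flag vectors is lower unitriangular.\<close>

lemma det_flag_mat: "det (flag_mat n x y v) = krylov_det n v x"
proof -
  define C where "C = mat n n (\<lambda>(k, j). Polynomial.coeff (flag_poly n y (n - 1 - j)) (n - 1 - k))"
  have "flag_mat n x y v = krylov_mat n v x * C"
  proof (rule eq_matI)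
    fix i j assume "i < dim_row (krylov_mat n v x * C)" "j < dim_col (krylov_mat n v x * C)"
    then have ij: "i < n" "j < n" by (auto simp: C_def krylov_mat_def)
    have "(krylov_mat n v x * C) $$ (i, j) =
        (\<Sum>k<n. krylov n x v (n - 1 - k) i * Polynomial.coeff (flag_poly n y (n - 1 - j)) (n - 1 - k))"
      using ij by (subst index_mult_mat_sum[of _ n n _ n]) (auto simp: C_def krylov_mat_def)
    also have "\<dots> = (\<Sum>l<n. krylov n x v l i * Polynomial.coeff (flag_poly n y (n - 1 - j)) l)"
      by (rule sum.reindex_bij_witness[of _ "\<lambda>t. n - 1 - t" "\<lambda>t. n - 1 - t"]) auto
    also have "\<dots> = (\<Sum>l\<le>n - 1 - j. krylov n x v l i * Polynomial.coeff (flag_poly n y (n - 1 - j)) l)"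
      by (rule sum.mono_neutral_right) (use ij flag_poly_high[of n y "n - 1 - j"] in auto)
    finally show "flag_mat n x y v $$ (i, j) = (krylov_mat n v x * C) $$ (i, j)"
      using ij by (simp add: flag_mat_def flag_vec_krylov mult.commute)
  qed (auto simp: C_def krylov_mat_def flag_mat_def)
  moreover have "det C = 1"
  proof -
    have "det C = prod_list (diag_mat C)"
      by (rule det_lower_triangular[of n]) (auto simp: C_def flag_poly_high)
    also have "diag_mat C = replicate n 1"
      by (rule nth_equalityI) (auto simp: diag_mat_def C_def flag_poly_high)
    finally show ?thesis by simp
  qed
  ultimately show ?thesis by (simp add: det_mult[of _ n] C_def krylov_mat_def)
qed

lemma flag_vec_conjugate:
  assumes "g \<in> carrier_mat n n" "b \<in> carrier_mat n n" "x \<in> carrier_mat n n" "x * g = g * b"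
    and "\<And>i. i < n \<Longrightarrow> v i = mv n g u i" "i < n"
  shows "flag_vec n x y v k i = mv n g (flag_vec n b y u k) i"
  using assms(6)
proof (induction k arbitrary: i)
  case 0 then show ?case using assms(5) by simp
next
  case (Suc k)
  have "mv n x (flag_vec n x y v k) i = mv n x (mv n g (flag_vec n b y u k)) i"
    using mv_cong[of n "flag_vec n x y v k"] Suc.IH by simp
  also have "\<dots> = mv n g (mv n b (flag_vec n b y u k)) i"
    using mv_mult[of x n g i] mv_mult[of g n b i] assms Suc.prems by simp
  finally show ?case using Suc by (simp add: mv_diff mv_cmult)
qed

lemma krylov_flag_vec: "krylov n x v k = flag_vec n x (\<lambda>_. 0) v k"
  by (induction k) auto

lemma krylov_det_conjugate:
  assumes "g \<in> carrier_mat n n" "b \<in> carrier_mat n n" "x \<in> carrier_mat n n" "x * g = g * b"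
    and "\<And>i. i < n \<Longrightarrow> v i = mv n g u i"
  shows "krylov_det n v x = det g * krylov_det n u b"
proof -
  have "krylov_mat n v x = g * krylov_mat n u b"
    unfolding krylov_mat_def mat_mult_mv[OF assms(1)]
    by (rule eq_matI) (auto simp: krylov_flag_vec flag_vec_conjugate[OF assms])
  then show ?thesis using assms(1) by (simp add: det_mult[of _ n] krylov_mat_def)
qed

text \<open>The factor b - b_rr maps the span of the first r + 1 unit vectors into the span of the
  first r. In descending order of r the factors strip off the last coordinates one by one.\<close>

lemma flag_vec_upper_triangular:
  assumes b: "b \<in> carrier_mat n n" "upper_triangular b" and y: "\<And>i. i < n \<Longrightarrow> y i = b $$ (i, i)"
    and "k \<le> n" "n - k \<le> i" "i < n"
  shows "flag_vec n b y u k i = 0"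
  using assms(4-6)
proof (induction k arbitrary: i)
  case 0 then show ?case by simp
next
  case (Suc k)
  have b0: "b $$ (i, l) = 0" if "l < i" for l using b that Suc.prems by auto
  have IH: "flag_vec n b y u k l = 0" if "n - k \<le> l" "l < n" for l using Suc.IH[of l] Suc.prems that by simp
  have "mv n b (flag_vec n b y u k) i = (\<Sum>l\<in>{i}. b $$ (i, l) * flag_vec n b y u k l)"
    unfolding mv_def
  proof (rule sum.mono_neutral_right)
    show "\<forall>l\<in>{..<n} - {i}. b $$ (i, l) * flag_vec n b y u k l = 0"
    proof
      fix l assume "l \<in> {..<n} - {i}"
      then show "b $$ (i, l) * flag_vec n b y u k l = 0"
        using b0[of l] IH[of l] Suc.prems by (cases "l < i", simp, cases "n - k \<le> l") auto
    qed
  qed (use Suc.prems in auto)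
  moreover have "b $$ (i, i) * flag_vec n b y u k i = y (n - 1 - k) * flag_vec n b y u k i"
    using IH[of i] y[of i] Suc.prems by (cases "n - k \<le> i") (auto simp: Suc_le_eq not_le less_Suc_eq_le dest!: order.antisym)
  ultimately show ?case by simp
qed

text \<open>The matrix of \<open>x\<close> in the basis \<open>flag_mat n x y v\<close>, whose first column is divided by \<open>d\<close>.\<close>

definition bidiag :: "nat \<Rightarrow> (nat \<Rightarrow> complex) \<Rightarrow> complex \<Rightarrow> complex mat" where
  "bidiag n y d = mat n n (\<lambda>(i, j). if i = j then y j else if Suc i = j then (if i = 0 then d else 1) else 0)"

definition flag_frame :: "nat \<Rightarrow> complex mat \<Rightarrow> (nat \<Rightarrow> complex) \<Rightarrow> (nat \<Rightarrow> complex) \<Rightarrow> complex mat" where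
  "flag_frame n x y v = mat n n (\<lambda>(i, j). flag_vec n x y v (n - 1 - j) i / (if j = 0 then krylov_det n v x else 1))"

lemma flag_frame_carrier [simp]: "flag_frame n x y v \<in> carrier_mat n n" "bidiag n y d \<in> carrier_mat n n"
  by (auto simp: flag_frame_def bidiag_def)

lemma flag_frame_SL:
  assumes "0 < n" "krylov_det n v x \<noteq> 0"
  shows "flag_frame n x y v \<in> carrier (SL n)"
proof -
  have eq: "flag_frame n x y v = flag_mat n x y v * mat_diag n (\<lambda>j. if j = 0 then 1 / krylov_det n v x else 1)"
    by (subst mat_diag_mult_right[of _ n n]) (auto simp: flag_frame_def flag_mat_def intro!: eq_matI)
  have "det (mat_diag n (\<lambda>j. if j = 0 then 1 / krylov_det n v x else 1)) = 1 / krylov_det n v x"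
    unfolding det_diag_nonzero using assms by (simp add: prod.remove[of _ 0])
  moreover have "flag_mat n x y v \<in> carrier_mat n n" by (simp add: flag_mat_def)
  ultimately show ?thesis
    using assms unfolding eq SL_carrier by (simp add: det_mult[of _ n] det_flag_mat)
qed

lemma flag_frame_intertwines:
  assumes x: "x \<in> carrier_mat n n" and z: "\<And>i. i < n \<Longrightarrow> flag_vec n x y v n i = 0"
    and d: "krylov_det n v x \<noteq> 0"
  shows "x * flag_frame n x y v = flag_frame n x y v * bidiag n y (krylov_det n v x)"
proof (rule eq_matI)
  let ?D = "krylov_det n v x" and ?F = "flag_frame n x y v"
  let ?B = "bidiag n y ?D"
  fix i j assume "i < dim_row (?F * ?B)" "j < dim_col (?F * ?B)"
  then have ij: "i < n" "j < n" by (auto simp: flag_frame_def bidiag_def)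
  let ?c = "if j = 0 then ?D else 1"
  have "(x * ?F) $$ (i, j) = mv n x (\<lambda>i. (1 / ?c) * flag_vec n x y v (n - 1 - j) i) i"
    using ij x unfolding flag_frame_def by (subst index_mult_mat_sum[of x n n _ n]) (auto simp: mv_def)
  also have "\<dots> = (1 / ?c) * mv n x (flag_vec n x y v (n - 1 - j)) i" by (simp only: mv_cmult)
  also have "mv n x (flag_vec n x y v (n - 1 - j)) i = flag_vec n x y v (n - j) i + y j * flag_vec n x y v (n - 1 - j) i"
  proof -
    have "n - j = Suc (n - 1 - j)" "n - 1 - (n - 1 - j) = j" using ij by auto
    then show ?thesis by simp
  qed
  finally have L: "(x * ?F) $$ (i, j) = (flag_vec n x y v (n - j) i + y j * flag_vec n x y v (n - 1 - j) i) / ?c"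
    by simp
  have R: "(?F * ?B) $$ (i, j) = (\<Sum>k<n. ?F $$ (i, k) * ?B $$ (k, j))"
    using ij by (subst index_mult_mat_sum[of _ n n _ n]) auto
  have "(\<Sum>k<n. ?F $$ (i, k) * ?B $$ (k, j)) =
      (\<Sum>k<n. (if k = j then ?F $$ (i, j) * y j else 0) + (if Suc k = j then ?F $$ (i, k) * (if k = 0 then ?D else 1) else 0))"
    using ij by (intro sum.cong refl) (auto simp: bidiag_def)
  also have "\<dots> = ?F $$ (i, j) * y j + (\<Sum>k<n. if Suc k = j then ?F $$ (i, k) * (if k = 0 then ?D else 1) else 0)"
    using ij by (simp add: sum.distrib sum.delta)
  also have "(\<Sum>k<n. if Suc k = j then ?F $$ (i, k) * (if k = 0 then ?D else 1) else 0) = flag_vec n x y v (n - j) i / ?c"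
  proof (cases j)
    \<comment> \<open>The first column has no predecessor; it is an eigenvector because the flag
      vector of level n vanishes by \<open>z\<close>.\<close>
    case 0
    then show ?thesis using z ij by simp
  next
    case (Suc l)
    then have "(\<Sum>k<n. if Suc k = j then ?F $$ (i, k) * (if k = 0 then ?D else 1) else 0) = ?F $$ (i, l) * (if l = 0 then ?D else 1)"
      using ij by (simp add: sum.delta)
    also have "\<dots> = flag_vec n x y v (n - 1 - l) i" using ij Suc d by (simp add: flag_frame_def)
    finally show ?thesis using Suc by simp
  qed
  also have "?F $$ (i, j) * y j + flag_vec n x y v (n - j) i / ?c = (x * ?F) $$ (i, j)"
    unfolding L using ij by (simp add: flag_frame_def add_divide_distrib)
  finally show "(x * ?F) $$ (i, j) = (?F * ?B) $$ (i, j)" using R by simp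
qed (use x in \<open>auto simp: flag_frame_def bidiag_def\<close>)

section \<open>Extension across codimension two\<close>

text \<open>Polynomials in one variable over the functions on \<open>V\<close>. The degree bound is
  uniform in x, which lets long division end after the same number of steps for all x.\<close>

definition ppoly :: "'a set \<Rightarrow> ('a \<Rightarrow> complex) set \<Rightarrow> ('a \<Rightarrow> complex poly) \<Rightarrow> bool" where
  "ppoly V E p \<longleftrightarrow> (\<forall>k. (\<lambda>x. Polynomial.coeff (p x) k) \<in> pfun V E) \<and>
    (\<exists>d. \<forall>x\<in>V. \<forall>k\<ge>d. Polynomial.coeff (p x) k = 0)"

lemma ppoly_const: "ppoly V E (\<lambda>_. p)"
  unfolding ppoly_def
proof (intro conjI allI pfun_const exI[of _ "Suc (Polynomial.degree p)"] ballI impI)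
  fix k assume "Suc (Polynomial.degree p) \<le> k"
  then show "Polynomial.coeff p k = 0" by (simp add: coeff_eq_0)
qed

lemma ppoly_add:
  assumes "ppoly V E p" "ppoly V E q"
  shows "ppoly V E (\<lambda>x. p x + q x)"
proof -
  obtain c d where "\<forall>x\<in>V. \<forall>k\<ge>c. Polynomial.coeff (p x) k = 0" "\<forall>x\<in>V. \<forall>k\<ge>d. Polynomial.coeff (q x) k = 0"
    using assms unfolding ppoly_def by blast
  then have "\<forall>x\<in>V. \<forall>k\<ge>max c d. Polynomial.coeff (p x + q x) k = 0" by simp
  moreover have "(\<lambda>x. Polynomial.coeff (p x + q x) k) \<in> pfun V E" for k
    using assms unfolding ppoly_def by (simp add: pfun_add)
  ultimately show ?thesis unfolding ppoly_def by blast
qed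

lemma ppoly_mult:
  assumes "ppoly V E p" "ppoly V E q"
  shows "ppoly V E (\<lambda>x. p x * q x)"
proof -
  obtain c d where cd: "\<And>x k. x \<in> V \<Longrightarrow> k \<ge> c \<Longrightarrow> Polynomial.coeff (p x) k = 0"
    "\<And>x k. x \<in> V \<Longrightarrow> k \<ge> d \<Longrightarrow> Polynomial.coeff (q x) k = 0"
    using assms unfolding ppoly_def by blast
  have "Polynomial.coeff (p x * q x) k = 0" if "x \<in> V" "k \<ge> c + d" for x k
    unfolding coeff_mult
  proof (rule sum.neutral, rule ballI)
    fix i assume "i \<in> {..k}"
    then show "Polynomial.coeff (p x) i * Polynomial.coeff (q x) (k - i) = 0"
      using cd(1)[of x i] cd(2)[of x "k - i"] that by (cases "i \<ge> c") auto
  qed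
  moreover have "(\<lambda>x. Polynomial.coeff (p x * q x) k) \<in> pfun V E" for k
    unfolding coeff_mult using assms unfolding ppoly_def by (intro pfun_sum pfun_mult) auto
  ultimately show ?thesis unfolding ppoly_def by blast
qed

lemma ppoly_power: "ppoly V E p \<Longrightarrow> ppoly V E (\<lambda>x. p x ^ k)"
  by (induction k) (auto intro: ppoly_const[of V E 1] ppoly_mult)

lemma ppoly_monom: "c \<in> pfun V E \<Longrightarrow> ppoly V E (\<lambda>x. Polynomial.monom (c x) k)"
  unfolding ppoly_def
proof (intro conjI allI exI[of _ "Suc k"] ballI impI)
  fix i assume "c \<in> pfun V E"
  then show "(\<lambda>x. Polynomial.coeff (Polynomial.monom (c x) k) i) \<in> pfun V E"
    by (cases "k = i") (auto intro: pfun_const)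
qed simp

lemma ppoly_diff: "ppoly V E p \<Longrightarrow> ppoly V E q \<Longrightarrow> ppoly V E (\<lambda>x. p x - q x)"
  using ppoly_add[OF _ ppoly_mult[OF ppoly_const[of V E "- 1"]], of p q] by simp

lemma pfun_along_lines:
  assumes "f \<in> pfun V E" "\<And>x t. x \<in> V \<Longrightarrow> \<phi> x t \<in> V"
    "\<And>e. e \<in> E \<Longrightarrow> \<exists>p. ppoly V E p \<and> (\<forall>x\<in>V. \<forall>t. e (\<phi> x t) = poly (p x) t)"
  shows "\<exists>p. ppoly V E p \<and> (\<forall>x\<in>V. \<forall>t. f (\<phi> x t) = poly (p x) t)"
  using assms(1)
proof induction
  case (const c) then show ?case by (intro exI[of _ "\<lambda>_. [:c:]"]) (auto intro: ppoly_const)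
next
  case (coord e) then show ?case by (rule assms)
next
  case (add f g)
  then obtain p q where "ppoly V E p" "ppoly V E q" "\<forall>x\<in>V. \<forall>t. f (\<phi> x t) = poly (p x) t"
    "\<forall>x\<in>V. \<forall>t. g (\<phi> x t) = poly (q x) t" by blast
  then show ?case by (intro exI[of _ "\<lambda>x. p x + q x"]) (auto intro: ppoly_add)
next
  case (mult f g)
  then obtain p q where "ppoly V E p" "ppoly V E q" "\<forall>x\<in>V. \<forall>t. f (\<phi> x t) = poly (p x) t"
    "\<forall>x\<in>V. \<forall>t. g (\<phi> x t) = poly (q x) t" by blast
  then show ?case by (intro exI[of _ "\<lambda>x. p x * q x"]) (auto intro: ppoly_mult)
next
  case (cong f g)
  then show ?case using assms(2) by auto
qed

text \<open>The divisor is monic, so long division never divides by a function of x; the induction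
  is on the uniform degree bound of p.\<close>

lemma ppoly_divide:
  assumes D: "ppoly V E D" "\<And>x. x \<in> V \<Longrightarrow> Polynomial.coeff (D x) m = 1"
    "\<And>x k. x \<in> V \<Longrightarrow> k > m \<Longrightarrow> Polynomial.coeff (D x) k = 0" and p: "ppoly V E p"
  shows "\<exists>q r. ppoly V E q \<and> ppoly V E r \<and>
    (\<forall>x\<in>V. p x = D x * q x + r x \<and> (\<forall>k\<ge>m. Polynomial.coeff (r x) k = 0))"
proof -
  obtain d where "\<forall>x\<in>V. \<forall>k\<ge>d. Polynomial.coeff (p x) k = 0" using p unfolding ppoly_def by blast
  then show ?thesis using p
  proof (induction d arbitrary: p)
    case 0
    then show ?case by (intro exI[of _ "\<lambda>_. 0"] exI[of _ p]) (auto intro: ppoly_const)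
  next
    case (Suc d)
    show ?case
    proof (cases "d < m")
      case True
      then show ?thesis using Suc by (intro exI[of _ "\<lambda>_. 0"] exI[of _ p]) (auto intro: ppoly_const)
    next
      case False
      define u where "u x = Polynomial.monom (Polynomial.coeff (p x) d) (d - m)" for x
      have u: "ppoly V E u" unfolding u_def using Suc.prems by (intro ppoly_monom) (auto simp: ppoly_def)
      have "Polynomial.coeff (p x - D x * u x) k = 0" if "x \<in> V" "k \<ge> d" for x k
      proof -
        have "Polynomial.coeff (D x * u x) k = Polynomial.coeff (p x) d * Polynomial.coeff (D x) (k - (d - m))"
          using that False unfolding u_def by (subst mult.commute) (simp add: coeff_monom_mult)
        then show ?thesis using that False D(2,3) Suc.prems(1) by (cases "k = d") auto
      qed
      then obtain q r where qr: "ppoly V E q" "ppoly V E r"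
        "\<And>x. x \<in> V \<Longrightarrow> p x - D x * u x = D x * q x + r x"
        "\<And>x k. x \<in> V \<Longrightarrow> k \<ge> m \<Longrightarrow> Polynomial.coeff (r x) k = 0"
        using Suc.IH[of "\<lambda>x. p x - D x * u x"] ppoly_diff[OF Suc.prems(2) ppoly_mult[OF D(1) u]] by blast
      have "p x = D x * (q x + u x) + r x" if "x \<in> V" for x
        using qr(3)[OF that] by (simp add: algebra_simps)
      then show ?thesis using qr(1,2,4) ppoly_add[OF qr(1) u]
        by (intro exI[of _ "\<lambda>x. q x + u x"] exI[of _ r]) auto
    qed
  qed
qed

lemma monic_multiple_small:
  fixes D u :: "complex poly"
  assumes D: "Polynomial.coeff D m = 1" "\<And>k. k > m \<Longrightarrow> Polynomial.coeff D k = 0"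
    and w: "\<And>k. k \<ge> m \<Longrightarrow> Polynomial.coeff (D * u) k = 0"
  shows "u = 0"
proof (rule ccontr)
  assume u: "u \<noteq> 0"
  have deg: "Polynomial.degree D = m" using D by (intro order.antisym degree_le le_degree) auto
  have "Polynomial.coeff (D * u) (Polynomial.degree D + Polynomial.degree u) = Polynomial.lead_coeff D * Polynomial.lead_coeff u"
    by (rule coeff_mult_degree_sum)
  then show False using w[of "m + Polynomial.degree u"] u D deg by auto
qed

text \<open>If \<open>D\<^sub>1\<close> is monic and \<open>D\<^sub>2\<close> is a nonzero constant at one point, then \<open>D\<^sub>1\<close> and \<open>D\<^sub>2\<close> are
  generically coprime: the determinant of multiplication by \<open>D\<^sub>2\<close> modulo \<open>D\<^sub>1\<close> is a resultant.\<close>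

lemma coprime_denominators:
  assumes V: "line_connected V E"
    and pp: "ppoly V E D1" "ppoly V E D2" "ppoly V E q1" "ppoly V E q2"
    and D1: "\<And>x. x \<in> V \<Longrightarrow> Polynomial.coeff (D1 x) m = 1"
      "\<And>x k. x \<in> V \<Longrightarrow> k > m \<Longrightarrow> Polynomial.coeff (D1 x) k = 0"
    and eq: "\<And>x. x \<in> V \<Longrightarrow> q1 x * D2 x = q2 x * D1 x"
    and x0: "x0 \<in> V" "D2 x0 = [:c:]" "c \<noteq> 0"
  shows "\<exists>s. ppoly V E s \<and> (\<forall>x\<in>V. q1 x = D1 x * s x)"
proof -
  \<comment> \<open>Divide by the monic D1; the aim is to show that the remainder r is zero.\<close>
  obtain s r where sr: "ppoly V E s" "ppoly V E r" "\<And>x. x \<in> V \<Longrightarrow> q1 x = D1 x * s x + r x"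
    "\<And>x k. x \<in> V \<Longrightarrow> k \<ge> m \<Longrightarrow> Polynomial.coeff (r x) k = 0"
    using ppoly_divide[OF pp(1) D1 pp(3)] by blast
  have "\<exists>s r. ppoly V E s \<and> ppoly V E r \<and>
    (\<forall>x\<in>V. Polynomial.monom 1 k * D2 x = D1 x * s x + r x \<and> (\<forall>i\<ge>m. Polynomial.coeff (r x) i = 0))" for k
    by (rule ppoly_divide[OF pp(1) D1 ppoly_mult[OF ppoly_const pp(2)]])
  then obtain sk rk where "\<And>k. ppoly V E (sk k) \<and> ppoly V E (rk k) \<and>
    (\<forall>x\<in>V. Polynomial.monom 1 k * D2 x = D1 x * sk k x + rk k x \<and> (\<forall>i\<ge>m. Polynomial.coeff (rk k x) i = 0))"
    by metis
  then have k: "\<And>k. ppoly V E (rk k)" "\<And>k x. x \<in> V \<Longrightarrow> Polynomial.monom 1 k * D2 x = D1 x * sk k x + rk k x"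
    "\<And>k x i. x \<in> V \<Longrightarrow> i \<ge> m \<Longrightarrow> Polynomial.coeff (rk k x) i = 0" by auto
  \<comment> \<open>The matrix of multiplication by D2 on the residues 1, ..., t^(m-1) modulo
    D1.\<close>
  define B where "B x = mat m m (\<lambda>(i, k). Polynomial.coeff (rk k x) i)" for x
  have B: "B x \<in> carrier_mat m m" for x by (simp add: B_def)
  \<comment> \<open>Since q1 D2 = q2 D1, also r D2 is a multiple of D1; so the coefficient vector of
    r lies in the kernel of B.\<close>
  have lin: "(\<Sum>k<m. Polynomial.coeff (r x) k * Polynomial.coeff (rk k x) i) = 0" if x: "x \<in> V" for x i
  proof -
    have "r x = (\<Sum>k<m. Polynomial.smult (Polynomial.coeff (r x) k) (Polynomial.monom 1 k))"
    proof (rule poly_eqI)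
      fix i
      have "(\<Sum>k<m. Polynomial.coeff (r x) k * (if k = i then 1 else 0)) = (if i < m then Polynomial.coeff (r x) i else 0)"
        by (simp add: if_distrib sum.delta cong: if_cong)
      then show "Polynomial.coeff (r x) i = Polynomial.coeff (\<Sum>k<m. Polynomial.smult (Polynomial.coeff (r x) k) (Polynomial.monom 1 k)) i"
        using sr(4)[OF x, of i] by (simp add: coeff_sum)
    qed
    then have "r x * D2 x = (\<Sum>k<m. Polynomial.smult (Polynomial.coeff (r x) k) (Polynomial.monom 1 k)) * D2 x" by simp
    also have "\<dots> = (\<Sum>k<m. Polynomial.smult (Polynomial.coeff (r x) k) (D1 x * sk k x + rk k x))"
      unfolding sum_distrib_right mult_smult_left k(2)[OF x] ..
    also have "\<dots> = D1 x * (\<Sum>k<m. Polynomial.smult (Polynomial.coeff (r x) k) (sk k x)) +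
        (\<Sum>k<m. Polynomial.smult (Polynomial.coeff (r x) k) (rk k x))"
      by (simp add: smult_add_right sum.distrib sum_distrib_left)
    finally have 1: "r x * D2 x = \<dots>" .
    have "r x * D2 x = D1 x * (q2 x - s x * D2 x)"
      using eq[OF x] sr(3)[OF x] by (simp add: algebra_simps)
    with 1 have 2: "D1 x * (q2 x - s x * D2 x - (\<Sum>k<m. Polynomial.smult (Polynomial.coeff (r x) k) (sk k x))) =
        (\<Sum>k<m. Polynomial.smult (Polynomial.coeff (r x) k) (rk k x))" by (simp add: algebra_simps)
    have "q2 x - s x * D2 x - (\<Sum>k<m. Polynomial.smult (Polynomial.coeff (r x) k) (sk k x)) = 0"
      by (rule monic_multiple_small[OF D1[OF x]]) (auto simp: x 2 coeff_sum k(3))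
    with 2 have "(\<Sum>k<m. Polynomial.smult (Polynomial.coeff (r x) k) (rk k x)) = 0" by simp
    then have "Polynomial.coeff (\<Sum>k<m. Polynomial.smult (Polynomial.coeff (r x) k) (rk k x)) i = 0" by simp
    then show ?thesis by (simp add: coeff_sum)
  qed
  \<comment> \<open>At x0 multiplication by D2 is multiplication by the constant c, also modulo
    D1.\<close>
  have "B x0 = c \<cdot>\<^sub>m 1\<^sub>m m"
  proof (rule eq_matI)
    fix i j assume "i < dim_row (c \<cdot>\<^sub>m 1\<^sub>m m)" "j < dim_col (c \<cdot>\<^sub>m 1\<^sub>m m)"
    then have ij: "i < m" "j < m" by auto
    have e: "D1 x0 * sk j x0 = Polynomial.monom c j - rk j x0"
      using k(2)[OF x0(1), of j] x0(2) by (simp add: smult_monom mult.commute)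
    have "sk j x0 = 0"
      by (rule monic_multiple_small[OF D1[OF x0(1)]]) (use ij x0 in \<open>auto simp: e k(3)\<close>)
    with e have "rk j x0 = Polynomial.monom c j" by simp
    then show "B x0 $$ (i, j) = (c \<cdot>\<^sub>m 1\<^sub>m m) $$ (i, j)" using ij by (auto simp: B_def)
  qed (auto simp: B_def)
  then have d0: "det (B x0) \<noteq> 0" using x0 by simp
  have dB: "(\<lambda>x. det (B x)) \<in> pfun V E"
    unfolding B_def by (rule pfun_det) (use k(1) in \<open>auto simp: ppoly_def\<close>)
  have "Polynomial.coeff (r x) j = 0" if "x \<in> V" for x j
  proof (rule pfun_density[OF V _ dB, of "\<lambda>x. Polynomial.coeff (r x) j" x0 x])
    show "(\<lambda>x. Polynomial.coeff (r x) j) \<in> pfun V E" using sr(2) by (auto simp: ppoly_def)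
    fix x assume x: "x \<in> V" "det (B x) \<noteq> 0"
    have "B x *\<^sub>v vec m (\<lambda>k. Polynomial.coeff (r x) k) = 0\<^sub>v m"
      using lin[OF x(1)] by (intro eq_vecI)
        (auto simp: B_def scalar_prod_def atLeast0LessThan mult.commute)
    then have "vec m (\<lambda>k. Polynomial.coeff (r x) k) = 0\<^sub>v m"
      using x(2) det_0_iff_vec_prod_zero[OF B[of x]] vec_carrier by blast
    then have "vec m (\<lambda>k. Polynomial.coeff (r x) k) $ j = 0" if "j < m" using that by simp
    then show "Polynomial.coeff (r x) j = 0" using sr(4)[OF x(1), of j] by (cases "j < m") auto
  qed (use x0 d0 that in auto)
  then have "r x = 0" if "x \<in> V" for x using that by (intro poly_eqI) auto
  then show ?thesis using sr by (intro exI[of _ s]) auto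
qed

text \<open>Substituting 1/z reverses coefficients. With this the leading coefficient of a Krylov
  determinant along a line is computed at the point at infinity of that line.\<close>

lemma poly_reverse:
  fixes p h :: "complex poly"
  assumes "\<And>z. z \<noteq> 0 \<Longrightarrow> poly p z = z ^ M * poly h (1 / z)"
  shows "Polynomial.coeff p M = poly h 0" "\<And>k. k > M \<Longrightarrow> Polynomial.coeff p k = 0"
proof -
  let ?d = "Polynomial.degree h"
  \<comment> \<open>The extra factor z takes care of z = 0, where the hypothesis says
    nothing.\<close>
  have "poly ([:0, 1:] * (Polynomial.monom 1 ?d * p - Polynomial.monom 1 M * reflect_poly h)) z = 0" for z
  proof (cases "z = 0")
    case False
    then show ?thesis using assms[of z] poly_reflect_poly_nz[of z h]
      by (simp add: poly_monom inverse_eq_divide)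
  qed simp
  then have "[:0, 1:] * (Polynomial.monom 1 ?d * p - Polynomial.monom 1 M * reflect_poly h) = 0"
    using poly_all_0_iff_0 by blast
  then have eq: "Polynomial.monom 1 ?d * p = Polynomial.monom 1 M * reflect_poly h" by simp
  have c: "Polynomial.coeff p k = (if k + ?d < M then 0 else Polynomial.coeff (reflect_poly h) (k + ?d - M))" for k
    using arg_cong[OF eq, of "\<lambda>p. Polynomial.coeff p (k + ?d)"] by (simp add: coeff_monom_mult)
  show "Polynomial.coeff p M = poly h 0" unfolding c by (simp add: coeff_reflect_poly poly_0_coeff_0)
  fix k assume "k > M"
  then show "Polynomial.coeff p k = 0" unfolding c by (simp add: coeff_reflect_poly)
qed

section \<open>Cyclic vectors of shift matrices\<close>

definition unit_fun :: "nat \<Rightarrow> nat \<Rightarrow> complex" where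
  "unit_fun j = (\<lambda>i. if i = j then 1 else 0)"

definition upshift :: "nat \<Rightarrow> complex mat" where
  "upshift n = mat n n (\<lambda>(i, j). if Suc i = j then 1 else 0)"

definition downshift :: "nat \<Rightarrow> complex mat" where
  "downshift n = mat n n (\<lambda>(i, j). if i = Suc j then 1 else 0)"

lemma shift_sl: "upshift n \<in> sl_lie n" "downshift n \<in> sl_lie n" "upshift n \<in> borel_lie n"
  by (auto simp: upshift_def downshift_def sl_lie_def borel_lie_def)

lemma krylov_upshift: "k < n \<Longrightarrow> i < n \<Longrightarrow> krylov n (upshift n) (unit_fun (n - 1)) k i = unit_fun (n - 1 - k) i"
proof (induction k arbitrary: i)
  case (Suc k)
  have "krylov n (upshift n) (unit_fun (n - 1)) (Suc k) i = mv n (upshift n) (unit_fun (n - 1 - k)) i"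
    using mv_cong[of n "krylov n (upshift n) (unit_fun (n - 1)) k" "unit_fun (n - 1 - k)"] Suc by simp
  also have "\<dots> = (\<Sum>l<n. if l = Suc i then unit_fun (n - 1 - k) (Suc i) else 0)"
    unfolding mv_def using Suc.prems by (intro sum.cong) (auto simp: upshift_def)
  also have "\<dots> = unit_fun (n - 1 - Suc k) i"
    using Suc.prems by (auto simp: sum.delta unit_fun_def)
  finally show ?case .
qed simp

lemma krylov_det_upshift: "krylov_det n (unit_fun (n - 1)) (upshift n) = 1"
proof -
  have "krylov n (upshift n) (unit_fun (n - 1)) (n - 1 - j) i = (if i = j then 1 else 0)" if "i < n" "j < n" for i j
    using krylov_upshift[of "n - 1 - j" n i] that by (simp add: unit_fun_def)
  then have "krylov_mat n (unit_fun (n - 1)) (upshift n) = 1\<^sub>m n"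
    unfolding krylov_mat_def by (intro eq_matI) auto
  then show ?thesis by simp
qed

text \<open>Each application of T moves the lowest nonzero coordinate down by one, with coefficient
  1. The entries of T on and above the diagonal are arbitrary, so the Krylov determinant of the
  first unit vector is constant on the line through \<open>downshift\<close> in direction
  \<open>upshift\<close>.\<close>

lemma krylov_hessenberg:
  assumes T: "\<And>i l. i < n \<Longrightarrow> l < n \<Longrightarrow> i > Suc l \<Longrightarrow> T $$ (i, l) = 0"
    "\<And>l. Suc l < n \<Longrightarrow> T $$ (Suc l, l) = 1"
  shows "k < n \<Longrightarrow> i < n \<Longrightarrow> k \<le> i \<Longrightarrow> krylov n T (unit_fun 0) k i = (if i = k then 1 else 0)"
proof (induction k arbitrary: i)
  case 0 then show ?case by (simp add: unit_fun_def)
next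
  case (Suc k)
  have "krylov n T (unit_fun 0) (Suc k) i = (\<Sum>l<n. T $$ (i, l) * krylov n T (unit_fun 0) k l)"
    by (simp add: mv_def)
  also have "\<dots> = (\<Sum>l<n. if l = k then (if i = Suc k then 1 else 0) else 0)"
  proof (intro sum.cong refl)
    fix l assume l: "l \<in> {..<n}"
    consider "l < k" | "l = k" | "l > k" by linarith
    then show "T $$ (i, l) * krylov n T (unit_fun 0) k l = (if l = k then (if i = Suc k then 1 else 0) else 0)"
    proof cases
      case 1 then show ?thesis using T(1)[of i l] l Suc.prems by simp
    next
      case 2 then show ?thesis using T(1)[of i l] T(2)[of l] Suc.IH[of l] l Suc.prems by (cases "i = Suc k") auto
    next
      case 3 then show ?thesis using Suc.IH[of l] l Suc.prems by simp
    qed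
  qed
  finally show ?case using Suc.prems by (simp add: sum.delta)
qed

text \<open>Puts the descending Krylov columns into ascending order, where the matrix becomes
  triangular. Its determinant is carried along as a nonzero constant.\<close>

definition reversal :: "nat \<Rightarrow> complex mat" where
  "reversal n = mat n n (\<lambda>(i, j). if j = n - 1 - i then 1 else 0)"

lemma krylov_det_hessenberg:
  assumes T: "\<And>i l. i < n \<Longrightarrow> l < n \<Longrightarrow> i > Suc l \<Longrightarrow> T $$ (i, l) = 0"
    "\<And>l. Suc l < n \<Longrightarrow> T $$ (Suc l, l) = 1"
  shows "krylov_det n (unit_fun 0) T * det (reversal n) = 1"
proof -
  let ?K = "mat n n (\<lambda>(i, j). krylov n T (unit_fun 0) j i)"
  have "krylov_mat n (unit_fun 0) T * reversal n = ?K"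
  proof (rule eq_matI)
    fix i j assume "i < dim_row ?K" "j < dim_col ?K"
    then have ij: "i < n" "j < n" by auto
    have "(krylov_mat n (unit_fun 0) T * reversal n) $$ (i, j) =
        (\<Sum>l<n. krylov n T (unit_fun 0) (n - 1 - l) i * reversal n $$ (l, j))"
      using ij by (subst index_mult_mat_sum[of _ n n _ n]) (auto simp: krylov_mat_def reversal_def)
    also have "\<dots> = (\<Sum>l<n. if l = n - 1 - j then krylov n T (unit_fun 0) j i else 0)"
      using ij by (intro sum.cong) (auto simp: reversal_def)
    finally show "(krylov_mat n (unit_fun 0) T * reversal n) $$ (i, j) = ?K $$ (i, j)"
      using ij by (simp add: sum.delta)
  qed (auto simp: krylov_mat_def reversal_def)
  moreover have "det ?K = 1"
  proof -
    have "det ?K = prod_list (diag_mat ?K)"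
      by (rule det_upper_triangular[of _ n]) (auto simp: krylov_hessenberg[OF T])
    also have "diag_mat ?K = replicate n 1"
      by (rule nth_equalityI) (auto simp: diag_mat_def krylov_hessenberg[OF T])
    finally show ?thesis by simp
  qed
  ultimately show ?thesis by (simp add: det_mult[of _ n, symmetric] krylov_mat_def reversal_def)
qed

lemma krylov_cmult: "krylov n (c \<cdot>\<^sub>m x) v k i = c ^ k * krylov n x v k i"
  if "x \<in> carrier_mat n n" "i < n"
  using that(2)
proof (induction k arbitrary: i)
  case (Suc k)
  have "krylov n (c \<cdot>\<^sub>m x) v (Suc k) i = mv n (c \<cdot>\<^sub>m x) (\<lambda>i. c ^ k * krylov n x v k i) i"
    using mv_cong[of n "krylov n (c \<cdot>\<^sub>m x) v k"] Suc by simp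
  also have "\<dots> = c ^ Suc k * krylov n x v (Suc k) i"
    using that Suc.prems by (simp add: mv_def sum_distrib_left mult_ac)
  finally show ?case .
qed simp

lemma krylov_det_cmult:
  assumes "x \<in> carrier_mat n n"
  shows "krylov_det n v (c \<cdot>\<^sub>m x) = c ^ (\<Sum>j<n. n - 1 - j) * krylov_det n v x"
proof -
  have "krylov_mat n v (c \<cdot>\<^sub>m x) = krylov_mat n v x * mat_diag n (\<lambda>j. c ^ (n - 1 - j))"
    by (subst mat_diag_mult_right[of _ n n])
      (auto simp: krylov_mat_def krylov_cmult[OF assms] intro!: eq_matI)
  then show ?thesis
    by (simp add: det_mult[of _ n] krylov_mat_def det_diag_nonzero power_sum)
qed

lemma pfun_mv:
  assumes "\<And>i j. i < n \<Longrightarrow> j < n \<Longrightarrow> (\<lambda>z. A z $$ (i, j)) \<in> pfun V E" "\<And>k. k < n \<Longrightarrow> (\<lambda>z. u z k) \<in> pfun V E" "i < n"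
  shows "(\<lambda>z. mv n (A z) (u z) i) \<in> pfun V E"
  unfolding mv_def by (intro pfun_sum pfun_mult assms) auto

lemma pfun_flag_vec:
  assumes "\<And>i j. i < n \<Longrightarrow> j < n \<Longrightarrow> (\<lambda>z. A z $$ (i, j)) \<in> pfun V E" "\<And>k. k < n \<Longrightarrow> (\<lambda>z. y z k) \<in> pfun V E"
    and "i < n" "k \<le> n"
  shows "(\<lambda>z. flag_vec n (A z) (y z) v k i) \<in> pfun V E"
  using assms(3,4)
proof (induction k arbitrary: i)
  case 0 then show ?case by (simp add: pfun_const)
next
  case (Suc k)
  then show ?case unfolding flag_vec.simps
    by (intro pfun_diff pfun_mult pfun_mv assms(1,2)) auto
qed

lemma pfun_krylov_det:
  assumes "\<And>i j. i < n \<Longrightarrow> j < n \<Longrightarrow> (\<lambda>z. A z $$ (i, j)) \<in> pfun V E"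
  shows "(\<lambda>z. krylov_det n v (A z)) \<in> pfun V E"
  unfolding krylov_mat_def krylov_flag_vec
  by (rule pfun_det) (auto intro!: pfun_flag_vec assms pfun_const)

lemma line_connected_subspace:
  assumes V: "V \<subseteq> carrier_mat n n" and L: "\<And>z z' t. z \<in> V \<Longrightarrow> z' \<in> V \<Longrightarrow> z + t \<cdot>\<^sub>m (z' - z) \<in> V"
  shows "line_connected V (entries n)"
proof (rule line_connectedI_affine[of _ "\<lambda>z z' t. z + t \<cdot>\<^sub>m (z' - z)"])
  fix z z' assume "z \<in> V" "z' \<in> V"
  then have c: "z \<in> carrier_mat n n" "z' \<in> carrier_mat n n" using V by auto
  show "z + 0 \<cdot>\<^sub>m (z' - z) = z" using c by (intro eq_matI) auto
  show "z + 1 \<cdot>\<^sub>m (z' - z) = z'" using c by (intro eq_matI) auto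
  fix e t assume "e \<in> entries n"
  then show "e (z + t \<cdot>\<^sub>m (z' - z)) = e z + t * (e z' - e z)" using c by (auto simp: entries_def)
qed (rule L)

lemma line_connected_sl: "line_connected (sl_lie n) (entries n)"
proof (rule line_connected_subspace)
  fix z z' t assume "z \<in> sl_lie n" "z' \<in> sl_lie n"
  then show "z + t \<cdot>\<^sub>m (z' - z) \<in> sl_lie n"
    by (auto simp: sl_lie_def sum.distrib sum_subtractf simp flip: sum_distrib_left)
qed (auto simp: sl_lie_def)

lemma line_connected_borel: "line_connected (borel_lie n) (entries n)"
proof (rule line_connected_subspace)
  fix z z' t assume z: "z \<in> borel_lie n" "z' \<in> borel_lie n"
  then have "z $$ (i, j) = 0" "z' $$ (i, j) = 0" if "j < i" "i < n" for i j
    using that by (auto simp: borel_lie_def sl_lie_def)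
  with z show "z + t \<cdot>\<^sub>m (z' - z) \<in> borel_lie n"
    by (auto simp: borel_lie_def sl_lie_def sum.distrib sum_subtractf simp flip: sum_distrib_left intro!: upper_triangularI)
qed (auto simp: sl_lie_def borel_lie_def)

text \<open>Everything is restricted to the lines x + t \<open>upshift\<close>. In t the determinant
  for the last unit vector is monic, by its value at \<open>upshift\<close>, the point at infinity;
  the one for the first unit vector is a nonzero constant on the line through
  \<open>downshift\<close>. So \<open>coprime_denominators\<close> applies, and t = 0 returns the
  quotient as a polynomial in x.\<close>

lemma krylov_hartogs:
  assumes n: "0 < n" and q: "q1 \<in> pfun (sl_lie n) (entries n)" "q2 \<in> pfun (sl_lie n) (entries n)"
    and eq: "\<And>x. x \<in> sl_lie n \<Longrightarrow>
      q1 x * krylov_det n (unit_fun 0) x ^ N2 = q2 x * krylov_det n (unit_fun (n - 1)) x ^ N1"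
  shows "\<exists>c\<in>pfun (sl_lie n) (entries n). \<forall>x\<in>sl_lie n. q1 x = krylov_det n (unit_fun (n - 1)) x ^ N1 * c x"
proof -
  let ?V = "sl_lie n" and ?E = "entries n"
  define \<phi> where "\<phi> x t = x + t \<cdot>\<^sub>m upshift n" for x and t :: complex
  have up: "upshift n \<in> carrier_mat n n" by (simp add: upshift_def)
  have \<phi>V: "\<phi> x t \<in> ?V" if "x \<in> ?V" for x t
    using that shift_sl[of n] by (auto simp: \<phi>_def sl_lie_def sum.distrib simp flip: sum_distrib_left)
  have lines: "\<exists>p. ppoly ?V ?E p \<and> (\<forall>x\<in>?V. \<forall>t. f (\<phi> x t) = poly (p x) t)" if f: "f \<in> pfun ?V ?E" for f
  proof (rule pfun_along_lines[OF f \<phi>V])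
    fix e assume "e \<in> ?E"
    then obtain i j where ij: "i < n" "j < n" "e = (\<lambda>x. x $$ (i, j))" by (auto simp: entries_def)
    have "ppoly ?V ?E (\<lambda>x. Polynomial.monom (x $$ (i, j)) 0 + [:0, upshift n $$ (i, j):])"
      by (intro ppoly_add ppoly_monom ppoly_const pfun_entry ij)
    moreover have "\<forall>x\<in>?V. \<forall>t. e (\<phi> x t) = poly (Polynomial.monom (x $$ (i, j)) 0 + [:0, upshift n $$ (i, j):]) t"
      using ij up by (auto simp: \<phi>_def monom_0)
    ultimately show "\<exists>p. ppoly ?V ?E p \<and> (\<forall>x\<in>?V. \<forall>t. e (\<phi> x t) = poly (p x) t)" by blast
  qed
  have Dp: "krylov_det n v \<in> pfun ?V ?E" for v
    by (rule pfun_krylov_det[of n "\<lambda>x. x"]) (rule pfun_entry)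
  obtain P1 where P1: "ppoly ?V ?E P1" "\<And>x t. x \<in> ?V \<Longrightarrow> krylov_det n (unit_fun (n - 1)) (\<phi> x t) = poly (P1 x) t"
    using lines[OF Dp] by blast
  obtain P2 where P2: "ppoly ?V ?E P2" "\<And>x t. x \<in> ?V \<Longrightarrow> krylov_det n (unit_fun 0) (\<phi> x t) = poly (P2 x) t"
    using lines[OF Dp] by blast
  obtain r1 where r1: "ppoly ?V ?E r1" "\<And>x t. x \<in> ?V \<Longrightarrow> q1 (\<phi> x t) = poly (r1 x) t"
    using lines[OF q(1)] by blast
  obtain r2 where r2: "ppoly ?V ?E r2" "\<And>x t. x \<in> ?V \<Longrightarrow> q2 (\<phi> x t) = poly (r2 x) t"
    using lines[OF q(2)] by blast
  define M where "M = (\<Sum>j<n. n - 1 - j)"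
  have mon: "Polynomial.coeff (P1 x) M = 1 \<and> (\<forall>k>M. Polynomial.coeff (P1 x) k = 0)" if x: "x \<in> ?V" for x
  proof -
    have xc: "x \<in> carrier_mat n n" using x by (simp add: sl_lie_def)
    obtain h where h: "\<And>t. krylov_det n (unit_fun (n - 1)) (upshift n + t \<cdot>\<^sub>m x) = poly h t"
    proof -
      have "\<exists>p. \<forall>t. krylov_det n (unit_fun (n - 1)) (upshift n + t \<cdot>\<^sub>m x) = poly p t"
      proof (rule pfun_on_curve[OF Dp])
        show "upshift n + t \<cdot>\<^sub>m x \<in> ?V" for t
          using x shift_sl[of n] by (auto simp: sl_lie_def sum.distrib simp flip: sum_distrib_left)
        show "\<forall>e\<in>?E. \<exists>p. \<forall>t. e (upshift n + t \<cdot>\<^sub>m x) = poly p t"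
        proof
          fix e assume "e \<in> ?E"
          then obtain i j where ij: "i < n" "j < n" "e = (\<lambda>x. x $$ (i, j))" by (auto simp: entries_def)
          then show "\<exists>p. \<forall>t. e (upshift n + t \<cdot>\<^sub>m x) = poly p t"
            using xc up by (intro exI[of _ "[:upshift n $$ (i, j), x $$ (i, j):]"]) auto
        qed
      qed
      then show thesis using that by blast
    qed
    \<comment> \<open>x + z \<open>upshift\<close> = z (\<open>upshift\<close> + x / z), and the
      Krylov determinant is homogeneous of degree M in the matrix.\<close>
    have e: "poly (P1 x) z = z ^ M * poly h (1 / z)" if z: "z \<noteq> 0" for z
    proof -
      have "\<phi> x z = z \<cdot>\<^sub>m (upshift n + (1 / z) \<cdot>\<^sub>m x)"
        using z xc up by (intro eq_matI) (auto simp: \<phi>_def algebra_simps)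
      moreover have "upshift n + (1 / z) \<cdot>\<^sub>m x \<in> carrier_mat n n" using xc up by auto
      ultimately show ?thesis
        using P1(2)[OF x, of z] h[of "1 / z"] krylov_det_cmult[of "upshift n + (1 / z) \<cdot>\<^sub>m x" n] by (simp add: M_def)
    qed
    have "upshift n + 0 \<cdot>\<^sub>m x = upshift n" using xc up by (intro eq_matI) auto
    then have "poly h 0 = 1" using h[of 0] krylov_det_upshift[of n] by simp
    then show ?thesis using poly_reverse[OF e] by simp
  qed
  have deg: "Polynomial.degree (P1 x) = M \<and> Polynomial.lead_coeff (P1 x) = 1" if x: "x \<in> ?V" for x
  proof -
    have "Polynomial.degree (P1 x) = M"
      using mon[OF x] by (intro order.antisym degree_le le_degree) auto
    then show ?thesis using mon[OF x] by simp
  qed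
  have degN: "Polynomial.degree (P1 x ^ N1) = M * N1" if x: "x \<in> ?V" for x
    using deg[OF x] by (subst degree_power_eq) auto
  have rev: "det (reversal n) \<noteq> 0"
  proof -
    have "krylov_det n (unit_fun 0) (downshift n) * det (reversal n) = 1"
      by (rule krylov_det_hessenberg) (auto simp: downshift_def)
    then show ?thesis by auto
  qed
  have P2c: "P2 (downshift n) = [:1 / det (reversal n):]"
  proof -
    have K: "krylov_det n (unit_fun 0) (\<phi> (downshift n) t) * det (reversal n) = 1" for t
      by (rule krylov_det_hessenberg) (auto simp: downshift_def \<phi>_def upshift_def)
    then have "poly (P2 (downshift n)) t = 1 / det (reversal n)" for t
      using K[of t] rev unfolding P2(2)[OF shift_sl(2)] by (simp add: eq_divide_eq)
    then have "poly (P2 (downshift n)) t = poly [:1 / det (reversal n):] t" for t by simp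
    then show ?thesis using poly_eq_poly_eq_iff by blast
  qed
  have "\<exists>s. ppoly ?V ?E s \<and> (\<forall>x\<in>?V. r1 x = P1 x ^ N1 * s x)"
  proof (rule coprime_denominators[OF line_connected_sl, where ?D2.0 = "\<lambda>x. P2 x ^ N2" and ?q2.0 = r2
        and m = "M * N1" and ?x0.0 = "downshift n" and c = "(1 / det (reversal n)) ^ N2"])
    show "Polynomial.coeff (P1 x ^ N1) (M * N1) = 1" if "x \<in> ?V" for x
      using deg[OF that] degN[OF that] by (metis lead_coeff_power power_one)
    show "Polynomial.coeff (P1 x ^ N1) k = 0" if "x \<in> ?V" "k > M * N1" for x k
      using degN[OF that(1)] that(2) by (simp add: coeff_eq_0)
    show "r1 x * P2 x ^ N2 = r2 x * P1 x ^ N1" if x: "x \<in> ?V" for x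
    proof -
      have "poly (r1 x * P2 x ^ N2) t = poly (r2 x * P1 x ^ N1) t" for t
        using eq[OF \<phi>V[OF x, of t]] r1(2)[OF x] r2(2)[OF x] P1(2)[OF x] P2(2)[OF x] by (simp add: poly_power)
      then show ?thesis using poly_eq_poly_eq_iff by blast
    qed
    show "P2 (downshift n) ^ N2 = [:(1 / det (reversal n)) ^ N2:]"
      unfolding P2c by (simp add: poly_const_pow)
    show "(1 / det (reversal n)) ^ N2 \<noteq> 0" using rev by simp
  qed (auto intro: ppoly_power P1 P2 r1 r2 shift_sl)
  then obtain s where s: "ppoly ?V ?E s" "\<And>x. x \<in> ?V \<Longrightarrow> r1 x = P1 x ^ N1 * s x" by blast
  have "q1 x = krylov_det n (unit_fun (n - 1)) x ^ N1 * Polynomial.coeff (s x) 0" if x: "x \<in> ?V" for x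
  proof -
    have xc: "x \<in> carrier_mat n n" using x by (simp add: sl_lie_def)
    have "\<phi> x 0 = x" using xc up by (intro eq_matI) (auto simp: \<phi>_def)
    then show ?thesis
      using r1(2)[OF x, of 0] P1(2)[OF x, of 0] s(2)[OF x] by (simp add: poly_power flip: poly_0_coeff_0)
  qed
  then show ?thesis using s(1) by (intro bexI[of _ "\<lambda>x. Polynomial.coeff (s x) 0"]) (auto simp: ppoly_def)
qed

section \<open>Functions invariant under the right Borel action\<close>

lemma pfun_denominators:
  assumes "P \<in> pfun UNIV E" and D: "D \<in> pfun W G"
    and E: "\<And>e. e \<in> E \<Longrightarrow> \<exists>q\<in>pfun W G. \<forall>z\<in>W. D z \<noteq> 0 \<longrightarrow> D z * e (\<phi> z) = q z"
  shows "\<exists>N. \<exists>Q\<in>pfun W G. \<forall>z\<in>W. D z \<noteq> 0 \<longrightarrow> D z ^ N * P (\<phi> z) = Q z"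
  using assms(1)
proof induction
  case (const c)
  show ?case by (intro exI[of _ 0] bexI[OF _ pfun_const[of c]]) auto
next
  case (coord e)
  then show ?case using E[of e] by (intro exI[of _ 1]) auto
next
  case (add f g)
  then obtain N Q N' Q' where *: "Q \<in> pfun W G" "Q' \<in> pfun W G"
    "\<forall>z\<in>W. D z \<noteq> 0 \<longrightarrow> D z ^ N * f (\<phi> z) = Q z" "\<forall>z\<in>W. D z \<noteq> 0 \<longrightarrow> D z ^ N' * g (\<phi> z) = Q' z" by blast
  show ?case
  proof (intro exI[of _ "N + N'"] bexI[of _ "\<lambda>z. D z ^ N' * Q z + D z ^ N * Q' z"] ballI impI)
    fix z assume z: "z \<in> W" "D z \<noteq> 0"
    then have "Q z = D z ^ N * f (\<phi> z)" "Q' z = D z ^ N' * g (\<phi> z)" using * by auto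
    then show "D z ^ (N + N') * (f (\<phi> z) + g (\<phi> z)) = D z ^ N' * Q z + D z ^ N * Q' z"
      by (simp add: power_add algebra_simps)
  qed (intro pfun_add pfun_mult pfun_power D *)
next
  case (mult f g)
  then obtain N Q N' Q' where *: "Q \<in> pfun W G" "Q' \<in> pfun W G"
    "\<forall>z\<in>W. D z \<noteq> 0 \<longrightarrow> D z ^ N * f (\<phi> z) = Q z" "\<forall>z\<in>W. D z \<noteq> 0 \<longrightarrow> D z ^ N' * g (\<phi> z) = Q' z" by blast
  show ?case
  proof (intro exI[of _ "N + N'"] bexI[of _ "\<lambda>z. Q z * Q' z"] ballI impI)
    fix z assume z: "z \<in> W" "D z \<noteq> 0"
    then have "Q z = D z ^ N * f (\<phi> z)" "Q' z = D z ^ N' * g (\<phi> z)" using * by auto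
    then show "D z ^ (N + N') * (f (\<phi> z) * g (\<phi> z)) = Q z * Q' z"
      by (simp add: power_add algebra_simps)
  qed (intro pfun_mult *)
next
  case (cong f g)
  then have "g = f" by auto
  then show ?case using cong by simp
qed

abbreviation diag_fun :: "complex mat \<Rightarrow> nat \<Rightarrow> complex" where
  "diag_fun b \<equiv> \<lambda>i. b $$ (i, i)"

lemma bidiag_borel: "(\<Sum>i<n. y i) = 0 \<Longrightarrow> bidiag n y d \<in> borel_lie n"
  by (auto simp: bidiag_def borel_lie_def sl_lie_def)

lemma conj_carrier:
  assumes "g \<in> carrier (SL n)" "b \<in> carrier_mat n n"
  shows "g * b * inv\<^bsub>SL n\<^esub> g \<in> carrier_mat n n" "g * b * inv\<^bsub>SL n\<^esub> g * g = g * b"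
    "inv\<^bsub>SL n\<^esub> g * b * g \<in> carrier_mat n n" "g * (inv\<^bsub>SL n\<^esub> g * b * g) * inv\<^bsub>SL n\<^esub> g = b"
proof -
  have g: "g \<in> carrier_mat n n" "inv\<^bsub>SL n\<^esub> g \<in> carrier_mat n n" "inv\<^bsub>SL n\<^esub> g * g = 1\<^sub>m n" "g * inv\<^bsub>SL n\<^esub> g = 1\<^sub>m n"
    using assms inv_SL[OF assms(1)] by (auto simp: SL_carrier)
  show "g * b * inv\<^bsub>SL n\<^esub> g \<in> carrier_mat n n" "inv\<^bsub>SL n\<^esub> g * b * g \<in> carrier_mat n n" using g assms by auto
  have "g * b * inv\<^bsub>SL n\<^esub> g * g = g * b * (inv\<^bsub>SL n\<^esub> g * g)"
    using g(1,2) assms(2) by (simp add: assoc_mult_mat[of _ n n _ n _ n])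
  then show "g * b * inv\<^bsub>SL n\<^esub> g * g = g * b" using g assms by simp
  have "g * (inv\<^bsub>SL n\<^esub> g * b * g) * inv\<^bsub>SL n\<^esub> g = (g * inv\<^bsub>SL n\<^esub> g) * b * (g * inv\<^bsub>SL n\<^esub> g)"
    using g(1,2) assms(2) by (simp add: assoc_mult_mat[of _ n n _ n _ n] mult_carrier_mat[of _ n n])
  then show "g * (inv\<^bsub>SL n\<^esub> g * b * g) * inv\<^bsub>SL n\<^esub> g = b" using g assms by simp
qed

lemma conj_sl:
  assumes g: "g \<in> carrier (SL n)" and b: "b \<in> sl_lie n"
  shows "g * b * inv\<^bsub>SL n\<^esub> g \<in> sl_lie n"
proof -
  have bc: "b \<in> carrier_mat n n" using b by (simp add: sl_lie_def)
  have gc: "g \<in> carrier_mat n n" using g by (simp add: SL_carrier)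
  have "(\<Sum>i<n. (g * b * inv\<^bsub>SL n\<^esub> g) $$ (i, i)) = (\<Sum>i<n. (inv\<^bsub>SL n\<^esub> g * (g * b)) $$ (i, i))"
    by (rule trace_mult_commute) (use gc bc inv_SL[OF g] in auto)
  also have "inv\<^bsub>SL n\<^esub> g * (g * b) = b"
    using gc bc inv_SL[OF g] by (subst assoc_mult_mat[of _ n n _ n _ n, symmetric]) auto
  finally show ?thesis using b conj_carrier(1)[OF g bc] by (simp add: sl_lie_def)
qed

lemma conj_unique:
  assumes "g \<in> carrier (SL n)" "b \<in> carrier_mat n n" "x \<in> carrier_mat n n" "x * g = g * b"
  shows "inv\<^bsub>SL n\<^esub> g * x * g = b" "g * b * inv\<^bsub>SL n\<^esub> g = x"
proof -
  have g: "g \<in> carrier_mat n n" "inv\<^bsub>SL n\<^esub> g \<in> carrier_mat n n" "inv\<^bsub>SL n\<^esub> g * g = 1\<^sub>m n" "g * inv\<^bsub>SL n\<^esub> g = 1\<^sub>m n"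
    using assms inv_SL[OF assms(1)] by (auto simp: SL_carrier)
  have "inv\<^bsub>SL n\<^esub> g * x * g = inv\<^bsub>SL n\<^esub> g * g * b"
    using g(1,2) assms by (simp add: assoc_mult_mat[of _ n n _ n _ n])
  then show "inv\<^bsub>SL n\<^esub> g * x * g = b" using g assms by simp
  have "g * b * inv\<^bsub>SL n\<^esub> g = x * (g * inv\<^bsub>SL n\<^esub> g)"
    using g(1,2) assms(1-3) unfolding assms(4)[symmetric] by (simp add: assoc_mult_mat[of _ n n _ n _ n])
  then show "g * b * inv\<^bsub>SL n\<^esub> g = x" using g assms by simp
qed

lemma borel_mat: "b \<in> borel_lie n \<Longrightarrow> b \<in> carrier_mat n n" "b \<in> borel_lie n \<Longrightarrow> upper_triangular b"
  "b \<in> borel_lie n \<Longrightarrow> (\<Sum>i<n. b $$ (i, i)) = 0" "b \<in> borel_lie n \<Longrightarrow> b \<in> sl_lie n"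
  by (auto simp: borel_lie_def sl_lie_def)

lemma mat_mult_assoc3:
  fixes A B C :: "complex mat"
  assumes "A \<in> carrier_mat n n" "B \<in> carrier_mat n n" "C \<in> carrier_mat n n"
  shows "A * B * C = A * (B * C)"
  using assms by (simp add: assoc_mult_mat[of _ n n _ n _ n])

context
  fixes n :: nat and f :: "complex mat \<times> complex mat \<Rightarrow> complex"
  assumes n: "0 < n"
    and inv_f: "\<And>g b p. g \<in> carrier (SL n) \<Longrightarrow> b \<in> borel_lie n \<Longrightarrow> p \<in> carrier (SL n) \<Longrightarrow> upper_triangular p \<Longrightarrow>
      f (g * p, inv\<^bsub>SL n\<^esub> p * b * p) = f (g, b)"
begin

text \<open>In the basis given by g, the columns of the frame are multiples of flag vectors of the
  triangular matrix b. So p = g\<inverse> \<open>flag_frame\<close> is upper triangular, and the new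
  pair is the right translate of (g, b) by p.\<close>

lemma flag_frame_invariant:
  assumes g: "g \<in> carrier (SL n)" and b: "b \<in> borel_lie n" and x: "x = g * b * inv\<^bsub>SL n\<^esub> g"
    and y: "\<And>i. i < n \<Longrightarrow> y i = b $$ (i, i)" and D: "krylov_det n v x \<noteq> 0"
  shows "i < n \<Longrightarrow> flag_vec n x y v n i = 0"
    "f (flag_frame n x y v, bidiag n y (krylov_det n v x)) = f (g, b)"
proof -
  let ?i = "inv\<^bsub>SL n\<^esub> g"
  have gm: "g \<in> carrier_mat n n" "?i \<in> carrier_mat n n" "?i * g = 1\<^sub>m n" "g * ?i = 1\<^sub>m n" "?i \<in> carrier (SL n)"
    using g inv_SL[OF g] by (auto simp: SL_carrier)
  have bm: "b \<in> carrier_mat n n" "upper_triangular b" using borel_mat[OF b] by auto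
  have xm: "x \<in> carrier_mat n n" "x * g = g * b" using conj_carrier[OF g bm(1)] x by auto
  have v: "v i = mv n g (mv n ?i v) i" if "i < n" for i
    using mv_mult[OF gm(1,2) that, of v] gm(4) mv_one[OF that, of v] by simp
  have fv: "flag_vec n x y v k i = mv n g (flag_vec n b y (mv n ?i v) k) i" if "i < n" for k i
    by (rule flag_vec_conjugate[OF gm(1) bm(1) xm v that])
  have z: "flag_vec n x y v n i = 0" if "i < n" for i
    unfolding fv[OF that] mv_def
    using flag_vec_upper_triangular[OF bm y, of n] by simp
  then show "i < n \<Longrightarrow> flag_vec n x y v n i = 0" .
  let ?F = "flag_frame n x y v" and ?D = "krylov_det n v x"
  let ?B = "bidiag n y ?D"
  have FS: "?F \<in> carrier (SL n)" by (rule flag_frame_SL[OF n D])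
  have int: "x * ?F = ?F * ?B" by (rule flag_frame_intertwines[OF xm(1) z D])
  define p where "p = ?i * ?F"
  have pS: "p \<in> carrier (SL n)" unfolding p_def by (rule SL_mult[OF gm(5) FS])
  have ut: "upper_triangular p"
  proof
    fix i j assume ij: "j < i" "i < dim_row p"
    have i: "i < n" using ij gm by (simp add: p_def)
    then have j: "j < n" using ij by simp
    let ?c = "if j = 0 then ?D else 1"
    have "p $$ (i, j) = mv n ?i (\<lambda>i. (1 / ?c) * flag_vec n x y v (n - 1 - j) i) i"
      unfolding p_def using i j gm by (subst index_mult_mat_sum[of _ n n _ n]) (auto simp: mv_def flag_frame_def)
    also have "\<dots> = (1 / ?c) * mv n ?i (mv n g (flag_vec n b y (mv n ?i v) (n - 1 - j))) i"
    proof -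
      have "mv n ?i (flag_vec n x y v (n - 1 - j)) = mv n ?i (mv n g (flag_vec n b y (mv n ?i v) (n - 1 - j)))"
        by (rule mv_cong) (rule fv)
      then show ?thesis by (simp only: mv_cmult)
    qed
    also have "mv n ?i (mv n g (flag_vec n b y (mv n ?i v) (n - 1 - j))) i = flag_vec n b y (mv n ?i v) (n - 1 - j) i"
      using mv_mult[OF gm(2,1) i, symmetric] gm(3) mv_one[OF i] by simp
    also have "\<dots> = 0"
      by (rule flag_vec_upper_triangular[OF bm y]) (use i j ij in auto)
    finally show "p $$ (i, j) = 0" by simp
  qed
  have gp: "g * p = ?F"
    unfolding p_def
    using mat_mult_assoc3[OF gm(1,2) flag_frame_carrier(1)] gm(4) left_mult_one_mat[OF flag_frame_carrier(1)] by simp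
  have "inv\<^bsub>SL n\<^esub> p * b * p = ?B"
  proof -
    have pm: "p \<in> carrier_mat n n" using pS by (simp add: SL_carrier)
    have Fm: "?F \<in> carrier_mat n n" by simp
    have bp: "b * p \<in> carrier_mat n n" "p * ?B \<in> carrier_mat n n" using bm(1) pm by auto
    have "g * (b * p) = x * g * p" unfolding xm(2) by (rule mat_mult_assoc3[OF gm(1) bm(1) pm, symmetric])
    also have "\<dots> = x * ?F" unfolding gp[symmetric] by (rule mat_mult_assoc3[OF xm(1) gm(1) pm])
    also have "\<dots> = g * p * ?B" unfolding gp by (rule int)
    also have "\<dots> = g * (p * ?B)" by (rule mat_mult_assoc3[OF gm(1) pm]) simp
    finally have "?i * (g * (b * p)) = ?i * (g * (p * ?B))" by simp
    then have "b * p = p * ?B"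
      unfolding mat_mult_assoc3[OF gm(2,1) bp(1), symmetric] mat_mult_assoc3[OF gm(2,1) bp(2), symmetric]
      unfolding gm(3) left_mult_one_mat[OF bp(1)] left_mult_one_mat[OF bp(2)] .
    then show ?thesis using conj_unique(1)[OF pS _ bm(1), of ?B] by simp
  qed
  then show "f (?F, ?B) = f (g, b)" using inv_f[OF g b pS ut] gp by simp
qed

text \<open>Each reordering of the eigenvalues of x yields an invariant flag, hence another point of
  \<open>GB n\<close> over the same x, because the flag vector of level n does not see the order.
  The symmetric expansion sums over these points.\<close>

lemma flag_frame_permuted:
  assumes g: "g \<in> carrier (SL n)" and b: "b \<in> borel_lie n" and x: "x = g * b * inv\<^bsub>SL n\<^esub> g"
    and D: "krylov_det n v x \<noteq> 0" and w: "w permutes {..<n}"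
  shows "flag_frame n x (diag_fun b \<circ> w) v \<in> carrier (SL n)"
    "bidiag n (diag_fun b \<circ> w) (krylov_det n v x) \<in> borel_lie n"
    "x = flag_frame n x (diag_fun b \<circ> w) v * bidiag n (diag_fun b \<circ> w) (krylov_det n v x) *
      inv\<^bsub>SL n\<^esub> (flag_frame n x (diag_fun b \<circ> w) v)"
proof -
  show 1: "flag_frame n x (diag_fun b \<circ> w) v \<in> carrier (SL n)" by (rule flag_frame_SL[OF n D])
  have "(\<Sum>i<n. b $$ (w i, w i)) = (\<Sum>i<n. b $$ (i, i))"
    by (rule sum.reindex_bij_betw[OF permutes_imp_bij[OF w]])
  then show "bidiag n (diag_fun b \<circ> w) (krylov_det n v x) \<in> borel_lie n"
    using borel_mat(3)[OF b] by (intro bidiag_borel) simp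
  have xm: "x \<in> carrier_mat n n" using conj_carrier(1)[OF g borel_mat(1)[OF b]] x by simp
  have "flag_vec n x (diag_fun b \<circ> w) v n i = 0" if "i < n" for i
    using flag_frame_invariant(1)[OF g b x refl D that] flag_vec_permute[OF w, of x "diag_fun b" v] by simp
  from conj_unique(2)[OF 1 _ xm flag_frame_intertwines[OF xm this D]]
  show "x = flag_frame n x (diag_fun b \<circ> w) v * bidiag n (diag_fun b \<circ> w) (krylov_det n v x) *
      inv\<^bsub>SL n\<^esub> (flag_frame n x (diag_fun b \<circ> w) v)" by simp
qed

text \<open>Where v is cyclic, (g, b) may be replaced by the pair \<open>flag_frame\<close>,
  \<open>bidiag\<close>. Its entries are polynomial in the eigenvalues and x, apart from the
  division of the first column by the Krylov determinant.\<close>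

lemma flag_frame_polynomial:
  assumes f: "f \<in> pfun (GB n) (pair_entries n)"
  shows "\<exists>N. \<exists>Q\<in>pfun (UNIV \<times> carrier_mat n n) (prod_coords (vcoords n) (entries n)).
    \<forall>g b y. g \<in> carrier (SL n) \<longrightarrow> b \<in> borel_lie n \<longrightarrow> (\<forall>i<n. y i = b $$ (i, i)) \<longrightarrow>
      krylov_det n v (g * b * inv\<^bsub>SL n\<^esub> g) \<noteq> 0 \<longrightarrow>
      krylov_det n v (g * b * inv\<^bsub>SL n\<^esub> g) ^ N * f (g, b) = Q (y, g * b * inv\<^bsub>SL n\<^esub> g)"
proof -
  let ?W = "(UNIV :: (nat \<Rightarrow> complex) set) \<times> carrier_mat n n" and ?G = "prod_coords (vcoords n) (entries n)"
  obtain P where P: "P \<in> pfun UNIV (pair_entries n)" "\<And>z. z \<in> GB n \<Longrightarrow> f z = P z"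
    using pfun_extend[OF f] by blast
  define D where "D z = krylov_det n v (snd z)" for z :: "(nat \<Rightarrow> complex) \<times> complex mat"
  define \<phi> where "\<phi> z = (flag_frame n (snd z) (fst z) v, bidiag n (fst z) (D z))" for z
  have ent: "(\<lambda>z. snd z $$ (i, j)) \<in> pfun ?W ?G" if "i < n" "j < n" for i j
    using pfun_snd[OF pfun_entry[OF that]] .
  have vec: "(\<lambda>z. fst z i) \<in> pfun ?W ?G" if "i < n" for i
    using pfun_fst[OF pfun_vcoord[OF that]] .
  have D: "D \<in> pfun ?W ?G" unfolding D_def by (rule pfun_krylov_det[OF ent])
  have "\<exists>N. \<exists>Q\<in>pfun ?W ?G. \<forall>z\<in>?W. D z \<noteq> 0 \<longrightarrow> D z ^ N * P (\<phi> z) = Q z"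
  proof (rule pfun_denominators[OF P(1) D])
    fix e assume "e \<in> pair_entries n"
    then consider i j where "i < n" "j < n" "e = (\<lambda>z. fst z $$ (i, j))" | i j where "i < n" "j < n" "e = (\<lambda>z. snd z $$ (i, j))"
      by (auto simp: pair_entries_eq prod_coords_def entries_def)
    then show "\<exists>q\<in>pfun ?W ?G. \<forall>z\<in>?W. D z \<noteq> 0 \<longrightarrow> D z * e (\<phi> z) = q z"
    proof cases
      case 1
      show ?thesis
      proof (intro bexI[of _ "\<lambda>z. (if j = 0 then 1 else D z) * flag_vec n (snd z) (fst z) v (n - 1 - j) i"] ballI impI)
        have "(\<lambda>z. if j = 0 then 1 else D z) \<in> pfun ?W ?G" using D by (cases "j = 0") (auto intro: pfun_const)
        then show "(\<lambda>z. (if j = 0 then 1 else D z) * flag_vec n (snd z) (fst z) v (n - 1 - j) i) \<in> pfun ?W ?G"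
          using 1 by (intro pfun_mult pfun_flag_vec ent vec) auto
        fix z assume "z \<in> ?W" "D z \<noteq> 0"
        then show "D z * e (\<phi> z) = (if j = 0 then 1 else D z) * flag_vec n (snd z) (fst z) v (n - 1 - j) i"
          using 1 by (simp add: \<phi>_def flag_frame_def D_def)
      qed
    next
      case 2
      have "(\<lambda>z. D z * (if i = j then fst z j else if Suc i = j then (if i = 0 then D z else 1) else 0)) \<in> pfun ?W ?G"
        using D vec[OF 2(2)]
        by (intro pfun_mult D) (cases "i = j"; cases "Suc i = j"; cases "i = 0"; auto intro: pfun_const)
      then show ?thesis
        by (rule bexI[rotated]) (use 2 in \<open>auto simp: \<phi>_def bidiag_def\<close>)
    qed
  qed
  then obtain N Q where Q: "Q \<in> pfun ?W ?G" "\<And>z. z \<in> ?W \<Longrightarrow> D z \<noteq> 0 \<Longrightarrow> D z ^ N * P (\<phi> z) = Q z" by blast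
  have "krylov_det n v (g * b * inv\<^bsub>SL n\<^esub> g) ^ N * f (g, b) = Q (y, g * b * inv\<^bsub>SL n\<^esub> g)"
    if g: "g \<in> carrier (SL n)" and b: "b \<in> borel_lie n" and y: "\<forall>i<n. y i = b $$ (i, i)"
      and d: "krylov_det n v (g * b * inv\<^bsub>SL n\<^esub> g) \<noteq> 0" for g b y
  proof -
    let ?x = "g * b * inv\<^bsub>SL n\<^esub> g"
    have xm: "?x \<in> carrier_mat n n" using conj_carrier(1)[OF g borel_mat(1)[OF b]] .
    have "f (flag_frame n ?x y v, bidiag n y (krylov_det n v ?x)) = f (g, b)"
      by (rule flag_frame_invariant(2)[OF g b refl _ d]) (use y in auto)
    moreover have "f (flag_frame n ?x y v, bidiag n y (krylov_det n v ?x)) = P (\<phi> (y, ?x))"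
    proof -
      have "(\<Sum>i<n. y i) = 0" using borel_mat(3)[OF b] y by simp
      then show ?thesis using P(2) flag_frame_SL[OF n d] bidiag_borel by (simp add: \<phi>_def D_def)
    qed
    ultimately show ?thesis using Q(2)[of "(y, ?x)"] xm d by (simp add: D_def)
  qed
  then show ?thesis using Q(1) by blast
qed

text \<open>The numerator in the chart is expanded over the m_j; its symmetric coefficients, taken
  at the eigenvalues of x, become polynomials in x. The second equation expresses them by values of
  f, a form in which the coefficients of different charts can be compared.\<close>

lemma borel_invariant_local:
  assumes f: "f \<in> pfun (GB n) (pair_entries n)"
    and ms: "\<And>j. j < (K::nat) \<Longrightarrow> m j \<in> pfun UNIV (vcoords n)" "\<And>j. j < K \<Longrightarrow> s j \<in> pfun UNIV (vcoords n)"
    and kern: "\<And>x z. kern id n x z = (\<Sum>j<K. m j x * s j z)"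
  shows "\<exists>N q. (\<forall>j<K. q j \<in> pfun (sl_lie n) (entries n)) \<and>
    (\<forall>g b x. g \<in> carrier (SL n) \<longrightarrow> b \<in> borel_lie n \<longrightarrow> x = g * b * inv\<^bsub>SL n\<^esub> g \<longrightarrow> krylov_det n v x \<noteq> 0 \<longrightarrow>
      krylov_det n v x ^ N * f (g, b) = (\<Sum>j<K. m j (diag_fun b) * q j x) \<and>
      (\<forall>j<K. vdm id n (diag_fun b) * q j x = krylov_det n v x ^ N *
        (\<Sum>w\<in>{w. w permutes {..<n}}. of_int (sign w) * s j (diag_fun b \<circ> w) *
          f (flag_frame n x (diag_fun b \<circ> w) v, bidiag n (diag_fun b \<circ> w) (krylov_det n v x)))))"
proof -
  let ?M = "carrier_mat n n :: complex mat set" and ?W = "{w. w permutes {..<n}}"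
  obtain N Q where Q: "Q \<in> pfun (UNIV \<times> ?M) (prod_coords (vcoords n) (entries n))"
    "\<And>g b y. g \<in> carrier (SL n) \<Longrightarrow> b \<in> borel_lie n \<Longrightarrow> (\<forall>i<n. y i = b $$ (i, i)) \<Longrightarrow>
      krylov_det n v (g * b * inv\<^bsub>SL n\<^esub> g) \<noteq> 0 \<Longrightarrow>
      krylov_det n v (g * b * inv\<^bsub>SL n\<^esub> g) ^ N * f (g, b) = Q (y, g * b * inv\<^bsub>SL n\<^esub> g)"
    using flag_frame_polynomial[OF f, of v] by blast
  have lcM: "line_connected ?M (entries n)"
    by (rule line_connected_subspace) auto
  obtain \<Phi> where "(\<forall>j<K. \<Phi> j \<in> pfun (UNIV \<times> ?M) (prod_coords (vcoords n) (entries n)) \<and>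
      (\<forall>v z. \<forall>p\<in>?M. v permutes {..<n} \<longrightarrow> \<Phi> j (z \<circ> v, p) = \<Phi> j (z, p)) \<and>
      (\<forall>z. \<forall>p\<in>?M. vdm id n z * \<Phi> j (z, p) =
        (\<Sum>w\<in>?W. of_int (sign w) * s j (z \<circ> w) * Q (z \<circ> w, p)))) \<and>
    (\<forall>z. \<forall>p\<in>?M. Q (z, p) = (\<Sum>j<K. m j z * \<Phi> j (z, p)))"
    using symmetric_expansion[OF inj_on_id ms kern Q(1) lcM] by blast
  then have \<Phi>: "\<And>j. j < K \<Longrightarrow> \<Phi> j \<in> pfun (UNIV \<times> ?M) (prod_coords (vcoords n) (entries n))"
    "\<And>j v z p. j < K \<Longrightarrow> v permutes {..<n} \<Longrightarrow> p \<in> ?M \<Longrightarrow> \<Phi> j (z \<circ> v, p) = \<Phi> j (z, p)"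
    "\<And>j z p. j < K \<Longrightarrow> p \<in> ?M \<Longrightarrow> vdm id n z * \<Phi> j (z, p) =
        (\<Sum>w\<in>?W. of_int (sign w) * s j (z \<circ> w) * Q (z \<circ> w, p))"
    "\<And>z p. p \<in> ?M \<Longrightarrow> Q (z, p) = (\<Sum>j<K. m j z * \<Phi> j (z, p))" by blast+
  have "\<exists>R\<in>pfun (?M \<times> ?M) (prod_coords (entries n) (entries n)). \<forall>g b g' p.
    g \<in> carrier_mat n n \<longrightarrow> b \<in> carrier_mat n n \<longrightarrow> g' \<in> carrier_mat n n \<longrightarrow> g' * g = 1\<^sub>m n \<longrightarrow>
    g * g' = 1\<^sub>m n \<longrightarrow> upper_triangular b \<longrightarrow> p \<in> ?M \<longrightarrow> R (g * b * g', p) = \<Phi> j (\<lambda>i. b $$ (i, i), p)"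
    if "j < K" for j
    by (rule symmetric_spectral[OF \<Phi>(1)[OF that]]) (use \<Phi>(2)[OF that] in auto)
  then have "\<exists>R. j < K \<longrightarrow> R \<in> pfun (?M \<times> ?M) (prod_coords (entries n) (entries n)) \<and> (\<forall>g b g' p.
    g \<in> carrier_mat n n \<longrightarrow> b \<in> carrier_mat n n \<longrightarrow> g' \<in> carrier_mat n n \<longrightarrow> g' * g = 1\<^sub>m n \<longrightarrow>
    g * g' = 1\<^sub>m n \<longrightarrow> upper_triangular b \<longrightarrow> p \<in> ?M \<longrightarrow> R (g * b * g', p) = \<Phi> j (\<lambda>i. b $$ (i, i), p))" for j
    by blast
  then obtain R where R0: "\<And>j. j < K \<longrightarrow> R j \<in> pfun (?M \<times> ?M) (prod_coords (entries n) (entries n)) \<and> (\<forall>g b g' p.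
    g \<in> carrier_mat n n \<longrightarrow> b \<in> carrier_mat n n \<longrightarrow> g' \<in> carrier_mat n n \<longrightarrow> g' * g = 1\<^sub>m n \<longrightarrow>
    g * g' = 1\<^sub>m n \<longrightarrow> upper_triangular b \<longrightarrow> p \<in> ?M \<longrightarrow> R j (g * b * g', p) = \<Phi> j (\<lambda>i. b $$ (i, i), p))"
    using choice[of "\<lambda>j R. j < K \<longrightarrow> R \<in> pfun (?M \<times> ?M) (prod_coords (entries n) (entries n)) \<and> (\<forall>g b g' p.
    g \<in> carrier_mat n n \<longrightarrow> b \<in> carrier_mat n n \<longrightarrow> g' \<in> carrier_mat n n \<longrightarrow> g' * g = 1\<^sub>m n \<longrightarrow>
    g * g' = 1\<^sub>m n \<longrightarrow> upper_triangular b \<longrightarrow> p \<in> ?M \<longrightarrow> R (g * b * g', p) = \<Phi> j (\<lambda>i. b $$ (i, i), p))"] by blast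
  \<comment> \<open>The matrix occurs twice, as parameter of the chart and through its eigenvalues;
    here both are set to the same x.\<close>
  define q where "q j x = R j (x, x)" for j x
  have qp: "q j \<in> pfun (sl_lie n) (entries n)" if "j < K" for j
  proof -
    have "R j \<in> pfun (?M \<times> ?M) (prod_coords (entries n) (entries n))" using R0 that by blast
    then show ?thesis unfolding q_def
      by (rule pfun_comp_pair) (auto intro: pfun_coord simp: sl_lie_def)
  qed
  have main: "krylov_det n v x ^ N * f (g, b) = (\<Sum>j<K. m j (diag_fun b) * q j x) \<and>
      (\<forall>j<K. vdm id n (diag_fun b) * q j x = krylov_det n v x ^ N *
        (\<Sum>w\<in>{w. w permutes {..<n}}. of_int (sign w) * s j (diag_fun b \<circ> w) *
          f (flag_frame n x (diag_fun b \<circ> w) v, bidiag n (diag_fun b \<circ> w) (krylov_det n v x))))"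
    if g: "g \<in> carrier (SL n)" and b: "b \<in> borel_lie n" and x: "x = g * b * inv\<^bsub>SL n\<^esub> g"
      and d: "krylov_det n v x \<noteq> 0" for g b x
  proof -
    have xm: "x \<in> ?M" using conj_carrier(1)[OF g borel_mat(1)[OF b]] x by simp
    have q: "q j x = \<Phi> j (diag_fun b, x)" if "j < K" for j
      using R0[of j] that xm g inv_SL[OF g] borel_mat[OF b] unfolding q_def x SL_carrier by blast
    have 1: "krylov_det n v x ^ N * f (g, b) = (\<Sum>j<K. m j (diag_fun b) * q j x)"
      using Q(2)[OF g b, of "diag_fun b"] d \<Phi>(4)[OF xm, of "diag_fun b"] q x by simp
    have Qw: "Q (diag_fun b \<circ> w, x) = krylov_det n v x ^ N *
        f (flag_frame n x (diag_fun b \<circ> w) v, bidiag n (diag_fun b \<circ> w) (krylov_det n v x))"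
      if "w permutes {..<n}" for w
    proof -
      note P = flag_frame_permuted[OF g b x d that]
      have "\<forall>i<n. (diag_fun b \<circ> w) i = bidiag n (diag_fun b \<circ> w) (krylov_det n v x) $$ (i, i)"
        by (simp add: bidiag_def)
      from Q(2)[OF P(1,2) this, folded P(3), OF d] show ?thesis by (rule sym)
    qed
    have "vdm id n (diag_fun b) * q j x = krylov_det n v x ^ N *
        (\<Sum>w\<in>?W. of_int (sign w) * s j (diag_fun b \<circ> w) *
          f (flag_frame n x (diag_fun b \<circ> w) v, bidiag n (diag_fun b \<circ> w) (krylov_det n v x)))" if "j < K" for j
      unfolding q[OF that] \<Phi>(3)[OF that xm] sum_distrib_left by (intro sum.cong refl) (simp add: Qw mult_ac)
    with 1 show ?thesis by blast
  qed
  show ?thesis using qp main by blast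
qed

text \<open>Cyclic vectors give charts of \<open>x\<close> with complement a hypersurface. In each chart \<open>f\<close> is a polynomial
  in \<open>x\<close> and the eigenvalues divided by a power of \<open>krylov_det\<close>, and two charts suffice to clear
  denominators.\<close>

lemma borel_invariant_polynomial:
  assumes f: "f \<in> pfun (GB n) (pair_entries n)"
  shows "\<exists>C\<in>pfun UNIV (prod_coords (vcoords n) (entries n)). \<forall>g b. g \<in> carrier (SL n) \<longrightarrow> b \<in> borel_lie n \<longrightarrow>
    f (g, b) = C (diag_fun b, g * b * inv\<^bsub>SL n\<^esub> g)"
proof -
  let ?V = "sl_lie n" and ?E = "entries n" and ?W = "{w. w permutes {..<n}}"
  obtain K :: nat and m s where ms0: "\<forall>j<K. m j \<in> pfun UNIV (vcoords n) \<and> s j \<in> pfun UNIV (vcoords n)"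
    and kern: "\<And>x z. kern id n x z = (\<Sum>j<K. m j x * s j z)"
    using kern_expansion[of n id] by metis
  then have ms: "\<And>j. j < K \<Longrightarrow> m j \<in> pfun UNIV (vcoords n)" "\<And>j. j < K \<Longrightarrow> s j \<in> pfun UNIV (vcoords n)" by auto
  define chart where "chart v N q \<longleftrightarrow> (\<forall>j<K. q j \<in> pfun ?V ?E) \<and>
    (\<forall>g b x. g \<in> carrier (SL n) \<longrightarrow> b \<in> borel_lie n \<longrightarrow> x = g * b * inv\<^bsub>SL n\<^esub> g \<longrightarrow> krylov_det n v x \<noteq> 0 \<longrightarrow>
      krylov_det n v x ^ N * f (g, b) = (\<Sum>j<K. m j (diag_fun b) * q j x) \<and>
      (\<forall>j<K. vdm id n (diag_fun b) * q j x = krylov_det n v x ^ N *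
        (\<Sum>w\<in>?W. of_int (sign w) * s j (diag_fun b \<circ> w) *
          f (flag_frame n x (diag_fun b \<circ> w) v, bidiag n (diag_fun b \<circ> w) (krylov_det n v x)))))" for v N q
  have ch: "\<exists>N q. chart v N q" for v
    unfolding chart_def by (rule borel_invariant_local[OF f ms kern])
  have Dp: "krylov_det n v \<in> pfun ?V ?E" for v
    by (rule pfun_krylov_det[of n "\<lambda>x. x"]) (rule pfun_entry)
  \<comment> \<open>The square of the Vandermonde product is symmetric, hence on eigenvalues a
    polynomial \<open>disc\<close> in x: the discriminant. Where it is nonzero, \<open>vdm\<close>
    can be cancelled.\<close>
  have "(\<lambda>y. vdm id n y * vdm id n y) \<in> symf n"
    unfolding symf_def
    by (auto intro!: pfun_mult pfun_vdm simp: vdm_permute[OF inj_on_id] mult_ac simp flip: of_int_mult)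
  from psum_alg_spectral[OF symf_psum_alg[OF this]]
  obtain disc where disc: "disc \<in> pfun (carrier_mat n n) ?E"
    "\<And>g b g'. g \<in> carrier_mat n n \<Longrightarrow> b \<in> carrier_mat n n \<Longrightarrow> g' \<in> carrier_mat n n \<Longrightarrow> g' * g = 1\<^sub>m n \<Longrightarrow>
      g * g' = 1\<^sub>m n \<Longrightarrow> upper_triangular b \<Longrightarrow> disc (g * b * g') = vdm id n (diag_fun b) * vdm id n (diag_fun b)"
    by blast
  have discV: "disc \<in> pfun ?V ?E" by (rule pfun_mono[OF disc(1)]) (auto simp: sl_lie_def)
  have disc_nz: "\<exists>x\<in>?V. disc x \<noteq> 0"
  proof -
    \<comment> \<open>Subtracting the mean makes the trace zero and keeps the entries
      distinct.\<close>
    define a :: complex where "a = (\<Sum>i<n. of_nat i) / of_nat n"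
    define y :: "nat \<Rightarrow> complex" where "y i = of_nat i - a" for i
    let ?b = "mat_diag n y"
    have "(\<Sum>i<n. y i) = 0" using n by (simp add: y_def sum_subtractf a_def)
    then have "?b \<in> ?V" by (auto simp: sl_lie_def mat_diag_def)
    moreover have "disc (1\<^sub>m n * ?b * 1\<^sub>m n) = vdm id n (diag_fun ?b) * vdm id n (diag_fun ?b)"
      by (rule disc(2)) (auto simp: mat_diag_def)
    moreover have "1\<^sub>m n * ?b * 1\<^sub>m n = ?b" by (simp add: left_mult_one_mat[of _ n n] right_mult_one_mat[of _ n n])
    moreover have "vdm id n (diag_fun ?b) \<noteq> 0" by (rule vdm_nonzero) (auto simp: mat_diag_def y_def)
    ultimately show ?thesis by (intro bexI[of _ ?b]) auto
  qed
  have chart_frame: "f (flag_frame n x y v, bidiag n y (krylov_det n v x)) =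
      f (flag_frame n x y v', bidiag n y (krylov_det n v' x))"
    if "g \<in> carrier (SL n)" "b \<in> borel_lie n" "x = g * b * inv\<^bsub>SL n\<^esub> g" "krylov_det n v x \<noteq> 0"
      "krylov_det n v' x \<noteq> 0" "w permutes {..<n}" "y = diag_fun b \<circ> w" for g b x y v v' w
  proof -
    note P = flag_frame_permuted[OF that(1-3,5,6), folded that(7)]
    show ?thesis by (rule flag_frame_invariant(2)[OF P(1,2,3) _ that(4)]) (simp add: bidiag_def)
  qed
  \<comment> \<open>Up to a power of the respective Krylov determinant and the factor
    \<open>vdm\<close>, both coefficients equal the same sum T over the reorderings of the
    eigenvalues, since f agrees on the frames of v and v'. This holds on a dense set of x, hence
    everywhere.\<close>
  have compat: "q j x * krylov_det n v' x ^ N' = q' j x * krylov_det n v x ^ N"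
    if c: "chart v N q" "chart v' N' q'" and j: "j < K"
      and nz: "\<exists>x\<in>?V. krylov_det n v x \<noteq> 0" "\<exists>x\<in>?V. krylov_det n v' x \<noteq> 0" and x: "x \<in> ?V"
    for v v' N N' q q' j x
  proof -
    have qp: "q j \<in> pfun ?V ?E" "q' j \<in> pfun ?V ?E" using c j by (auto simp: chart_def)
    obtain x1 where x1: "x1 \<in> ?V" "krylov_det n v x1 \<noteq> 0" using nz(1) by blast
    obtain x2 where x2: "x2 \<in> ?V" "krylov_det n v' x2 \<noteq> 0" using nz(2) by blast
    obtain x3 where x3: "x3 \<in> ?V" "disc x3 \<noteq> 0" using disc_nz by blast
    obtain x4 where x4: "x4 \<in> ?V" "krylov_det n v x4 \<noteq> 0 \<and> krylov_det n v' x4 \<noteq> 0"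
      using pfun_nonzero_mult[OF line_connected_sl Dp Dp x1 x2] by blast
    obtain x5 where x5: "x5 \<in> ?V" "(krylov_det n v x5 * krylov_det n v' x5) * disc x5 \<noteq> 0"
      using pfun_nonzero_mult[OF line_connected_sl discV pfun_mult[OF Dp Dp] x4(1) _ x3, of v v'] x4 by auto
    have "q j x * krylov_det n v' x ^ N' - q' j x * krylov_det n v x ^ N = 0"
    proof (rule pfun_density[OF line_connected_sl _ pfun_mult[OF pfun_mult[OF Dp Dp] discV] x5 _ x,
          of "\<lambda>x. q j x * krylov_det n v' x ^ N' - q' j x * krylov_det n v x ^ N"])
      show "(\<lambda>x. q j x * krylov_det n v' x ^ N' - q' j x * krylov_det n v x ^ N) \<in> pfun ?V ?E"
        by (intro pfun_diff pfun_mult pfun_power qp Dp)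
      fix x assume x: "x \<in> ?V" and "krylov_det n v x * krylov_det n v' x * disc x \<noteq> 0"
      then have nz: "krylov_det n v x \<noteq> 0" "krylov_det n v' x \<noteq> 0" "disc x \<noteq> 0" by auto
      obtain g b where gb: "g \<in> carrier (SL n)" "b \<in> borel_lie n" "x = g * b * inv\<^bsub>SL n\<^esub> g"
        using triangularize[OF x n] by blast
      have "disc x = vdm id n (diag_fun b) * vdm id n (diag_fun b)"
        unfolding gb(3) by (rule disc(2)) (use gb inv_SL[OF gb(1)] borel_mat[OF gb(2)] in \<open>auto simp: SL_carrier\<close>)
      then have vnz: "vdm id n (diag_fun b) \<noteq> 0" using nz by auto
      have F: "f (flag_frame n x (diag_fun b \<circ> w) v, bidiag n (diag_fun b \<circ> w) (krylov_det n v x)) =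
          f (flag_frame n x (diag_fun b \<circ> w) v', bidiag n (diag_fun b \<circ> w) (krylov_det n v' x))"
        if "w \<in> ?W" for w
        using that by (intro chart_frame[OF gb nz(1,2)]) auto
      define T where "T = (\<Sum>w\<in>?W. of_int (sign w) * s j (diag_fun b \<circ> w) *
          f (flag_frame n x (diag_fun b \<circ> w) v', bidiag n (diag_fun b \<circ> w) (krylov_det n v' x)))"
      have T1: "vdm id n (diag_fun b) * q' j x = krylov_det n v' x ^ N' * T"
        using c(2) gb nz j unfolding chart_def T_def by blast
      have T2: "vdm id n (diag_fun b) * q j x = krylov_det n v x ^ N * T"
      proof -
        have "vdm id n (diag_fun b) * q j x = krylov_det n v x ^ N * (\<Sum>w\<in>?W. of_int (sign w) * s j (diag_fun b \<circ> w) *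
          f (flag_frame n x (diag_fun b \<circ> w) v, bidiag n (diag_fun b \<circ> w) (krylov_det n v x)))"
          using c(1) gb nz j unfolding chart_def by blast
        also have "(\<Sum>w\<in>?W. of_int (sign w) * s j (diag_fun b \<circ> w) *
          f (flag_frame n x (diag_fun b \<circ> w) v, bidiag n (diag_fun b \<circ> w) (krylov_det n v x))) = T"
          unfolding T_def by (intro sum.cong refl) (simp only: F)
        finally show ?thesis .
      qed
      have "vdm id n (diag_fun b) * (q j x * krylov_det n v' x ^ N' - q' j x * krylov_det n v x ^ N) =
        (vdm id n (diag_fun b) * q j x) * krylov_det n v' x ^ N' - (vdm id n (diag_fun b) * q' j x) * krylov_det n v x ^ N"
        by (simp add: algebra_simps)
      also have "\<dots> = 0" unfolding T1 T2 by simp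
      finally show "q j x * krylov_det n v' x ^ N' - q' j x * krylov_det n v x ^ N = 0" using vnz by simp
    qed
    then show ?thesis by simp
  qed
  define v1 where "v1 = unit_fun (n - 1)"
  define v0 where "v0 = unit_fun 0"
  obtain N1 q1 where c1: "chart v1 N1 q1" using ch by blast
  obtain N0 q0 where c0: "chart v0 N0 q0" using ch by blast
  have nz1: "\<exists>x\<in>?V. krylov_det n v1 x \<noteq> 0"
    using krylov_det_upshift[of n] shift_sl(1)[of n] unfolding v1_def by (intro bexI[of _ "upshift n"]) auto
  have nz0: "\<exists>x\<in>?V. krylov_det n v0 x \<noteq> 0"
  proof -
    have "krylov_det n v0 (downshift n) * det (reversal n) = 1"
      unfolding v0_def by (rule krylov_det_hessenberg) (auto simp: downshift_def)
    then show ?thesis using shift_sl(2)[of n] by (intro bexI[of _ "downshift n"]) auto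
  qed
  have "\<exists>c\<in>pfun ?V ?E. \<forall>x\<in>?V. q1 j x = krylov_det n v1 x ^ N1 * c x" if j: "j < K" for j
    unfolding v1_def
  proof (rule krylov_hartogs[OF n])
    show "q1 j \<in> pfun ?V ?E" "q0 j \<in> pfun ?V ?E" using c1 c0 j by (auto simp: chart_def)
    show "q1 j x * krylov_det n (unit_fun 0) x ^ N0 = q0 j x * krylov_det n (unit_fun (n - 1)) x ^ N1" if "x \<in> ?V" for x
      using compat[OF c1 c0 j nz1 nz0 that] by (simp add: v0_def v1_def)
  qed
  then obtain c where c: "\<And>j. j < K \<Longrightarrow> c j \<in> pfun ?V ?E"
    "\<And>j x. j < K \<Longrightarrow> x \<in> ?V \<Longrightarrow> q1 j x = krylov_det n v1 x ^ N1 * c j x" by metis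
  \<comment> \<open>The quotient c_j, found from two charts, serves every chart of some cyclic v:
    compare with the chart of v1.\<close>
  have cq: "q j x = krylov_det n v x ^ N * c j x"
    if ch: "chart v N q" and j: "j < K" and nz: "\<exists>x\<in>?V. krylov_det n v x \<noteq> 0" and x: "x \<in> ?V" for v N q j x
  proof -
    obtain x1 where x1: "x1 \<in> ?V" "krylov_det n v1 x1 \<noteq> 0" using nz1 by blast
    have "q j x - krylov_det n v x ^ N * c j x = 0"
    proof (rule pfun_density[OF line_connected_sl _ Dp x1 _ x, of "\<lambda>x. q j x - krylov_det n v x ^ N * c j x"])
      show "(\<lambda>x. q j x - krylov_det n v x ^ N * c j x) \<in> pfun ?V ?E"
        using ch j by (intro pfun_diff pfun_mult pfun_power Dp c) (auto simp: chart_def)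
      fix x assume x: "x \<in> ?V" "krylov_det n v1 x \<noteq> 0"
      have "q j x * krylov_det n v1 x ^ N1 = krylov_det n v1 x ^ N1 * c j x * krylov_det n v x ^ N"
        using compat[OF ch c1 j nz nz1 x(1)] c(2)[OF j x(1)] by simp
      then show "q j x - krylov_det n v x ^ N * c j x = 0" using x(2) by (simp add: mult_ac)
    qed
    then show ?thesis by simp
  qed
  have main: "f (g, b) = (\<Sum>j<K. m j (diag_fun b) * c j (g * b * inv\<^bsub>SL n\<^esub> g))"
    if g: "g \<in> carrier (SL n)" and b: "b \<in> borel_lie n" for g b
  proof -
    have gm: "g \<in> carrier_mat n n" using g by (simp add: SL_carrier)
    \<comment> \<open>For fixed g this vector is adapted to b: its Krylov determinant at g b
      g\<inverse> is that of the last unit vector at b, which is nonzero at b =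
      \<open>upshift\<close>. So the chart of v covers a dense set of b.\<close>
    define v where "v = mv n g (unit_fun (n - 1))"
    obtain N q where cv: "chart v N q" using ch by blast
    have kd: "krylov_det n v (g * b * inv\<^bsub>SL n\<^esub> g) = krylov_det n (unit_fun (n - 1)) b" if "b \<in> borel_lie n" for b
      using krylov_det_conjugate[OF gm borel_mat(1)[OF that] conj_carrier(1,2)[OF g borel_mat(1)[OF that]], of v "unit_fun (n - 1)"] g
      by (simp add: v_def SL_carrier)
    have nzv: "\<exists>x\<in>?V. krylov_det n v x \<noteq> 0"
    proof (rule bexI)
      show "krylov_det n v (g * upshift n * inv\<^bsub>SL n\<^esub> g) \<noteq> 0"
        using kd[OF shift_sl(3)] krylov_det_upshift[of n] by simp
      show "g * upshift n * inv\<^bsub>SL n\<^esub> g \<in> ?V" by (rule conj_sl[OF g shift_sl(1)])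
    qed
    have ent: "(\<lambda>b. (g * b * inv\<^bsub>SL n\<^esub> g) $$ (i, j)) \<in> pfun (borel_lie n) ?E" if "i < n" "j < n" for i j
    proof (rule pfun_mat_mult[of _ _ n n _ n])
      fix i l assume il: "i < n" "l < n"
      show "(\<lambda>b. (g * b) $$ (i, l)) \<in> pfun (borel_lie n) ?E"
        by (rule pfun_mat_mult[of _ _ n n _ n]) (use gm il in \<open>auto intro: pfun_const pfun_entry dest: borel_mat\<close>)
    qed (use gm inv_SL[OF g] that in \<open>auto intro: pfun_const dest: borel_mat\<close>)
    have "f (g, b) - (\<Sum>j<K. m j (diag_fun b) * c j (g * b * inv\<^bsub>SL n\<^esub> g)) = 0"
    proof (rule pfun_density[OF line_connected_borel _ _ shift_sl(3) _ _ b,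
          of "\<lambda>b. f (g, b) - (\<Sum>j<K. m j (diag_fun b) * c j (g * b * inv\<^bsub>SL n\<^esub> g))" "krylov_det n (unit_fun (n - 1))"])
      show "krylov_det n (unit_fun (n - 1)) \<in> pfun (borel_lie n) ?E"
        by (rule pfun_krylov_det[of n "\<lambda>x. x"]) (rule pfun_entry)
      show "krylov_det n (unit_fun (n - 1)) (upshift n) \<noteq> 0" by (simp add: krylov_det_upshift[unfolded One_nat_def])
      have 1: "(\<lambda>b. f (g, b)) \<in> pfun (borel_lie n) ?E"
        by (rule pfun_comp_pair[OF f[unfolded pair_entries_eq]]) (use g in \<open>auto intro: pfun_const pfun_coord\<close>)
      have 2: "(\<lambda>b. m j (diag_fun b)) \<in> pfun (borel_lie n) ?E" if "j < K" for j
        by (rule pfun_comp[OF ms(1)[OF that]]) (auto simp: vcoords_def intro: pfun_entry)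
      have 3: "(\<lambda>b. c j (g * b * inv\<^bsub>SL n\<^esub> g)) \<in> pfun (borel_lie n) ?E" if "j < K" for j
        by (rule pfun_comp[OF c(1)[OF that]]) (use ent conj_sl[OF g] borel_mat in \<open>auto simp: entries_def\<close>)
      show "(\<lambda>b. f (g, b) - (\<Sum>j<K. m j (diag_fun b) * c j (g * b * inv\<^bsub>SL n\<^esub> g))) \<in> pfun (borel_lie n) ?E"
        by (intro pfun_diff pfun_sum pfun_mult 1 2 3) auto
      fix b assume b: "b \<in> borel_lie n" "krylov_det n (unit_fun (n - 1)) b \<noteq> 0"
      let ?x = "g * b * inv\<^bsub>SL n\<^esub> g"
      have nz: "krylov_det n v ?x \<noteq> 0" using kd b by simp
      have xV: "?x \<in> ?V" by (rule conj_sl[OF g borel_mat(4)[OF b(1)]])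
      have "krylov_det n v ?x ^ N * f (g, b) = (\<Sum>j<K. m j (diag_fun b) * q j ?x)"
        using cv g b(1) nz unfolding chart_def by blast
      also have "\<dots> = krylov_det n v ?x ^ N * (\<Sum>j<K. m j (diag_fun b) * c j ?x)"
        using cq[OF cv _ nzv xV] by (simp add: sum_distrib_left mult_ac)
      finally show "f (g, b) - (\<Sum>j<K. m j (diag_fun b) * c j ?x) = 0" using nz by simp
    qed
    then show ?thesis by simp
  qed
  have "\<exists>c'. \<forall>j<K. c' j \<in> pfun UNIV ?E \<and> (\<forall>x\<in>?V. c j x = c' j x)"
    using pfun_extend[OF c(1)] by metis
  then obtain c' where c': "\<And>j. j < K \<Longrightarrow> c' j \<in> pfun UNIV ?E" "\<And>j x. j < K \<Longrightarrow> x \<in> ?V \<Longrightarrow> c j x = c' j x" by blast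
  show ?thesis
  proof (intro bexI[of _ "\<lambda>z. \<Sum>j<K. m j (fst z) * c' j (snd z)"] allI impI)
    have "(\<lambda>z. \<Sum>j<K. m j (fst z) * c' j (snd z)) \<in> pfun (UNIV \<times> UNIV) (prod_coords (vcoords n) ?E)"
      by (intro pfun_sum pfun_mult pfun_fst pfun_snd ms c') auto
    then show "(\<lambda>z. \<Sum>j<K. m j (fst z) * c' j (snd z)) \<in> pfun UNIV (prod_coords (vcoords n) ?E)" by simp
    fix g b assume gb: "g \<in> carrier (SL n)" "b \<in> borel_lie n"
    then show "f (g, b) = (\<Sum>j<K. m j (fst (diag_fun b, g * b * inv\<^bsub>SL n\<^esub> g)) * c' j (snd (diag_fun b, g * b * inv\<^bsub>SL n\<^esub> g)))"
      using main[OF gb] c'(2)[OF _ conj_sl[OF gb(1) borel_mat(4)[OF gb(2)]]] by simp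
  qed
qed

end

section \<open>Rings of functions\<close>

definition fring :: "'a set \<Rightarrow> ('a \<Rightarrow> complex) set \<Rightarrow> ('a \<Rightarrow> complex) ring" where
  "fring V C = (fun_ring V)\<lparr>carrier := C\<rparr>"

definition subfunctions :: "'a set \<Rightarrow> ('a \<Rightarrow> complex) set \<Rightarrow> bool" where
  "subfunctions V C \<longleftrightarrow> C \<subseteq> extensional V \<and> (\<forall>c. (\<lambda>z\<in>V. c) \<in> C) \<and>
    (\<forall>f\<in>C. \<forall>g\<in>C. (\<lambda>z\<in>V. f z + g z) \<in> C) \<and> (\<forall>f\<in>C. \<forall>g\<in>C. (\<lambda>z\<in>V. f z * g z) \<in> C)"

lemma fring_simps:
  "carrier (fring V C) = C" "mult (fring V C) = (\<lambda>f g. \<lambda>z\<in>V. f z * g z)" "one (fring V C) = (\<lambda>z\<in>V. 1)"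
  "zero (fring V C) = (\<lambda>z\<in>V. 0)" "add (fring V C) = (\<lambda>f g. \<lambda>z\<in>V. f z + g z)"
  by (auto simp: fring_def fun_ring_def)

lemma subfunctionsD:
  assumes "subfunctions V C"
  shows "f \<in> C \<Longrightarrow> f \<in> extensional V" "(\<lambda>z\<in>V. c) \<in> C"
    "f \<in> C \<Longrightarrow> g \<in> C \<Longrightarrow> (\<lambda>z\<in>V. f z + g z) \<in> C" "f \<in> C \<Longrightarrow> g \<in> C \<Longrightarrow> (\<lambda>z\<in>V. f z * g z) \<in> C"
    "f \<in> C \<Longrightarrow> (\<lambda>z\<in>V. c * f z) \<in> C" "f \<in> C \<Longrightarrow> (\<lambda>z\<in>V. - f z) \<in> C"
    "f \<in> C \<Longrightarrow> g \<in> C \<Longrightarrow> (\<lambda>z\<in>V. f z - g z) \<in> C"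
proof -
  show 1: "(\<lambda>z\<in>V. c) \<in> C" for c using assms by (auto simp: subfunctions_def)
  show "f \<in> C \<Longrightarrow> f \<in> extensional V" using assms by (auto simp: subfunctions_def)
  show 2: "f \<in> C \<Longrightarrow> g \<in> C \<Longrightarrow> (\<lambda>z\<in>V. f z + g z) \<in> C" for f g using assms by (auto simp: subfunctions_def)
  show 3: "f \<in> C \<Longrightarrow> g \<in> C \<Longrightarrow> (\<lambda>z\<in>V. f z * g z) \<in> C" for f g using assms by (auto simp: subfunctions_def)
  show 4: "f \<in> C \<Longrightarrow> (\<lambda>z\<in>V. c * f z) \<in> C" for f c
    using 3[OF 1[of c], of f] by (simp add: restrict_def cong: if_cong)
  show 5: "f \<in> C \<Longrightarrow> (\<lambda>z\<in>V. - f z) \<in> C" for f using 4[of f "-1"] by simp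
  show "f \<in> C \<Longrightarrow> g \<in> C \<Longrightarrow> (\<lambda>z\<in>V. f z - g z) \<in> C"
    using 2[OF _ 5, of f g] by (simp add: restrict_def cong: if_cong)
qed

lemma extensional_eqI: "f \<in> extensional V \<Longrightarrow> g \<in> extensional V \<Longrightarrow> (\<And>z. z \<in> V \<Longrightarrow> f z = g z) \<Longrightarrow> f = g"
  by (rule extensionalityI)

lemma cring_fring:
  assumes C: "subfunctions V C"
  shows "cring (fring V C)"
proof (rule cringI)
  note D = subfunctionsD[OF C]
  show "abelian_group (fring V C)"
  proof (rule abelian_groupI)
    fix f assume f: "f \<in> carrier (fring V C)"
    then show "\<exists>g\<in>carrier (fring V C). g \<oplus>\<^bsub>fring V C\<^esub> f = \<zero>\<^bsub>fring V C\<^esub>"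
      using D(6)[of f] by (intro bexI[of _ "\<lambda>z\<in>V. - f z"]) (auto simp: fring_simps fun_eq_iff)
    show "\<zero>\<^bsub>fring V C\<^esub> \<oplus>\<^bsub>fring V C\<^esub> f = f"
      using f D(1)[of f] by (intro extensional_eqI[of _ V]) (auto simp: fring_simps)
  qed (use D in \<open>auto simp: fring_simps fun_eq_iff algebra_simps\<close>)
  show "comm_monoid (fring V C)"
  proof (rule comm_monoidI)
    fix f assume f: "f \<in> carrier (fring V C)"
    show "\<one>\<^bsub>fring V C\<^esub> \<otimes>\<^bsub>fring V C\<^esub> f = f"
      using f D(1)[of f] by (intro extensional_eqI[of _ V]) (auto simp: fring_simps)
  qed (use D in \<open>auto simp: fring_simps fun_eq_iff algebra_simps\<close>)
qed (auto simp: fring_simps fun_eq_iff algebra_simps)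

lemma fring_minus:
  assumes C: "subfunctions V C" and "f \<in> C" "g \<in> C"
  shows "\<ominus>\<^bsub>fring V C\<^esub> f = (\<lambda>z\<in>V. - f z)" "f \<ominus>\<^bsub>fring V C\<^esub> g = (\<lambda>z\<in>V. f z - g z)"
proof -
  interpret cring "fring V C" by (rule cring_fring[OF C])
  note D = subfunctionsD[OF C]
  have "\<ominus>\<^bsub>fring V C\<^esub> f = (\<lambda>z\<in>V. - f z)" if "f \<in> C" for f
    by (rule minus_equality) (use D(6) that in \<open>auto simp: fring_simps fun_eq_iff\<close>)
  then show "\<ominus>\<^bsub>fring V C\<^esub> f = (\<lambda>z\<in>V. - f z)" "f \<ominus>\<^bsub>fring V C\<^esub> g = (\<lambda>z\<in>V. f z - g z)"
    using assms by (auto simp: a_minus_def fring_simps fun_eq_iff)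
qed

text \<open>Extensionality selects one representative of each restriction to \<open>V\<close>, so
  that equality in the ring is equality of functions.\<close>

definition pfun_on :: "'a set \<Rightarrow> ('a \<Rightarrow> complex) set \<Rightarrow> ('a \<Rightarrow> complex) set" where
  "pfun_on V E = pfun V E \<inter> extensional V"

lemma restrict_pfun_on: "f \<in> pfun V E \<Longrightarrow> restrict f V \<in> pfun_on V E"
  unfolding pfun_on_def by (auto intro: pfun.cong)

lemma pfun_onD: "f \<in> pfun_on V E \<Longrightarrow> f \<in> pfun V E" "f \<in> pfun_on V E \<Longrightarrow> f \<in> extensional V"
  by (auto simp: pfun_on_def)

lemma subfunctions_pfun_on: "subfunctions V (pfun_on V E)"
  unfolding subfunctions_def using restrict_pfun_on[of _ V E]
  by (auto simp: pfun_on_def intro!: pfun_const pfun_add pfun_mult restrict_pfun_on)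

text \<open>Exchanges the generated subring for the inductive description by \<open>pfun\<close>, on
  which the inductions of the proof run.\<close>

lemma coord_ring_eq: "coord_ring V E = fring V (pfun_on V E)"
proof -
  have fr: "fun_ring V = fring V (extensional V)" by (auto simp: fring_def fun_ring_def PiE_def)
  have sub: "subfunctions V (extensional V)" by (auto simp: subfunctions_def)
  interpret cring "fring V (extensional V)" by (rule cring_fring[OF sub])
  let ?H = "{\<lambda>z\<in>V. c | c. True} \<union> {\<lambda>z\<in>V. e z | e. e \<in> E}"
  have H: "?H \<subseteq> carrier (fring V (extensional V))" by (auto simp: fring_simps)
  have "generate_ring (fring V (extensional V)) ?H = pfun_on V E"
  proof
    have "subring (pfun_on V E) (fring V (extensional V))"
    proof (rule subringI)
      note D = subfunctionsD[OF subfunctions_pfun_on[of V E]]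
      show "pfun_on V E \<subseteq> carrier (fring V (extensional V))" by (auto simp: fring_simps pfun_on_def)
      fix f assume "f \<in> pfun_on V E"
      then show "\<ominus>\<^bsub>fring V (extensional V)\<^esub> f \<in> pfun_on V E"
        using fring_minus(1)[OF sub, of f f] D(6) by (auto simp: pfun_on_def)
    qed (use subfunctionsD[OF subfunctions_pfun_on[of V E]] in \<open>auto simp: fring_simps\<close>)
    then show "generate_ring (fring V (extensional V)) ?H \<subseteq> pfun_on V E"
      by (rule generate_ring_min_subring1[OF H]) (auto intro: restrict_pfun_on pfun_const pfun_coord)
  next
    have "restrict f V \<in> generate_ring (fring V (extensional V)) ?H" if "f \<in> pfun V E" for f
      using that
    proof induction
      case (const c) show ?case by (rule generate_ring.incl) auto
    next
      case (coord e) then show ?case by (intro generate_ring.incl) auto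
    next
      case (add f g)
      from generate_ring.eng_add[OF add.IH] show ?case by (simp add: fring_simps restrict_def cong: if_cong)
    next
      case (mult f g)
      from generate_ring.eng_mult[OF mult.IH] show ?case by (simp add: fring_simps restrict_def cong: if_cong)
    next
      case (cong f g)
      then have "restrict g V = restrict f V" by auto
      then show ?case using cong by simp
    qed
    note gen = this
    show "pfun_on V E \<subseteq> generate_ring (fring V (extensional V)) ?H"
    proof
      fix f assume f: "f \<in> pfun_on V E"
      from gen[OF pfun_onD(1)[OF f]] show "f \<in> generate_ring (fring V (extensional V)) ?H"
        by (simp only: extensional_restrict[OF pfun_onD(2)[OF f]])
    qed
  qed
  then show ?thesis unfolding coord_ring_def fr by (simp add: fring_def)
qed

section \<open>The ring of regular functions and its fixed ideal\<close>

definition regf :: "nat \<Rightarrow> (complex mat \<times> complex mat \<Rightarrow> complex) set" where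
  "regf n = {f \<in> pfun_on (GB n) (pair_entries n).
    \<forall>u\<in>unipotent n. \<forall>g\<in>carrier (SL n). \<forall>b\<in>borel_lie n. f (g * u, inv\<^bsub>SL n\<^esub> u * b * u) = f (g, b)}"

lemma cotangent_ring_eq: "cotangent_ring n = fring (GB n) (regf n)"
  by (auto simp: cotangent_ring_def coord_ring_eq fring_def regf_def)

section \<open>Actions of triangular matrices and of the torus\<close>

lemma upper_triangular_inverse:
  fixes p q :: "complex mat"
  assumes "p \<in> carrier_mat n n" "q \<in> carrier_mat n n" "q * p = 1\<^sub>m n" "upper_triangular p"
    and nz: "\<And>i. i < n \<Longrightarrow> p $$ (i, i) \<noteq> 0"
  shows "upper_triangular q" "\<And>i. i < n \<Longrightarrow> q $$ (i, i) = 1 / p $$ (i, i)"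
proof -
  have p0: "p $$ (i, j) = 0" if "j < i" "i < n" for i j using assms that by auto
  have sm: "(\<Sum>l<n. q $$ (i, l) * p $$ (l, j)) = (if i = j then 1 else 0)" if "i < n" "j < n" for i j
    using index_mult_mat_sum[OF assms(2,1) that] assms(3) that by simp
  have q0: "j < i \<longrightarrow> q $$ (i, j) = 0" if "i < n" "j < n" for i j
    using that(2)
  proof (induction j rule: less_induct)
    case (less j)
    show ?case
    proof
      assume ji: "j < i"
      have "(\<Sum>l<n. q $$ (i, l) * p $$ (l, j)) = (\<Sum>l\<in>{j}. q $$ (i, l) * p $$ (l, j))"
      proof (rule sum.mono_neutral_right)
        show "\<forall>l\<in>{..<n} - {j}. q $$ (i, l) * p $$ (l, j) = 0"
        proof
          fix l assume "l \<in> {..<n} - {j}"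
          then show "q $$ (i, l) * p $$ (l, j) = 0"
            using less.IH[of l] p0[of j l] ji by (cases "l < j") auto
        qed
      qed (use less in auto)
      then show "q $$ (i, j) = 0" using sm[OF that(1), of j] less nz ji by simp
    qed
  qed
  then show "upper_triangular q" using assms(2) by (intro upper_triangularI) auto
  fix i assume i: "i < n"
  have "(\<Sum>l<n. q $$ (i, l) * p $$ (l, i)) = (\<Sum>l\<in>{i}. q $$ (i, l) * p $$ (l, i))"
  proof (rule sum.mono_neutral_right)
    show "\<forall>l\<in>{..<n} - {i}. q $$ (i, l) * p $$ (l, i) = 0"
    proof
      fix l assume "l \<in> {..<n} - {i}"
      then show "q $$ (i, l) * p $$ (l, i) = 0"
        using q0[OF i, of l] p0[of i l] by (cases "l < i") auto
    qed
  qed (use i in auto)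
  then show "q $$ (i, i) = 1 / p $$ (i, i)" using sm[OF i i] nz[OF i] by (simp add: field_simps)
qed

lemma det_upper_triangular_prod:
  fixes p :: "complex mat"
  assumes "p \<in> carrier_mat n n" "upper_triangular p"
  shows "det p = (\<Prod>i<n. p $$ (i, i))"
proof -
  have "det p = prod_list (diag_mat p)" by (rule det_upper_triangular[OF assms(2,1)])
  also have "diag_mat p = map (\<lambda>i. p $$ (i, i)) [0..<n]" using assms by (auto simp: diag_mat_def)
  finally show ?thesis
    using prod.distinct_set_conv_list[of "[0..<n]" "\<lambda>i. p $$ (i, i)"] by (simp add: atLeast0LessThan)
qed

lemma SL_upper_triangular:
  assumes p: "p \<in> carrier (SL n)" "upper_triangular p"
  shows "(\<Prod>i<n. p $$ (i, i)) = 1" "\<And>i. i < n \<Longrightarrow> p $$ (i, i) \<noteq> 0"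
    "upper_triangular (inv\<^bsub>SL n\<^esub> p)" "\<And>i. i < n \<Longrightarrow> (inv\<^bsub>SL n\<^esub> p) $$ (i, i) = 1 / p $$ (i, i)"
proof -
  have pm: "p \<in> carrier_mat n n" using p by (simp add: SL_carrier)
  show 1: "(\<Prod>i<n. p $$ (i, i)) = 1" using det_upper_triangular_prod[OF pm p(2)] p by (simp add: SL_carrier)
  show nz: "p $$ (i, i) \<noteq> 0" if "i < n" for i
  proof
    assume "p $$ (i, i) = 0"
    then have "(\<Prod>i<n. p $$ (i, i)) = 0" using that by (intro prod_zero) auto
    then show False using 1 by simp
  qed
  from upper_triangular_inverse[OF pm inv_SL(2)[OF p(1)] inv_SL(3)[OF p(1)] p(2) nz]
  show "upper_triangular (inv\<^bsub>SL n\<^esub> p)" "\<And>i. i < n \<Longrightarrow> (inv\<^bsub>SL n\<^esub> p) $$ (i, i) = 1 / p $$ (i, i)" by auto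
qed

lemma borel_action:
  assumes p: "p \<in> carrier (SL n)" "upper_triangular p" and b: "b \<in> borel_lie n"
  shows "inv\<^bsub>SL n\<^esub> p * b * p \<in> borel_lie n" "\<And>i. i < n \<Longrightarrow> (inv\<^bsub>SL n\<^esub> p * b * p) $$ (i, i) = b $$ (i, i)"
proof -
  have pm: "p \<in> carrier_mat n n" "inv\<^bsub>SL n\<^esub> p \<in> carrier_mat n n" using p inv_SL[OF p(1)] by (auto simp: SL_carrier)
  note bm = borel_mat[OF b] and q = SL_upper_triangular[OF p]
  have 1: "upper_triangular (inv\<^bsub>SL n\<^esub> p * b)" by (rule upper_triangular_mult(1)[OF pm(2) bm(1) q(3) bm(2)])
  have c1: "inv\<^bsub>SL n\<^esub> p * b \<in> carrier_mat n n" using pm bm by simp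
  have 2: "upper_triangular (inv\<^bsub>SL n\<^esub> p * b * p)" by (rule upper_triangular_mult(1)[OF c1 pm(1) 1 p(2)])
  show 3: "(inv\<^bsub>SL n\<^esub> p * b * p) $$ (i, i) = b $$ (i, i)" if "i < n" for i
    using upper_triangular_mult(2)[OF c1 pm(1) 1 p(2) that] upper_triangular_mult(2)[OF pm(2) bm(1) q(3) bm(2) that]
      q(2,4)[OF that] by simp
  show "inv\<^bsub>SL n\<^esub> p * b * p \<in> borel_lie n"
    using 2 3 bm(3) c1 pm(1) by (auto simp: borel_lie_def sl_lie_def)
qed

lemma unipotentD: "u \<in> unipotent n \<Longrightarrow> u \<in> carrier (SL n)" "u \<in> unipotent n \<Longrightarrow> upper_triangular u"
  "u \<in> unipotent n \<Longrightarrow> i < n \<Longrightarrow> u $$ (i, i) = 1"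
  by (auto simp: unipotent_def)

lemma subfunctions_cot: "subfunctions (GB n) (regf n)"
proof -
  note D = subfunctionsD[OF subfunctions_pfun_on[of "GB n" "pair_entries n"]]
  have mem: "(g * u, inv\<^bsub>SL n\<^esub> u * b * u) \<in> GB n" if "u \<in> unipotent n" "g \<in> carrier (SL n)" "b \<in> borel_lie n" for g b u
    using that unipotentD[OF that(1)] by (auto intro!: SL_mult borel_action)
  show ?thesis unfolding subfunctions_def regf_def using D mem by (auto simp: regf_def)
qed

interpretation cotR: cring "cotangent_ring n" for n
  unfolding cotangent_ring_eq by (rule cring_fring[OF subfunctions_cot])

lemma cot_simps:
  "carrier (cotangent_ring n) = regf n"
  "mult (cotangent_ring n) = (\<lambda>f g. \<lambda>z\<in>GB n. f z * g z)"
  "one (cotangent_ring n) = (\<lambda>z\<in>GB n. 1)"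
  "zero (cotangent_ring n) = (\<lambda>z\<in>GB n. 0)"
  "add (cotangent_ring n) = (\<lambda>f g. \<lambda>z\<in>GB n. f z + g z)"
  by (simp_all add: cotangent_ring_eq fring_simps)

lemmas cotD = subfunctionsD[OF subfunctions_cot]

lemma cot_minus: "f \<in> regf n \<Longrightarrow> g \<in> regf n \<Longrightarrow> f \<ominus>\<^bsub>cotangent_ring n\<^esub> g = (\<lambda>z\<in>GB n. f z - g z)"
  unfolding cotangent_ring_eq by (rule fring_minus(2)[OF subfunctions_cot])

lemma torusD:
  assumes "t \<in> torus n"
  shows "t \<in> carrier (SL n)" "t \<in> carrier_mat n n" "upper_triangular t" "inv\<^bsub>SL n\<^esub> t \<in> torus n"
    "t = mat_diag n (diag_fun t)" "inv\<^bsub>SL n\<^esub> t = mat_diag n (\<lambda>i. 1 / t $$ (i, i))"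
proof -
  show t: "t \<in> carrier (SL n)" "t \<in> carrier_mat n n" using assms by (auto simp: torus_def SL_carrier)
  show ut: "upper_triangular t" using assms t by (auto simp: torus_def diagonal_mat_def)
  show eq: "t = mat_diag n (diag_fun t)"
    using assms t by (intro eq_matI) (auto simp: torus_def diagonal_mat_def mat_diag_def)
  note q = SL_upper_triangular[OF t(1) ut]
  have "mat_diag n (\<lambda>i. 1 / t $$ (i, i)) * t = mat_diag n (\<lambda>i. 1 / t $$ (i, i)) * mat_diag n (diag_fun t)"
    using eq by simp
  also have "\<dots> = mat_diag n (\<lambda>i. 1)" using q(2) unfolding mat_diag_diag by (intro eq_matI) (auto simp: mat_diag_def)
  finally have inv: "mat_diag n (\<lambda>i. 1 / t $$ (i, i)) * t = 1\<^sub>m n" by simp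
  have "det (mat_diag n (\<lambda>i. 1 / t $$ (i, i))) = 1"
    unfolding det_diag_nonzero using q(1) by (simp add: prod_dividef)
  then have "mat_diag n (\<lambda>i. 1 / t $$ (i, i)) \<in> carrier (SL n)" by (simp add: SL_carrier)
  then show e: "inv\<^bsub>SL n\<^esub> t = mat_diag n (\<lambda>i. 1 / t $$ (i, i))" using inv_SL_eq[OF t(1) _ inv] by simp
  show "inv\<^bsub>SL n\<^esub> t \<in> torus n"
    using inv_SL(1)[OF t(1)] unfolding e by (auto simp: torus_def diagonal_mat_def mat_diag_def)
qed

lemma torusI: "(\<Prod>i<n. \<tau> i) = 1 \<Longrightarrow> mat_diag n \<tau> \<in> torus n"
  unfolding torus_def SL_carrier by (simp add: det_diag_nonzero) (auto simp: diagonal_mat_def mat_diag_def)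

lemma torus_one: "1\<^sub>m n \<in> torus n"
  using torusI[of "\<lambda>_. 1" n] by simp

lemma torus_mult: "t \<in> torus n \<Longrightarrow> s \<in> torus n \<Longrightarrow> t * s \<in> torus n"
proof -
  assume ts: "t \<in> torus n" "s \<in> torus n"
  have "t * s = mat_diag n (\<lambda>i. t $$ (i, i) * s $$ (i, i))"
    using torusD(5)[OF ts(1)] torusD(5)[OF ts(2)] by (metis mat_diag_diag)
  then show ?thesis using SL_mult[OF torusD(1)[OF ts(1)] torusD(1)[OF ts(2)]]
    by (auto simp: torus_def diagonal_mat_def mat_diag_def)
qed

lemma torus_point_GB:
  assumes "t \<in> torus n" "s \<in> torus n" "z \<in> GB n"
  shows "torus_point n (t, s) z \<in> GB n"
  using assms(3) torusD(1)[OF assms(1)] torusD(1,3)[OF assms(2)]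
  by (auto simp: torus_point_def intro!: SL_mult borel_action(1))

lemma torus_point_pfun:
  assumes ts: "t \<in> torus n" "s \<in> torus n" and f: "f \<in> pfun (GB n) (pair_entries n)"
  shows "(\<lambda>z. f (torus_point n (t, s) z)) \<in> pfun (GB n) (pair_entries n)"
proof -
  have m: "t \<in> carrier_mat n n" "s \<in> carrier_mat n n" "inv\<^bsub>SL n\<^esub> s \<in> carrier_mat n n"
    using ts torusD inv_SL(2) by auto
  have c: "fst z \<in> carrier_mat n n" "snd z \<in> carrier_mat n n" if "z \<in> GB n" for z
    using that by (auto simp: SL_carrier dest: borel_mat)
  have e: "(\<lambda>z. fst z $$ (i, j)) \<in> pfun (GB n) (pair_entries n)" "(\<lambda>z. snd z $$ (i, j)) \<in> pfun (GB n) (pair_entries n)"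
    if "i < n" "j < n" for i j
    unfolding pair_entries_eq by (rule pfun_fst[OF pfun_entry[OF that]], rule pfun_snd[OF pfun_entry[OF that]])
  have 1: "(\<lambda>z. (t * fst z) $$ (i, j)) \<in> pfun (GB n) (pair_entries n)" if "i < n" "j < n" for i j
    by (rule pfun_mat_mult[of _ _ n n _ n]) (use m c e that in \<open>auto intro: pfun_const\<close>)
  have 2: "(\<lambda>z. (t * fst z * s) $$ (i, j)) \<in> pfun (GB n) (pair_entries n)" if "i < n" "j < n" for i j
    by (rule pfun_mat_mult[of _ _ n n _ n]) (use m c 1 that in \<open>auto intro: pfun_const\<close>)
  have 3: "(\<lambda>z. (inv\<^bsub>SL n\<^esub> s * snd z) $$ (i, j)) \<in> pfun (GB n) (pair_entries n)" if "i < n" "j < n" for i j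
    by (rule pfun_mat_mult[of _ _ n n _ n]) (use m c e that in \<open>auto intro: pfun_const\<close>)
  have 4: "(\<lambda>z. (inv\<^bsub>SL n\<^esub> s * snd z * s) $$ (i, j)) \<in> pfun (GB n) (pair_entries n)" if "i < n" "j < n" for i j
    by (rule pfun_mat_mult[of _ _ n n _ n]) (use m c 3 that in \<open>auto intro: pfun_const\<close>)
  show ?thesis
  proof (rule pfun_comp[OF f])
    fix e assume "e \<in> pair_entries n"
    then show "(\<lambda>z. e (torus_point n (t, s) z)) \<in> pfun (GB n) (pair_entries n)"
      using 2 4 by (auto simp: pair_entries_eq prod_coords_def entries_def torus_point_def case_prod_beta')
  qed (rule torus_point_GB[OF ts])
qed

lemma unipotent_normalized:
  assumes s: "s \<in> torus n" and u: "u \<in> unipotent n"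
  shows "inv\<^bsub>SL n\<^esub> s * u * s \<in> unipotent n"
proof -
  note S = torusD[OF s] and U = unipotentD[OF u]
  note q = SL_upper_triangular[OF S(1,3)]
  have m: "s \<in> carrier_mat n n" "inv\<^bsub>SL n\<^esub> s \<in> carrier_mat n n" "u \<in> carrier_mat n n"
    using S U inv_SL(2)[OF S(1)] by (auto simp: SL_carrier)
  have 1: "upper_triangular (inv\<^bsub>SL n\<^esub> s * u)" by (rule upper_triangular_mult(1)[OF m(2,3) q(3) U(2)])
  have c1: "inv\<^bsub>SL n\<^esub> s * u \<in> carrier_mat n n" using m by simp
  have 2: "upper_triangular (inv\<^bsub>SL n\<^esub> s * u * s)" by (rule upper_triangular_mult(1)[OF c1 m(1) 1 S(3)])
  have 3: "(inv\<^bsub>SL n\<^esub> s * u * s) $$ (i, i) = 1" if "i < n" for i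
    using upper_triangular_mult(2)[OF c1 m(1) 1 S(3) that] upper_triangular_mult(2)[OF m(2,3) q(3) U(2) that]
      q(2,4)[OF that] U(3)[OF that] by simp
  have "inv\<^bsub>SL n\<^esub> s * u * s \<in> carrier (SL n)" using S(1) U(1) inv_SL(1)[OF S(1)] by (intro SL_mult)
  then show ?thesis using 2 3 by (auto simp: unipotent_def)
qed

text \<open>The torus normalizes \<open>U\<close>: \<open>u s = s (s\<inverse> u s)\<close>.\<close>

lemma torus_point_unipotent:
  assumes ts: "t \<in> torus n" "s \<in> torus n" and u: "u \<in> unipotent n"
    and g: "g \<in> carrier (SL n)" and b: "b \<in> borel_lie n" and f: "f \<in> regf n"
  shows "f (torus_point n (t, s) (g * u, inv\<^bsub>SL n\<^esub> u * b * u)) =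
    f (fst (torus_point n (t, s) (g, b)) * (inv\<^bsub>SL n\<^esub> s * u * s),
       inv\<^bsub>SL n\<^esub> (inv\<^bsub>SL n\<^esub> s * u * s) * snd (torus_point n (t, s) (g, b)) * (inv\<^bsub>SL n\<^esub> s * u * s))"
    "f (torus_point n (t, s) (g * u, inv\<^bsub>SL n\<^esub> u * b * u)) = f (torus_point n (t, s) (g, b))"
proof -
  note S = torusD[OF ts(2)] and U = unipotentD[OF u] and T = torusD[OF ts(1)]
  let ?s = "inv\<^bsub>SL n\<^esub> s" and ?u = "inv\<^bsub>SL n\<^esub> u"
  have m: "s \<in> carrier_mat n n" "?s \<in> carrier_mat n n" "u \<in> carrier_mat n n" "?u \<in> carrier_mat n n"
    "t \<in> carrier_mat n n" "g \<in> carrier_mat n n" "b \<in> carrier_mat n n"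
    using S U T inv_SL(2)[OF S(1)] inv_SL(2)[OF U(1)] g borel_mat(1)[OF b] by (auto simp: SL_carrier)
  have ss: "s * ?s = 1\<^sub>m n" "?s * s = 1\<^sub>m n" using inv_SL[OF S(1)] by auto
  have iv: "inv\<^bsub>SL n\<^esub> (?s * u * s) = ?s * ?u * s"
  proof (rule inv_SL_eq)
    have uu: "?u * u = 1\<^sub>m n" using inv_SL[OF U(1)] by auto
    have "?s * ?u * s * (?s * u * s) = ?s * ?u * (s * ?s) * u * s"
      using m by (simp add: assoc_mult_mat[of _ n n _ n _ n] mult_carrier_mat[of _ n n])
    also have "\<dots> = ?s * (?u * u) * s" unfolding ss(1) using m
      by (simp add: assoc_mult_mat[of _ n n _ n _ n] mult_carrier_mat[of _ n n])
    also have "\<dots> = 1\<^sub>m n" unfolding uu using m ss by simp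
    finally show "?s * ?u * s * (?s * u * s) = 1\<^sub>m n" .
  qed (use S(1) U(1) inv_SL(1) in \<open>auto intro!: SL_mult\<close>)
  have "t * g * s * (?s * u * s) = t * g * (s * ?s) * u * s"
    using m by (simp add: assoc_mult_mat[of _ n n _ n _ n] mult_carrier_mat[of _ n n])
  also have "\<dots> = t * (g * u) * s" unfolding ss(1) using m
    by (simp add: assoc_mult_mat[of _ n n _ n _ n] mult_carrier_mat[of _ n n])
  finally have 1: "t * g * s * (?s * u * s) = t * (g * u) * s" .
  have "?s * ?u * s * (?s * b * s) * (?s * u * s) = ?s * ?u * (s * ?s) * b * (s * ?s) * u * s"
    using m by (simp add: assoc_mult_mat[of _ n n _ n _ n] mult_carrier_mat[of _ n n])
  also have "\<dots> = ?s * (?u * b * u) * s" unfolding ss(1) using m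
    by (simp add: assoc_mult_mat[of _ n n _ n _ n] mult_carrier_mat[of _ n n])
  finally have 2: "?s * ?u * s * (?s * b * s) * (?s * u * s) = ?s * (?u * b * u) * s" .
  show 3: "f (torus_point n (t, s) (g * u, ?u * b * u)) =
    f (fst (torus_point n (t, s) (g, b)) * (?s * u * s),
       inv\<^bsub>SL n\<^esub> (?s * u * s) * snd (torus_point n (t, s) (g, b)) * (?s * u * s))"
    unfolding iv by (simp add: torus_point_def 1 2)
  have "torus_point n (t, s) (g, b) \<in> GB n" by (rule torus_point_GB[OF ts]) (use g b in auto)
  then show "f (torus_point n (t, s) (g * u, ?u * b * u)) = f (torus_point n (t, s) (g, b))"
    unfolding 3 using f unipotent_normalized[OF ts(2) u] unfolding regf_def
    by (cases "torus_point n (t, s) (g, b)") auto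
qed

lemma torus_translate_cot:
  assumes ts: "t \<in> torus n" "s \<in> torus n" and f: "f \<in> regf n"
  shows "(\<lambda>z\<in>GB n. f (torus_point n (t, s) z)) \<in> regf n"
  unfolding regf_def
proof (intro CollectI conjI ballI)
  show "(\<lambda>z\<in>GB n. f (torus_point n (t, s) z)) \<in> pfun_on (GB n) (pair_entries n)"
    using f by (intro restrict_pfun_on torus_point_pfun[OF ts]) (auto simp: regf_def pfun_on_def)
  fix u g b assume u: "u \<in> unipotent n" "g \<in> carrier (SL n)" "b \<in> borel_lie n"
  then have "(g * u, inv\<^bsub>SL n\<^esub> u * b * u) \<in> GB n" using unipotentD[OF u(1)] by (auto intro!: SL_mult borel_action)
  then show "(\<lambda>z\<in>GB n. f (torus_point n (t, s) z)) (g * u, inv\<^bsub>SL n\<^esub> u * b * u) = (\<lambda>z\<in>GB n. f (torus_point n (t, s) z)) (g, b)"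
    using u torus_point_unipotent(2)[OF ts u f] by simp
qed

lemma fixed_generators:
  "{f \<ominus>\<^bsub>cotangent_ring n\<^esub> torus_act n h f | f h. f \<in> carrier (cotangent_ring n) \<and> h \<in> torus n \<times> torus n} =
   {\<lambda>z\<in>GB n. f z - f (torus_point n (t, s) z) | f t s. f \<in> regf n \<and> t \<in> torus n \<and> s \<in> torus n}" (is "?L = ?R")
proof
  have eq: "f \<ominus>\<^bsub>cotangent_ring n\<^esub> torus_act n (t, s) f = (\<lambda>z\<in>GB n. f z - f (torus_point n (inv\<^bsub>SL n\<^esub> t, inv\<^bsub>SL n\<^esub> s) z))"
    if f: "f \<in> regf n" and ts: "t \<in> torus n" "s \<in> torus n" for f t s
    using cot_minus[OF f torus_translate_cot[OF torusD(4)[OF ts(1)] torusD(4)[OF ts(2)] f]]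
    by (simp add: torus_act_def restrict_def cong: if_cong)
  show "?L \<subseteq> ?R" using eq torusD(4) by (fastforce simp: cot_simps)
  show "?R \<subseteq> ?L"
  proof
    fix x assume "x \<in> ?R"
    then obtain f t s where x: "x = (\<lambda>z\<in>GB n. f z - f (torus_point n (t, s) z))" "f \<in> regf n" "t \<in> torus n" "s \<in> torus n"
      by blast
    have "x = f \<ominus>\<^bsub>cotangent_ring n\<^esub> torus_act n (inv\<^bsub>SL n\<^esub> t, inv\<^bsub>SL n\<^esub> s) f"
      using eq[OF x(2) torusD(4)[OF x(3)] torusD(4)[OF x(4)]] x(1) inv_SL_inv[OF torusD(1)[OF x(3)]] inv_SL_inv[OF torusD(1)[OF x(4)]]
      by simp
    then show "x \<in> ?L" using x torusD(4)[OF x(3)] torusD(4)[OF x(4)] by (auto simp: cot_simps)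
  qed
qed

lemma fixed_generator_cot:
  "f \<in> regf n \<Longrightarrow> t \<in> torus n \<Longrightarrow> s \<in> torus n \<Longrightarrow> (\<lambda>z\<in>GB n. f z - f (torus_point n (t, s) z)) \<in> regf n"
  using cotD(7)[OF _ torus_translate_cot[of t n s f], of f] by (simp add: restrict_def cong: if_cong)

lemma fixed_ideal_eq: "fixed_ideal n = Idl\<^bsub>cotangent_ring n\<^esub>
   {\<lambda>z\<in>GB n. f z - f (torus_point n (t, s) z) | f t s. f \<in> regf n \<and> t \<in> torus n \<and> s \<in> torus n}"
  unfolding fixed_ideal_def fixed_generators ..

lemma fixed_generators_carrier:
  "{\<lambda>z\<in>GB n. f z - f (torus_point n (t, s) z) | f t s. f \<in> regf n \<and> t \<in> torus n \<and> s \<in> torus n} \<subseteq> carrier (cotangent_ring n)"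
  using fixed_generator_cot by (auto simp: cot_simps)

lemma ideal_fixed: "ideal (fixed_ideal n) (cotangent_ring n)"
  unfolding fixed_ideal_eq by (rule cotR.genideal_ideal[OF fixed_generators_carrier])

lemmas fixed_ideal_subgroup = ideal.axioms(1)[OF ideal_fixed]

lemma fixed_ideal_mono: "f \<in> fixed_ideal n \<Longrightarrow> f \<in> regf n"
  using additive_subgroup.a_subset[OF fixed_ideal_subgroup, of n] by (auto simp: cot_simps)

lemma fixed_ideal_add: "f \<in> fixed_ideal n \<Longrightarrow> g \<in> fixed_ideal n \<Longrightarrow> (\<lambda>z\<in>GB n. f z + g z) \<in> fixed_ideal n"
  using additive_subgroup.a_closed[OF fixed_ideal_subgroup, of f n g] by (simp add: cot_simps)

lemma fixed_ideal_mult: "f \<in> regf n \<Longrightarrow> g \<in> fixed_ideal n \<Longrightarrow> (\<lambda>z\<in>GB n. f z * g z) \<in> fixed_ideal n"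
  using ideal.I_l_closed[OF ideal_fixed, of g n f] by (simp add: cot_simps)

lemma fixed_ideal_zero: "(\<lambda>z\<in>GB n. 0) \<in> fixed_ideal n"
  using additive_subgroup.zero_closed[OF fixed_ideal_subgroup, of n] by (simp add: cot_simps)

text \<open>The generator of the ideal attached to f and (t, s) is (1 - c) f, and 1 - c is a
  unit.\<close>

lemma weight_in_fixed_ideal:
  assumes f: "f \<in> regf n" and ts: "t \<in> torus n" "s \<in> torus n" and c: "c \<noteq> 1"
    and w: "\<And>z. z \<in> GB n \<Longrightarrow> f (torus_point n (t, s) z) = c * f z"
  shows "f \<in> fixed_ideal n"
proof -
  have "(\<lambda>z\<in>GB n. f z - f (torus_point n (t, s) z)) \<in> fixed_ideal n"
    unfolding fixed_ideal_eq by (rule subsetD[OF cotR.genideal_self[OF fixed_generators_carrier]]) (use f ts in blast)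
  from fixed_ideal_mult[OF cotD(2)[of "1 / (1 - c)" n] this]
  have "(\<lambda>z\<in>GB n. (\<lambda>z\<in>GB n. 1 / (1 - c)) z * (\<lambda>z\<in>GB n. f z - f (torus_point n (t, s) z)) z) \<in> fixed_ideal n" .
  also have "(\<lambda>z\<in>GB n. (\<lambda>z\<in>GB n. 1 / (1 - c)) z * (\<lambda>z\<in>GB n. f z - f (torus_point n (t, s) z)) z) = f"
  proof (rule extensional_eqI)
    fix z assume z: "z \<in> GB n"
    have "1 / (1 - c) * (f z - c * f z) = f z" using c by (simp add: field_simps)
    then show "(\<lambda>z\<in>GB n. (\<lambda>z\<in>GB n. 1 / (1 - c)) z * (\<lambda>z\<in>GB n. f z - f (torus_point n (t, s) z)) z) z = f z"
      using z w[OF z] by simp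
  qed (use cotD(1)[OF f] in auto)
  finally show ?thesis .
qed

text \<open>The eigenvalues come first and the matrix x second, opposite to
  \<open>moment_pullback\<close>, because symmetrization and division act on the first argument. For
  \<open>vpull\<close> below the order is again x before y.\<close>

definition mpull :: "nat \<Rightarrow> ((nat \<Rightarrow> complex) \<times> complex mat \<Rightarrow> complex) \<Rightarrow> complex mat \<times> complex mat \<Rightarrow> complex" where
  "mpull n C = (\<lambda>z\<in>GB n. C (diag_fun (snd z), fst z * snd z * inv\<^bsub>SL n\<^esub> (fst z)))"

lemma mpull_cot:
  assumes C: "C \<in> pfun V (prod_coords (vcoords n) (entries n))" and "UNIV \<times> sl_lie n \<subseteq> V"
  shows "mpull n C \<in> regf n"
  unfolding regf_def
proof (intro CollectI conjI ballI)
  let ?P = "pfun (GB n) (pair_entries n)"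
  have e: "(\<lambda>z. fst z $$ (i, j)) \<in> ?P" "(\<lambda>z. snd z $$ (i, j)) \<in> ?P" if "i < n" "j < n" for i j
    unfolding pair_entries_eq by (rule pfun_fst[OF pfun_entry[OF that]], rule pfun_snd[OF pfun_entry[OF that]])
  have c: "fst z \<in> carrier_mat n n" "snd z \<in> carrier_mat n n" "inv\<^bsub>SL n\<^esub> (fst z) \<in> carrier_mat n n" if "z \<in> GB n" for z
    using that inv_SL(2) by (auto simp: SL_carrier dest: borel_mat)
  have 1: "(\<lambda>z. (fst z * snd z) $$ (i, j)) \<in> ?P" if "i < n" "j < n" for i j
    by (rule pfun_mat_mult[of _ _ n n _ n]) (use c e that in auto)
  have 2: "(\<lambda>z. (inv\<^bsub>SL n\<^esub> (fst z)) $$ (i, j)) \<in> ?P" if "i < n" "j < n" for i j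
    by (rule pfun_inv_SL) (use that e in auto)
  have 3: "(\<lambda>z. (fst z * snd z * inv\<^bsub>SL n\<^esub> (fst z)) $$ (i, j)) \<in> ?P" if "i < n" "j < n" for i j
    by (rule pfun_mat_mult[of _ _ n n _ n]) (use c 1 2 that in \<open>auto intro!: mult_carrier_mat\<close>)
  have C': "C \<in> pfun (UNIV \<times> sl_lie n) (prod_coords (vcoords n) (entries n))" by (rule pfun_mono[OF C]) (use assms in auto)
  then have "(\<lambda>z. C (diag_fun (snd z), fst z * snd z * inv\<^bsub>SL n\<^esub> (fst z))) \<in> ?P"
    by (rule pfun_comp_pair) (use e 3 in \<open>auto simp: vcoords_def entries_def intro!: conj_sl[OF _ borel_mat(4)]\<close>)
  then show "mpull n C \<in> pfun_on (GB n) (pair_entries n)" unfolding mpull_def by (rule restrict_pfun_on)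
  fix u g b assume u: "u \<in> unipotent n" "g \<in> carrier (SL n)" "b \<in> borel_lie n"
  note U = unipotentD[OF u(1)]
  let ?b = "inv\<^bsub>SL n\<^esub> u * b * u"
  have b': "?b \<in> borel_lie n" "g * u \<in> carrier (SL n)" using u U by (auto intro!: SL_mult borel_action)
  have m: "g \<in> carrier_mat n n" "u \<in> carrier_mat n n" "b \<in> carrier_mat n n" "inv\<^bsub>SL n\<^esub> g \<in> carrier_mat n n"
    "inv\<^bsub>SL n\<^esub> u \<in> carrier_mat n n"
    using u U inv_SL(2) borel_mat(1) by (auto simp: SL_carrier)
  have "g * u * ?b * inv\<^bsub>SL n\<^esub> (g * u) = g * (u * inv\<^bsub>SL n\<^esub> u) * b * (u * inv\<^bsub>SL n\<^esub> u) * inv\<^bsub>SL n\<^esub> g"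
    unfolding inv_SL_mult[OF u(2) U(1)] using m
    by (simp add: assoc_mult_mat[of _ n n _ n _ n] mult_carrier_mat[of _ n n])
  also have "\<dots> = g * b * inv\<^bsub>SL n\<^esub> g" using m inv_SL(4)[OF U(1)] by simp
  finally have x: "g * u * ?b * inv\<^bsub>SL n\<^esub> (g * u) = g * b * inv\<^bsub>SL n\<^esub> g" .
  have "C (diag_fun ?b, g * b * inv\<^bsub>SL n\<^esub> g) = C (diag_fun b, g * b * inv\<^bsub>SL n\<^esub> g)"
  proof -
    have "(\<lambda>y. C (y, g * b * inv\<^bsub>SL n\<^esub> g)) \<in> pfun UNIV (vcoords n)"
      by (rule pfun_comp_pair[OF C']) (use conj_sl[OF u(2) borel_mat(4)[OF u(3)]] in \<open>auto intro: pfun_coord pfun_const\<close>)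
    then show ?thesis by (rule pfun_vec_cong) (use borel_action(2)[OF U(1,2) u(3)] in auto)
  qed
  then show "mpull n C (g * u, ?b) = mpull n C (g, b)" using u b' x by (simp add: mpull_def)
qed

section \<open>Descent to the eigenvalue data\<close>

text \<open>An upper triangular p is the product of its diagonal part s and the unipotent matrix
  s\<inverse> p, and f is invariant under both.\<close>

lemma regf_borel_invariant:
  assumes f: "f \<in> regf n"
    and T: "\<And>s z. s \<in> torus n \<Longrightarrow> z \<in> GB n \<Longrightarrow> f (torus_point n (1\<^sub>m n, s) z) = f z"
    and g: "g \<in> carrier (SL n)" and b: "b \<in> borel_lie n" and p: "p \<in> carrier (SL n)" "upper_triangular p"
  shows "f (g * p, inv\<^bsub>SL n\<^esub> p * b * p) = f (g, b)"
proof -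
  note q = SL_upper_triangular[OF p]
  define s where "s = mat_diag n (diag_fun p)"
  have s: "s \<in> torus n" unfolding s_def by (rule torusI[OF q(1)])
  note S = torusD[OF s]
  let ?s = "inv\<^bsub>SL n\<^esub> s"
  have sd: "?s = mat_diag n (\<lambda>i. 1 / p $$ (i, i))" unfolding S(6) by (intro eq_matI) (auto simp: s_def mat_diag_def)
  have m: "s \<in> carrier_mat n n" "?s \<in> carrier_mat n n" "p \<in> carrier_mat n n" "g \<in> carrier_mat n n"
    "b \<in> carrier_mat n n" "inv\<^bsub>SL n\<^esub> p \<in> carrier_mat n n"
    using S inv_SL(2) p g borel_mat(1)[OF b] by (auto simp: SL_carrier)
  have ss: "s * ?s = 1\<^sub>m n" using inv_SL[OF S(1)] by auto
  let ?u = "?s * p"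
  have uS: "?u \<in> carrier (SL n)" using inv_SL(1)[OF S(1)] p by (intro SL_mult)
  have u: "?u \<in> unipotent n"
    unfolding unipotent_def using uS upper_triangular_mult[OF m(2,3) torusD(3)[OF S(4)] p(2)] q(2)
    by (auto simp: sd mat_diag_def)
  have gs: "torus_point n (1\<^sub>m n, s) (g, b) = (g * s, ?s * b * s)" using m by (simp add: torus_point_def)
  have GB: "(g * s, ?s * b * s) \<in> GB n"
    using torus_point_GB[OF torus_one s, of "(g, b)"] g b unfolding gs by auto
  have inv_u: "inv\<^bsub>SL n\<^esub> ?u = inv\<^bsub>SL n\<^esub> p * s"
    using inv_SL_mult[OF inv_SL(1)[OF S(1)] p(1)] inv_SL_inv[OF S(1)] by simp
  have "g * s * ?u = g * (s * ?s) * p" using m by (simp add: assoc_mult_mat[of _ n n _ n _ n] mult_carrier_mat[of _ n n])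
  also have "\<dots> = g * p" unfolding ss using m by simp
  finally have 1: "g * s * ?u = g * p" .
  have "inv\<^bsub>SL n\<^esub> ?u * (?s * b * s) * ?u = inv\<^bsub>SL n\<^esub> p * (s * ?s) * b * (s * ?s) * p"
    unfolding inv_u using m by (simp add: assoc_mult_mat[of _ n n _ n _ n] mult_carrier_mat[of _ n n])
  also have "\<dots> = inv\<^bsub>SL n\<^esub> p * b * p" unfolding ss using m by simp
  finally have 2: "inv\<^bsub>SL n\<^esub> ?u * (?s * b * s) * ?u = inv\<^bsub>SL n\<^esub> p * b * p" .
  have "f (g * s * ?u, inv\<^bsub>SL n\<^esub> ?u * (?s * b * s) * ?u) = f (g * s, ?s * b * s)"
    using f u GB unfolding regf_def by auto
  also have "\<dots> = f (g, b)" using T[OF s, of "(g, b)"] g b unfolding gs by simp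
  finally show ?thesis unfolding 1 2 .
qed

lemma regf_descends:
  assumes n: "0 < n" and f: "f \<in> regf n"
    and T: "\<And>s z. s \<in> torus n \<Longrightarrow> z \<in> GB n \<Longrightarrow> f (torus_point n (1\<^sub>m n, s) z) = f z"
  shows "\<exists>C\<in>pfun UNIV (prod_coords (vcoords n) (entries n)). f = mpull n C"
proof -
  have fp: "f \<in> pfun (GB n) (pair_entries n)" "f \<in> extensional (GB n)" using f by (auto simp: regf_def pfun_on_def)
  obtain C where C: "C \<in> pfun UNIV (prod_coords (vcoords n) (entries n))"
    "\<And>g b. g \<in> carrier (SL n) \<Longrightarrow> b \<in> borel_lie n \<Longrightarrow> f (g, b) = C (diag_fun b, g * b * inv\<^bsub>SL n\<^esub> g)"
    using borel_invariant_polynomial[OF n _ fp(1)] regf_borel_invariant[OF f T] by blast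
  have "f = mpull n C"
    by (rule extensional_eqI[OF fp(2)]) (auto simp: C(2) mpull_def)
  then show ?thesis using C(1) by blast
qed

lemma mpull_regf: "C \<in> pfun UNIV (prod_coords (vcoords n) (entries n)) \<Longrightarrow> mpull n C \<in> regf n"
  by (rule mpull_cot) auto

lemma torus_conj_entry:
  assumes t: "t \<in> torus n" and x: "x \<in> carrier_mat n n" and ij: "i < n" "j < n"
  shows "(t * x * inv\<^bsub>SL n\<^esub> t) $$ (i, j) = t $$ (i, i) * x $$ (i, j) / t $$ (j, j)"
proof -
  note T = torusD[OF t]
  have "t * x = mat n n (\<lambda>(i, j). t $$ (i, i) * x $$ (i, j))"
    using mat_diag_mult_left[OF x, of "diag_fun t"] T(5) by simp
  moreover have "(t * x) * inv\<^bsub>SL n\<^esub> t = mat n n (\<lambda>(i, j). (t * x) $$ (i, j) * (1 / t $$ (j, j)))"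
    unfolding T(6) by (rule mat_diag_mult_right) (use T x in auto)
  ultimately show ?thesis using ij by simp
qed

text \<open>A test element of the torus: since 2 has infinite order, the value of a character at it
  determines the difference of the exponents at i and j.\<close>

lemma two_point_torus:
  assumes "i < n" "j < n" "i \<noteq> j"
  shows "mat_diag n (\<lambda>k. if k = i then 2 else if k = j then 1 / 2 else 1) \<in> torus n"
proof (rule torusI)
  have "(\<Prod>k<n. if k = i then 2 else if k = j then 1 / 2 else (1 :: complex)) =
    (\<Prod>k\<in>{i, j}. if k = i then 2 else if k = j then 1 / 2 else 1)"
    by (rule prod.mono_neutral_right) (use assms in auto)
  then show "(\<Prod>k<n. if k = i then 2 else if k = j then 1 / 2 else (1 :: complex)) = 1" using assms by simp
qed

text \<open>An off-diagonal entry of the moment map has nonzero weight.\<close>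

lemma offdiagonal_in_fixed_ideal:
  assumes ij: "i < n" "j < n" "i \<noteq> j"
  shows "mpull n (\<lambda>z. snd z $$ (i, j)) \<in> fixed_ideal n"
\<comment> \<open>The entry (i, j) is multiplied by t_i / t_j = 2 / (1/2) = 4.\<close>
proof (rule weight_in_fixed_ideal[OF _ two_point_torus[OF ij] torus_one, where c = 4])
  let ?t = "mat_diag n (\<lambda>k. if k = i then 2 else if k = j then 1 / 2 else (1 :: complex))"
  show "mpull n (\<lambda>z. snd z $$ (i, j)) \<in> regf n"
    by (rule mpull_cot[OF pfun_snd[OF pfun_entry[OF ij(1,2)], of UNIV UNIV]]) auto
  fix z assume z: "z \<in> GB n"
  obtain g b where gb: "z = (g, b)" "g \<in> carrier (SL n)" "b \<in> borel_lie n" using z by auto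
  note T = torusD[OF two_point_torus[OF ij]]
  have m: "g \<in> carrier_mat n n" "b \<in> carrier_mat n n" "inv\<^bsub>SL n\<^esub> g \<in> carrier_mat n n"
    using gb inv_SL(2) by (auto simp: SL_carrier dest: borel_mat)
  have i1: "inv\<^bsub>SL n\<^esub> (1\<^sub>m n) = 1\<^sub>m n" using monoid.inv_one[OF group.is_monoid[OF group_SL[of n]]] by (simp add: SL_simps)
  have pt: "torus_point n (?t, 1\<^sub>m n) z = (?t * g, b)"
    using m gb T(2) by (simp add: torus_point_def i1 right_mult_one_mat[of _ n n] left_mult_one_mat[of _ n n])
  have "?t * g * b * inv\<^bsub>SL n\<^esub> (?t * g) = ?t * (g * b * inv\<^bsub>SL n\<^esub> g) * inv\<^bsub>SL n\<^esub> ?t"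
    unfolding inv_SL_mult[OF T(1) gb(2)] using m T(2) inv_SL(2)[OF T(1)]
    by (simp add: assoc_mult_mat[of _ n n _ n _ n] mult_carrier_mat[of _ n n])
  then have "(?t * g * b * inv\<^bsub>SL n\<^esub> (?t * g)) $$ (i, j) = 4 * (g * b * inv\<^bsub>SL n\<^esub> g) $$ (i, j)"
    using torus_conj_entry[OF two_point_torus[OF ij] _ ij(1,2), of "g * b * inv\<^bsub>SL n\<^esub> g"] ij m
    by (simp add: mat_diag_def)
  then show "mpull n (\<lambda>z. snd z $$ (i, j)) (torus_point n (?t, 1\<^sub>m n) z) = 4 * mpull n (\<lambda>z. snd z $$ (i, j)) z"
    unfolding pt using gb SL_mult[OF T(1) gb(2)] by (simp add: mpull_def)
qed simp

lemma fixed_ideal_cong: "f \<in> fixed_ideal n \<Longrightarrow> g \<in> extensional (GB n) \<Longrightarrow> (\<And>z. z \<in> GB n \<Longrightarrow> g z = f z) \<Longrightarrow> g \<in> fixed_ideal n"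
  using extensional_eqI[of g "GB n" f] cotD(1)[OF fixed_ideal_mono] by metis

lemma mpull_ext: "mpull n C \<in> extensional (GB n)"
  by (simp add: mpull_def)

text \<open>For a coordinate the difference is zero or an off-diagonal entry of x, which lies in the
  ideal. Products are handled by C C' - D D' = C (C' - D') + D' (C - D).\<close>

lemma diagonal_part_congruent:
  assumes "C \<in> pfun UNIV (prod_coords (vcoords n) (entries n))"
  shows "mpull n (\<lambda>z. C z - C (fst z, mat_diag n (diag_fun (snd z)))) \<in> fixed_ideal n"
proof -
  let ?E = "prod_coords (vcoords n) (entries n)"
  have dg: "(\<lambda>z. C (fst z, mat_diag n (diag_fun (snd z)))) \<in> pfun UNIV ?E" if C: "C \<in> pfun UNIV ?E" for C
  proof -
    have "C \<in> pfun (UNIV \<times> UNIV) ?E" using C by simp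
    then show ?thesis
    proof (rule pfun_comp_pair)
      fix e assume "e \<in> vcoords n"
      then show "(\<lambda>z. e (fst z)) \<in> pfun UNIV ?E" using pfun_fst[OF pfun_coord, of e "vcoords n" UNIV UNIV] by simp
    next
      fix e assume "e \<in> entries n"
      then obtain i j where ij: "i < n" "j < n" "e = (\<lambda>x. x $$ (i, j))" by (auto simp: entries_def)
      show "(\<lambda>z. e (mat_diag n (diag_fun (snd z)))) \<in> pfun UNIV ?E"
        using pfun_snd[OF pfun_entry[of i n i], of UNIV UNIV] ij
        by (cases "i = j") (auto simp: mat_diag_def intro: pfun_const)
    qed auto
  qed
  show ?thesis using assms
  proof induction
    case (const c)
    show ?case by (rule fixed_ideal_cong[OF fixed_ideal_zero mpull_ext]) (simp add: mpull_def)
  next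
    case (coord e)
    then consider "\<exists>e'. e = (\<lambda>z. e' (fst z))" | i j where "i < n" "j < n" "i = j" "e = (\<lambda>z. snd z $$ (i, j))"
      | i j where "i < n" "j < n" "i \<noteq> j" "e = (\<lambda>z. snd z $$ (i, j))"
      unfolding prod_coords_def entries_def by blast
    then show ?case
    proof cases
      case 1
      then show ?thesis by (intro fixed_ideal_cong[OF fixed_ideal_zero mpull_ext]) (auto simp: mpull_def)
    next
      case 2
      then show ?thesis by (intro fixed_ideal_cong[OF fixed_ideal_zero mpull_ext]) (auto simp: mpull_def mat_diag_def)
    next
      case 3
      then show ?thesis
        by (intro fixed_ideal_cong[OF offdiagonal_in_fixed_ideal[of i n j] mpull_ext]) (auto simp: mpull_def mat_diag_def)
    qed
  next
    case (add P Q)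
    show ?case by (rule fixed_ideal_cong[OF fixed_ideal_add[OF add.IH] mpull_ext]) (auto simp: mpull_def)
  next
    case (mult P Q)
    note I = fixed_ideal_add[OF fixed_ideal_mult[OF mpull_regf[OF mult(1)] mult.IH(2)]
        fixed_ideal_mult[OF mpull_regf[OF dg[OF mult(2)]] mult.IH(1)]]
    show ?case by (rule fixed_ideal_cong[OF I mpull_ext]) (auto simp: mpull_def algebra_simps)
  next
    case (cong P Q)
    then have "Q = P" by auto
    then show ?case using cong by simp
  qed
qed

definition vpull :: "nat \<Rightarrow> ((nat \<Rightarrow> complex) \<times> (nat \<Rightarrow> complex) \<Rightarrow> complex) \<Rightarrow> complex mat \<times> complex mat \<Rightarrow> complex" where
  "vpull n P = mpull n (\<lambda>z. P (diag_fun (snd z), fst z))"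

abbreviation vpairs :: "nat \<Rightarrow> ((nat \<Rightarrow> complex) \<times> (nat \<Rightarrow> complex) \<Rightarrow> complex) set" where
  "vpairs n \<equiv> pfun (UNIV \<times> UNIV) (prod_coords (vcoords n) (vcoords n))"

lemma vpull_regf: "P \<in> vpairs n \<Longrightarrow> vpull n P \<in> regf n"
proof -
  assume P: "P \<in> vpairs n"
  have "(\<lambda>z. P (diag_fun (snd z), fst z)) \<in> pfun (UNIV \<times> UNIV) (prod_coords (vcoords n) (entries n))"
  proof (rule pfun_comp_pair[OF P])
    fix e assume e: "e \<in> vcoords n"
    then show "(\<lambda>z. e (fst z)) \<in> pfun (UNIV \<times> UNIV) (prod_coords (vcoords n) (entries n))"
      by (rule pfun_fst[OF pfun_coord])
    obtain i where i: "i < n" "e = (\<lambda>y. y i)" using e by (auto simp: vcoords_def)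
    show "(\<lambda>z. e (diag_fun (snd z))) \<in> pfun (UNIV \<times> UNIV) (prod_coords (vcoords n) (entries n))"
      unfolding i(2) by (rule pfun_snd[OF pfun_entry[OF i(1) i(1)]])
  qed auto
  then show ?thesis unfolding vpull_def by (intro mpull_regf) simp
qed

lemma vpull_ext: "vpull n P \<in> extensional (GB n)"
  by (simp add: vpull_def mpull_ext)

text \<open>On \<open>GB n\<close> both arguments of \<open>P\<close> are traceless.\<close>

lemma vpull_cong:
  assumes "\<And>x y. (\<Sum>i<n. x i) = 0 \<Longrightarrow> (\<Sum>i<n. y i) = 0 \<Longrightarrow> P (x, y) = Q (x, y)"
  shows "vpull n P = vpull n Q"
proof (rule extensional_eqI[OF vpull_ext vpull_ext])
  fix z assume "z \<in> GB n"
  then show "vpull n P z = vpull n Q z"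
    using assms borel_mat(3,4) conj_sl unfolding vpull_def mpull_def
    by (auto simp: sl_lie_def)
qed

lemma sym_differences_pfun: "D \<in> sym_differences n \<Longrightarrow> D \<in> vpairs n"
proof (induction rule: sym_differences.induct)
  case (diff q r)
  then show ?case
    by (intro pfun_mult pfun_diff pfun_fst[of q] pfun_snd[of q]) (auto simp: symf_def)
next
  case (plus f g)
  show ?case by (rule pfun_add[OF plus.IH])
qed

text \<open>A symmetric function q of the eigenvalues is a polynomial Q' in x. On the one hand Q'(x)
  is q at the diagonal of b; on the other hand, modulo the ideal, x may be replaced by its diagonal
  part, where Q' takes the value of q at the diagonal of x.\<close>

lemma sym_difference_in_fixed_ideal:
  assumes "D \<in> sym_differences n"
  shows "vpull n D \<in> fixed_ideal n"
  using assms
proof induction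
  case (diff q r)
  obtain Q where Q: "Q \<in> pfun (carrier_mat n n) (entries n)"
    "\<And>g b g'. g \<in> carrier_mat n n \<Longrightarrow> b \<in> carrier_mat n n \<Longrightarrow> g' \<in> carrier_mat n n \<Longrightarrow> g' * g = 1\<^sub>m n \<Longrightarrow>
      g * g' = 1\<^sub>m n \<Longrightarrow> upper_triangular b \<Longrightarrow> Q (g * b * g') = q (\<lambda>i. b $$ (i, i))"
    using psum_alg_spectral[OF symf_psum_alg[OF diff(1)]] by blast
  obtain Q' where Q': "Q' \<in> pfun UNIV (entries n)" "\<And>x. x \<in> carrier_mat n n \<Longrightarrow> Q x = Q' x"
    using pfun_extend[OF Q(1)] by blast
  have "(\<lambda>z. Q' (snd z)) \<in> pfun UNIV (prod_coords (vcoords n) (entries n))"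
    using pfun_snd[OF Q'(1), of UNIV] by simp
  from fixed_ideal_mult[OF cotD(2)[of "-1"] diagonal_part_congruent[OF this]]
  have I: "(\<lambda>z\<in>GB n. (\<lambda>z\<in>GB n. - 1) z * mpull n (\<lambda>z. Q' (snd z) - Q' (snd (fst z, mat_diag n (diag_fun (snd z))))) z)
    \<in> fixed_ideal n" by simp
  note I' = fixed_ideal_mult[OF vpull_regf[OF diff(2)] I]
  show ?case
  proof (rule fixed_ideal_cong[OF I' vpull_ext])
    fix z assume z: "z \<in> GB n"
    obtain g b where gb: "z = (g, b)" "g \<in> carrier (SL n)" "b \<in> borel_lie n" using z by auto
    let ?x = "g * b * inv\<^bsub>SL n\<^esub> g"
    have m: "g \<in> carrier_mat n n" "b \<in> carrier_mat n n" "inv\<^bsub>SL n\<^esub> g \<in> carrier_mat n n"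
      using gb inv_SL(2) by (auto simp: SL_carrier dest: borel_mat)
    have "Q' ?x = q (diag_fun b)"
      using Q(2)[of g b "inv\<^bsub>SL n\<^esub> g"] Q'(2)[of ?x] gb m inv_SL[OF gb(2)] borel_mat(2) by simp
    moreover have "Q' (mat_diag n (diag_fun ?x)) = q (diag_fun ?x)"
    proof -
      have "Q (1\<^sub>m n * mat_diag n (diag_fun ?x) * 1\<^sub>m n) = q (diag_fun (mat_diag n (diag_fun ?x)))"
        by (rule Q(2)) (auto simp: mat_diag_def)
      moreover have "q (diag_fun (mat_diag n (diag_fun ?x))) = q (diag_fun ?x)"
        using diff(1) by (intro pfun_vec_cong[of q n]) (auto simp: symf_def mat_diag_def)
      ultimately show ?thesis
        using Q'(2)[of "mat_diag n (diag_fun ?x)"]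
        by (simp add: left_mult_one_mat[of _ n n] right_mult_one_mat[of _ n n])
    qed
    ultimately show "vpull n (\<lambda>z. (q (fst z) - q (snd z)) * r z) z =
      (\<lambda>z\<in>GB n. vpull n r z * (\<lambda>z\<in>GB n. (\<lambda>z\<in>GB n. - 1) z *
        mpull n (\<lambda>z. Q' (snd z) - Q' (snd (fst z, mat_diag n (diag_fun (snd z))))) z) z) z"
      using gb by (simp add: vpull_def mpull_def)
  qed
next
  case (plus D D')
  show ?case by (rule fixed_ideal_cong[OF fixed_ideal_add[OF plus.IH] vpull_ext]) (auto simp: vpull_def mpull_def)
qed

text \<open>The projection onto traceless vectors. It commutes with permutations and so maps
  permutation graphs to permutation graphs, which transfers results from affine n-space to
  \<hh>.\<close>

definition trless :: "nat \<Rightarrow> (nat \<Rightarrow> complex) \<Rightarrow> nat \<Rightarrow> complex" where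
  "trless n y = (\<lambda>i. y i - (\<Sum>k<n. y k) / of_nat n)"

lemma trless_sum: "0 < n \<Longrightarrow> (\<Sum>i<n. trless n y i) = 0"
  by (simp add: trless_def sum_subtractf)

lemma trless_id: "(\<Sum>i<n. y i) = 0 \<Longrightarrow> trless n y = y"
  by (simp add: trless_def)

lemma trless_permute: "v permutes {..<n} \<Longrightarrow> trless n (y \<circ> v) = trless n y \<circ> v"
  using sum.reindex_bij_betw[OF permutes_imp_bij, of v "{..<n}" y] by (auto simp: trless_def)

lemma pfun_trless:
  assumes "P \<in> vpairs n"
  shows "(\<lambda>z. P (trless n (fst z), trless n (snd z))) \<in> vpairs n"
proof (rule pfun_comp_pair[OF assms])
  fix e assume "e \<in> vcoords n"
  then obtain i where i: "i < n" "e = (\<lambda>y. y i)" by (auto simp: vcoords_def)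
  show "(\<lambda>z. e (trless n (fst z))) \<in> vpairs n" "(\<lambda>z. e (trless n (snd z))) \<in> vpairs n"
    unfolding i(2) trless_def divide_inverse using i(1)
    by (intro pfun_diff pfun_mult pfun_const pfun_sum pfun_fst[of "\<lambda>y. y _"] pfun_snd[of "\<lambda>y. y _"] pfun_vcoord; auto)+
qed auto

lemma vanish_on_graphs_traceless:
  assumes n: "0 < n" and P: "P \<in> vpairs n"
    and van: "\<And>v y. v permutes {..<n} \<Longrightarrow> (\<Sum>i<n. y i) = 0 \<Longrightarrow> P (y \<circ> v, y) = 0"
  shows "\<exists>D\<in>sym_differences n. \<forall>x y. (\<Sum>i<n. x i) = 0 \<longrightarrow> (\<Sum>i<n. y i) = 0 \<longrightarrow> P (x, y) = D (x, y)"
proof -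
  have "(\<lambda>z. P (trless n (fst z), trless n (snd z))) \<in> sym_differences n"
    by (rule vanish_on_graphs[OF pfun_trless[OF P]]) (simp add: trless_permute van trless_sum[OF n])
  then show ?thesis by (rule bexI[rotated]) (simp add: trless_id)
qed

lemma supported_on_graphs_traceless:
  assumes n: "0 < n" and P: "P \<in> vpairs n" and I: "I \<subseteq> {..<n}" "S' \<subseteq> {..<n}" "card I + card S' = n"
    and van: "\<And>v y. v permutes {..<n} \<Longrightarrow> (\<Sum>i<n. y i) = 0 \<Longrightarrow> v ` I \<inter> S' \<noteq> {} \<Longrightarrow> P (y \<circ> v, y) = 0"
  shows "\<exists>D\<in>sym_differences n. \<exists>H\<in>vpairs n. \<forall>x y. (\<Sum>i<n. x i) = 0 \<longrightarrow> (\<Sum>i<n. y i) = 0 \<longrightarrow>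
    P (x, y) = D (x, y) + (\<Prod>i\<in>I. \<Prod>t\<in>S'. x i - y t) * H (x, y)"
proof -
  let ?P = "\<lambda>z. P (trless n (fst z), trless n (snd z))"
  have "\<exists>H\<in>vpairs n. (\<lambda>(x, y). ?P (x, y) - (\<Prod>i\<in>I. \<Prod>t\<in>S'. x i - y t) * H (x, y)) \<in> sym_differences n"
    by (rule supported_on_graphs[OF pfun_trless[OF P] I]) (simp add: trless_permute van trless_sum[OF n])
  then obtain H where H: "H \<in> vpairs n"
    "(\<lambda>(x, y). ?P (x, y) - (\<Prod>i\<in>I. \<Prod>t\<in>S'. x i - y t) * H (x, y)) \<in> sym_differences n" by blast
  show ?thesis by (rule bexI[OF _ H(2)], rule bexI[OF _ H(1)]) (simp add: trless_id)
qed

section \<open>Weyl group points\<close>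

definition perm_mat :: "nat \<Rightarrow> (nat \<Rightarrow> nat) \<Rightarrow> complex mat" where
  "perm_mat n v = mat n n (\<lambda>(i, j). if j = v i then 1 else 0)"

text \<open>A representative of v in SL_n: the permutation matrix with column 0 rescaled to
  determinant 1. The convention that row i has its entry in column v i makes conjugation send
  diag(y) to diag(y v).\<close>

definition weyl_lift :: "nat \<Rightarrow> (nat \<Rightarrow> nat) \<Rightarrow> complex mat" where
  "weyl_lift n v = mat n n (\<lambda>(i, j). if j = v i then (if j = 0 then 1 / det (perm_mat n v) else 1) else 0)"

lemma perm_mat_mult:
  assumes "v permutes {..<n}"
  shows "perm_mat n v * perm_mat n u = perm_mat n (u \<circ> v)"
proof (rule eq_matI)
  fix i j assume "i < dim_row (perm_mat n (u \<circ> v))" "j < dim_col (perm_mat n (u \<circ> v))"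
  then have ij: "i < n" "j < n" by (auto simp: perm_mat_def)
  have vi: "v i < n" using permutes_in_image[OF assms, of i] ij by simp
  have "(perm_mat n v * perm_mat n u) $$ (i, j) = (\<Sum>l<n. perm_mat n v $$ (i, l) * perm_mat n u $$ (l, j))"
    by (rule index_mult_mat_sum[of _ n n _ n]) (use ij in \<open>auto simp: perm_mat_def\<close>)
  also have "\<dots> = (\<Sum>l<n. if l = v i then perm_mat n u $$ (l, j) else 0)"
    using ij by (intro sum.cong) (auto simp: perm_mat_def)
  also have "\<dots> = perm_mat n (u \<circ> v) $$ (i, j)" using vi ij by (simp add: sum.delta perm_mat_def)
  finally show "(perm_mat n v * perm_mat n u) $$ (i, j) = perm_mat n (u \<circ> v) $$ (i, j)" .
qed (auto simp: perm_mat_def)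

lemma det_perm_mat: "v permutes {..<n} \<Longrightarrow> det (perm_mat n v) \<noteq> 0"
proof -
  assume v: "v permutes {..<n}"
  have "perm_mat n v * perm_mat n (inv_into UNIV v) = perm_mat n id"
    unfolding perm_mat_mult[OF v] using permutes_inv_o(2)[OF v] by simp
  also have "\<dots> = 1\<^sub>m n" by (rule eq_matI) (auto simp: perm_mat_def)
  finally have "det (perm_mat n v) * det (perm_mat n (inv_into UNIV v)) = 1"
    by (subst det_mult[symmetric, of _ n]) (auto simp: perm_mat_def)
  then show ?thesis by auto
qed

lemma weyl_lift_SL:
  assumes n: "0 < n" and v: "v permutes {..<n}"
  shows "weyl_lift n v \<in> carrier (SL n)"
proof -
  have eq: "weyl_lift n v = perm_mat n v * mat_diag n (\<lambda>j. if j = 0 then 1 / det (perm_mat n v) else 1)"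
    by (subst mat_diag_mult_right[of _ n n]) (auto simp: weyl_lift_def perm_mat_def intro!: eq_matI)
  have "det (mat_diag n (\<lambda>j. if j = 0 then 1 / det (perm_mat n v) else 1)) = 1 / det (perm_mat n v)"
    unfolding det_diag_nonzero using n by (simp add: prod.remove[of _ 0])
  moreover have "perm_mat n v \<in> carrier_mat n n" by (simp add: perm_mat_def)
  ultimately show ?thesis
    using det_perm_mat[OF v] unfolding eq SL_carrier by (simp add: det_mult[of _ n])
qed

lemma weyl_point:
  assumes n: "0 < n" and v: "v permutes {..<n}" and y: "(\<Sum>i<n. y i) = 0"
  shows "(weyl_lift n v, mat_diag n y) \<in> GB n"
    "weyl_lift n v * mat_diag n y * inv\<^bsub>SL n\<^esub> (weyl_lift n v) = mat_diag n (y \<circ> v)"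
proof -
  have w: "weyl_lift n v \<in> carrier (SL n)" by (rule weyl_lift_SL[OF n v])
  then show "(weyl_lift n v, mat_diag n y) \<in> GB n" using y by (auto simp: borel_lie_def sl_lie_def mat_diag_def)
  have wm: "weyl_lift n v \<in> carrier_mat n n" using w by (simp add: SL_carrier)
  show "weyl_lift n v * mat_diag n y * inv\<^bsub>SL n\<^esub> (weyl_lift n v) = mat_diag n (y \<circ> v)"
  proof (rule conj_unique(2)[OF w])
    show "mat_diag n (y \<circ> v) * weyl_lift n v = weyl_lift n v * mat_diag n y"
      unfolding mat_diag_mult_left[OF wm] mat_diag_mult_right[OF wm]
      by (rule eq_matI) (auto simp: weyl_lift_def)
  qed auto
qed

lemma mpull_weyl:
  assumes n: "0 < n" and v: "v permutes {..<n}" and y: "(\<Sum>i<n. y i) = 0"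
    and C: "C \<in> pfun UNIV (prod_coords (vcoords n) (entries n))"
  shows "mpull n C (weyl_lift n v, mat_diag n y) = C (y, mat_diag n (y \<circ> v))"
proof -
  have "(\<lambda>u. C (u, mat_diag n (y \<circ> v))) \<in> pfun UNIV (vcoords n)"
    by (rule pfun_comp_pair[of C UNIV UNIV "vcoords n" "entries n"]) (use C in \<open>auto intro: pfun_coord pfun_const\<close>)
  then have "C (diag_fun (mat_diag n y), mat_diag n (y \<circ> v)) = C (y, mat_diag n (y \<circ> v))"
    by (rule pfun_vec_cong) (simp add: mat_diag_def)
  then show ?thesis using weyl_point[OF n v y] by (simp add: mpull_def)
qed

lemma vpairs_cong:
  assumes P: "P \<in> vpairs n" and "\<And>i. i < n \<Longrightarrow> x i = x' i" "\<And>i. i < n \<Longrightarrow> y i = y' i"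
  shows "P (x, y) = P (x', y')"
proof -
  have "(\<lambda>u. P (u, y)) \<in> pfun UNIV (vcoords n)"
    by (rule pfun_comp_pair[OF P]) (auto intro: pfun_coord pfun_const)
  then have 1: "P (x, y) = P (x', y)" by (rule pfun_vec_cong) (rule assms(2))
  have "(\<lambda>u. P (x', u)) \<in> pfun UNIV (vcoords n)"
    by (rule pfun_comp_pair[OF P]) (auto intro: pfun_coord pfun_const)
  then have "P (x', y) = P (x', y')" by (rule pfun_vec_cong) (rule assms(3))
  with 1 show ?thesis by simp
qed

lemma vpull_weyl:
  assumes n: "0 < n" and v: "v permutes {..<n}" and y: "(\<Sum>i<n. y i) = 0" and P: "P \<in> vpairs n"
  shows "vpull n P (weyl_lift n v, mat_diag n y) = P (y \<circ> v, y)"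
proof -
  let ?a = "diag_fun (mat_diag n (y \<circ> v))" and ?b = "diag_fun (mat_diag n y)"
  have 1: "vpull n P (weyl_lift n v, mat_diag n y) = P (?a, ?b)"
    using weyl_point[OF n v y] by (simp add: vpull_def mpull_def)
  have 2: "P (?a, ?b) = P (y \<circ> v, y)" by (rule vpairs_cong[OF P]) (simp_all add: mat_diag_def)
  show ?thesis using 1 2 by simp
qed

definition diag_restriction :: "nat \<Rightarrow> ((nat \<Rightarrow> complex) \<times> complex mat \<Rightarrow> complex) \<Rightarrow> (nat \<Rightarrow> complex) \<times> (nat \<Rightarrow> complex) \<Rightarrow> complex" where
  "diag_restriction n C z = C (snd z, mat_diag n (fst z))"

lemma pfun_mat_diag: "e \<in> entries n \<Longrightarrow> (\<lambda>y. e (mat_diag n y)) \<in> pfun V (vcoords n)"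
proof -
  assume "e \<in> entries n"
  then obtain i j where "i < n" "j < n" "e = (\<lambda>x. x $$ (i, j))" by (auto simp: entries_def)
  then show ?thesis using pfun_vcoord[of i n V] by (cases "i = j") (simp_all add: mat_diag_def pfun_const)
qed

lemma diag_restriction_pfun:
  assumes C: "C \<in> pfun UNIV (prod_coords (vcoords n) (entries n))"
  shows "diag_restriction n C \<in> vpairs n"
  unfolding diag_restriction_def
proof (rule pfun_comp_pair[of C UNIV UNIV])
  show "C \<in> pfun (UNIV \<times> UNIV) (prod_coords (vcoords n) (entries n))" using C by simp
  fix e assume "e \<in> vcoords n"
  then show "(\<lambda>z. e (snd z)) \<in> vpairs n" by (rule pfun_snd[OF pfun_coord])
next
  fix e assume "e \<in> entries n"
  then show "(\<lambda>z. e (mat_diag n (fst z))) \<in> vpairs n" by (rule pfun_fst[OF pfun_mat_diag])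
qed auto

lemma mpull_diag_restriction:
  assumes C: "C \<in> pfun UNIV (prod_coords (vcoords n) (entries n))"
  shows "(\<lambda>z\<in>GB n. mpull n C z - vpull n (diag_restriction n C) z) \<in> fixed_ideal n"
  by (rule fixed_ideal_cong[OF diagonal_part_congruent[OF C]]) (auto simp: vpull_def mpull_def diag_restriction_def)

section \<open>Eigenvector minors\<close>

text \<open>\<open>strip n b S t\<close> is the product of the commuting operators \<open>b - b\<^sub>r\<^sub>r\<close> over all \<open>r < t\<close> outside \<open>S\<close>.
  The vectors \<open>strip n b S j e\<^sub>j\<close> with \<open>j \<in> S\<close> span generically the sum of the eigenspaces of the
  upper triangular matrix \<open>b\<close> for the eigenvalues with index in \<open>S\<close>.\<close>

primrec strip :: "nat \<Rightarrow> complex mat \<Rightarrow> nat set \<Rightarrow> nat \<Rightarrow> (nat \<Rightarrow> complex) \<Rightarrow> nat \<Rightarrow> complex" where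
  "strip n b S 0 u = u"
| "strip n b S (Suc t) u = strip n b S t (if t \<in> S then u else (\<lambda>i. mv n b u i - b $$ (t, t) * u i))"

lemma strip_add: "strip n b S t (\<lambda>i. u i + u' i) = (\<lambda>i. strip n b S t u i + strip n b S t u' i)"
proof (induction t arbitrary: u u')
  case (Suc t)
  have "(\<lambda>i. mv n b (\<lambda>i. u i + u' i) i - b $$ (t, t) * (u i + u' i)) =
    (\<lambda>i. (mv n b u i - b $$ (t, t) * u i) + (mv n b u' i - b $$ (t, t) * u' i))"
    by (auto simp: mv_add algebra_simps)
  then show ?case using Suc by simp
qed simp

lemma strip_cmult: "strip n b S t (\<lambda>i. c * u i) = (\<lambda>i. c * strip n b S t u i)"
proof (induction t arbitrary: u)
  case (Suc t)
  have "(\<lambda>i. mv n b (\<lambda>i. c * u i) i - b $$ (t, t) * (c * u i)) = (\<lambda>i. c * (mv n b u i - b $$ (t, t) * u i))"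
    by (auto simp: mv_cmult algebra_simps)
  then show ?case using Suc by simp
qed simp

lemma strip_cong:
  "(\<And>k. k < n \<Longrightarrow> u k = u' k) \<Longrightarrow> i < n \<Longrightarrow> strip n b S t u i = strip n b S t u' i"
proof (induction t arbitrary: u u')
  case (Suc t)
  show ?case unfolding strip.simps
    by (rule Suc.IH) (use Suc.prems mv_cong[of n u u' b] in auto)
qed simp

lemma strip_intertwine:
  assumes "p \<in> carrier_mat n n" "b \<in> carrier_mat n n" "b' \<in> carrier_mat n n" "p * b' = b * p"
    and d: "\<And>i. i < n \<Longrightarrow> b' $$ (i, i) = b $$ (i, i)" and "t \<le> n" "i < n"
  shows "mv n p (strip n b' S t u) i = strip n b S t (mv n p u) i"
  using assms(6)
proof (induction t arbitrary: u)
  case (Suc t)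
  show ?case
  proof (cases "t \<in> S")
    case False
    have eq: "mv n p (\<lambda>i. mv n b' u i - b' $$ (t, t) * u i) k = mv n b (mv n p u) k - b $$ (t, t) * mv n p u k"
      if "k < n" for k
      using mv_mult[OF assms(1,3) that, of u] mv_mult[OF assms(2,1) that, of u] assms(4) d[of t] Suc.prems
      by (simp add: mv_diff mv_cmult)
    have "mv n p (strip n b' S (Suc t) u) i = strip n b S t (mv n p (\<lambda>i. mv n b' u i - b' $$ (t, t) * u i)) i"
      using False Suc by simp
    also have "\<dots> = strip n b S t (\<lambda>k. mv n b (mv n p u) k - b $$ (t, t) * mv n p u k) i"
      by (rule strip_cong[OF eq assms(7)])
    finally show ?thesis using False by simp
  qed (use Suc in simp)
qed simp

text \<open>An index j outside S removes the top coordinate, by applying b - b_jj; an index j in S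
  splits it off as a multiple of \<open>strip n b S j (unit_fun j)\<close>.\<close>

lemma strip_span:
  assumes b: "b \<in> carrier_mat n n" "upper_triangular b"
  shows "j \<le> n \<Longrightarrow> (\<And>i. j \<le> i \<Longrightarrow> i < n \<Longrightarrow> z i = 0) \<Longrightarrow>
    \<exists>c. \<forall>i<n. strip n b S j z i = (\<Sum>l\<in>S \<inter> {..<j}. c l * strip n b S l (unit_fun l) i)"
proof (induction j arbitrary: z)
  case 0
  then show ?case by simp
next
  case (Suc j)
  show ?case
  proof (cases "j \<in> S")
    case True
    define z' where "z' i = (if i = j then 0 else z i)" for i
    have "\<exists>c. \<forall>i<n. strip n b S j z' i = (\<Sum>l\<in>S \<inter> {..<j}. c l * strip n b S l (unit_fun l) i)"
      by (rule Suc.IH) (use Suc.prems in \<open>auto simp: z'_def\<close>)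
    then obtain c where c: "\<And>i. i < n \<Longrightarrow> strip n b S j z' i = (\<Sum>l\<in>S \<inter> {..<j}. c l * strip n b S l (unit_fun l) i)"
      by blast
    have z: "z = (\<lambda>i. z' i + z j * unit_fun j i)" by (auto simp: z'_def unit_fun_def)
    have "S \<inter> {..<Suc j} = insert j (S \<inter> {..<j})" using True by auto
    then have "\<forall>i<n. strip n b S (Suc j) z i = (\<Sum>l\<in>S \<inter> {..<Suc j}. (c(j := z j)) l * strip n b S l (unit_fun l) i)"
      using True c by (subst z) (auto simp: strip_add strip_cmult intro!: sum.cong)
    then show ?thesis by blast
  next
    case False
    let ?z = "\<lambda>i. mv n b z i - b $$ (j, j) * z i"
    have "?z i = 0" if i: "j \<le> i" "i < n" for i
    proof -
      have "mv n b z i = (\<Sum>k\<in>{i}. b $$ (i, k) * z k)"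
        unfolding mv_def
      proof (rule sum.mono_neutral_right)
        show "\<forall>k\<in>{..<n} - {i}. b $$ (i, k) * z k = 0"
        proof
          fix k assume "k \<in> {..<n} - {i}"
          then show "b $$ (i, k) * z k = 0"
            using b Suc.prems(2)[of k] i by (cases "k < i") auto
        qed
      qed (use i in auto)
      then show ?thesis using Suc.prems(2)[of i] i by (cases "i = j") auto
    qed
    then have "\<exists>c. \<forall>i<n. strip n b S j ?z i = (\<Sum>l\<in>S \<inter> {..<j}. c l * strip n b S l (unit_fun l) i)"
      by (intro Suc.IH) (use Suc.prems in auto)
    moreover have "S \<inter> {..<Suc j} = S \<inter> {..<j}" using False less_Suc_eq by auto
    ultimately show ?thesis using False by simp
  qed
qed

text \<open>For a permutation \<open>\<rho>\<close>, expansion along the constant columns gives, up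
  to sign, the minor with rows in \<rho>(S) of the vectors
  \<open>strip n b S j (unit_fun j)\<close>, j in S, transported by g. Completing the minor to an n
  by n matrix avoids submatrices.\<close>

definition eigen_minor :: "nat \<Rightarrow> nat set \<Rightarrow> (nat \<Rightarrow> nat) \<Rightarrow> complex mat \<times> complex mat \<Rightarrow> complex" where
  "eigen_minor n S \<rho> z = det (mat n n (\<lambda>(i, j).
     if j \<in> S then mv n (fst z) (strip n (snd z) S j (unit_fun j)) i else if i = \<rho> j then 1 else 0))"

text \<open>Right translation by p acts on the columns with index in S by a triangular matrix with
  diagonal entries p_jj, so the minor is a semi-invariant whose weight is the product of these
  entries.\<close>

lemma eigen_minor_borel:
  assumes g: "g \<in> carrier (SL n)" and b: "b \<in> borel_lie n" and p: "p \<in> carrier (SL n)" "upper_triangular p"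
  shows "eigen_minor n S \<rho> (g * p, inv\<^bsub>SL n\<^esub> p * b * p) = (\<Prod>j\<in>S \<inter> {..<n}. p $$ (j, j)) * eigen_minor n S \<rho> (g, b)"
proof -
  let ?b = "inv\<^bsub>SL n\<^esub> p * b * p"
  note bm = borel_mat[OF b] and b' = borel_action[OF p b]
  have m: "g \<in> carrier_mat n n" "p \<in> carrier_mat n n" "?b \<in> carrier_mat n n"
    using g p borel_mat(1)[OF b'(1)] by (auto simp: SL_carrier)
  have pb: "p * ?b = b * p"
  proof -
    have "p * ?b * inv\<^bsub>SL n\<^esub> p * p = b * p" using conj_carrier(4)[OF p(1) bm(1)] by simp
    then show ?thesis using conj_carrier(2)[OF p(1) m(3)] by simp
  qed
  have "\<exists>c. \<forall>i<n. strip n b S j (\<lambda>i. if i < j then p $$ (i, j) else 0) i =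
      (\<Sum>l\<in>S \<inter> {..<j}. c l * strip n b S l (unit_fun l) i)" if "j < n" for j
    by (rule strip_span[OF bm(1,2)]) (use that in auto)
  then have "\<forall>j. \<exists>c. j < n \<longrightarrow> (\<forall>i<n. strip n b S j (\<lambda>i. if i < j then p $$ (i, j) else 0) i =
      (\<Sum>l\<in>S \<inter> {..<j}. c l * strip n b S l (unit_fun l) i))" by blast
  from choice[OF this]
  obtain c where c: "\<And>j i. j < n \<Longrightarrow> i < n \<Longrightarrow> strip n b S j (\<lambda>i. if i < j then p $$ (i, j) else 0) i =
      (\<Sum>l\<in>S \<inter> {..<j}. c j l * strip n b S l (unit_fun l) i)" by blast
  define M where "M z = mat n n (\<lambda>(i, j).
     if j \<in> S then mv n (fst z) (strip n (snd z) S j (unit_fun j)) i else if i = \<rho> j then 1 else 0)" for z :: "complex mat \<times> complex mat"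
  \<comment> \<open>Column operations: p e_j is p_jj e_j plus a vector supported on indices below j,
    and by \<open>strip_span\<close> the latter contributes only columns l < j with l in S.\<close>
  define C where "C = mat n n (\<lambda>(l, j). if l = j then (if j \<in> S then p $$ (j, j) else 1)
    else if l < j \<and> j \<in> S \<and> l \<in> S then c j l else 0)"
  have "M (g * p, ?b) = M (g, b) * C"
  proof (rule eq_matI)
    fix i j assume "i < dim_row (M (g, b) * C)" "j < dim_col (M (g, b) * C)"
    then have ij: "i < n" "j < n" by (auto simp: M_def C_def)
    have R: "(M (g, b) * C) $$ (i, j) = (\<Sum>l<n. M (g, b) $$ (i, l) * C $$ (l, j))"
      by (rule index_mult_mat_sum[of _ n n _ n]) (use ij in \<open>auto simp: M_def C_def\<close>)
    show "M (g * p, ?b) $$ (i, j) = (M (g, b) * C) $$ (i, j)"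
    proof (cases "j \<in> S")
      case False
      have "(\<Sum>l<n. M (g, b) $$ (i, l) * C $$ (l, j)) = (\<Sum>l\<in>{j}. M (g, b) $$ (i, l) * C $$ (l, j))"
        by (rule sum.mono_neutral_right) (use False ij in \<open>auto simp: C_def\<close>)
      then show ?thesis unfolding R using False ij by (simp add: M_def C_def)
    next
      case True
      let ?e = "\<lambda>l. strip n b S l (unit_fun l)"
      have pe: "mv n p (unit_fun j) k = p $$ (j, j) * unit_fun j k + (if k < j then p $$ (k, j) else 0)" if "k < n" for k
      proof -
        have "mv n p (unit_fun j) k = (\<Sum>l<n. if l = j then p $$ (k, j) else 0)"
          unfolding mv_def by (intro sum.cong) (auto simp: unit_fun_def)
        then have "mv n p (unit_fun j) k = p $$ (k, j)" using ij by (simp add: sum.delta)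
        then show ?thesis using p(2) m(2) that ij by (cases "k < j"; cases "k = j") (auto simp: unit_fun_def)
      qed
      have col: "mv n p (strip n ?b S j (unit_fun j)) k = p $$ (j, j) * ?e j k + (\<Sum>l\<in>S \<inter> {..<j}. c j l * ?e l k)"
        if "k < n" for k
      proof -
        have "mv n p (strip n ?b S j (unit_fun j)) k = strip n b S j (mv n p (unit_fun j)) k"
          by (rule strip_intertwine[OF m(2) bm(1) m(3) pb b'(2)]) (use ij that in auto)
        also have "\<dots> = strip n b S j (\<lambda>k. p $$ (j, j) * unit_fun j k + (if k < j then p $$ (k, j) else 0)) k"
          by (rule strip_cong[OF pe that])
        also have "\<dots> = p $$ (j, j) * ?e j k + strip n b S j (\<lambda>k. if k < j then p $$ (k, j) else 0) k"
          by (simp add: strip_add strip_cmult)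
        finally show ?thesis using c[OF ij(2) that] by simp
      qed
      have "M (g * p, ?b) $$ (i, j) = mv n (g * p) (strip n ?b S j (unit_fun j)) i"
        using True ij by (simp add: M_def)
      also have "\<dots> = mv n g (mv n p (strip n ?b S j (unit_fun j))) i" by (rule mv_mult[OF m(1,2) ij(1)])
      also have "\<dots> = mv n g (\<lambda>k. p $$ (j, j) * ?e j k + (\<Sum>l\<in>S \<inter> {..<j}. c j l * ?e l k)) i"
        using mv_cong[OF col, where x = g] by simp
      also have "\<dots> = p $$ (j, j) * mv n g (?e j) i + (\<Sum>l\<in>S \<inter> {..<j}. c j l * mv n g (?e l) i)"
        by (simp add: mv_add mv_cmult mv_sum)
      finally have L: "M (g * p, ?b) $$ (i, j) = \<dots>" .
      have "(\<Sum>l<n. M (g, b) $$ (i, l) * C $$ (l, j)) = (\<Sum>l\<in>insert j (S \<inter> {..<j}). M (g, b) $$ (i, l) * C $$ (l, j))"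
        by (rule sum.mono_neutral_right) (use True ij in \<open>auto simp: C_def\<close>)
      also have "\<dots> = M (g, b) $$ (i, j) * C $$ (j, j) + (\<Sum>l\<in>S \<inter> {..<j}. M (g, b) $$ (i, l) * C $$ (l, j))"
        by (rule sum.insert) auto
      also have "(\<Sum>l\<in>S \<inter> {..<j}. M (g, b) $$ (i, l) * C $$ (l, j)) = (\<Sum>l\<in>S \<inter> {..<j}. c j l * mv n g (?e l) i)"
        by (intro sum.cong refl) (use True ij in \<open>auto simp: M_def C_def\<close>)
      finally show ?thesis unfolding R L using True ij by (simp add: M_def C_def mult.commute)
    qed
  qed (auto simp: M_def C_def)
  moreover have "det C = (\<Prod>j\<in>S \<inter> {..<n}. p $$ (j, j))"
  proof -
    have "det C = (\<Prod>j<n. C $$ (j, j))"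
      by (rule det_upper_triangular_prod) (auto simp: C_def)
    also have "\<dots> = (\<Prod>j<n. if j \<in> S then p $$ (j, j) else 1)" by (intro prod.cong) (auto simp: C_def)
    also have "\<dots> = (\<Prod>j\<in>S \<inter> {..<n}. p $$ (j, j))"
      by (rule prod.mono_neutral_cong_right) auto
    finally show ?thesis .
  qed
  ultimately show ?thesis
    unfolding eigen_minor_def M_def[symmetric] by (simp add: det_mult[of _ n] M_def C_def)
qed

lemma pfun_strip:
  assumes A: "\<And>i j. i < n \<Longrightarrow> j < n \<Longrightarrow> (\<lambda>z. A z $$ (i, j)) \<in> pfun V E"
  shows "(\<And>k. k < n \<Longrightarrow> (\<lambda>z. u z k) \<in> pfun V E) \<Longrightarrow> t \<le> n \<Longrightarrow> i < n \<Longrightarrow> (\<lambda>z. strip n (A z) S t (u z) i) \<in> pfun V E"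
proof (induction t arbitrary: u)
  case (Suc t)
  show ?case
  proof (cases "t \<in> S")
    case True then show ?thesis using Suc by simp
  next
    case False
    have "(\<lambda>z. strip n (A z) S t (\<lambda>i. mv n (A z) (u z) i - A z $$ (t, t) * u z i) i) \<in> pfun V E"
      by (rule Suc.IH) (use Suc.prems in \<open>auto intro!: pfun_diff pfun_mult pfun_mv A\<close>)
    then show ?thesis using False by simp
  qed
qed simp

lemma eigen_minor_pfun: "eigen_minor n S \<rho> \<in> pfun (GB n) (pair_entries n)"
proof -
  have e: "(\<lambda>z. fst z $$ (i, j)) \<in> pfun (GB n) (pair_entries n)" "(\<lambda>z. snd z $$ (i, j)) \<in> pfun (GB n) (pair_entries n)"
    if "i < n" "j < n" for i j
    unfolding pair_entries_eq by (rule pfun_fst[OF pfun_entry[OF that]], rule pfun_snd[OF pfun_entry[OF that]])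
  have "(\<lambda>z. if j \<in> S then mv n (fst z) (strip n (snd z) S j (unit_fun j)) i else if i = \<rho> j then 1 else 0)
    \<in> pfun (GB n) (pair_entries n)" if "i < n" "j < n" for i j
  proof (cases "j \<in> S")
    case True
    then show ?thesis using that by (auto intro!: pfun_mv pfun_strip e pfun_const)
  next
    case False
    then show ?thesis by (simp add: pfun_const)
  qed
  then show ?thesis unfolding eigen_minor_def[abs_def] by (intro pfun_det) auto
qed

lemma eigen_minor_regf: "restrict (eigen_minor n S \<rho>) (GB n) \<in> regf n"
  unfolding regf_def
proof (intro CollectI conjI ballI)
  show "restrict (eigen_minor n S \<rho>) (GB n) \<in> pfun_on (GB n) (pair_entries n)"
    by (rule restrict_pfun_on[OF eigen_minor_pfun])
  fix u g b assume u: "u \<in> unipotent n" "g \<in> carrier (SL n)" "b \<in> borel_lie n"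
  note U = unipotentD[OF u(1)]
  have "(g * u, inv\<^bsub>SL n\<^esub> u * b * u) \<in> GB n" using u U by (auto intro!: SL_mult borel_action)
  then show "restrict (eigen_minor n S \<rho>) (GB n) (g * u, inv\<^bsub>SL n\<^esub> u * b * u) = restrict (eigen_minor n S \<rho>) (GB n) (g, b)"
    using eigen_minor_borel[OF u(2,3) U(1,2), of S \<rho>] u U(3) by simp
qed

lemma eigen_minor_torus:
  assumes s: "s \<in> torus n" and z: "z \<in> GB n"
  shows "restrict (eigen_minor n S \<rho>) (GB n) (torus_point n (1\<^sub>m n, s) z) =
    (\<Prod>j\<in>S \<inter> {..<n}. s $$ (j, j)) * restrict (eigen_minor n S \<rho>) (GB n) z"
proof -
  obtain g b where gb: "z = (g, b)" "g \<in> carrier (SL n)" "b \<in> borel_lie n" using z by auto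
  have "g \<in> carrier_mat n n" using gb by (simp add: SL_carrier)
  then have "torus_point n (1\<^sub>m n, s) z = (g * s, inv\<^bsub>SL n\<^esub> s * b * s)" using gb by (simp add: torus_point_def)
  then show ?thesis
    using eigen_minor_borel[OF gb(2,3) torusD(1,3)[OF s], of S \<rho>] torus_point_GB[OF torus_one s z] gb(1) z by simp
qed

lemma strip_diagonal:
  assumes t: "t \<le> n" and j: "j < n" "i < n"
  shows "strip n (mat_diag n y) S t (unit_fun j) i = (\<Prod>r\<in>{..<t} - S. y j - y r) * unit_fun j i"
  using t
proof (induction t)
  case (Suc t)
  show ?case
  proof (cases "t \<in> S")
    case True
    then have "{..<Suc t} - S = {..<t} - S" using less_Suc_eq by auto
    then show ?thesis using True Suc by simp
  next
    case False
    have mv: "mv n (mat_diag n y) (unit_fun j) k = y j * unit_fun j k" if "k < n" for k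
    proof -
      have "mv n (mat_diag n y) (unit_fun j) k = (\<Sum>l<n. if l = j then (if k = j then y j else 0) else 0)"
        unfolding mv_def using that by (intro sum.cong) (auto simp: unit_fun_def mat_diag_def)
      then show ?thesis using j by (simp add: sum.delta unit_fun_def)
    qed
    have "strip n (mat_diag n y) S (Suc t) (unit_fun j) i =
        strip n (mat_diag n y) S t (\<lambda>k. (y j - y t) * unit_fun j k) i"
    proof -
      have "strip n (mat_diag n y) S t (\<lambda>k. mv n (mat_diag n y) (unit_fun j) k - mat_diag n y $$ (t, t) * unit_fun j k) i =
          strip n (mat_diag n y) S t (\<lambda>k. (y j - y t) * unit_fun j k) i"
        by (rule strip_cong[OF _ j(2)]) (use Suc.prems mv in \<open>simp add: mat_diag_def algebra_simps\<close>)
      then show ?thesis using False by simp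
    qed
    also have "\<dots> = (y j - y t) * ((\<Prod>r\<in>{..<t} - S. y j - y r) * unit_fun j i)"
      using Suc by (simp add: strip_cmult)
    also have "{..<Suc t} - S = insert t ({..<t} - S)" using False by auto
    then have "(y j - y t) * ((\<Prod>r\<in>{..<t} - S. y j - y r) * unit_fun j i) = (\<Prod>r\<in>{..<Suc t} - S. y j - y r) * unit_fun j i"
      by simp
    finally show ?thesis .
  qed
qed simp

definition minor_mat :: "nat \<Rightarrow> nat set \<Rightarrow> (nat \<Rightarrow> nat) \<Rightarrow> (nat \<Rightarrow> nat) \<Rightarrow> (nat \<Rightarrow> complex) \<Rightarrow> complex mat" where
  "minor_mat n S \<rho> v y = mat n n (\<lambda>(i, j).
     if j \<in> S then (\<Prod>r\<in>{..<j} - S. y j - y r) * weyl_lift n v $$ (i, j) else if i = \<rho> j then 1 else 0)"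

lemma eigen_minor_weyl: "eigen_minor n S \<rho> (weyl_lift n v, mat_diag n y) = det (minor_mat n S \<rho> v y)"
proof -
  have "mv n (weyl_lift n v) (strip n (mat_diag n y) S j (unit_fun j)) i =
    (\<Prod>r\<in>{..<j} - S. y j - y r) * weyl_lift n v $$ (i, j)" if "i < n" "j < n" for i j
  proof -
    have "mv n (weyl_lift n v) (strip n (mat_diag n y) S j (unit_fun j)) i =
      mv n (weyl_lift n v) (\<lambda>k. (\<Prod>r\<in>{..<j} - S. y j - y r) * unit_fun j k) i"
      by (rule fun_cong[OF mv_cong]) (rule strip_diagonal, use that in auto)
    also have "\<dots> = (\<Prod>r\<in>{..<j} - S. y j - y r) * (\<Sum>l<n. if l = j then weyl_lift n v $$ (i, l) else 0)"
      unfolding mv_cmult mv_def by (intro arg_cong2[of _ _ _ _ "(*)"] sum.cong refl) (simp add: unit_fun_def)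
    finally show ?thesis using that by (simp add: sum.delta)
  qed
  then show ?thesis
    unfolding eigen_minor_def minor_mat_def by (intro arg_cong[of _ _ det] eq_matI) auto
qed

text \<open>The matrix of \<open>\<rho>\<close> is placed between the two minor matrices. For j in S
  the second one has the constant column e_(\<rho> j), which now selects column j of the first. For
  j outside S, \<open>vS\<close> puts the nonzero row of column j into the image under
  \<open>\<rho>\<close> of the complement of S, where the first has constant columns and restores
  it. The result is the lift of v with rescaled columns.\<close>

lemma minor_mat_product:
  assumes n: "0 < n" and v: "v permutes {..<n}" and \<rho>: "\<rho> permutes {..<n}" and S: "S \<subseteq> {..<n}"
    and vS: "\<And>i. i < n \<Longrightarrow> v i \<in> S \<longleftrightarrow> i \<in> \<rho> ` S"
  shows "det (minor_mat n S \<rho> v y) * det (minor_mat n ({..<n} - S) \<rho> v y) * det (perm_mat n \<rho>) =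
    (\<Prod>j\<in>S. \<Prod>r\<in>{..<j} - S. y j - y r) * (\<Prod>j\<in>{..<n} - S. \<Prod>r\<in>{..<j} - ({..<n} - S). y j - y r)"
proof -
  let ?S' = "{..<n} - S" and ?w = "weyl_lift n v" and ?R = "perm_mat n \<rho>"
  define c where "c j = (if j \<in> S then (\<Prod>r\<in>{..<j} - S. y j - y r) else (\<Prod>r\<in>{..<j} - ?S'. y j - y r))" for j
  have inj\<rho>: "\<rho> i = \<rho> j \<longleftrightarrow> i = j" for i j using permutes_inj[OF \<rho>] by (auto simp: inj_def)
  have lt: "\<rho> i < n" if "i < n" for i using permutes_in_image[OF \<rho>, of i] that by simp
  have m: "minor_mat n S \<rho> v y \<in> carrier_mat n n" "minor_mat n ?S' \<rho> v y \<in> carrier_mat n n" "?R \<in> carrier_mat n n"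
    "?w \<in> carrier_mat n n"
    by (auto simp: minor_mat_def perm_mat_def weyl_lift_def)
  have RM: "(?R * minor_mat n ?S' \<rho> v y) $$ (i, j) = minor_mat n ?S' \<rho> v y $$ (\<rho> i, j)" if ij: "i < n" "j < n" for i j
  proof -
    have "(?R * minor_mat n ?S' \<rho> v y) $$ (i, j) = (\<Sum>l<n. if l = \<rho> i then minor_mat n ?S' \<rho> v y $$ (l, j) else 0)"
      unfolding index_mult_mat_sum[OF m(3,2) ij] using ij by (intro sum.cong) (auto simp: perm_mat_def)
    then show ?thesis using lt[OF ij(1)] by (simp add: sum.delta)
  qed
  have Rc: "?R * minor_mat n ?S' \<rho> v y \<in> carrier_mat n n" using m by simp
  have "minor_mat n S \<rho> v y * (?R * minor_mat n ?S' \<rho> v y) = ?w * mat_diag n c"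
  proof (rule eq_matI)
    fix i j assume "i < dim_row (?w * mat_diag n c)" "j < dim_col (?w * mat_diag n c)"
    then have ij: "i < n" "j < n" using m by (auto simp: mat_diag_def)
    have R: "(?w * mat_diag n c) $$ (i, j) = ?w $$ (i, j) * c j"
      using ij by (subst mat_diag_mult_right[OF m(4)]) simp
    have L: "(minor_mat n S \<rho> v y * (?R * minor_mat n ?S' \<rho> v y)) $$ (i, j) =
      (\<Sum>l<n. minor_mat n S \<rho> v y $$ (i, l) * minor_mat n ?S' \<rho> v y $$ (\<rho> l, j))"
      unfolding index_mult_mat_sum[OF m(1) Rc ij] using ij by (intro sum.cong refl) (simp add: RM)
    show "(minor_mat n S \<rho> v y * (?R * minor_mat n ?S' \<rho> v y)) $$ (i, j) = (?w * mat_diag n c) $$ (i, j)"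
    proof (cases "j \<in> S")
      case True
      have "(\<Sum>l<n. minor_mat n S \<rho> v y $$ (i, l) * minor_mat n ?S' \<rho> v y $$ (\<rho> l, j)) =
        (\<Sum>l<n. if l = j then minor_mat n S \<rho> v y $$ (i, l) else 0)"
        using True ij lt by (intro sum.cong refl) (auto simp: minor_mat_def inj\<rho>)
      also have "\<dots> = ?w $$ (i, j) * c j" using True ij by (simp add: sum.delta minor_mat_def c_def mult.commute)
      finally show ?thesis using L R by simp
    next
      case False
      have "(\<Sum>l<n. minor_mat n S \<rho> v y $$ (i, l) * minor_mat n ?S' \<rho> v y $$ (\<rho> l, j)) =
        (\<Sum>l<n. if \<rho> l = i then c j * ?w $$ (i, j) else 0)"
      proof (intro sum.cong refl)
        fix l assume l: "l \<in> {..<n}"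
        have M2: "minor_mat n ?S' \<rho> v y $$ (\<rho> l, j) = c j * ?w $$ (\<rho> l, j)"
          using False ij lt l by (simp add: minor_mat_def c_def)
        show "minor_mat n S \<rho> v y $$ (i, l) * minor_mat n ?S' \<rho> v y $$ (\<rho> l, j) = (if \<rho> l = i then c j * ?w $$ (i, j) else 0)"
        proof (cases "?w $$ (\<rho> l, j) = 0")
          case True
          then show ?thesis using M2 by auto
        next
          case nz: False
          then have vj: "v (\<rho> l) = j" using ij lt l by (auto simp: weyl_lift_def split: if_splits)
          then have "l \<notin> S" using vS[OF lt, of l] False l by auto
          then show ?thesis using M2 ij l by (simp add: minor_mat_def)
        qed
      qed
      also have "\<dots> = (\<Sum>l<n. if l = inv_into UNIV \<rho> i then c j * ?w $$ (i, j) else 0)"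
      proof (intro sum.cong refl)
        fix l
        have "l = inv_into UNIV \<rho> i \<longleftrightarrow> \<rho> l = i" using permutes_inv_eq[OF \<rho>, of i l] by auto
        then show "(if \<rho> l = i then c j * ?w $$ (i, j) else 0) = (if l = inv_into UNIV \<rho> i then c j * ?w $$ (i, j) else 0)"
          by simp
      qed
      also have "\<dots> = ?w $$ (i, j) * c j"
        using permutes_in_image[OF permutes_inv[OF \<rho>], of i] ij by (simp add: sum.delta mult.commute)
      finally show ?thesis using L R by simp
    qed
  qed (use m in \<open>auto simp: mat_diag_def\<close>)
  then have "det (minor_mat n S \<rho> v y) * (det ?R * det (minor_mat n ?S' \<rho> v y)) = det ?w * det (mat_diag n c)"
    using det_mult[OF m(1) Rc] det_mult[OF m(3,2)] det_mult[OF m(4) mat_diag_dim[of n c]] by simp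
  moreover have "det ?w = 1" using weyl_lift_SL[OF n v] by (simp add: SL_carrier)
  moreover have "det (mat_diag n c) = (\<Prod>j\<in>S. c j) * (\<Prod>j\<in>?S'. c j)"
    unfolding det_diag_nonzero using S by (subst prod.union_disjoint[symmetric]) (auto intro: finite_subset arg_cong[of _ _ "prod c"])
  moreover have "(\<Prod>j\<in>S. c j) = (\<Prod>j\<in>S. \<Prod>r\<in>{..<j} - S. y j - y r)" by (simp add: c_def)
  moreover have "(\<Prod>j\<in>?S'. c j) = (\<Prod>j\<in>?S'. \<Prod>r\<in>{..<j} - ?S'. y j - y r)" by (simp add: c_def)
  ultimately show ?thesis by (simp add: mult_ac)
qed

text \<open>The only nonzero entry of row i of the lift lies in column v i, outside S, and no
  constant column hits row i since i is in \<rho>(S). So row i of the minor matrix is zero.\<close>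

lemma minor_mat_zero:
  assumes v: "v permutes {..<n}" and \<rho>: "\<rho> permutes {..<n}" and i: "i < n" "v i \<notin> S" "i \<in> \<rho> ` S"
  shows "det (minor_mat n S \<rho> v y) = 0"
proof -
  have row: "minor_mat n S \<rho> v y $$ (i, j) = 0" if "j < n" for j
  proof -
    have "i \<noteq> \<rho> j" if "j \<notin> S" using i(3) that permutes_inj[OF \<rho>] by (auto simp: inj_def)
    then show ?thesis using i \<open>j < n\<close> by (auto simp: minor_mat_def weyl_lift_def)
  qed
  have "det (minor_mat n S \<rho> v y) = (\<Sum>p\<in>{p. p permutes {0..<n}}. signof p * (\<Prod>k = 0..<n. minor_mat n S \<rho> v y $$ (k, p k)))"
    by (rule det_def') (simp add: minor_mat_def)
  also have "\<dots> = 0"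
  proof (rule sum.neutral, rule ballI)
    fix p assume "p \<in> {p. p permutes {0..<n}}"
    then have "p i < n" using i permutes_nat_less by blast
    then have "(\<Prod>k = 0..<n. minor_mat n S \<rho> v y $$ (k, p k)) = 0"
      using i row[of "p i"] by (intro prod_zero) auto
    then show "signof p * (\<Prod>k = 0..<n. minor_mat n S \<rho> v y $$ (k, p k)) = 0" by simp
  qed
  finally show ?thesis .
qed

section \<open>The relations hold on the fixed points\<close>

definition block_prod :: "nat set \<Rightarrow> nat set \<Rightarrow> (nat \<Rightarrow> complex) \<times> (nat \<Rightarrow> complex) \<Rightarrow> complex" where
  "block_prod I S' z = (\<Prod>i\<in>I. \<Prod>t\<in>S'. fst z i - snd z t)"

lemma block_prod_pfun: "I \<subseteq> {..<n} \<Longrightarrow> S' \<subseteq> {..<n} \<Longrightarrow> block_prod I S' \<in> vpairs n"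
  unfolding block_prod_def
  by (intro pfun_prod pfun_diff pfun_fst[of "\<lambda>y. y _"] pfun_snd[of "\<lambda>y. y _"] pfun_vcoord) auto

lemma permutation_with_image:
  assumes "S \<subseteq> {..<n}" "I \<subseteq> {..<n}" "card S = card I"
  shows "\<exists>\<rho>. \<rho> permutes {..<n} \<and> \<rho> ` S = (I :: nat set)"
proof -
  have fin: "finite S" "finite I" using assms finite_subset by auto
  obtain h where h: "bij_betw h S I" using finite_same_card_bij[OF fin assms(3)] by blast
  have "card ({..<n} - S) = card ({..<n} - I)" using assms fin by (simp add: card_Diff_subset)
  then obtain k where k: "bij_betw k ({..<n} - S) ({..<n} - I)" using finite_same_card_bij[of "{..<n} - S" "{..<n} - I"] by blast
  define \<rho> where "\<rho> i = (if i \<in> S then h i else if i < n then k i else i)" for i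
  have "bij_betw \<rho> S I" using h by (rule bij_betw_cong[THEN iffD1, rotated]) (simp add: \<rho>_def)
  moreover have "bij_betw \<rho> ({..<n} - S) ({..<n} - I)"
    using k by (rule bij_betw_cong[THEN iffD1, rotated]) (simp add: \<rho>_def)
  ultimately have "bij_betw \<rho> (S \<union> ({..<n} - S)) (I \<union> ({..<n} - I))" by (rule bij_betw_combine) auto
  moreover have "S \<union> ({..<n} - S) = {..<n}" "I \<union> ({..<n} - I) = {..<n}" using assms by auto
  ultimately have "bij_betw \<rho> {..<n} {..<n}" by simp
  then have "\<rho> permutes {..<n}" by (rule bij_imp_permutes) (use assms in \<open>auto simp: \<rho>_def\<close>)
  moreover have "\<rho> ` S = I" using \<open>bij_betw \<rho> S I\<close> by (simp add: bij_betw_def)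
  ultimately show ?thesis by blast
qed

lemma prod_subset_single:
  assumes "s \<in> torus n" "S \<subseteq> {..<n}"
  shows "(\<Prod>j\<in>S. s $$ (j, j)) * (\<Prod>j\<in>{..<n} - S. s $$ (j, j)) = 1"
proof -
  have "(\<Prod>j\<in>S. s $$ (j, j)) * (\<Prod>j\<in>{..<n} - S. s $$ (j, j)) = (\<Prod>j<n. s $$ (j, j))"
    using assms(2) by (subst prod.union_disjoint[symmetric]) (auto intro: finite_subset arg_cong[of _ _ "prod _"])
  then show ?thesis using SL_upper_triangular(1)[OF torusD(1,3)[OF assms(1)]] by simp
qed

text \<open>With S the complement of S', the minors for S and S' have opposite B/U-weights, so their
  product descends to a polynomial P in (x, y); it lies in the ideal because the first minor does.
  On the permutation graphs P is a nonzero constant times the block product, hence equal to it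
  modulo differences of symmetric functions.\<close>

lemma block_prod_in_fixed_ideal:
  assumes n: "0 < n" and I: "I \<subseteq> {..<n}" "S' \<subseteq> {..<n}" "I \<noteq> {}" "S' \<noteq> {}" "card I + card S' = n"
  shows "vpull n (block_prod I S') \<in> fixed_ideal n"
proof -
  define S where "S = {..<n} - S'"
  have fin: "finite I" "finite S'" "finite S" using I finite_subset by (auto simp: S_def)
  have S: "S \<subseteq> {..<n}" "{..<n} - S = S'" "card S = card I"
    using I fin by (auto simp: S_def card_Diff_subset)
  then have "S \<noteq> {}" using I(3) fin by (metis card_eq_0_iff)
  then obtain j0 where j0: "j0 \<in> S" "j0 < n" using S by auto
  obtain j1 where j1: "j1 \<in> S'" "j1 < n" using I by auto
  have j01: "j0 \<noteq> j1" "j1 \<notin> S" using j0 j1 S by (auto simp: S_def)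
  obtain \<rho> where \<rho>: "\<rho> permutes {..<n}" "\<rho> ` S = I" using permutation_with_image[OF S(1) I(1) S(3)] by blast
  define u where "u = restrict (eigen_minor n S \<rho>) (GB n)"
  define u' where "u' = restrict (eigen_minor n S' \<rho>) (GB n)"
  have uA: "u \<in> regf n" "u' \<in> regf n" unfolding u_def u'_def by (rule eigen_minor_regf)+
  have uI: "u \<in> fixed_ideal n"
  \<comment> \<open>The test element has 2 at j0 in S and 1/2 at j1 outside S, so the product over S
    is 2.\<close>
  proof (rule weight_in_fixed_ideal[OF uA(1) torus_one two_point_torus[OF j0(2) j1(2) j01(1)], where c = 2])
    fix z assume z: "z \<in> GB n"
    let ?s = "mat_diag n (\<lambda>k. if k = j0 then 2 else if k = j1 then 1 / 2 else (1 :: complex))"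
    have "(\<Prod>j\<in>S \<inter> {..<n}. ?s $$ (j, j)) = (\<Prod>j\<in>S \<inter> {..<n}. if j = j0 then 2 else 1)"
      using j01 by (intro prod.cong) (auto simp: mat_diag_def)
    also have "\<dots> = 2" using j0 fin by (simp add: prod.delta)
    finally show "u (torus_point n (1\<^sub>m n, ?s) z) = 2 * u z"
      using eigen_minor_torus[OF two_point_torus[OF j0(2) j1(2) j01(1)] z, of S \<rho>] by (simp add: u_def)
  qed simp
  define w where "w = (\<lambda>z\<in>GB n. u' z * u z)"
  have wA: "w \<in> regf n" unfolding w_def by (rule cotD(4)[OF uA(2,1)])
  have wI: "w \<in> fixed_ideal n" unfolding w_def by (rule fixed_ideal_mult[OF uA(2) uI])
  have "w (torus_point n (1\<^sub>m n, s) z) = w z" if s: "s \<in> torus n" and z: "z \<in> GB n" for s z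
  proof -
    have "S \<inter> {..<n} = S" "S' \<inter> {..<n} = S'" using S I by auto
    then have "w (torus_point n (1\<^sub>m n, s) z) = ((\<Prod>j\<in>S. s $$ (j, j)) * (\<Prod>j\<in>{..<n} - S. s $$ (j, j))) * (u' z * u z)"
      using eigen_minor_torus[OF s z] torus_point_GB[OF torus_one s z] S(2) by (simp add: w_def u_def u'_def)
    then show ?thesis using prod_subset_single[OF s S(1)] z by (simp add: w_def)
  qed
  then obtain C where C: "C \<in> pfun UNIV (prod_coords (vcoords n) (entries n))" "w = mpull n C"
    using regf_descends[OF n wA] by blast
  define P where "P = diag_restriction n C"
  have P: "P \<in> vpairs n" unfolding P_def by (rule diag_restriction_pfun[OF C(1)])
  have PI: "vpull n P \<in> fixed_ideal n"
  proof -
    note 1 = fixed_ideal_mult[OF cotD(2)[of "-1"] mpull_diag_restriction[OF C(1), folded C(2) P_def]]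
    show ?thesis
      by (rule fixed_ideal_cong[OF fixed_ideal_add[OF wI 1] vpull_ext]) auto
  qed
  \<comment> \<open>The sign that arises from writing y_t - y_s as -(y_s - y_t) for the pairs with s
    < t.\<close>
  define \<kappa> :: complex where "\<kappa> = (\<Prod>s\<in>S. \<Prod>t\<in>S'. if t < s then 1 else - 1)"
  have \<kappa>: "\<kappa> \<noteq> 0" unfolding \<kappa>_def using fin by auto
  have prods: "(\<Prod>j\<in>S. \<Prod>r\<in>{..<j} - S. y j - y r) * (\<Prod>j\<in>{..<n} - S. \<Prod>r\<in>{..<j} - ({..<n} - S). y j - y r) =
      \<kappa> * (\<Prod>s\<in>S. \<Prod>t\<in>S'. y s - y t)" for y :: "nat \<Rightarrow> complex"
  proof -
    have "(\<Prod>j\<in>S. \<Prod>r\<in>{..<j} - S. y j - y r) = (\<Prod>s\<in>S. \<Prod>t\<in>S'. if t < s then y s - y t else 1)"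
    proof (rule prod.cong[OF refl])
      fix s assume "s \<in> S"
      then show "(\<Prod>r\<in>{..<s} - S. y s - y r) = (\<Prod>t\<in>S'. if t < s then y s - y t else 1)"
        using S fin I by (intro prod.mono_neutral_cong_left) (auto simp: S_def)
    qed
    moreover have "(\<Prod>j\<in>{..<n} - S. \<Prod>r\<in>{..<j} - ({..<n} - S). y j - y r) = (\<Prod>t\<in>S'. \<Prod>s\<in>S. if t < s then 1 else y t - y s)"
      unfolding S(2)
    proof (rule prod.cong[OF refl])
      fix t assume t: "t \<in> S'"
      then have "t \<notin> S" "t < n" using I by (auto simp: S_def)
      then show "(\<Prod>r\<in>{..<t} - S'. y t - y r) = (\<Prod>s\<in>S. if t < s then 1 else y t - y s)"
      proof (intro prod.mono_neutral_cong_left ballI)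
        show "{..<t} - S' \<subseteq> S" using \<open>t < n\<close> by (auto simp: S_def)
        fix s assume "s \<in> S - ({..<t} - S')"
        then have "\<not> s < t" "s \<noteq> t" using \<open>t \<notin> S\<close> by (auto simp: S_def)
        then show "(if t < s then 1 else y t - y s) = 1" by simp
      qed (use fin in auto)
    qed
    moreover have "(\<Prod>t\<in>S'. \<Prod>s\<in>S. if t < s then 1 else y t - y s) = (\<Prod>s\<in>S. \<Prod>t\<in>S'. if t < s then 1 else y t - y s)"
      by (rule prod.swap)
    ultimately have "(\<Prod>j\<in>S. \<Prod>r\<in>{..<j} - S. y j - y r) * (\<Prod>j\<in>{..<n} - S. \<Prod>r\<in>{..<j} - ({..<n} - S). y j - y r) =
      (\<Prod>s\<in>S. \<Prod>t\<in>S'. (if t < s then y s - y t else 1) * (if t < s then 1 else y t - y s))"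
      by (simp add: prod.distrib)
    also have "\<dots> = (\<Prod>s\<in>S. \<Prod>t\<in>S'. (if t < s then 1 else - 1) * (y s - y t))"
      by (intro prod.cong refl) auto
    finally show ?thesis by (simp add: prod.distrib \<kappa>_def)
  qed
  let ?\<delta> = "det (perm_mat n \<rho>)"
  have graph: "?\<delta> * P (y \<circ> v, y) = \<kappa> * block_prod I S' (y \<circ> v, y)"
    if v: "v permutes {..<n}" and y: "(\<Sum>i<n. y i) = 0" for v y
  proof -
    have lt: "v i < n" if "i < n" for i using permutes_in_image[OF v, of i] that by simp
    have "P (y \<circ> v, y) = w (weyl_lift n v, mat_diag n y)"
      using mpull_weyl[OF n v y C(1)] C(2) by (simp add: P_def diag_restriction_def)
    also have "\<dots> = det (minor_mat n S' \<rho> v y) * det (minor_mat n S \<rho> v y)"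
      using weyl_point(1)[OF n v y] by (simp add: w_def u_def u'_def eigen_minor_weyl)
    finally have Pd: "P (y \<circ> v, y) = det (minor_mat n S' \<rho> v y) * det (minor_mat n S \<rho> v y)" .
    show ?thesis
    proof (cases "v ` I \<subseteq> S")
      case True
      have inj: "inj_on v A" for A using permutes_inj[OF v] by (simp add: inj_on_def)
      have "v ` I = S" using True card_subset_eq[OF fin(3)] card_image[OF inj] S(3) by metis
      then have vS: "v i \<in> S \<longleftrightarrow> i \<in> \<rho> ` S" if "i < n" for i
        using \<rho>(2) inj_on_image_mem_iff[OF inj, of i UNIV I] by auto
      have "?\<delta> * P (y \<circ> v, y) = \<kappa> * (\<Prod>s\<in>S. \<Prod>t\<in>S'. y s - y t)"
        using minor_mat_product[OF n v \<rho>(1) S(1) vS, of y] prods[of y] unfolding Pd S(2) by (simp add: mult_ac)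
      also have "(\<Prod>s\<in>S. \<Prod>t\<in>S'. y s - y t) = block_prod I S' (y \<circ> v, y)"
        unfolding \<open>v ` I = S\<close>[symmetric] prod.reindex[OF inj] by (simp add: block_prod_def)
      finally show ?thesis .
    next
      case False
      then obtain i where i: "i \<in> I" "v i \<notin> S" by auto
      then have "i < n" using I by auto
      then have "det (minor_mat n S \<rho> v y) = 0" using minor_mat_zero[OF v \<rho>(1) _ i(2)] i \<rho>(2) by blast
      moreover have "v i \<in> S'" using i lt[OF \<open>i < n\<close>] by (simp add: S_def)
      then have "(\<Prod>t\<in>S'. (y \<circ> v) i - y t) = 0" using fin by (intro prod_zero) auto
      then have "block_prod I S' (y \<circ> v, y) = 0" unfolding block_prod_def using fin i by (intro prod_zero) auto
      ultimately show ?thesis using Pd by simp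
    qed
  qed
  define Q where "Q z = ?\<delta> * P z - \<kappa> * block_prod I S' z" for z
  have Q: "Q \<in> vpairs n" unfolding Q_def by (intro pfun_diff pfun_cmult P block_prod_pfun I)
  obtain D where D: "D \<in> sym_differences n" "\<And>x y. (\<Sum>i<n. x i) = 0 \<Longrightarrow> (\<Sum>i<n. y i) = 0 \<Longrightarrow> Q (x, y) = D (x, y)"
    using vanish_on_graphs_traceless[OF n Q] graph by (auto simp: Q_def)
  have "vpull n Q = vpull n D" by (rule vpull_cong) (rule D(2))
  then have QI: "vpull n Q \<in> fixed_ideal n" using sym_difference_in_fixed_ideal[OF D(1)] by simp
  note 1 = fixed_ideal_add[OF fixed_ideal_mult[OF cotD(2)[of "?\<delta> / \<kappa>"] PI] fixed_ideal_mult[OF cotD(2)[of "- 1 / \<kappa>"] QI]]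
  show ?thesis
    by (rule fixed_ideal_cong[OF 1 vpull_ext]) (use \<kappa> in \<open>auto simp: vpull_def mpull_def Q_def field_simps\<close>)
qed

text \<open>The ideal of the claimed quotient, taken among polynomials in (x, y). On traceless
  vectors it is to coincide with the preimage of \<open>fixed_ideal n\<close> under
  \<open>vpull n\<close>.\<close>

inductive_set relations :: "nat \<Rightarrow> ((nat \<Rightarrow> complex) \<times> (nat \<Rightarrow> complex) \<Rightarrow> complex) set" for n where
  sym: "D \<in> sym_differences n \<Longrightarrow> D \<in> relations n"
| block: "I \<subseteq> {..<n} \<Longrightarrow> S' \<subseteq> {..<n} \<Longrightarrow> I \<noteq> {} \<Longrightarrow> S' \<noteq> {} \<Longrightarrow> card I + card S' = n \<Longrightarrow> H \<in> vpairs n \<Longrightarrow>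
    (\<lambda>z. block_prod I S' z * H z) \<in> relations n"
| plus: "F \<in> relations n \<Longrightarrow> G \<in> relations n \<Longrightarrow> (\<lambda>z. F z + G z) \<in> relations n"

lemma relations_mult: "F \<in> relations n \<Longrightarrow> P \<in> vpairs n \<Longrightarrow> (\<lambda>z. P z * F z) \<in> relations n"
proof (induction rule: relations.induct)
  case (sym D)
  then show ?case by (intro relations.sym sym_differences_mult)
next
  case (block I S' H)
  from relations.block[OF block(1-5) pfun_mult[OF block(7,6)]] show ?case by (simp add: mult_ac)
next
  case (plus F G)
  then show ?case using relations.plus by (force simp: distrib_left)
qed

section \<open>Weights\<close>

text \<open>A character is stored as a function on T times T and not as a pair of exponent vectors,
  since exponents that differ by a constant define the same character of the torus of SL_n.
  Restriction to the torus makes equality of characters equality of functions.\<close>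

definition weight_char :: "nat \<Rightarrow> (nat \<Rightarrow> int) \<Rightarrow> (nat \<Rightarrow> int) \<Rightarrow> complex mat \<times> complex mat \<Rightarrow> complex" where
  "weight_char n l m = (\<lambda>p\<in>torus n \<times> torus n.
    (\<Prod>i<n. fst p $$ (i, i) powi l i) * (\<Prod>i<n. snd p $$ (i, i) powi m i))"

definition characters :: "nat \<Rightarrow> (complex mat \<times> complex mat \<Rightarrow> complex) set" where
  "characters n = {weight_char n l m | l m. True}"

abbreviation one_char :: "nat \<Rightarrow> complex mat \<times> complex mat \<Rightarrow> complex" where
  "one_char n \<equiv> weight_char n (\<lambda>_. 0) (\<lambda>_. 0)"

definition char_mult :: "nat \<Rightarrow> (complex mat \<times> complex mat \<Rightarrow> complex) \<Rightarrow> (complex mat \<times> complex mat \<Rightarrow> complex)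
    \<Rightarrow> complex mat \<times> complex mat \<Rightarrow> complex" where
  "char_mult n \<chi> \<psi> = (\<lambda>p\<in>torus n \<times> torus n. \<chi> p * \<psi> p)"

lemma torus_nonzero: "t \<in> torus n \<Longrightarrow> i < n \<Longrightarrow> t $$ (i, i) \<noteq> 0"
  using SL_upper_triangular(2)[OF torusD(1,3)] .

lemma one_char: "p \<in> torus n \<times> torus n \<Longrightarrow> one_char n p = 1"
  by (simp add: weight_char_def)

lemma one_char_in: "one_char n \<in> characters n"
  unfolding characters_def by blast

lemma char_mult_in:
  assumes "\<chi> \<in> characters n" "\<psi> \<in> characters n"
  shows "char_mult n \<chi> \<psi> \<in> characters n"
proof -
  obtain l m l' m' where *: "\<chi> = weight_char n l m" "\<psi> = weight_char n l' m'" using assms by (auto simp: characters_def)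
  have "char_mult n \<chi> \<psi> = weight_char n (\<lambda>i. l i + l' i) (\<lambda>i. m i + m' i)"
  proof
    fix p
    show "char_mult n \<chi> \<psi> p = weight_char n (\<lambda>i. l i + l' i) (\<lambda>i. m i + m' i) p"
    proof (cases "p \<in> torus n \<times> torus n")
      case True
      have "(\<Prod>i<n. fst p $$ (i, i) powi (l i + l' i)) = (\<Prod>i<n. fst p $$ (i, i) powi l i * fst p $$ (i, i) powi l' i)"
        "(\<Prod>i<n. snd p $$ (i, i) powi (m i + m' i)) = (\<Prod>i<n. snd p $$ (i, i) powi m i * snd p $$ (i, i) powi m' i)"
        using True torus_nonzero by (auto intro!: prod.cong simp: power_int_add)
      then show ?thesis using True by (simp add: char_mult_def weight_char_def * prod.distrib mult_ac)
    qed (auto simp: char_mult_def weight_char_def)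
  qed
  then show ?thesis by (auto simp: characters_def)
qed

lemma torus_mult_entry: "t \<in> torus n \<Longrightarrow> s \<in> torus n \<Longrightarrow> i < n \<Longrightarrow> (t * s) $$ (i, i) = t $$ (i, i) * s $$ (i, i)"
  using upper_triangular_mult(2)[OF torusD(2) torusD(2) torusD(3) torusD(3)] .

lemma character_mult:
  assumes "\<chi> \<in> characters n" "p \<in> torus n \<times> torus n" "q \<in> torus n \<times> torus n"
  shows "\<chi> (fst p * fst q, snd p * snd q) = \<chi> p * \<chi> q"
proof -
  obtain l m where *: "\<chi> = weight_char n l m" using assms by (auto simp: characters_def)
  have e: "(fst p * fst q) $$ (i, i) = fst p $$ (i, i) * fst q $$ (i, i)" "(snd p * snd q) $$ (i, i) = snd p $$ (i, i) * snd q $$ (i, i)"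
    if "i < n" for i using torus_mult_entry[of _ n _ i] assms that by auto
  have m: "(fst p * fst q, snd p * snd q) \<in> torus n \<times> torus n" using assms torus_mult by auto
  have "(\<Prod>i<n. (fst p * fst q) $$ (i, i) powi l i) = (\<Prod>i<n. fst p $$ (i, i) powi l i * fst q $$ (i, i) powi l i)"
    "(\<Prod>i<n. (snd p * snd q) $$ (i, i) powi m i) = (\<Prod>i<n. snd p $$ (i, i) powi m i * snd q $$ (i, i) powi m i)"
    by (auto intro!: prod.cong simp: e power_int_mult_distrib)
  then show ?thesis using m assms(2,3) by (simp add: * weight_char_def prod.distrib mult_ac)
qed

lemma character_one: "\<chi> \<in> characters n \<Longrightarrow> \<chi> (1\<^sub>m n, 1\<^sub>m n) = 1"
  using torus_one by (auto simp: characters_def weight_char_def)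

text \<open>Dedekind's argument: with q separating \<chi> from \<psi>, the relation at p q and
  \<psi>(q) times the relation at p differ by a relation in which \<psi> no longer occurs.\<close>

lemma characters_independent:
  assumes "finite X" "X \<subseteq> characters n"
    and "\<And>p. p \<in> torus n \<times> torus n \<Longrightarrow> (\<Sum>\<chi>\<in>X. a \<chi> * \<chi> p) = 0" "\<chi> \<in> X"
  shows "a \<chi> = 0"
  using assms
proof (induction X arbitrary: a \<chi> rule: finite_induct)
  case empty then show ?case by simp
next
  case (insert \<psi> X)
  have \<psi>: "\<psi> \<in> characters n" and X: "X \<subseteq> characters n" using insert.prems by auto
  have rel: "a \<psi> * \<psi> p + (\<Sum>\<chi>\<in>X. a \<chi> * \<chi> p) = 0" if "p \<in> torus n \<times> torus n" for p
    using insert.prems(2)[OF that] insert.hyps by simp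
  have zero: "a \<chi> = 0" if \<chi>: "\<chi> \<in> X" for \<chi>
  proof -
    have ext: "\<chi> \<in> extensional (torus n \<times> torus n)" "\<psi> \<in> extensional (torus n \<times> torus n)"
      using X \<psi> \<chi> by (auto simp: characters_def weight_char_def)
    have "\<chi> \<noteq> \<psi>" using \<chi> insert.hyps by auto
    then obtain q where q: "q \<in> torus n \<times> torus n" "\<chi> q \<noteq> \<psi> q"
      using extensional_eqI[OF ext] by blast
    have "(\<Sum>\<chi>\<in>X. (a \<chi> * (\<psi> q - \<chi> q)) * \<chi> p) = 0" if p: "p \<in> torus n \<times> torus n" for p
    proof -
      have pq: "(fst p * fst q, snd p * snd q) \<in> torus n \<times> torus n" using p q torus_mult by auto
      have aux: "A + x = 0 \<Longrightarrow> A + y = 0 \<Longrightarrow> y - x = 0" for A x y :: complex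
        by (metis add_left_imp_eq diff_self)
      have "a \<psi> * \<psi> p * \<psi> q + (\<Sum>\<chi>\<in>X. a \<chi> * (\<chi> p * \<chi> q)) = 0"
        using rel[OF pq] character_mult[OF \<psi> p q(1)] character_mult[OF subsetD[OF X] p q(1)] by (simp add: mult.assoc)
      moreover have "a \<psi> * \<psi> p * \<psi> q + (\<Sum>\<chi>\<in>X. a \<chi> * \<chi> p) * \<psi> q = 0"
        using arg_cong[OF rel[OF p], of "\<lambda>x. x * \<psi> q"] by (simp add: distrib_right)
      ultimately have "(\<Sum>\<chi>\<in>X. a \<chi> * \<chi> p) * \<psi> q - (\<Sum>\<chi>\<in>X. a \<chi> * (\<chi> p * \<chi> q)) = 0"
        by (rule aux)
      moreover have "(\<Sum>\<chi>\<in>X. (a \<chi> * (\<psi> q - \<chi> q)) * \<chi> p) =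
          (\<Sum>\<chi>\<in>X. a \<chi> * \<chi> p) * \<psi> q - (\<Sum>\<chi>\<in>X. a \<chi> * (\<chi> p * \<chi> q))"
        unfolding sum_distrib_right sum_subtractf[symmetric] by (intro sum.cong refl) (simp add: algebra_simps)
      ultimately show ?thesis by simp
    qed
    from insert.IH[OF X this \<chi>] show ?thesis using q(2) by simp
  qed
  have one: "(1\<^sub>m n, 1\<^sub>m n) \<in> torus n \<times> torus n" using torus_one by auto
  have "a \<psi> = 0" using rel[OF one] character_one[OF \<psi>] zero by simp
  then show ?case using zero insert.prems by auto
qed

definition has_weight :: "nat \<Rightarrow> (complex mat \<times> complex mat \<Rightarrow> complex) \<Rightarrow> (complex mat \<times> complex mat \<Rightarrow> complex) \<Rightarrow> bool" where
  "has_weight n \<chi> f \<longleftrightarrow> (\<forall>p\<in>torus n \<times> torus n. \<forall>z\<in>GB n. f (torus_point n p z) = \<chi> p * f z)"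

lemma torus_point_GB': "p \<in> torus n \<times> torus n \<Longrightarrow> z \<in> GB n \<Longrightarrow> torus_point n p z \<in> GB n"
  using torus_point_GB[of "fst p" n "snd p" z] by (cases p) auto

inductive_set weight_sums :: "nat \<Rightarrow> (complex mat \<times> complex mat \<Rightarrow> complex) set" for n where
  hom: "f \<in> pfun (GB n) (pair_entries n) \<Longrightarrow> \<chi> \<in> characters n \<Longrightarrow> has_weight n \<chi> f \<Longrightarrow> f \<in> weight_sums n"
| plus: "f \<in> weight_sums n \<Longrightarrow> g \<in> weight_sums n \<Longrightarrow> (\<lambda>z. f z + g z) \<in> weight_sums n"

lemma weight_sums_mult:
  assumes "f \<in> weight_sums n" "g \<in> weight_sums n"
  shows "(\<lambda>z. f z * g z) \<in> weight_sums n"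
  using assms(1)
proof induction
  case (hom f \<chi>)
  show ?case using assms(2)
  proof induction
    case (hom g \<psi>)
    show ?case
      by (rule weight_sums.hom[OF pfun_mult char_mult_in[of \<chi> n \<psi>]])
        (use hom \<open>f \<in> pfun (GB n) (pair_entries n)\<close> \<open>\<chi> \<in> characters n\<close> \<open>has_weight n \<chi> f\<close> in
          \<open>auto simp: has_weight_def char_mult_def\<close>)
  next
    case (plus f g) then show ?case using weight_sums.plus by (force simp: distrib_left)
  qed
next
  case (plus f f') then show ?case using weight_sums.plus by (force simp: distrib_right)
qed

lemma torus_point_entries:
  assumes p: "p \<in> torus n \<times> torus n" and z: "z \<in> GB n" and ij: "i < n" "j < n"
  shows "fst (torus_point n p z) $$ (i, j) = fst p $$ (i, i) * snd p $$ (j, j) * fst z $$ (i, j)"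
    "snd (torus_point n p z) $$ (i, j) = snd p $$ (j, j) / snd p $$ (i, i) * snd z $$ (i, j)"
proof -
  obtain t s g b where *: "p = (t, s)" "t \<in> torus n" "s \<in> torus n" "z = (g, b)" "g \<in> carrier_mat n n" "b \<in> carrier_mat n n"
    using p z by (auto simp: SL_carrier dest: borel_mat)
  note T = torusD[OF *(2)] and S = torusD[OF *(3)]
  have tg: "t * g = mat n n (\<lambda>(i, j). t $$ (i, i) * g $$ (i, j))"
    using mat_diag_mult_left[OF *(5), of "diag_fun t"] T(5) by simp
  have tgs: "t * g * s = mat n n (\<lambda>(i, j). (t * g) $$ (i, j) * s $$ (j, j))"
    using mat_diag_mult_right[of "t * g" n n "diag_fun s"] S(5) T *(5) by simp
  have sb: "inv\<^bsub>SL n\<^esub> s * b = mat n n (\<lambda>(i, j). 1 / s $$ (i, i) * b $$ (i, j))"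
    unfolding S(6) by (rule mat_diag_mult_left[OF *(6)])
  have "inv\<^bsub>SL n\<^esub> s * b \<in> carrier_mat n n" using inv_SL(2)[OF S(1)] *(6) by simp
  then have sbs: "inv\<^bsub>SL n\<^esub> s * b * s = mat n n (\<lambda>(i, j). (inv\<^bsub>SL n\<^esub> s * b) $$ (i, j) * s $$ (j, j))"
    using mat_diag_mult_right[of "inv\<^bsub>SL n\<^esub> s * b" n n "diag_fun s"] S(5) by simp
  show "fst (torus_point n p z) $$ (i, j) = fst p $$ (i, i) * snd p $$ (j, j) * fst z $$ (i, j)"
    using ij by (simp add: *(1,4) torus_point_def tgs) (simp add: tg mult_ac)
  show "snd (torus_point n p z) $$ (i, j) = snd p $$ (j, j) / snd p $$ (i, i) * snd z $$ (i, j)"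
    using ij by (simp add: *(1,4) torus_point_def sbs) (simp add: sb mult_ac)
qed

lemma prod_powi_indicator:
  fixes t :: "nat \<Rightarrow> complex"
  assumes "i < n"
  shows "(\<Prod>k<n. t k powi (if k = i then c else 0)) = t i powi c"
proof -
  have "(\<Prod>k<n. t k powi (if k = i then c else 0)) = (\<Prod>k<n. if k = i then t k powi c else 1)"
    by (intro prod.cong) auto
  then show ?thesis using assms by (simp add: prod.delta)
qed

lemma pfun_weight_sums:
  assumes "f \<in> pfun (GB n) (pair_entries n)"
  shows "\<exists>g\<in>weight_sums n. \<forall>z\<in>GB n. f z = g z"
  using assms
proof induction
  case (const c)
  show ?case
    by (rule bexI[OF _ weight_sums.hom[OF pfun_const[of c] one_char_in]]) (auto simp: has_weight_def one_char)
next
  case (coord e)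
  then consider i j where "i < n" "j < n" "e = (\<lambda>z. fst z $$ (i, j))" | i j where "i < n" "j < n" "e = (\<lambda>z. snd z $$ (i, j))"
    by (auto simp: pair_entries_eq prod_coords_def entries_def)
  then have "\<exists>\<chi>\<in>characters n. has_weight n \<chi> e"
  proof cases
    case 1
    let ?\<chi> = "weight_char n (\<lambda>k. if k = i then 1 else 0) (\<lambda>k. if k = j then 1 else 0)"
    have "?\<chi> \<in> characters n" unfolding characters_def by blast
    moreover have "has_weight n ?\<chi> e" unfolding has_weight_def
      using 1 by (simp add: torus_point_entries weight_char_def prod_powi_indicator)
    ultimately show ?thesis by blast
  next
    case 2
    \<comment> \<open>The entry (i, j) of b has weight s_j / s_i; the two exponents are added so
      that they cancel when i = j.\<close>
    have "weight_char n (\<lambda>_. 0) (\<lambda>k. (if k = j then 1 else 0) + (if k = i then - 1 else 0)) p = snd p $$ (j, j) / snd p $$ (i, i)"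
      if p: "p \<in> torus n \<times> torus n" for p
    proof -
      have "(\<Prod>k<n. snd p $$ (k, k) powi ((if k = j then 1 else 0) + (if k = i then - 1 else 0))) =
        (\<Prod>k<n. snd p $$ (k, k) powi (if k = j then 1 else 0) * snd p $$ (k, k) powi (if k = i then - 1 else 0))"
        using p torus_nonzero by (intro prod.cong refl power_int_add) auto
      then show ?thesis using p 2
        by (simp add: weight_char_def prod.distrib prod_powi_indicator power_int_minus divide_inverse)
    qed
    then show ?thesis
      by (intro bexI[of _ "weight_char n (\<lambda>_. 0) (\<lambda>k. (if k = j then 1 else 0) + (if k = i then - 1 else 0))"])
        (use 2 in \<open>auto simp: has_weight_def torus_point_entries characters_def\<close>)
  qed
  then show ?case using weight_sums.hom[OF pfun_coord[OF coord]] by blast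
next
  case (add f g)
  then obtain f' g' where "f' \<in> weight_sums n" "g' \<in> weight_sums n" "\<forall>z\<in>GB n. f z = f' z" "\<forall>z\<in>GB n. g z = g' z" by blast
  then show ?case by (intro bexI[OF _ weight_sums.plus[of f' n g']]) auto
next
  case (mult f g)
  then obtain f' g' where "f' \<in> weight_sums n" "g' \<in> weight_sums n" "\<forall>z\<in>GB n. f z = f' z" "\<forall>z\<in>GB n. g z = g' z" by blast
  then show ?case by (intro bexI[OF _ weight_sums_mult[of f' n g']]) auto
next
  case (cong f g) then show ?case by auto
qed

lemma weight_sums_decompose:
  assumes "f \<in> weight_sums n"
  shows "\<exists>X F. finite X \<and> X \<subseteq> characters n \<and> (\<forall>\<chi>\<in>X. F \<chi> \<in> pfun (GB n) (pair_entries n) \<and> has_weight n \<chi> (F \<chi>)) \<and>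
    (\<forall>z. f z = (\<Sum>\<chi>\<in>X. F \<chi> z))"
  using assms
proof induction
  case (hom f \<chi>)
  then show ?case by (intro exI[of _ "{\<chi>}"] exI[of _ "\<lambda>_. f"]) auto
next
  case (plus f g)
  obtain X F where X: "finite X" "X \<subseteq> characters n" "\<forall>\<chi>\<in>X. F \<chi> \<in> pfun (GB n) (pair_entries n) \<and> has_weight n \<chi> (F \<chi>)"
    "\<forall>z. f z = (\<Sum>\<chi>\<in>X. F \<chi> z)" using plus.IH(1) by blast
  obtain Y G where Y: "finite Y" "Y \<subseteq> characters n" "\<forall>\<chi>\<in>Y. G \<chi> \<in> pfun (GB n) (pair_entries n) \<and> has_weight n \<chi> (G \<chi>)"
    "\<forall>z. g z = (\<Sum>\<chi>\<in>Y. G \<chi> z)" using plus.IH(2) by blast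
  define H where "H \<chi> z = (if \<chi> \<in> X then F \<chi> z else 0) + (if \<chi> \<in> Y then G \<chi> z else 0)" for \<chi> z
  have "H \<chi> \<in> pfun (GB n) (pair_entries n) \<and> has_weight n \<chi> (H \<chi>)" if "\<chi> \<in> X \<union> Y" for \<chi>
  proof
    show "H \<chi> \<in> pfun (GB n) (pair_entries n)"
      unfolding H_def using X(3) Y(3) by (intro pfun_add; cases "\<chi> \<in> X"; cases "\<chi> \<in> Y") (simp_all add: pfun_const)
    show "has_weight n \<chi> (H \<chi>)"
      using X(3) Y(3) by (auto simp: H_def has_weight_def algebra_simps)
  qed
  moreover have "f z + g z = (\<Sum>\<chi>\<in>X \<union> Y. H \<chi> z)" for z
  proof -
    have "(\<Sum>\<chi>\<in>X \<union> Y. if \<chi> \<in> X then F \<chi> z else 0) = (\<Sum>\<chi>\<in>X. F \<chi> z)"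
      "(\<Sum>\<chi>\<in>X \<union> Y. if \<chi> \<in> Y then G \<chi> z else 0) = (\<Sum>\<chi>\<in>Y. G \<chi> z)"
      using X(1) Y(1) by (auto intro!: sum.mono_neutral_cong_right)
    then show ?thesis by (simp only: H_def sum.distrib X(4)[rule_format, of z] Y(4)[rule_format, of z])
  qed
  ultimately show ?case using X(1,2) Y(1,2) by (intro exI[of _ "X \<union> Y"] exI[of _ H]) auto
qed

definition weight_decomposition :: "nat \<Rightarrow> (complex mat \<times> complex mat \<Rightarrow> complex) \<Rightarrow> (complex mat \<times> complex mat \<Rightarrow> complex) set
    \<Rightarrow> ((complex mat \<times> complex mat \<Rightarrow> complex) \<Rightarrow> complex mat \<times> complex mat \<Rightarrow> complex) \<Rightarrow> bool" where
  "weight_decomposition n f X F \<longleftrightarrow> finite X \<and> X \<subseteq> characters n \<and> one_char n \<in> X \<and>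
    (\<forall>\<chi>\<in>X. F \<chi> \<in> regf n \<and> has_weight n \<chi> (F \<chi>)) \<and> (\<forall>z\<in>GB n. f z = (\<Sum>\<chi>\<in>X. F \<chi> z))"

text \<open>The torus normalizes U, so each torus translate of f is again invariant under U.
  Comparing its weight expansions at a point and at its translate by u, independence of characters
  makes every component invariant.\<close>

lemma regf_decompose:
  assumes f: "f \<in> regf n"
  shows "\<exists>X F. weight_decomposition n f X F"
proof -
  have "f \<in> pfun (GB n) (pair_entries n)" using f by (auto simp: regf_def pfun_on_def)
  then obtain g where g: "g \<in> weight_sums n" "\<And>z. z \<in> GB n \<Longrightarrow> f z = g z" using pfun_weight_sums by blast
  obtain X F where X: "finite X" "X \<subseteq> characters n" "\<And>\<chi>. \<chi> \<in> X \<Longrightarrow> F \<chi> \<in> pfun (GB n) (pair_entries n)"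
    "\<And>\<chi>. \<chi> \<in> X \<Longrightarrow> has_weight n \<chi> (F \<chi>)" "\<And>z. g z = (\<Sum>\<chi>\<in>X. F \<chi> z)"
    using weight_sums_decompose[OF g(1)] by blast
  have U: "F \<chi> (g * u, inv\<^bsub>SL n\<^esub> u * b * u) = F \<chi> (g, b)"
    if \<chi>: "\<chi> \<in> X" and u: "u \<in> unipotent n" "g \<in> carrier (SL n)" "b \<in> borel_lie n" for \<chi> u g b
  proof -
    note U = unipotentD[OF u(1)]
    have z: "(g * u, inv\<^bsub>SL n\<^esub> u * b * u) \<in> GB n" "(g, b) \<in> GB n" using u U by (auto intro!: SL_mult borel_action)
    have "(\<Sum>\<chi>\<in>X. (F \<chi> (g * u, inv\<^bsub>SL n\<^esub> u * b * u) - F \<chi> (g, b)) * \<chi> p) = 0" if p: "p \<in> torus n \<times> torus n" for p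
    proof -
      have sum: "f (torus_point n p z) = (\<Sum>\<chi>\<in>X. F \<chi> z * \<chi> p)" if "z \<in> GB n" for z
      proof -
        have "F \<chi> (torus_point n p z) = F \<chi> z * \<chi> p" if "\<chi> \<in> X" for \<chi>
          using X(4)[OF that] p \<open>z \<in> GB n\<close> unfolding has_weight_def by (simp only: mult.commute)
        then show ?thesis using g(2)[OF torus_point_GB'[OF p that]] by (simp add: X(5))
      qed
      have "f (torus_point n p (g * u, inv\<^bsub>SL n\<^esub> u * b * u)) = f (torus_point n p (g, b))"
        using torus_point_unipotent(2)[of "fst p" n "snd p" u g b f] p u f by (cases p) auto
      then show ?thesis unfolding sum[OF z(1)] sum[OF z(2)] by (simp add: sum_subtractf left_diff_distrib)
    qed
    from characters_independent[OF X(1,2) this \<chi>] show ?thesis by simp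
  qed
  \<comment> \<open>If the trivial character does not occur in X, its component is zero; it is
    always listed so that it can be singled out later.\<close>
  define G where "G \<chi> = (if \<chi> \<in> X then restrict (F \<chi>) (GB n) else (\<lambda>z\<in>GB n. 0))" for \<chi>
  have GX: "G \<chi> \<in> regf n \<and> has_weight n \<chi> (G \<chi>)" if \<chi>: "\<chi> \<in> X" for \<chi>
  proof
    show "G \<chi> \<in> regf n" unfolding regf_def
    proof (intro CollectI conjI ballI)
      show "G \<chi> \<in> pfun_on (GB n) (pair_entries n)" using \<chi> restrict_pfun_on[OF X(3)[OF \<chi>]] by (simp add: G_def)
      fix u g b assume u: "u \<in> unipotent n" "g \<in> carrier (SL n)" "b \<in> borel_lie n"
      note U' = unipotentD[OF u(1)]
      have z: "(g * u, inv\<^bsub>SL n\<^esub> u * b * u) \<in> GB n" "(g, b) \<in> GB n" using u U' by (auto intro!: SL_mult borel_action)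
      then show "G \<chi> (g * u, inv\<^bsub>SL n\<^esub> u * b * u) = G \<chi> (g, b)" using \<chi> U[OF \<chi> u] by (simp add: G_def)
    qed
    show "has_weight n \<chi> (G \<chi>)" using X(4)[OF \<chi>] \<chi> torus_point_GB'[of _ n] by (simp add: has_weight_def G_def)
  qed
  have "weight_decomposition n f (insert (one_char n) X) G"
    unfolding weight_decomposition_def
  proof (intro conjI ballI)
    show "finite (insert (one_char n) X)" "insert (one_char n) X \<subseteq> characters n" "one_char n \<in> insert (one_char n) X"
      using X one_char_in by auto
    fix \<chi> assume "\<chi> \<in> insert (one_char n) X"
    then show "G \<chi> \<in> regf n" "has_weight n \<chi> (G \<chi>)"
      using GX cotD(2)[of 0 n] torus_point_GB'[of _ n] by (auto simp: G_def has_weight_def)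
  next
    fix z assume z: "z \<in> GB n"
    have "(\<Sum>\<chi>\<in>insert (one_char n) X. G \<chi> z) = (\<Sum>\<chi>\<in>X. F \<chi> z)"
      using X(1) z by (intro sum.mono_neutral_cong_right) (auto simp: G_def)
    then show "f z = (\<Sum>\<chi>\<in>insert (one_char n) X. G \<chi> z)" using g(2)[OF z] X(5) by simp
  qed
  then show ?thesis by blast
qed

text \<open>The comparison is made only at the points [v, y], because a polynomial on \<hh> times
  \<hh> is determined by these values modulo differences of symmetric functions.\<close>

definition weyl_related :: "nat \<Rightarrow> (complex mat \<times> complex mat \<Rightarrow> complex) \<Rightarrow> bool" where
  "weyl_related n f \<longleftrightarrow> (\<exists>G\<in>relations n. \<forall>v y. v permutes {..<n} \<longrightarrow> (\<Sum>i<n. y i) = 0 \<longrightarrow>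
    f (weyl_lift n v, mat_diag n y) = G (y \<circ> v, y))"

lemma relations_zero: "(\<lambda>z. 0) \<in> relations n"
  by (rule relations.sym[OF sym_differences_zero])

lemma relations_pfun: "F \<in> relations n \<Longrightarrow> F \<in> vpairs n"
proof (induction rule: relations.induct)
  case (sym D) then show ?case by (rule sym_differences_pfun)
next
  case (block I S' H) then show ?case by (intro pfun_mult block_prod_pfun)
next
  case (plus F G) then show ?case by (intro pfun_add)
qed

lemma prod_powi: "(\<Prod>i\<in>A. f i powi k) = (\<Prod>i\<in>A. f i :: complex) powi k"
  by (induction A rule: infinite_finite_induct) (simp_all add: power_int_mult_distrib)

lemma two_powi_inject:
  assumes "(2 :: complex) powi a = 2 powi b"
  shows "a = b"
proof -
  have "norm ((2 :: complex) powi a) = norm ((2 :: complex) powi b)" using assms by simp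
  then have eq: "(2 :: real) powi a = 2 powi b" by (simp add: norm_power_int)
  show ?thesis
    using power_int_strict_increasing[of a b "2 :: real"] power_int_strict_increasing[of b a "2 :: real"] eq
    by (cases a b rule: linorder_cases) auto
qed

text \<open>At the element with 2 at a and 1/2 at b the product is 2 to the power e_a - e_b.\<close>

lemma torus_weight_constant:
  assumes e: "\<And>s. s \<in> torus n \<Longrightarrow> (\<Prod>j<n. s $$ (j, j) powi e j) = 1" and ab: "a < n" "b < n"
  shows "e a = e b"
proof (cases "a = b")
  case False
  let ?d = "\<lambda>k. if k = a then 2 else if k = b then 1 / 2 else (1 :: complex)"
  have "1 = (\<Prod>j<n. mat_diag n ?d $$ (j, j) powi e j)" using e[OF two_point_torus[OF ab False]] by simp
  also have "\<dots> = (\<Prod>j\<in>{a, b}. mat_diag n ?d $$ (j, j) powi e j)"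
    using ab by (intro prod.mono_neutral_right) (auto simp: mat_diag_def)
  also have "\<dots> = 2 powi e a * (1 / 2) powi e b" using ab False by (simp add: mat_diag_def)
  also have "\<dots> = 2 powi e a / 2 powi e b" by (simp add: power_int_divide_distrib)
  finally have "2 powi e a = (2 :: complex) powi e b" by (simp add: field_simps)
  then show ?thesis by (rule two_powi_inject)
qed simp

text \<open>Row i of the lift has its only nonzero entry in column v i, so scaling row i by 1 / s_(v
  i) undoes the scaling of the columns by s.\<close>

lemma weyl_point_fixed:
  assumes n: "0 < n" and v: "v permutes {..<n}" and y: "(\<Sum>i<n. y i) = 0" and s: "s \<in> torus n"
  shows "mat_diag n (\<lambda>i. 1 / s $$ (v i, v i)) \<in> torus n"
    "torus_point n (mat_diag n (\<lambda>i. 1 / s $$ (v i, v i)), s) (weyl_lift n v, mat_diag n y) = (weyl_lift n v, mat_diag n y)"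
proof -
  let ?t = "mat_diag n (\<lambda>i. 1 / s $$ (v i, v i))" and ?z = "(weyl_lift n v, mat_diag n y)"
  have lt: "v i < n" if "i < n" for i using permutes_in_image[OF v, of i] that by simp
  have s0: "s $$ (i, i) \<noteq> 0" if "i < n" for i by (rule torus_nonzero[OF s that])
  have "(\<Prod>i<n. s $$ (v i, v i)) = (\<Prod>i<n. s $$ (i, i))"
    using prod.permute[OF v, of "\<lambda>i. s $$ (i, i)"] by (simp add: comp_def)
  then show t: "?t \<in> torus n"
    using SL_upper_triangular(1)[OF torusD(1,3)[OF s]] by (intro torusI) (simp add: prod_dividef)
  have p: "(?t, s) \<in> torus n \<times> torus n" using t s by simp
  note z = weyl_point(1)[OF n v y]
  note e = torus_point_entries[OF p z]
  have c: "fst (torus_point n (?t, s) ?z) \<in> carrier_mat n n" "snd (torus_point n (?t, s) ?z) \<in> carrier_mat n n"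
    using torus_point_GB'[OF p z] by (auto simp: mem_Times_iff SL_carrier dest: borel_mat)
  have w: "weyl_lift n v \<in> carrier_mat n n" by (simp add: weyl_lift_def)
  have "fst (torus_point n (?t, s) ?z) = weyl_lift n v"
  proof (rule eq_matI)
    fix i j assume "i < dim_row (weyl_lift n v)" "j < dim_col (weyl_lift n v)"
    then have ij: "i < n" "j < n" using w by auto
    show "fst (torus_point n (?t, s) ?z) $$ (i, j) = weyl_lift n v $$ (i, j)"
      using e(1)[OF ij] ij s0[OF ij(2)] by (cases "j = v i") (simp_all add: weyl_lift_def mat_diag_def)
  qed (use c w in auto)
  moreover have "snd (torus_point n (?t, s) ?z) = mat_diag n y"
  proof (rule eq_matI)
    fix i j assume "i < dim_row (mat_diag n y)" "j < dim_col (mat_diag n y)"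
    then have ij: "i < n" "j < n" by (auto simp: mat_diag_def)
    show "snd (torus_point n (?t, s) ?z) $$ (i, j) = mat_diag n y $$ (i, j)"
      using e(2)[OF ij] ij s0[OF ij(2)] by (cases "i = j") (simp_all add: mat_diag_def)
  qed (use c in \<open>auto simp: mat_diag_def\<close>)
  ultimately show "torus_point n (?t, s) ?z = ?z" by (rule prod_eqI[of _ ?z, unfolded fst_conv snd_conv])
qed

text \<open>Where u is nonzero, its character must be trivial on the stabilizer of the point. On the
  stabilizer found in \<open>weyl_point_fixed\<close> the character has exponents m_(v i) - l_i at
  s_(v i), and these must be constant because the determinant is 1.\<close>

lemma weight_support:
  assumes n: "0 < n" and v: "v permutes {..<n}" and y: "(\<Sum>i<n. y i) = 0"
    and u: "has_weight n (weight_char n l m) u" "u (weyl_lift n v, mat_diag n y) \<noteq> 0"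
    and ab: "a < n" "b < n"
  shows "m (v a) - l a = m (v b) - l b"
proof -
  let ?v' = "inv_into UNIV v"
  have inv: "?v' (v i) = i" for i using permutes_inverses(2)[OF v] .
  have lt: "v i < n" if "i < n" for i using permutes_in_image[OF v, of i] that by simp
  have "m (v a) - l (?v' (v a)) = m (v b) - l (?v' (v b))"
  proof (rule torus_weight_constant[where e = "\<lambda>j. m j - l (?v' j)"])
    fix s assume s: "s \<in> torus n"
    let ?t = "mat_diag n (\<lambda>i. 1 / s $$ (v i, v i))"
    have p: "(?t, s) \<in> torus n \<times> torus n" using weyl_point_fixed(1)[OF n v y s] s by simp
    have "weight_char n l m (?t, s) * u (weyl_lift n v, mat_diag n y) = u (weyl_lift n v, mat_diag n y)"
      using u(1) p weyl_point(1)[OF n v y] weyl_point_fixed(2)[OF n v y s] unfolding has_weight_def by metis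
    then have "weight_char n l m (?t, s) = 1" using u(2) by simp
    then have 1: "(\<Prod>i<n. (1 / s $$ (v i, v i)) powi l i) * (\<Prod>j<n. s $$ (j, j) powi m j) = 1"
      using p by (simp add: weight_char_def mat_diag_def)
    have "(\<Prod>j<n. (1 / s $$ (j, j)) powi l (?v' j)) = (\<Prod>i<n. (1 / s $$ (v i, v i)) powi l i)"
      using prod.permute[OF v, of "\<lambda>j. (1 / s $$ (j, j)) powi l (?v' j)"] by (simp add: comp_def inv)
    with 1 have "(\<Prod>j<n. (1 / s $$ (j, j)) powi l (?v' j) * s $$ (j, j) powi m j) = 1" by (simp add: prod.distrib)
    moreover have "(\<Prod>j<n. (1 / s $$ (j, j)) powi l (?v' j) * s $$ (j, j) powi m j) = (\<Prod>j<n. s $$ (j, j) powi (m j - l (?v' j)))"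
      using torus_nonzero[OF s] by (intro prod.cong refl) (simp add: power_int_diff power_int_divide_distrib)
    ultimately show "(\<Prod>j<n. s $$ (j, j) powi (m j - l (?v' j))) = 1" by simp
  qed (use lt ab in auto)
  then show ?thesis by (simp add: inv)
qed

lemma constant_weight_char:
  assumes "\<And>i. i < n \<Longrightarrow> l i = a" "\<And>i. i < n \<Longrightarrow> m i = b"
  shows "weight_char n l m = one_char n"
proof (rule extensional_eqI)
  fix p assume p: "p \<in> torus n \<times> torus n"
  have d: "(\<Prod>i<n. t $$ (i, i)) = 1" if "t \<in> torus n" for t
    using SL_upper_triangular(1)[OF torusD(1,3)[OF that]] .
  have e: "(\<Prod>i<n. t $$ (i, i) powi k) = 1" if "t \<in> torus n" for t k
    using d[OF that] by (simp add: prod_powi)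
  have "weight_char n l m p = (\<Prod>i<n. fst p $$ (i, i) powi a) * (\<Prod>i<n. snd p $$ (i, i) powi b)"
    using p assms by (simp add: weight_char_def)
  then show "weight_char n l m p = one_char n p" using p e one_char[OF p] by (simp add: mem_Times_iff)
qed (auto simp: weight_char_def)

text \<open>The product descends to a polynomial P. By \<open>weight_support\<close>, P can be
  nonzero on the graph of v only if m_(v i) = l_i + d for all i, so v carries each level set of l +
  d onto one of m. With I and the complement of S' such level sets, P vanishes on all graphs with
  v(I) meeting S', and \<open>supported_on_graphs_traceless\<close> applies.\<close>

lemma opposite_weights_related:
  assumes n: "0 < n" and u: "u \<in> regf n" "u' \<in> regf n" and w: "has_weight n \<chi> u" "has_weight n \<psi> u'"
    and \<psi>: "\<psi> \<in> characters n" "char_mult n \<chi> \<psi> = one_char n" "\<psi> \<noteq> one_char n"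
  shows "weyl_related n (\<lambda>z\<in>GB n. u z * u' z)"
proof -
  define f where "f = (\<lambda>z\<in>GB n. u z * u' z)"
  obtain l m where \<psi>_eq: "\<psi> = weight_char n l m" using \<psi>(1) by (auto simp: characters_def)
  have f: "f \<in> regf n" unfolding f_def by (rule cotD(4)[OF u])
  have "f (torus_point n (1\<^sub>m n, s) z) = f z" if s: "s \<in> torus n" and z: "z \<in> GB n" for s z
  proof -
    have p: "(1\<^sub>m n, s) \<in> torus n \<times> torus n" using torus_one s by simp
    have "\<chi> (1\<^sub>m n, s) * \<psi> (1\<^sub>m n, s) = char_mult n \<chi> \<psi> (1\<^sub>m n, s)" unfolding char_mult_def using p by simp
    then have 1: "\<chi> (1\<^sub>m n, s) * \<psi> (1\<^sub>m n, s) = 1" using one_char[OF p] \<psi>(2) by simp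
    have "f (torus_point n (1\<^sub>m n, s) z) = (\<chi> (1\<^sub>m n, s) * u z) * (\<psi> (1\<^sub>m n, s) * u' z)"
      using w[unfolded has_weight_def, rule_format, OF p z] torus_point_GB'[OF p z] by (simp add: f_def)
    also have "\<dots> = (\<chi> (1\<^sub>m n, s) * \<psi> (1\<^sub>m n, s)) * (u z * u' z)" by (simp only: mult_ac)
    finally show ?thesis unfolding 1 using z by (simp add: f_def)
  qed
  then obtain C where C: "C \<in> pfun UNIV (prod_coords (vcoords n) (entries n))" "f = mpull n C"
    using regf_descends[OF n f] by blast
  define P where "P = diag_restriction n C"
  have P: "P \<in> vpairs n" unfolding P_def by (rule diag_restriction_pfun[OF C(1)])
  have Pf: "f (weyl_lift n v, mat_diag n y) = P (y \<circ> v, y)" if "v permutes {..<n}" "(\<Sum>i<n. y i) = 0" for v y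
    using mpull_weyl[OF n that C(1)] C(2) by (simp add: P_def diag_restriction_def)
  have traceless: "(\<Sum>i<n. (y \<circ> v) i) = 0" if "v permutes {..<n}" "(\<Sum>i<n. y i) = 0" for v and y :: "nat \<Rightarrow> complex"
    using sum.permute[OF that(1), of y] that(2) by (simp add: comp_def)
  have "\<exists>G\<in>relations n. \<forall>x y. (\<Sum>i<n. x i) = 0 \<longrightarrow> (\<Sum>i<n. y i) = 0 \<longrightarrow> P (x, y) = G (x, y)"
  proof (cases "\<exists>v y. v permutes {..<n} \<and> (\<Sum>i<n. y i) = 0 \<and> P (y \<circ> v, y) \<noteq> 0")
    case False
    then obtain D where "D \<in> sym_differences n" "\<forall>x y. (\<Sum>i<n. x i) = 0 \<longrightarrow> (\<Sum>i<n. y i) = 0 \<longrightarrow> P (x, y) = D (x, y)"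
      using vanish_on_graphs_traceless[OF n P] by blast
    then show ?thesis using relations.sym by blast
  next
    case True
    have supp: "m (v a) - l a = m (v b) - l b"
      if "v permutes {..<n}" "(\<Sum>i<n. y i) = 0" "P (y \<circ> v, y) \<noteq> 0" "a < n" "b < n" for v y a b
    proof (rule weight_support[OF n that(1,2) w(2)[unfolded \<psi>_eq] _ that(4,5)])
      show "u' (weyl_lift n v, mat_diag n y) \<noteq> 0"
        using that(3) Pf[OF that(1,2)] weyl_point(1)[OF n that(1,2)] by (auto simp: f_def)
    qed
    \<comment> \<open>Summing m_(v i) - l_i over i shows that the common difference is the same for
      every v that occurs.\<close>
    define c where "c = (\<Sum>j<n. m j) - (\<Sum>i<n. l i)"
    have sc: "int n * (m (v a) - l a) = c" if "v permutes {..<n}" "(\<Sum>i<n. y i) = 0" "P (y \<circ> v, y) \<noteq> 0" "a < n" for v y a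
    proof -
      have "(\<Sum>b<n. m (v b) - l b) = (\<Sum>b<n. m (v a) - l a)"
        by (rule sum.cong[OF refl], rule supp[OF that, symmetric]) simp
      then have "int n * (m (v a) - l a) = (\<Sum>b<n. m (v b) - l b)" by simp
      also have "\<dots> = (\<Sum>b<n. m (v b)) - (\<Sum>b<n. l b)" by (rule sum_subtractf)
      also have "(\<Sum>b<n. m (v b)) = (\<Sum>b<n. m b)" using sum.permute[OF that(1), of m] by (simp add: comp_def)
      finally show ?thesis by (simp add: c_def)
    qed
    obtain v0 y0 where v0: "v0 permutes {..<n}" "(\<Sum>i<n. y0 i) = 0" "P (y0 \<circ> v0, y0) \<noteq> 0" using True by blast
    define d where "d = m (v0 0) - l 0"
    have nd: "int n * d = c" unfolding d_def by (rule sc[OF v0 n])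
    have mv: "m (v a) = l a + d" if "v permutes {..<n}" "(\<Sum>i<n. y i) = 0" "P (y \<circ> v, y) \<noteq> 0" "a < n" for v y a
    proof -
      have "int n * (m (v a) - l a) = int n * d" using sc[OF that] nd by simp
      then show ?thesis using n by simp
    qed
    \<comment> \<open>Cutting at the value m_0 keeps I nonempty, as it contains the preimage of 0,
      and S' is nonempty because otherwise m and l would be constant and the weight trivial.\<close>
    define S' where "S' = {j. j < n \<and> m j \<noteq> m 0}"
    define I where "I = {i. i < n \<and> l i + d = m 0}"
    have lt: "v0 i < n" if "i < n" for i using permutes_in_image[OF v0(1), of i] that by simp
    have im: "v0 ` I = {j. j < n \<and> m j = m 0}"
    proof (intro equalityI subsetI)
      fix j assume "j \<in> {j. j < n \<and> m j = m 0}"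
      then obtain i where i: "i < n" "j = v0 i" "m j = m 0" using permutes_image[OF v0(1)] by blast
      then show "j \<in> v0 ` I" using mv[OF v0 i(1)] by (auto simp: I_def)
    qed (use lt mv[OF v0] in \<open>auto simp: I_def\<close>)
    have "card I = card {j. j < n \<and> m j = m 0}"
      using card_image[OF inj_on_subset[OF permutes_inj[OF v0(1)] subset_UNIV], of I] im by simp
    moreover have "card {j. j < n \<and> m j = m 0} + card S' = card {..<n}"
    proof -
      have "{..<n} = {j. j < n \<and> m j = m 0} \<union> S'" "{j. j < n \<and> m j = m 0} \<inter> S' = {}" by (auto simp: S'_def)
      then show ?thesis by (simp add: card_Un_disjoint S'_def)
    qed
    ultimately have card: "card I + card S' = n" by simp
    have sub: "I \<subseteq> {..<n}" "S' \<subseteq> {..<n}" by (auto simp: I_def S'_def)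
    have "0 \<in> v0 ` I" unfolding im using n by simp
    then have ne: "I \<noteq> {}" by blast
    have ne': "S' \<noteq> {}"
    proof
      assume "S' = {}"
      then have "j \<notin> S'" for j by blast
      then have m0: "m j = m 0" if "j < n" for j using that unfolding S'_def by blast
      have "l i = m 0 - d" if "i < n" for i using mv[OF v0 that] m0[OF lt[OF that]] by simp
      then have "\<psi> = one_char n" unfolding \<psi>_eq using m0 by (rule constant_weight_char)
      then show False using \<psi>(3) by simp
    qed
    obtain D H where DH: "D \<in> sym_differences n" "H \<in> vpairs n"
      "\<forall>x y. (\<Sum>i<n. x i) = 0 \<longrightarrow> (\<Sum>i<n. y i) = 0 \<longrightarrow> P (x, y) = D (x, y) + (\<Prod>i\<in>I. \<Prod>t\<in>S'. x i - y t) * H (x, y)"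
    proof -
      have "P (y \<circ> v, y) = 0" if v: "v permutes {..<n}" "(\<Sum>i<n. y i) = 0" "v ` I \<inter> S' \<noteq> {}" for v y
      proof (rule ccontr)
        assume P0: "P (y \<circ> v, y) \<noteq> 0"
        obtain i where "i \<in> I" "v i \<in> S'" using v(3) by blast
        then show False using mv[OF v(1,2) P0, of i] by (auto simp: I_def S'_def)
      qed
      from supported_on_graphs_traceless[OF n P sub card this] show ?thesis using that by blast
    qed
    show ?thesis
      by (rule bexI[OF _ relations.plus[OF relations.sym[OF DH(1)] relations.block[OF sub ne ne' card DH(2)]]])
        (use DH(3) in \<open>simp add: block_prod_def\<close>)
  qed
  then obtain G where G: "G \<in> relations n" "\<forall>x y. (\<Sum>i<n. x i) = 0 \<longrightarrow> (\<Sum>i<n. y i) = 0 \<longrightarrow> P (x, y) = G (x, y)" by blast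
  show ?thesis unfolding weyl_related_def
    by (rule bexI[OF _ G(1)]) (use G(2) traceless Pf in \<open>simp add: f_def\<close>)
qed

section \<open>Functions of trivial weight in the ideal of the fixed points\<close>

text \<open>An upper bound for \<open>fixed_ideal n\<close>: nontrivial weights are unrestricted,
  and a function of trivial weight is restricted only through its values at the points
  [v, y].\<close>

inductive_set weight_related :: "nat \<Rightarrow> (complex mat \<times> complex mat \<Rightarrow> complex) set" for n where
  nontrivial: "f \<in> regf n \<Longrightarrow> \<chi> \<in> characters n \<Longrightarrow> has_weight n \<chi> f \<Longrightarrow> \<chi> \<noteq> one_char n \<Longrightarrow> f \<in> weight_related n"
| trivial: "f \<in> regf n \<Longrightarrow> has_weight n (one_char n) f \<Longrightarrow> weyl_related n f \<Longrightarrow> f \<in> weight_related n"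
| plus: "f \<in> weight_related n \<Longrightarrow> g \<in> weight_related n \<Longrightarrow> (\<lambda>z\<in>GB n. f z + g z) \<in> weight_related n"

lemma weight_related_regf: "f \<in> weight_related n \<Longrightarrow> f \<in> regf n"
proof (induction rule: weight_related.induct)
  case (plus f g) show ?case by (rule cotD(3)[OF plus.IH])
qed

lemma has_weightD: "has_weight n \<chi> f \<Longrightarrow> p \<in> torus n \<times> torus n \<Longrightarrow> z \<in> GB n \<Longrightarrow> f (torus_point n p z) = \<chi> p * f z"
  unfolding has_weight_def by blast

lemma weyl_related_zero:
  assumes "0 < n" shows "weyl_related n (\<lambda>z\<in>GB n. 0)"
  unfolding weyl_related_def using weyl_point(1)[OF assms] by (intro bexI[OF _ relations_zero]) auto

lemma weyl_related_add:
  assumes n: "0 < n" and "weyl_related n f" "weyl_related n g"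
  shows "weyl_related n (\<lambda>z. f z + g z)"
proof -
  obtain F where F: "F \<in> relations n" "\<And>v y. v permutes {..<n} \<Longrightarrow> (\<Sum>i<n. y i) = 0 \<Longrightarrow>
    f (weyl_lift n v, mat_diag n y) = F (y \<circ> v, y)" using assms(2) by (auto simp: weyl_related_def)
  obtain G where G: "G \<in> relations n" "\<And>v y. v permutes {..<n} \<Longrightarrow> (\<Sum>i<n. y i) = 0 \<Longrightarrow>
    g (weyl_lift n v, mat_diag n y) = G (y \<circ> v, y)" using assms(3) by (auto simp: weyl_related_def)
  show ?thesis unfolding weyl_related_def
    by (rule bexI[OF _ relations.plus[OF F(1) G(1)]]) (simp add: F(2) G(2))
qed

lemma weight_related_zero:
  assumes "0 < n" shows "(\<lambda>z\<in>GB n. 0) \<in> weight_related n"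
proof (rule weight_related.trivial[OF cotD(2) _ weyl_related_zero[OF assms]])
  show "has_weight n (one_char n) (\<lambda>z\<in>GB n. 0)" unfolding has_weight_def using torus_point_GB' by auto
qed

lemma weight_related_sum:
  assumes n: "0 < n" and "finite X" "\<And>\<chi>. \<chi> \<in> X \<Longrightarrow> F \<chi> \<in> weight_related n"
  shows "(\<lambda>z\<in>GB n. \<Sum>\<chi>\<in>X. F \<chi> z) \<in> weight_related n"
  using assms(2,3)
proof (induction X)
  case empty show ?case unfolding sum.empty by (rule weight_related_zero[OF n])
next
  case (insert \<chi> X)
  have eq: "(\<lambda>z\<in>GB n. \<Sum>\<chi>\<in>insert \<chi> X. F \<chi> z) = (\<lambda>z\<in>GB n. F \<chi> z + (\<lambda>z\<in>GB n. \<Sum>\<chi>\<in>X. F \<chi> z) z)"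
    by (rule restrict_ext) (use insert.hyps in simp)
  show ?case unfolding eq by (rule weight_related.plus) (use insert in blast)+
qed

lemma has_weight_mult:
  assumes "has_weight n \<chi> f" "has_weight n \<psi> g"
  shows "has_weight n (char_mult n \<chi> \<psi>) (\<lambda>z\<in>GB n. f z * g z)"
  unfolding has_weight_def
proof (intro ballI)
  fix p z assume p: "p \<in> torus n \<times> torus n" and z: "z \<in> GB n"
  have "f (torus_point n p z) = \<chi> p * f z" "g (torus_point n p z) = \<psi> p * g z"
    using assms p z unfolding has_weight_def by blast+
  then show "(\<lambda>z\<in>GB n. f z * g z) (torus_point n p z) = char_mult n \<chi> \<psi> p * (\<lambda>z\<in>GB n. f z * g z) z"
    using p z torus_point_GB'[OF p z] by (simp add: char_mult_def mult_ac del: mem_Sigma_iff)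
qed

lemma char_mult_one: "\<chi> \<in> characters n \<Longrightarrow> char_mult n \<chi> (one_char n) = \<chi>"
  by (rule extensional_eqI[of _ "torus n \<times> torus n"]) (auto simp: char_mult_def characters_def weight_char_def)

lemma trivial_weight_related_mult:
  assumes n: "0 < n" and f: "f \<in> regf n" "has_weight n (one_char n) f" and g: "weyl_related n g"
  shows "weyl_related n (\<lambda>z\<in>GB n. f z * g z)"
proof -
  have "f (torus_point n (1\<^sub>m n, s) z) = f z" if s: "s \<in> torus n" and z: "z \<in> GB n" for s z
  proof -
    have p: "(1\<^sub>m n, s) \<in> torus n \<times> torus n" using torus_one s by simp
    show ?thesis using has_weightD[OF f(2) p z] one_char[OF p] by simp
  qed
  then obtain C where C: "C \<in> pfun UNIV (prod_coords (vcoords n) (entries n))" "f = mpull n C"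
    using regf_descends[OF n f(1)] by blast
  obtain G where G: "G \<in> relations n" "\<And>v y. v permutes {..<n} \<Longrightarrow> (\<Sum>i<n. y i) = 0 \<Longrightarrow>
    g (weyl_lift n v, mat_diag n y) = G (y \<circ> v, y)" using g by (auto simp: weyl_related_def)
  show ?thesis unfolding weyl_related_def
    by (rule bexI[OF _ relations_mult[OF G(1) diag_restriction_pfun[OF C(1)]]])
      (use mpull_weyl[OF n _ _ C(1)] weyl_point(1)[OF n] in \<open>simp add: G(2) C(2) diag_restriction_def\<close>)
qed

text \<open>A product acquires trivial weight either from opposite nontrivial weights, which is
  \<open>opposite_weights_related\<close>, or from two trivial ones, where a relation is multiplied
  by a polynomial.\<close>

lemma weight_related_hom_mult:
  assumes n: "0 < n" and r: "r \<in> regf n" "has_weight n \<psi> r" "\<psi> \<in> characters n" and "f \<in> weight_related n"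
  shows "(\<lambda>z\<in>GB n. r z * f z) \<in> weight_related n"
  using assms(5)
proof induction
  case (nontrivial f \<chi>)
  note w = has_weight_mult[OF r(2) nontrivial(3)]
  show ?case
  proof (cases "char_mult n \<psi> \<chi> = one_char n")
    case True
    show ?thesis
      by (rule weight_related.trivial[OF cotD(4)[OF r(1) nontrivial(1)] w[unfolded True]
          opposite_weights_related[OF n r(1) nontrivial(1) r(2) nontrivial(3,2) True nontrivial(4)]])
  next
    case False
    show ?thesis
      by (rule weight_related.nontrivial[OF cotD(4)[OF r(1) nontrivial(1)] char_mult_in[OF r(3) nontrivial(2)] w False])
  qed
next
  case (trivial f)
  have w: "has_weight n \<psi> (\<lambda>z\<in>GB n. r z * f z)"
    using has_weight_mult[OF r(2) trivial(2)] char_mult_one[OF r(3)] by simp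
  note A = cotD(4)[OF r(1) trivial(1)]
  show ?case
  proof (cases "\<psi> = one_char n")
    case True
    show ?thesis
      by (rule weight_related.trivial[OF A w[unfolded True] trivial_weight_related_mult[OF n r(1) r(2)[unfolded True] trivial(3)]])
  next
    case False
    show ?thesis by (rule weight_related.nontrivial[OF A r(3) w False])
  qed
next
  case (plus f g)
  have "(\<lambda>z\<in>GB n. r z * (\<lambda>z\<in>GB n. f z + g z) z) = (\<lambda>z\<in>GB n. (\<lambda>z\<in>GB n. r z * f z) z + (\<lambda>z\<in>GB n. r z * g z) z)"
    by (rule restrict_ext) (simp add: distrib_left)
  then show ?case using weight_related.plus[OF plus.IH] by (simp only:)
qed

lemma weight_related_mult:
  assumes n: "0 < n" and r: "r \<in> regf n" and f: "f \<in> weight_related n"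
  shows "(\<lambda>z\<in>GB n. r z * f z) \<in> weight_related n"
proof -
  obtain X F where X: "weight_decomposition n r X F" using regf_decompose[OF r] by blast
  have FX: "F \<chi> \<in> regf n" "has_weight n \<chi> (F \<chi>)" "\<chi> \<in> characters n" if "\<chi> \<in> X" for \<chi>
    using X that by (auto simp: weight_decomposition_def)
  have "finite X" using X by (simp add: weight_decomposition_def)
  then have "(\<lambda>z\<in>GB n. \<Sum>\<chi>\<in>X. (\<lambda>z\<in>GB n. F \<chi> z * f z) z) \<in> weight_related n"
    by (rule weight_related_sum[OF n]) (rule weight_related_hom_mult[OF n FX f])
  also have "(\<lambda>z\<in>GB n. \<Sum>\<chi>\<in>X. (\<lambda>z\<in>GB n. F \<chi> z * f z) z) = (\<lambda>z\<in>GB n. r z * f z)"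
  proof (rule restrict_ext)
    fix z assume z: "z \<in> GB n"
    then have "r z = (\<Sum>\<chi>\<in>X. F \<chi> z)" using X unfolding weight_decomposition_def by blast
    then show "(\<Sum>\<chi>\<in>X. (\<lambda>z\<in>GB n. F \<chi> z * f z) z) = r z * f z" using z by (simp add: sum_distrib_right)
  qed
  finally show ?thesis .
qed

text \<open>The component of weight \<chi> of a generator is (1 - \<chi>(t, s)) times that of f, so
  its trivial component is zero and the other components are unrestricted.\<close>

lemma fixed_ideal_weight_related:
  assumes n: "0 < n"
  shows "fixed_ideal n \<subseteq> weight_related n"
  unfolding fixed_ideal_eq
proof (rule cotR.genideal_minimal)
  have neg: "\<ominus>\<^bsub>cotangent_ring n\<^esub> f \<in> weight_related n" if f: "f \<in> weight_related n" for f
  proof -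
    have "\<ominus>\<^bsub>cotangent_ring n\<^esub> f = (\<lambda>z\<in>GB n. (\<lambda>z\<in>GB n. - 1) z * f z)"
      unfolding cotangent_ring_eq fring_minus(1)[OF subfunctions_cot weight_related_regf[OF f] weight_related_regf[OF f]]
      by (rule restrict_ext) simp
    then show ?thesis using weight_related_mult[OF n cotD(2) f, of "- 1"] by simp
  qed
  show "ideal (weight_related n) (cotangent_ring n)"
  proof (rule idealI[OF cotR.ring_axioms])
    show "subgroup (weight_related n) (add_monoid (cotangent_ring n))"
      using weight_related_regf weight_related_zero[OF n] neg weight_related.plus
      by (intro cotR.add.subgroupI) (auto simp: cot_simps a_inv_def[symmetric])
    fix f r assume fr: "f \<in> weight_related n" "r \<in> carrier (cotangent_ring n)"
    then show "r \<otimes>\<^bsub>cotangent_ring n\<^esub> f \<in> weight_related n"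
      using weight_related_mult[OF n] by (simp add: cot_simps)
    then show "f \<otimes>\<^bsub>cotangent_ring n\<^esub> r \<in> weight_related n" by (simp add: cot_simps mult.commute)
  qed
  show "{\<lambda>z\<in>GB n. f z - f (torus_point n (t, s) z) | f t s. f \<in> regf n \<and> t \<in> torus n \<and> s \<in> torus n} \<subseteq> weight_related n"
  proof
    fix h assume "h \<in> {\<lambda>z\<in>GB n. f z - f (torus_point n (t, s) z) | f t s. f \<in> regf n \<and> t \<in> torus n \<and> s \<in> torus n}"
    then obtain f t s where h: "h = (\<lambda>z\<in>GB n. f z - f (torus_point n (t, s) z))" "f \<in> regf n" "(t, s) \<in> torus n \<times> torus n"
      by blast
    obtain X F where X: "weight_decomposition n f X F" using regf_decompose[OF h(2)] by blast
    have FX: "F \<chi> \<in> regf n" "has_weight n \<chi> (F \<chi>)" "\<chi> \<in> characters n" if "\<chi> \<in> X" for \<chi>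
      using X that by (auto simp: weight_decomposition_def)
    have fin: "finite X" and fz: "\<And>z. z \<in> GB n \<Longrightarrow> f z = (\<Sum>\<chi>\<in>X. F \<chi> z)"
      using X unfolding weight_decomposition_def by blast+
    have "(\<lambda>z\<in>GB n. (1 - \<chi> (t, s)) * F \<chi> z) \<in> weight_related n" if \<chi>: "\<chi> \<in> X" for \<chi>
    proof (cases "\<chi> = one_char n")
      case True
      then have "(\<lambda>z\<in>GB n. (1 - \<chi> (t, s)) * F \<chi> z) = (\<lambda>z\<in>GB n. 0)" using one_char[OF h(3)] by simp
      then show ?thesis using weight_related_zero[OF n] by simp
    next
      case False
      have "has_weight n \<chi> (\<lambda>z\<in>GB n. (1 - \<chi> (t, s)) * F \<chi> z)"
        unfolding has_weight_def
      proof (intro ballI)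
        fix p z assume p: "p \<in> torus n \<times> torus n" and z: "z \<in> GB n"
        have "F \<chi> (torus_point n p z) = \<chi> p * F \<chi> z" by (rule has_weightD[OF FX(2)[OF \<chi>] p z])
        then show "(\<lambda>z\<in>GB n. (1 - \<chi> (t, s)) * F \<chi> z) (torus_point n p z) = \<chi> p * (\<lambda>z\<in>GB n. (1 - \<chi> (t, s)) * F \<chi> z) z"
          using z torus_point_GB'[OF p z] by (simp del: mem_Sigma_iff)
      qed
      then show ?thesis by (rule weight_related.nontrivial[OF cotD(5)[OF FX(1)[OF \<chi>]] FX(3)[OF \<chi>] _ False])
    qed
    from weight_related_sum[OF n fin this]
    have "(\<lambda>z\<in>GB n. \<Sum>\<chi>\<in>X. (\<lambda>z\<in>GB n. (1 - \<chi> (t, s)) * F \<chi> z) z) \<in> weight_related n" .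
    also have "(\<lambda>z\<in>GB n. \<Sum>\<chi>\<in>X. (\<lambda>z\<in>GB n. (1 - \<chi> (t, s)) * F \<chi> z) z) = h"
      unfolding h(1)
    proof (rule restrict_ext)
      fix z assume z: "z \<in> GB n"
      have "F \<chi> (torus_point n (t, s) z) = \<chi> (t, s) * F \<chi> z" if "\<chi> \<in> X" for \<chi>
        by (rule has_weightD[OF FX(2)[OF that] h(3) z])
      then show "(\<Sum>\<chi>\<in>X. (\<lambda>z\<in>GB n. (1 - \<chi> (t, s)) * F \<chi> z) z) = f z - f (torus_point n (t, s) z)"
        using fz[OF z] fz[OF torus_point_GB'[OF h(3) z]] z by (simp add: sum_subtractf left_diff_distrib)
    qed
    finally show "h \<in> weight_related n" .
  qed
qed

text \<open>F is given for all characters and is zero off X, so that two families can be added over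
  the union of their supports.\<close>

lemma weight_related_split:
  assumes n: "0 < n" and "f \<in> weight_related n"
  shows "\<exists>X F. finite X \<and> X \<subseteq> characters n \<and> (\<forall>\<chi>. has_weight n \<chi> (F \<chi>)) \<and> (\<forall>\<chi>. \<chi> \<notin> X \<longrightarrow> F \<chi> = (\<lambda>_. 0)) \<and>
    weyl_related n (F (one_char n)) \<and> (\<forall>z\<in>GB n. f z = (\<Sum>\<chi>\<in>X. F \<chi> z))"
  using assms(2)
proof induction
  case (nontrivial f \<chi>)
  have "weyl_related n (\<lambda>_. 0)" unfolding weyl_related_def by (rule bexI[OF _ relations_zero]) simp
  then show ?case using nontrivial
    by (intro exI[of _ "{\<chi>}"] exI[of _ "\<lambda>\<psi>. if \<psi> = \<chi> then f else (\<lambda>_. 0)"]) (auto simp: has_weight_def)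
next
  case (trivial f)
  then show ?case using one_char_in
    by (intro exI[of _ "{one_char n}"] exI[of _ "\<lambda>\<psi>. if \<psi> = one_char n then f else (\<lambda>_. 0)"]) (auto simp: has_weight_def)
next
  case (plus f g)
  obtain X F where X: "finite X" "X \<subseteq> characters n" "\<forall>\<chi>. has_weight n \<chi> (F \<chi>)" "\<forall>\<chi>. \<chi> \<notin> X \<longrightarrow> F \<chi> = (\<lambda>_. 0)"
    "weyl_related n (F (one_char n))" "\<forall>z\<in>GB n. f z = (\<Sum>\<chi>\<in>X. F \<chi> z)" using plus.IH(1) by blast
  obtain Y G where Y: "finite Y" "Y \<subseteq> characters n" "\<forall>\<chi>. has_weight n \<chi> (G \<chi>)" "\<forall>\<chi>. \<chi> \<notin> Y \<longrightarrow> G \<chi> = (\<lambda>_. 0)"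
    "weyl_related n (G (one_char n))" "\<forall>z\<in>GB n. g z = (\<Sum>\<chi>\<in>Y. G \<chi> z)" using plus.IH(2) by blast
  let ?H = "\<lambda>\<chi> z. F \<chi> z + G \<chi> z"
  have "\<forall>\<chi>. has_weight n \<chi> (?H \<chi>)" using X(3) Y(3) unfolding has_weight_def by (simp add: distrib_left)
  moreover have "(\<Sum>\<chi>\<in>X \<union> Y. F \<chi> z) = (\<Sum>\<chi>\<in>X. F \<chi> z)" "(\<Sum>\<chi>\<in>X \<union> Y. G \<chi> z) = (\<Sum>\<chi>\<in>Y. G \<chi> z)" for z
    using X(1,4) Y(1,4) by (auto intro!: sum.mono_neutral_right)
  then have "\<forall>z\<in>GB n. (\<lambda>z\<in>GB n. f z + g z) z = (\<Sum>\<chi>\<in>X \<union> Y. ?H \<chi> z)" using X(6) Y(6) by (simp add: sum.distrib)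
  ultimately show ?case using X(1,2,4) Y(1,2,4) weyl_related_add[OF n X(5) Y(5)]
    by (intro exI[of _ "X \<union> Y"] exI[of _ ?H]) auto
qed

lemma vpull_trivial_weight:
  assumes P: "P \<in> vpairs n"
  shows "has_weight n (one_char n) (vpull n P)"
  unfolding has_weight_def
proof (intro ballI)
  fix p z assume p: "p \<in> torus n \<times> torus n" and z: "z \<in> GB n"
  obtain t s g b where *: "p = (t, s)" "t \<in> torus n" "s \<in> torus n" "z = (g, b)" "g \<in> carrier (SL n)" "b \<in> borel_lie n"
    using p z by auto
  note T = torusD[OF *(2)] and S = torusD[OF *(3)]
  have m: "g \<in> carrier_mat n n" "b \<in> carrier_mat n n" "inv\<^bsub>SL n\<^esub> g \<in> carrier_mat n n" "inv\<^bsub>SL n\<^esub> s \<in> carrier_mat n n"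
    "inv\<^bsub>SL n\<^esub> t \<in> carrier_mat n n"
    using *(5,6) inv_SL(2) T(1) S(1) by (auto simp: SL_carrier dest: borel_mat)
  have tg: "t * g \<in> carrier (SL n)" by (rule SL_mult[OF T(1) *(5)])
  have ss: "s * inv\<^bsub>SL n\<^esub> s = 1\<^sub>m n" using inv_SL[OF S(1)] by auto
  let ?x = "g * b * inv\<^bsub>SL n\<^esub> g"
  have "t * g * s * (inv\<^bsub>SL n\<^esub> s * b * s) * inv\<^bsub>SL n\<^esub> (t * g * s) =
    t * g * (s * inv\<^bsub>SL n\<^esub> s) * b * (s * inv\<^bsub>SL n\<^esub> s) * (inv\<^bsub>SL n\<^esub> g * inv\<^bsub>SL n\<^esub> t)"
    unfolding inv_SL_mult[OF tg S(1)] inv_SL_mult[OF T(1) *(5)] using m T(2) S(2)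
    by (simp add: assoc_mult_mat[of _ n n _ n _ n] mult_carrier_mat[of _ n n])
  also have "\<dots> = t * ?x * inv\<^bsub>SL n\<^esub> t"
    unfolding ss using m T(2)
    by (simp add: assoc_mult_mat[of _ n n _ n _ n] mult_carrier_mat[of _ n n] left_mult_one_mat[of _ n n])
  finally have conj: "t * g * s * (inv\<^bsub>SL n\<^esub> s * b * s) * inv\<^bsub>SL n\<^esub> (t * g * s) = t * ?x * inv\<^bsub>SL n\<^esub> t" .
  have "P (diag_fun (t * ?x * inv\<^bsub>SL n\<^esub> t), diag_fun (inv\<^bsub>SL n\<^esub> s * b * s)) = P (diag_fun ?x, diag_fun b)"
  proof (rule vpairs_cong[OF P])
    fix i assume i: "i < n"
    have "?x \<in> carrier_mat n n" using m by (simp add: mult_carrier_mat[of _ n n])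
    then show "diag_fun (t * ?x * inv\<^bsub>SL n\<^esub> t) i = diag_fun ?x i"
      using torus_conj_entry[OF *(2) _ i i] torus_nonzero[OF *(2) i] by simp
    show "diag_fun (inv\<^bsub>SL n\<^esub> s * b * s) i = diag_fun b i"
      using torus_point_entries(2)[OF p z i i] torus_nonzero[OF *(3) i] by (simp add: *(1,4) torus_point_def)
  qed
  then show "vpull n P (torus_point n p z) = one_char n p * vpull n P z"
    using torus_point_GB'[OF p z] z one_char[OF p] conj by (simp add: *(1,4) vpull_def mpull_def torus_point_def)
qed

text \<open>By independence of characters the trivial component of \<open>vpull n P\<close> is
  \<open>vpull n P\<close> itself, so on the permutation graphs P has the values of a relation G.
  Then P - G vanishes on all graphs.\<close>

lemma vpull_fixed_ideal_relations:
  assumes n: "0 < n" and P: "P \<in> vpairs n" and I: "vpull n P \<in> fixed_ideal n"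
  shows "\<exists>G\<in>relations n. \<forall>x y. (\<Sum>i<n. x i) = 0 \<longrightarrow> (\<Sum>i<n. y i) = 0 \<longrightarrow> P (x, y) = G (x, y)"
proof -
  obtain X F where X: "finite X" "X \<subseteq> characters n" "\<forall>\<chi>. has_weight n \<chi> (F \<chi>)" "\<forall>\<chi>. \<chi> \<notin> X \<longrightarrow> F \<chi> = (\<lambda>_. 0)"
    "weyl_related n (F (one_char n))" "\<forall>z\<in>GB n. vpull n P z = (\<Sum>\<chi>\<in>X. F \<chi> z)"
    using weight_related_split[OF n subsetD[OF fixed_ideal_weight_related[OF n] I]] by blast
  have F1: "F (one_char n) z = vpull n P z" if z: "z \<in> GB n" for z
  proof -
    let ?X = "insert (one_char n) X"
    let ?a = "\<lambda>\<chi>. F \<chi> z - (if \<chi> = one_char n then vpull n P z else 0)"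
    have "(\<Sum>\<chi>\<in>?X. ?a \<chi> * \<chi> p) = 0" if p: "p \<in> torus n \<times> torus n" for p
    proof -
      have "F \<chi> (torus_point n p z) = \<chi> p * F \<chi> z" for \<chi> by (rule has_weightD[OF X(3)[rule_format] p z])
      moreover have "vpull n P (torus_point n p z) = vpull n P z"
        using has_weightD[OF vpull_trivial_weight[OF P] p z] one_char[OF p] by simp
      ultimately have "(\<Sum>\<chi>\<in>X. F \<chi> z * \<chi> p) = vpull n P z"
        using X(6) torus_point_GB'[OF p z] by (simp add: mult.commute del: mem_Sigma_iff)
      moreover have "(\<Sum>\<chi>\<in>X. F \<chi> z * \<chi> p) = (\<Sum>\<chi>\<in>?X. F \<chi> z * \<chi> p)"
        using X(1,4) by (intro sum.mono_neutral_left) auto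
      moreover have "(\<Sum>\<chi>\<in>?X. (if \<chi> = one_char n then vpull n P z else 0) * \<chi> p) = vpull n P z"
        using X(1) one_char[OF p] by (subst sum.remove[of _ "one_char n"]) auto
      ultimately show ?thesis by (simp only: left_diff_distrib sum_subtractf) simp
    qed
    then have "?a (one_char n) = 0"
      by (rule characters_independent[of ?X n, rotated 2]) (use X(1,2) one_char_in in auto)
    then show ?thesis by simp
  qed
  obtain G where G: "G \<in> relations n" "\<And>v y. v permutes {..<n} \<Longrightarrow> (\<Sum>i<n. y i) = 0 \<Longrightarrow>
    F (one_char n) (weyl_lift n v, mat_diag n y) = G (y \<circ> v, y)" using X(5) by (auto simp: weyl_related_def)
  have "(\<lambda>z. P z - G z) \<in> vpairs n" by (intro pfun_diff P relations_pfun[OF G(1)])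
  moreover have "P (y \<circ> v, y) - G (y \<circ> v, y) = 0" if v: "v permutes {..<n}" "(\<Sum>i<n. y i) = 0" for v y
    using G(2)[OF v] F1[OF weyl_point(1)[OF n v]] vpull_weyl[OF n v P] by simp
  ultimately obtain D where D: "D \<in> sym_differences n"
    "\<forall>x y. (\<Sum>i<n. x i) = 0 \<longrightarrow> (\<Sum>i<n. y i) = 0 \<longrightarrow> P (x, y) - G (x, y) = D (x, y)"
    using vanish_on_graphs_traceless[OF n, of "\<lambda>z. P z - G z"] by blast
  show ?thesis
    by (rule bexI[OF _ relations.plus[OF G(1) relations.sym[OF D(1)]]]) (use D(2) in \<open>simp add: algebra_simps\<close>)
qed

section \<open>Factoring a ring homomorphism\<close>

lemma (in ideal) quot_carrierE:
  assumes "X \<in> carrier (R Quot I)"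
  obtains r where "r \<in> carrier R" "X = I +> r"
  using assms by (auto simp: FactRing_def A_RCOSETS_def')

lemma hom_factor:
  fixes R (structure) and S (structure)
  assumes h: "ring_hom_ring R S h" and I: "ideal I R" and k: "I \<subseteq> a_kernel R S h"
  shows "r \<in> carrier R \<Longrightarrow> the_elem (h ` (I +> r)) = h r"
    "ring_hom_ring (R Quot I) S (\<lambda>X. the_elem (h ` X))"
proof -
  interpret h: ring_hom_ring R S h by (rule h)
  interpret I: ideal I R by (rule I)
  show val: "the_elem (h ` (I +> r)) = h r" if r: "r \<in> carrier R" for r
  proof (rule the_elem_image_unique)
    show "I +> r \<noteq> {}" using I.a_rcos_self[OF r] by blast
    fix x assume "x \<in> I +> r"
    then obtain i where i: "i \<in> I" "x = i \<oplus> r" by (auto simp: a_r_coset_def')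
    then show "h x = h r" using k r I.Icarr[OF i(1)] h.kernel_zero[of i] by auto
  qed
  note q = I.rcos_ring_hom
  show "ring_hom_ring (R Quot I) S (\<lambda>X. the_elem (h ` X))"
  proof (rule ring_hom_ringI[OF I.quotient_is_ring h.S.ring_axioms])
    fix X assume "X \<in> carrier (R Quot I)"
    then obtain x where x: "x \<in> carrier R" "X = I +> x" by (rule I.quot_carrierE)
    then show "the_elem (h ` X) \<in> carrier S" using val by simp
    fix Y assume "Y \<in> carrier (R Quot I)"
    then obtain y where y: "y \<in> carrier R" "Y = I +> y" by (rule I.quot_carrierE)
    show "the_elem (h ` (X \<otimes>\<^bsub>R Quot I\<^esub> Y)) = the_elem (h ` X) \<otimes>\<^bsub>S\<^esub> the_elem (h ` Y)"
      unfolding x y ring_hom_mult[OF q x(1) y(1), symmetric] using x y by (simp add: val)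
    show "the_elem (h ` (X \<oplus>\<^bsub>R Quot I\<^esub> Y)) = the_elem (h ` X) \<oplus>\<^bsub>S\<^esub> the_elem (h ` Y)"
      unfolding x y ring_hom_add[OF q x(1) y(1), symmetric] using x y by (simp add: val)
  next
    show "the_elem (h ` \<one>\<^bsub>R Quot I\<^esub>) = \<one>\<^bsub>S\<^esub>"
      unfolding ring_hom_one[OF q, symmetric] by (simp add: val)
  qed
qed

section \<open>Functions on the product of two Cartan subalgebras\<close>

abbreviation hfun :: "nat \<Rightarrow> (complex mat \<times> complex mat \<Rightarrow> complex) set" where
  "hfun n \<equiv> pfun_on (HH n) (pair_entries n)"

abbreviation hh_ring :: "nat \<Rightarrow> (complex mat \<times> complex mat \<Rightarrow> complex) ring" where
  "hh_ring n \<equiv> coord_ring (HH n) (pair_entries n)"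

interpretation hhR: cring "hh_ring n" for n
  unfolding coord_ring_eq by (rule cring_fring[OF subfunctions_pfun_on])

lemmas hh_simps = fring_simps[of "HH n" "hfun n" for n, folded coord_ring_eq]

lemma cartan_diag:
  assumes "x \<in> cartan_lie n"
  shows "mat_diag n (diag_fun x) = x" "(\<Sum>i<n. x $$ (i, i)) = 0"
  using assms by (auto simp: cartan_lie_def sl_lie_def diagonal_mat_def mat_diag_def intro!: eq_matI)

lemma mat_diag_cartan: "(\<Sum>i<n. y i) = 0 \<Longrightarrow> mat_diag n y \<in> cartan_lie n"
  by (auto simp: cartan_lie_def sl_lie_def diagonal_mat_def mat_diag_def)

definition hh_fun :: "nat \<Rightarrow> ((nat \<Rightarrow> complex) \<times> (nat \<Rightarrow> complex) \<Rightarrow> complex) \<Rightarrow> complex mat \<times> complex mat \<Rightarrow> complex" where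
  "hh_fun n P = (\<lambda>z\<in>HH n. P (diag_fun (fst z), diag_fun (snd z)))"

lemma hh_fun_hfun:
  assumes "P \<in> vpairs n"
  shows "hh_fun n P \<in> hfun n"
  unfolding hh_fun_def pair_entries_eq
proof (rule restrict_pfun_on[OF pfun_comp_pair[OF assms]])
  fix e assume "e \<in> vcoords n"
  then obtain i where i: "i < n" "e = (\<lambda>y. y i)" by (auto simp: vcoords_def)
  show "(\<lambda>z. e (diag_fun (fst z))) \<in> pfun (HH n) (prod_coords (entries n) (entries n))"
    "(\<lambda>z. e (diag_fun (snd z))) \<in> pfun (HH n) (prod_coords (entries n) (entries n))"
    unfolding i by (rule pfun_fst[OF pfun_entry[OF i(1) i(1)]] pfun_snd[OF pfun_entry[OF i(1) i(1)]])+
qed auto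

lemma hh_fun_cong:
  "(\<And>x y. (\<Sum>i<n. x i) = 0 \<Longrightarrow> (\<Sum>i<n. y i) = 0 \<Longrightarrow> P (x, y) = Q (x, y)) \<Longrightarrow> hh_fun n P = hh_fun n Q"
  unfolding hh_fun_def by (rule restrict_ext) (auto simp: cartan_diag(2))

lemma hh_fun_apply:
  assumes "P \<in> vpairs n" "(\<Sum>i<n. x i) = 0" "(\<Sum>i<n. y i) = 0"
  shows "hh_fun n P (mat_diag n x, mat_diag n y) = P (x, y)"
proof -
  have "P (diag_fun (mat_diag n x), diag_fun (mat_diag n y)) = P (x, y)"
    by (rule vpairs_cong[OF assms(1)]) (simp_all add: mat_diag_def)
  then show ?thesis using mat_diag_cartan assms(2,3) by (simp add: hh_fun_def)
qed

lemma hfun_lift: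
  assumes "F \<in> hfun n"
  shows "\<exists>P\<in>vpairs n. F = hh_fun n P"
proof -
  obtain p where p: "p \<in> pfun UNIV (pair_entries n)" "\<And>z. z \<in> HH n \<Longrightarrow> F z = p z"
    using pfun_extend[OF pfun_onD(1)[OF assms]] by blast
  have "p \<in> pfun (UNIV \<times> UNIV) (prod_coords (entries n) (entries n))" using p(1) by (simp add: pair_entries_eq)
  then have "(\<lambda>z. p (mat_diag n (fst z), mat_diag n (snd z))) \<in> vpairs n"
  proof (rule pfun_comp_pair)
    fix e assume "e \<in> entries n"
    then show "(\<lambda>z. e (mat_diag n (fst z))) \<in> vpairs n" "(\<lambda>z. e (mat_diag n (snd z))) \<in> vpairs n"
      by (rule pfun_fst[OF pfun_mat_diag] pfun_snd[OF pfun_mat_diag])+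
  qed auto
  moreover have "F = hh_fun n (\<lambda>z. p (mat_diag n (fst z), mat_diag n (snd z)))"
    by (rule extensional_eqI[OF pfun_onD(2)[OF assms]]) (auto simp: hh_fun_def p(2) cartan_diag(1))
  ultimately show ?thesis by blast
qed

text \<open>Pullback along the moment map followed by the projection of its first component to the
  diagonal. Modulo \<open>fixed_ideal n\<close> the projection makes no difference, and it lets
  functions on \<hh> times \<hh> alone be pulled back.\<close>

definition hpull :: "nat \<Rightarrow> (complex mat \<times> complex mat \<Rightarrow> complex) \<Rightarrow> complex mat \<times> complex mat \<Rightarrow> complex" where
  "hpull n F = (\<lambda>z\<in>GB n. F (mat_diag n (diag_fun (fst z * snd z * inv\<^bsub>SL n\<^esub> (fst z))), mat_diag n (diag_fun (snd z))))"

lemma hpull_point: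
  assumes "g \<in> carrier (SL n)" "b \<in> borel_lie n"
  shows "mat_diag n (diag_fun (g * b * inv\<^bsub>SL n\<^esub> g)) \<in> cartan_lie n" "mat_diag n (diag_fun b) \<in> cartan_lie n"
    "g * b * inv\<^bsub>SL n\<^esub> g \<in> sl_lie n"
proof -
  show x: "g * b * inv\<^bsub>SL n\<^esub> g \<in> sl_lie n" using conj_sl assms borel_mat(4) by blast
  then show "mat_diag n (diag_fun (g * b * inv\<^bsub>SL n\<^esub> g)) \<in> cartan_lie n"
    by (intro mat_diag_cartan) (simp add: sl_lie_def)
  show "mat_diag n (diag_fun b) \<in> cartan_lie n"
    using assms(2) by (intro mat_diag_cartan) (simp add: borel_lie_def sl_lie_def)
qed

lemma hpull_hh_fun:
  assumes P: "P \<in> vpairs n"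
  shows "hpull n (hh_fun n P) = vpull n P"
  unfolding hpull_def vpull_def mpull_def
proof (rule restrict_ext)
  fix z assume z: "z \<in> GB n"
  let ?x = "diag_fun (fst z * snd z * inv\<^bsub>SL n\<^esub> (fst z))" and ?y = "diag_fun (snd z)"
  have "mat_diag n ?x \<in> cartan_lie n" "mat_diag n ?y \<in> cartan_lie n" using hpull_point[of "fst z" n "snd z"] z by auto
  moreover have "P (diag_fun (mat_diag n ?x), diag_fun (mat_diag n ?y)) = P (?x, ?y)"
    by (rule vpairs_cong[OF P]) (simp_all add: mat_diag_def)
  ultimately show "hh_fun n P (mat_diag n ?x, mat_diag n ?y) =
      P (diag_fun (snd (?y, fst z * snd z * inv\<^bsub>SL n\<^esub> (fst z))), fst (?y, fst z * snd z * inv\<^bsub>SL n\<^esub> (fst z)))"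
    by (simp add: hh_fun_def)
qed

lemma hpull_hom: "ring_hom_ring (hh_ring n) (cotangent_ring n) (hpull n)"
proof (rule ring_hom_ringI[OF hhR.ring_axioms cotR.ring_axioms])
  have pt: "(mat_diag n (diag_fun (fst z * snd z * inv\<^bsub>SL n\<^esub> (fst z))), mat_diag n (diag_fun (snd z))) \<in> HH n"
    if "z \<in> GB n" for z using hpull_point[of "fst z" n "snd z"] that by auto
  fix F assume "F \<in> carrier (hh_ring n)"
  then obtain P where "P \<in> vpairs n" "F = hh_fun n P" using hfun_lift[of F n] by (auto simp: hh_simps)
  then show "hpull n F \<in> carrier (cotangent_ring n)" using vpull_regf by (simp add: hpull_hh_fun cot_simps)
  fix G
  show "hpull n (F \<otimes>\<^bsub>hh_ring n\<^esub> G) = hpull n F \<otimes>\<^bsub>cotangent_ring n\<^esub> hpull n G"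
    "hpull n (F \<oplus>\<^bsub>hh_ring n\<^esub> G) = hpull n F \<oplus>\<^bsub>cotangent_ring n\<^esub> hpull n G"
    unfolding hh_simps cot_simps hpull_def by (rule restrict_ext, use pt in \<open>simp del: mem_Sigma_iff\<close>)+
next
  show "hpull n \<one>\<^bsub>hh_ring n\<^esub> = \<one>\<^bsub>cotangent_ring n\<^esub>"
    unfolding hh_simps cot_simps hpull_def
    by (rule restrict_ext) (use hpull_point in auto)
qed

definition to_fixed :: "nat \<Rightarrow> (complex mat \<times> complex mat \<Rightarrow> complex) \<Rightarrow> (complex mat \<times> complex mat \<Rightarrow> complex) set" where
  "to_fixed n F = fixed_ideal n +>\<^bsub>cotangent_ring n\<^esub> hpull n F"

lemma fixed_coset_eq:
  "f \<in> regf n \<Longrightarrow> g \<in> regf n \<Longrightarrow> (\<lambda>z\<in>GB n. f z - g z) \<in> fixed_ideal n \<Longrightarrow>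
    fixed_ideal n +>\<^bsub>cotangent_ring n\<^esub> f = fixed_ideal n +>\<^bsub>cotangent_ring n\<^esub> g"
  using cotR.quotient_eq_iff_same_a_r_cos[OF ideal_fixed, of f n g] cot_minus[of f n g] by (simp add: cot_simps)

lemma to_fixed_hom: "ring_hom_ring (hh_ring n) (fixed_ring n) (to_fixed n)"
proof -
  have "(+>\<^bsub>cotangent_ring n\<^esub>) (fixed_ideal n) \<circ> hpull n \<in> ring_hom (hh_ring n) (fixed_ring n)"
    unfolding fixed_ring_def
    by (rule ring_hom_trans[OF ring_hom_ring.homh[OF hpull_hom] ideal.rcos_ring_hom[OF ideal_fixed]])
  moreover have "(+>\<^bsub>cotangent_ring n\<^esub>) (fixed_ideal n) \<circ> hpull n = to_fixed n" by (auto simp: to_fixed_def)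
  ultimately show ?thesis
    using ring_hom_ringI2[OF hhR.ring_axioms ideal.quotient_is_ring[OF ideal_fixed[of n]]] by (simp add: fixed_ring_def)
qed

lemma to_fixed_kernel: "F \<in> a_kernel (hh_ring n) (fixed_ring n) (to_fixed n) \<longleftrightarrow> F \<in> hfun n \<and> hpull n F \<in> fixed_ideal n"
proof -
  interpret hp: ring_hom_ring "hh_ring n" "cotangent_ring n" "hpull n" by (rule hpull_hom)
  interpret q: ring_hom_ring "cotangent_ring n" "fixed_ring n" "(+>\<^bsub>cotangent_ring n\<^esub>) (fixed_ideal n)"
    unfolding fixed_ring_def by (rule ideal.rcos_ring_hom_ring[OF ideal_fixed])
  have "to_fixed n F = \<zero>\<^bsub>fixed_ring n\<^esub> \<longleftrightarrow> hpull n F \<in> fixed_ideal n" if "F \<in> hfun n"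
  proof -
    have c: "hpull n F \<in> carrier (cotangent_ring n)" using that by (intro hp.hom_closed) (simp add: hh_simps)
    then show ?thesis
      using cotR.quotient_eq_iff_same_a_r_cos[OF ideal_fixed c cotR.zero_closed] q.hom_zero
      by (simp add: to_fixed_def a_minus_def)
  qed
  then show ?thesis unfolding a_kernel_def' hh_simps(1) by blast
qed

section \<open>The ideal of the fibre product\<close>

lemma weyl_invariant_hfun:
  assumes "p \<in> weyl_invariants n"
  shows "(\<lambda>(x, y)\<in>HH n. p x - p y) \<in> hfun n"
proof -
  have "p \<in> pfun (cartan_lie n) (entries n)"
    using assms by (auto simp: weyl_invariants_def coord_ring_eq fring_simps dest: pfun_onD)
  then have "(\<lambda>z. p (fst z) - p (snd z)) \<in> pfun (HH n) (pair_entries n)"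
    unfolding pair_entries_eq by (intro pfun_diff pfun_fst[of p] pfun_snd[of p])
  then show ?thesis using restrict_pfun_on by (simp add: case_prod_beta')
qed

lemma ideal_fibre: "ideal (fibre_ideal n) (hh_ring n)"
  unfolding fibre_ideal_def
  by (rule hhR.genideal_ideal) (use weyl_invariant_hfun in \<open>auto simp: hh_simps\<close>)

lemma weyl_invariant_permute:
  assumes p: "p \<in> weyl_invariants n" and v: "v permutes {..<n}" and y: "(\<Sum>i<n. y i) = 0"
  shows "p (mat_diag n (y \<circ> v)) = p (mat_diag n y)"
proof -
  have "v i < n" if "i < n" for i using permutes_in_image[OF v, of i] that by simp
  then have "mat_diag n (\<lambda>i. mat_diag n y $$ (v i, v i)) = mat_diag n (y \<circ> v)"
    by (intro eq_matI) (auto simp: mat_diag_def)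
  moreover have "p (mat_diag n (\<lambda>i. mat_diag n y $$ (v i, v i))) = p (mat_diag n y)"
    using p v mat_diag_cartan[OF y] unfolding weyl_invariants_def by blast
  ultimately show ?thesis by (simp only:)
qed

text \<open>An invariant p is given only on traceless diagonal matrices. Instead of extending it to
  a symmetric polynomial, one observes that p(x) - p(y) vanishes on all permutation graphs.\<close>

lemma fibre_ideal_kernel:
  assumes n: "0 < n"
  shows "fibre_ideal n \<subseteq> a_kernel (hh_ring n) (fixed_ring n) (to_fixed n)"
  unfolding fibre_ideal_def
proof (rule hhR.genideal_minimal[OF ring_hom_ring.kernel_is_ideal[OF to_fixed_hom]], rule subsetI)
  fix F assume "F \<in> {\<lambda>(x, y)\<in>HH n. p x - p y | p. p \<in> weyl_invariants n}"
  then obtain p where p: "p \<in> weyl_invariants n" "F = (\<lambda>(x, y)\<in>HH n. p x - p y)" by blast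
  have F: "F \<in> hfun n" unfolding p(2) by (rule weyl_invariant_hfun[OF p(1)])
  then obtain P where P: "P \<in> vpairs n" "F = hh_fun n P" using hfun_lift by blast
  have "P (y \<circ> v, y) = 0" if v: "v permutes {..<n}" and y: "(\<Sum>i<n. y i) = 0" for v y
  proof -
    have yv: "(\<Sum>i<n. (y \<circ> v) i) = 0" using sum.permute[OF v, of y] y by simp
    have "P (y \<circ> v, y) = F (mat_diag n (y \<circ> v), mat_diag n y)" unfolding P(2) by (rule hh_fun_apply[OF P(1) yv y, symmetric])
    also have "\<dots> = p (mat_diag n (y \<circ> v)) - p (mat_diag n y)"
      using mat_diag_cartan[OF yv] mat_diag_cartan[OF y] by (simp add: p(2) del: comp_apply)
    finally show ?thesis using weyl_invariant_permute[OF p(1) v y] by simp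
  qed
  then obtain D where D: "D \<in> sym_differences n"
    "\<And>x y. (\<Sum>i<n. x i) = 0 \<Longrightarrow> (\<Sum>i<n. y i) = 0 \<Longrightarrow> P (x, y) = D (x, y)"
    using vanish_on_graphs_traceless[OF n P(1)] by blast
  have "vpull n P = vpull n D" by (rule vpull_cong) (rule D(2))
  then have "hpull n F \<in> fixed_ideal n"
    using sym_difference_in_fixed_ideal[OF D(1)] hpull_hh_fun[OF P(1)] P(2) by simp
  then show "F \<in> a_kernel (hh_ring n) (fixed_ring n) (to_fixed n)" using F to_fixed_kernel by blast
qed

lemma symf_weyl_invariant:
  assumes "q \<in> symf n"
  shows "(\<lambda>x\<in>cartan_lie n. q (diag_fun x)) \<in> weyl_invariants n"
  unfolding weyl_invariants_def
proof (intro CollectI conjI allI impI ballI)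
  have q: "q \<in> pfun UNIV (vcoords n)" using assms by (simp add: symf_def)
  have "(\<lambda>x. q (diag_fun x)) \<in> pfun (cartan_lie n) (entries n)"
    by (rule pfun_comp[OF q]) (auto simp: vcoords_def intro: pfun_entry)
  then show "(\<lambda>x\<in>cartan_lie n. q (diag_fun x)) \<in> carrier (coord_ring (cartan_lie n) (entries n))"
    unfolding coord_ring_eq fring_simps by (rule restrict_pfun_on)
  fix \<sigma> x assume \<sigma>: "\<sigma> permutes {..<n}" and x: "x \<in> cartan_lie n"
  have "(\<Sum>i<n. x $$ (\<sigma> i, \<sigma> i)) = 0" using sum.permute[OF \<sigma>, of "diag_fun x"] cartan_diag(2)[OF x] by (simp add: comp_def)
  then have m: "mat_diag n (\<lambda>i. x $$ (\<sigma> i, \<sigma> i)) \<in> cartan_lie n" by (rule mat_diag_cartan)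
  have "q (diag_fun (mat_diag n (\<lambda>i. x $$ (\<sigma> i, \<sigma> i)))) = q (diag_fun x \<circ> \<sigma>)"
    by (rule pfun_vec_cong[OF q]) (simp add: mat_diag_def)
  also have "\<dots> = q (diag_fun x)" using assms \<sigma> by (simp add: symf_def)
  finally show "(\<lambda>x\<in>cartan_lie n. q (diag_fun x)) (mat_diag n (\<lambda>i. x $$ (\<sigma> i, \<sigma> i))) = (\<lambda>x\<in>cartan_lie n. q (diag_fun x)) x"
    using m x by simp
qed

lemma sym_difference_fibre_ideal:
  assumes "D \<in> sym_differences n"
  shows "hh_fun n D \<in> fibre_ideal n"
  using assms
proof induction
  case (diff q r)
  let ?p = "\<lambda>x\<in>cartan_lie n. q (diag_fun x)"
  have "(\<lambda>(x, y)\<in>HH n. ?p x - ?p y) \<in> fibre_ideal n"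
    unfolding fibre_ideal_def
  proof (rule subsetD[OF hhR.genideal_self])
    show "{\<lambda>(x, y)\<in>HH n. p x - p y | p. p \<in> weyl_invariants n} \<subseteq> carrier (hh_ring n)"
      using weyl_invariant_hfun by (auto simp: hh_simps)
    show "(\<lambda>(x, y)\<in>HH n. ?p x - ?p y) \<in> {\<lambda>(x, y)\<in>HH n. p x - p y | p. p \<in> weyl_invariants n}"
      using symf_weyl_invariant[OF diff(1)] by blast
  qed
  moreover have "hh_fun n r \<in> carrier (hh_ring n)" using hh_fun_hfun[OF diff(2)] by (simp add: hh_simps)
  ultimately have "(\<lambda>(x, y)\<in>HH n. ?p x - ?p y) \<otimes>\<^bsub>hh_ring n\<^esub> hh_fun n r \<in> fibre_ideal n"
    by (rule ideal.I_r_closed[OF ideal_fibre])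
  also have "(\<lambda>(x, y)\<in>HH n. ?p x - ?p y) \<otimes>\<^bsub>hh_ring n\<^esub> hh_fun n r = hh_fun n (\<lambda>z. (q (fst z) - q (snd z)) * r z)"
    unfolding hh_simps hh_fun_def by (rule restrict_ext) auto
  finally show ?case .
next
  case (plus f g)
  have "hh_fun n f \<oplus>\<^bsub>hh_ring n\<^esub> hh_fun n g \<in> fibre_ideal n"
    using additive_subgroup.a_closed[OF ideal.axioms(1)[OF ideal_fibre] plus.IH] .
  also have "hh_fun n f \<oplus>\<^bsub>hh_ring n\<^esub> hh_fun n g = hh_fun n (\<lambda>z. f z + g z)"
    unfolding hh_simps hh_fun_def by (rule restrict_ext) auto
  finally show ?case .
qed

lemma block_prod_f_SS: "restrict (f_SS S S') (HH n) = hh_fun n (block_prod S S')"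
  unfolding hh_fun_def by (rule restrict_ext) (auto simp: f_SS_def block_prod_def)

lemma fibre_class_eq: "fibre_class n F = fibre_ideal n +>\<^bsub>hh_ring n\<^esub> restrict F (HH n)"
  by (simp add: fibre_class_def)

lemma fibre_quot_hom: "ring_hom_ring (hh_ring n) (fibre_ring n) ((+>\<^bsub>hh_ring n\<^esub>) (fibre_ideal n))"
  unfolding fibre_ring_def by (rule ideal.rcos_ring_hom_ring[OF ideal_fibre])

lemma f_generators_carrier:
  "{fibre_class n (f_SS S S') | S S'. S \<subseteq> {..<n} \<and> S' \<subseteq> {..<n} \<and> S \<noteq> {} \<and> S' \<noteq> {} \<and> card S + card S' = n} \<subseteq> carrier (fibre_ring n)"
proof -
  interpret q: ring_hom_ring "hh_ring n" "fibre_ring n" "(+>\<^bsub>hh_ring n\<^esub>) (fibre_ideal n)" by (rule fibre_quot_hom)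
  have "fibre_class n (f_SS S S') \<in> carrier (fibre_ring n)" if "S \<subseteq> {..<n}" "S' \<subseteq> {..<n}" for S S'
    unfolding fibre_class_eq block_prod_f_SS
    by (rule q.hom_closed) (simp add: hh_simps hh_fun_hfun[OF block_prod_pfun[OF that]])
  then show ?thesis by blast
qed

lemma relations_f_ideal:
  assumes "G \<in> relations n"
  shows "fibre_ideal n +>\<^bsub>hh_ring n\<^esub> hh_fun n G \<in> f_ideal n"
proof -
  interpret q: ring_hom_ring "hh_ring n" "fibre_ring n" "(+>\<^bsub>hh_ring n\<^esub>) (fibre_ideal n)" by (rule fibre_quot_hom)
  have I: "ideal (f_ideal n) (fibre_ring n)" unfolding f_ideal_def by (rule q.S.genideal_ideal[OF f_generators_carrier])
  note A = ideal.axioms(1)[OF I]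
  show ?thesis using assms
  proof induction
    case (sym D)
    have "fibre_ideal n +>\<^bsub>hh_ring n\<^esub> hh_fun n D = \<zero>\<^bsub>fibre_ring n\<^esub>"
    proof -
      have D: "hh_fun n D \<in> fibre_ideal n" by (rule sym_difference_fibre_ideal[OF sym])
      have c: "hh_fun n D \<in> carrier (hh_ring n)" by (rule ideal.Icarr[OF ideal_fibre D])
      have "hh_fun n D \<ominus>\<^bsub>hh_ring n\<^esub> \<zero>\<^bsub>hh_ring n\<^esub> \<in> fibre_ideal n" using D c by (simp add: a_minus_def)
      then show ?thesis
        using hhR.quotient_eq_iff_same_a_r_cos[OF ideal_fibre c hhR.zero_closed] q.hom_zero by simp
    qed
    then show ?case using additive_subgroup.zero_closed[OF A] by simp
  next
    case (block S S' H)
    have "fibre_class n (f_SS S S') \<in> f_ideal n"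
      unfolding f_ideal_def by (rule subsetD[OF q.S.genideal_self[OF f_generators_carrier]]) (use block(1-5) in blast)
    then have 1: "fibre_ideal n +>\<^bsub>hh_ring n\<^esub> hh_fun n (block_prod S S') \<in> f_ideal n"
      unfolding fibre_class_eq block_prod_f_SS .
    have c: "hh_fun n (block_prod S S') \<in> carrier (hh_ring n)" "hh_fun n H \<in> carrier (hh_ring n)"
      using hh_fun_hfun[OF block_prod_pfun[OF block(1,2)]] hh_fun_hfun[OF block(6)] by (simp_all add: hh_simps)
    have "(fibre_ideal n +>\<^bsub>hh_ring n\<^esub> hh_fun n (block_prod S S')) \<otimes>\<^bsub>fibre_ring n\<^esub> (fibre_ideal n +>\<^bsub>hh_ring n\<^esub> hh_fun n H) \<in> f_ideal n"
      by (rule ideal.I_r_closed[OF I 1 q.hom_closed[OF c(2)]])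
    moreover have "hh_fun n (block_prod S S') \<otimes>\<^bsub>hh_ring n\<^esub> hh_fun n H = hh_fun n (\<lambda>z. block_prod S S' z * H z)"
      unfolding hh_simps hh_fun_def by (rule restrict_ext) auto
    ultimately show ?case using q.hom_mult[OF c] by simp
  next
    case (plus F G)
    have c: "hh_fun n F \<in> carrier (hh_ring n)" "hh_fun n G \<in> carrier (hh_ring n)"
      using hh_fun_hfun[OF relations_pfun] plus(1,2) by (simp_all add: hh_simps)
    have "hh_fun n F \<oplus>\<^bsub>hh_ring n\<^esub> hh_fun n G = hh_fun n (\<lambda>z. F z + G z)"
      unfolding hh_simps hh_fun_def by (rule restrict_ext) auto
    then show ?case using q.hom_add[OF c] additive_subgroup.a_closed[OF A plus.IH] by simp
  qed
qed

section \<open>The coordinate ring of the fixed points\<close>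

lemma fixed_ideal_sum:
  assumes "finite X" "\<And>\<chi>. \<chi> \<in> X \<Longrightarrow> F \<chi> \<in> fixed_ideal n"
  shows "(\<lambda>z\<in>GB n. \<Sum>\<chi>\<in>X. F \<chi> z) \<in> fixed_ideal n"
  using assms
proof (induction X)
  case empty show ?case unfolding sum.empty by (rule fixed_ideal_zero)
next
  case (insert \<chi> X)
  have eq: "(\<lambda>z\<in>GB n. \<Sum>\<chi>\<in>insert \<chi> X. F \<chi> z) = (\<lambda>z\<in>GB n. F \<chi> z + (\<lambda>z\<in>GB n. \<Sum>\<chi>\<in>X. F \<chi> z) z)"
    by (rule restrict_ext) (use insert.hyps in simp)
  show ?case unfolding eq by (rule fixed_ideal_add) (use insert in blast)+
qed

text \<open>Components of nontrivial weight lie in the ideal; the trivial one descends to a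
  polynomial in (y, x), and modulo the ideal x may be replaced by its diagonal part.\<close>

lemma regf_congruent_vpull:
  assumes n: "0 < n" and f: "f \<in> regf n"
  shows "\<exists>P\<in>vpairs n. (\<lambda>z\<in>GB n. f z - vpull n P z) \<in> fixed_ideal n"
proof -
  obtain X F where X: "weight_decomposition n f X F" using regf_decompose[OF f] by blast
  have FX: "F \<chi> \<in> regf n" "has_weight n \<chi> (F \<chi>)" "\<chi> \<in> characters n" if "\<chi> \<in> X" for \<chi>
    using X that by (auto simp: weight_decomposition_def)
  have fin: "finite X" and one: "one_char n \<in> X" and fz: "\<And>z. z \<in> GB n \<Longrightarrow> f z = (\<Sum>\<chi>\<in>X. F \<chi> z)"
    using X unfolding weight_decomposition_def by blast+
  have "F \<chi> \<in> fixed_ideal n" if \<chi>: "\<chi> \<in> X - {one_char n}" for \<chi>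
  proof -
    have "\<chi> \<in> extensional (torus n \<times> torus n)" "one_char n \<in> extensional (torus n \<times> torus n)"
      using FX(3) \<chi> by (auto simp: characters_def weight_char_def)
    then obtain p where p: "p \<in> torus n \<times> torus n" "\<chi> p \<noteq> one_char n p"
      using extensional_eqI[of \<chi> "torus n \<times> torus n" "one_char n"] \<chi> by blast
    show ?thesis
    proof (rule weight_in_fixed_ideal[of _ _ "fst p" "snd p" "\<chi> p"])
      show "\<chi> p \<noteq> 1" using p one_char by simp
      show "F \<chi> (torus_point n (fst p, snd p) z) = \<chi> p * F \<chi> z" if "z \<in> GB n" for z
        using has_weightD[OF FX(2) p(1) that] \<chi> by simp
    qed (use p FX \<chi> in auto)
  qed
  then have 1: "(\<lambda>z\<in>GB n. \<Sum>\<chi>\<in>X - {one_char n}. F \<chi> z) \<in> fixed_ideal n"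
    using fin by (intro fixed_ideal_sum) auto
  have "F (one_char n) (torus_point n (1\<^sub>m n, s) z) = F (one_char n) z" if s: "s \<in> torus n" and z: "z \<in> GB n" for s z
  proof -
    have p: "(1\<^sub>m n, s) \<in> torus n \<times> torus n" using torus_one s by simp
    show ?thesis using has_weightD[OF FX(2)[OF one] p z] one_char[OF p] by simp
  qed
  then obtain C where C: "C \<in> pfun UNIV (prod_coords (vcoords n) (entries n))" "F (one_char n) = mpull n C"
    using regf_descends[OF n FX(1)[OF one]] by blast
  show ?thesis
  proof (rule bexI[OF _ diag_restriction_pfun[OF C(1)]])
    show "(\<lambda>z\<in>GB n. f z - vpull n (diag_restriction n C) z) \<in> fixed_ideal n"
    proof (rule fixed_ideal_cong[OF fixed_ideal_add[OF 1 mpull_diag_restriction[OF C(1)]]])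
      fix z assume z: "z \<in> GB n"
      have "f z = F (one_char n) z + (\<Sum>\<chi>\<in>X - {one_char n}. F \<chi> z)"
        unfolding fz[OF z] by (rule sum.remove[OF fin one])
      then show "(\<lambda>z\<in>GB n. f z - vpull n (diag_restriction n C) z) z =
        (\<lambda>z\<in>GB n. (\<lambda>z\<in>GB n. \<Sum>\<chi>\<in>X - {one_char n}. F \<chi> z) z + (\<lambda>z\<in>GB n. mpull n C z - vpull n (diag_restriction n C) z) z) z"
        using z by (simp add: C(2) del: mem_Sigma_iff)
    qed auto
  qed
qed

lemma to_fixed_surj:
  assumes n: "0 < n"
  shows "to_fixed n ` carrier (hh_ring n) = carrier (fixed_ring n)"
proof
  show "to_fixed n ` carrier (hh_ring n) \<subseteq> carrier (fixed_ring n)"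
    using ring_hom_closed[OF ring_hom_ring.homh[OF to_fixed_hom]] by blast
  show "carrier (fixed_ring n) \<subseteq> to_fixed n ` carrier (hh_ring n)"
  proof
    fix X assume "X \<in> carrier (fixed_ring n)"
    then obtain f where f: "f \<in> regf n" "X = fixed_ideal n +>\<^bsub>cotangent_ring n\<^esub> f"
      unfolding fixed_ring_def by (rule ideal.quot_carrierE[OF ideal_fixed]) (simp add: cot_simps)
    obtain P where P: "P \<in> vpairs n" "(\<lambda>z\<in>GB n. f z - vpull n P z) \<in> fixed_ideal n"
      using regf_congruent_vpull[OF n f(1)] by blast
    have "X = to_fixed n (hh_fun n P)"
      unfolding f(2) to_fixed_def hpull_hh_fun[OF P(1)] by (rule fixed_coset_eq[OF f(1) vpull_regf[OF P(1)] P(2)])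
    then show "X \<in> to_fixed n ` carrier (hh_ring n)" using hh_fun_hfun[OF P(1)] by (simp add: hh_simps)
  qed
qed

lemma to_fixed_moment:
  assumes F: "F \<in> carrier (coord_ring (sl_lie n \<times> cartan_lie n) (pair_entries n))"
  shows "restrict F (HH n) \<in> hfun n"
    "to_fixed n (restrict F (HH n)) = fixed_ideal n +>\<^bsub>cotangent_ring n\<^esub> moment_pullback n F"
proof -
  have Fp: "F \<in> pfun (sl_lie n \<times> cartan_lie n) (pair_entries n)"
    using F pfun_onD(1) by (simp add: coord_ring_eq fring_simps)
  have "cartan_lie n \<subseteq> sl_lie n" by (auto simp: cartan_lie_def)
  then show R: "restrict F (HH n) \<in> hfun n" by (intro restrict_pfun_on pfun_mono[OF Fp]) auto
  obtain Q where Q: "Q \<in> pfun UNIV (pair_entries n)" "\<And>z. z \<in> sl_lie n \<times> cartan_lie n \<Longrightarrow> F z = Q z"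
    using pfun_extend[OF Fp] by blast
  define C where "C z = Q (snd z, mat_diag n (fst z))" for z
  have "Q \<in> pfun (UNIV \<times> UNIV) (prod_coords (entries n) (entries n))" using Q(1) by (simp add: pair_entries_eq)
  then have "C \<in> pfun (UNIV \<times> UNIV) (prod_coords (vcoords n) (entries n))"
    unfolding C_def
  proof (rule pfun_comp_pair)
    fix e assume e: "e \<in> entries n"
    show "(\<lambda>z. e (snd z)) \<in> pfun (UNIV \<times> UNIV) (prod_coords (vcoords n) (entries n))" by (rule pfun_snd[OF pfun_coord[OF e]])
    show "(\<lambda>z. e (mat_diag n (fst z))) \<in> pfun (UNIV \<times> UNIV) (prod_coords (vcoords n) (entries n))"
      by (rule pfun_fst[OF pfun_mat_diag[OF e]])
  qed auto
  then have C: "C \<in> pfun UNIV (prod_coords (vcoords n) (entries n))" by simp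
  have 1: "moment_pullback n F = mpull n C"
    unfolding moment_pullback_def mpull_def
  proof (rule restrict_ext)
    fix z assume "z \<in> GB n"
    then obtain g b where z: "z = (g, b)" "g \<in> carrier (SL n)" "b \<in> borel_lie n" by blast
    show "(case z of (g, b) \<Rightarrow> F (g * b * inv\<^bsub>SL n\<^esub> g, mat_diag n (diag_fun b))) =
        C (diag_fun (snd z), fst z * snd z * inv\<^bsub>SL n\<^esub> (fst z))"
      using hpull_point[OF z(2,3)] by (simp add: z(1) C_def Q(2))
  qed
  have 2: "hpull n (restrict F (HH n)) z = C (diag_fun (snd z), mat_diag n (diag_fun (fst z * snd z * inv\<^bsub>SL n\<^esub> (fst z))))"
    if zGB: "z \<in> GB n" for z
  proof -
    obtain g b where z: "z = (g, b)" "g \<in> carrier (SL n)" "b \<in> borel_lie n" using zGB by blast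
    have "mat_diag n (diag_fun (g * b * inv\<^bsub>SL n\<^esub> g)) \<in> sl_lie n"
      using hpull_point(1)[OF z(2,3)] by (simp add: cartan_lie_def)
    then show ?thesis using hpull_point[OF z(2,3)] zGB by (simp add: z hpull_def C_def Q(2))
  qed
  interpret hp: ring_hom_ring "hh_ring n" "cotangent_ring n" "hpull n" by (rule hpull_hom)
  have h: "hpull n (restrict F (HH n)) \<in> regf n" using hp.hom_closed[of "restrict F (HH n)"] R by (simp add: hh_simps cot_simps)
  have "(\<lambda>z\<in>GB n. mpull n C z - hpull n (restrict F (HH n)) z) \<in> fixed_ideal n"
    by (rule fixed_ideal_cong[OF diagonal_part_congruent[OF C]])
      (simp, simp add: 2 mpull_def del: mem_Sigma_iff)
  then show "to_fixed n (restrict F (HH n)) = fixed_ideal n +>\<^bsub>cotangent_ring n\<^esub> moment_pullback n F"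
    unfolding to_fixed_def 1 using fixed_coset_eq[OF mpull_regf[OF C] h] by simp
qed

theorem theorem1p2:
  fixes n :: nat
  assumes "n \<ge> 2"
  shows "\<exists>\<pi>. is_closed_embedding n \<pi> \<and>
    (\<exists>\<Phi> \<in> ring_iso (fibre_ring n Quot f_ideal n) (fixed_ring n).
       \<forall>r \<in> carrier (fibre_ring n). \<Phi> (f_ideal n +>\<^bsub>fibre_ring n\<^esub> r) = \<pi> r)"
proof -
  have n: "0 < n" using assms by simp
  define \<pi> where "\<pi> = (\<lambda>X. the_elem (to_fixed n ` X))"
  have \<pi>_apply: "\<pi> (fibre_ideal n +>\<^bsub>hh_ring n\<^esub> F) = to_fixed n F" if "F \<in> hfun n" for F
    unfolding \<pi>_def by (rule hom_factor(1)[OF to_fixed_hom ideal_fibre fibre_ideal_kernel[OF n]]) (simp add: hh_simps that)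
  have \<pi>_hom: "ring_hom_ring (fibre_ring n) (fixed_ring n) \<pi>"
    unfolding \<pi>_def fibre_ring_def by (rule hom_factor(2)[OF to_fixed_hom ideal_fibre fibre_ideal_kernel[OF n]])
  interpret p: ring_hom_ring "fibre_ring n" "fixed_ring n" \<pi> by (rule \<pi>_hom)
  interpret q: ring_hom_ring "hh_ring n" "fibre_ring n" "(+>\<^bsub>hh_ring n\<^esub>) (fibre_ideal n)" by (rule fibre_quot_hom)
  have surj: "\<pi> ` carrier (fibre_ring n) = carrier (fixed_ring n)"
  proof
    show "carrier (fixed_ring n) \<subseteq> \<pi> ` carrier (fibre_ring n)"
    proof
      fix X assume "X \<in> carrier (fixed_ring n)"
      then obtain F where F: "F \<in> carrier (hh_ring n)" "X = to_fixed n F" using to_fixed_surj[OF n] by blast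
      then have "X = \<pi> (fibre_ideal n +>\<^bsub>hh_ring n\<^esub> F)" using \<pi>_apply by (simp add: hh_simps)
      then show "X \<in> \<pi> ` carrier (fibre_ring n)" using q.hom_closed[OF F(1)] by blast
    qed
  qed (use p.hom_closed in blast)
  have embedding: "is_closed_embedding n \<pi>"
    unfolding is_closed_embedding_def fibre_class_eq
    using p.homh surj \<pi>_apply[OF to_fixed_moment(1)] to_fixed_moment(2) by simp
  \<comment> \<open>One inclusion is the vanishing of the block products on the fixed points. For
    the other, a class killed by \<open>\<pi>\<close> is represented by some P with
    \<open>vpull n P\<close> in the fixed ideal, hence by a relation.\<close>
  have kernel: "f_ideal n = a_kernel (fibre_ring n) (fixed_ring n) \<pi>"
  proof
    show "f_ideal n \<subseteq> a_kernel (fibre_ring n) (fixed_ring n) \<pi>"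
      unfolding f_ideal_def
    proof (rule p.R.genideal_minimal[OF p.kernel_is_ideal], rule subsetI)
      fix X assume X: "X \<in> {fibre_class n (f_SS S S') | S S'. S \<subseteq> {..<n} \<and> S' \<subseteq> {..<n} \<and> S \<noteq> {} \<and> S' \<noteq> {} \<and> card S + card S' = n}"
      then obtain S S' where S: "X = fibre_class n (f_SS S S')" "S \<subseteq> {..<n}" "S' \<subseteq> {..<n}" "S \<noteq> {}" "S' \<noteq> {}" "card S + card S' = n"
        by blast
      note bp = block_prod_pfun[OF S(2,3)]
      have "hh_fun n (block_prod S S') \<in> a_kernel (hh_ring n) (fixed_ring n) (to_fixed n)"
        using block_prod_in_fixed_ideal[OF n S(2-6)] hh_fun_hfun[OF bp] hpull_hh_fun[OF bp] to_fixed_kernel by simp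
      then have "to_fixed n (hh_fun n (block_prod S S')) = \<zero>\<^bsub>fixed_ring n\<^esub>" by (simp add: a_kernel_def')
      then have "\<pi> X = \<zero>\<^bsub>fixed_ring n\<^esub>"
        unfolding S(1) fibre_class_eq block_prod_f_SS using \<pi>_apply[OF hh_fun_hfun[OF bp]] by simp
      then show "X \<in> a_kernel (fibre_ring n) (fixed_ring n) \<pi>"
        using subsetD[OF f_generators_carrier X] unfolding a_kernel_def' by blast
    qed
    show "a_kernel (fibre_ring n) (fixed_ring n) \<pi> \<subseteq> f_ideal n"
    proof
      fix X assume X: "X \<in> a_kernel (fibre_ring n) (fixed_ring n) \<pi>"
      then have X0: "X \<in> carrier (fibre_ring n)" "\<pi> X = \<zero>\<^bsub>fixed_ring n\<^esub>" unfolding a_kernel_def' by blast+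
      then have "X \<in> carrier (hh_ring n Quot fibre_ideal n)" by (simp only: fibre_ring_def)
      then obtain F where F: "F \<in> carrier (hh_ring n)" "X = fibre_ideal n +>\<^bsub>hh_ring n\<^esub> F"
        by (rule ideal.quot_carrierE[OF ideal_fibre])
      obtain P where P: "P \<in> vpairs n" "F = hh_fun n P" using F(1) hfun_lift[of F n] by (auto simp: hh_simps)
      have "to_fixed n F = \<zero>\<^bsub>fixed_ring n\<^esub>" using X0(2) F \<pi>_apply[of F] by (simp add: hh_simps)
      then have "F \<in> a_kernel (hh_ring n) (fixed_ring n) (to_fixed n)" using F(1) unfolding a_kernel_def' by blast
      then have "vpull n P \<in> fixed_ideal n" using to_fixed_kernel hpull_hh_fun[OF P(1)] P(2) by metis
      then obtain G where G: "G \<in> relations n" "\<And>x y. (\<Sum>i<n. x i) = 0 \<Longrightarrow> (\<Sum>i<n. y i) = 0 \<Longrightarrow> P (x, y) = G (x, y)"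
        using vpull_fixed_ideal_relations[OF n P(1)] by blast
      have "hh_fun n P = hh_fun n G" by (rule hh_fun_cong) (rule G(2))
      then show "X \<in> f_ideal n" using relations_f_ideal[OF G(1)] F(2) P(2) by simp
    qed
  qed
  have iso: "(\<lambda>X. the_elem (\<pi> ` X)) \<in> ring_iso (fibre_ring n Quot f_ideal n) (fixed_ring n)"
    unfolding kernel by (rule p.FactRing_iso_set[OF surj])
  have val: "the_elem (\<pi> ` (f_ideal n +>\<^bsub>fibre_ring n\<^esub> r)) = \<pi> r" if "r \<in> carrier (fibre_ring n)" for r
    unfolding kernel by (rule p.the_elem_simp[OF that])
  show ?thesis
    by (rule exI[of _ \<pi>], rule conjI[OF embedding], rule bexI[OF _ iso], rule ballI, rule val)
qed

end
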